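(* Let $T=((G,\Sigma),Ax)$ be a varietal linear $\mathcal{V}\lambda$-theory. A $\mathcal{V}$-equation-in-context $\Gamma\rhd v=_q w:A$ is a theorem of $T$ if and only if it holds in all models of $T$.
   Context: Standing assumptions on $\mathcal{V}$: commutative unital quantale (complete lattice with commutative associative $\otimes$ distributing over arbitrary joins, unit $k$), integral ($k=\top$), underlying lattice continuous (every $x$ is the join of all $y\ll x$, where $y\ll x$ means: whenever $x\le\bigvee X$ there is finite $A\subseteq X$ with $y\le\bigvee A$), with fixed basis $B$ (for each $x$, $B\cap\{y\mid y\ll x\}$ is directed with join $x$) closed under finite joins and $\otimes$, containing $k$. Linear $\lambda$-calculus over $(G,\Sigma)$: $G$ a class of ground types; types $A::=X\in G\mid I\mid A\otimes A\mid A\multimap A$; $\Sigma$ a class of operation symbols $f:A_1,\dots,A_n\to A$, $n\ge1$. Contexts: lists of distinct typed variables; a shuffle of $\Gamma_1,\dots,\Gamma_n$ is a permutation of the concatenation preserving relative order within each $\Gamma_i$. Term formation: $E\rhd f(v_1,\dots,v_n):A$ from $\Gamma_i\rhd v_i:A_i$ with $E$ a shuffle of the $\Gamma_i$; $x:A\rhd x:A$; $-\rhd\ast:I$; $E\rhd v\ \mathtt{to}\ \ast.\,w:A$ from $\Gamma\rhd v:I$, $\Delta\rhd w:A$; $E\rhd v\otimes w:A\otimes B$ from $\Gamma\rhd v:A$, $\Delta\rhd w:B$; $E\rhd\mathtt{pm}\ v\ \mathtt{to}\ x\otimes y.\,w:C$ from $\Gamma\rhd v:A\otimes B$, $\Delta,x:A,y:B\rhd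 w:C$; $\Gamma\rhd\lambda x:A.\,v:A\multimap B$ from $\Gamma,x:A\rhd v:B$; $E\rhd v\,w:B$ from $\Gamma\rhd v:A\multimap B$, $\Delta\rhd w:A$ ($E$ a shuffle of $\Gamma,\Delta$). A $\mathcal{V}$-equation-in-context is $\Gamma\rhd v=_q w:A$ with $q\in B$ and both terms of type $A$ in context $\Gamma$; $v=w$ abbreviates $v=_\top w$ and $w=_\top v$. A linear $\mathcal{V}\lambda$-theory $((G,\Sigma),Ax)$ has a class $Ax$ of $\mathcal{V}$-equations-in-context (axioms). Its theorems form the smallest class containing $Ax$, the equations $\mathtt{pm}\ v\otimes w\ \mathtt{to}\ x\otimes y.\,u=u[v/x,w/y]$, $\mathtt{pm}\ v\ \mathtt{to}\ x\otimes y.\,u[x\otimes y/z]=u[v/z]$, $\ast\ \mathtt{to}\ \ast.\,v=v$, $v\ \mathtt{to}\ \ast.\,w[\ast/z]=w[v/z]$, $(\lambda x.\,v)\,w=v[w/x]$, $\lambda x.(v\,x)=v$, $u[v\ \mathtt{to}\ \ast.\,w/z]=v\ \mathtt{to}\ \ast.\,u[w/z]$, $u[\mathtt{pm}\ v\ \mathtt{to}\ x\otimes y.\,w/z]=\mathtt{pm}\ v\ \mathtt{to}\ x\otimes y.\,u[w/z]$, and closed under: $v=_\top v$; $v=_q w,\ w=_r u\Rightarrow v=_{q\otimes r}u$; $v=_q w,\ r\le q\Rightarrow v=_r w$; ($v=_r w$ for all $r\ll q$) $\Rightarrow v=_q w$; ($v=_{q_i}w$ for all $i\le n$) $\Rightarrow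 v=_{\bigvee_i q_i}w$ (including $n=0$); compatibility: $v_i=_{q_i}w_i\Rightarrow f(\vec v)=_{\otimes q_i}f(\vec w)$; $v=_q w,\ v'=_r w'$ imply $v\otimes v'=_{q\otimes r}w\otimes w'$, $\mathtt{pm}\ v\ \mathtt{to}\ x\otimes y.\,v'=_{q\otimes r}\mathtt{pm}\ w\ \mathtt{to}\ x\otimes y.\,w'$, $v\ \mathtt{to}\ \ast.\,v'=_{q\otimes r}w\ \mathtt{to}\ \ast.\,w'$, $v\,v'=_{q\otimes r}w\,w'$, $v[v'/x]=_{q\otimes r}w[w'/x]$; $v=_q w\Rightarrow\lambda x.\,v=_q\lambda x.\,w$; and permutation of the context. Varietal: for types $A,B$, let $\mathrm{Val}(A,B)$ be the class of terms $v$ with $x:A\rhd v:B$, with $a(v,w)=\bigvee\{q\mid x:A\rhd v=_q w:B$ is a theorem$\}$; this is a $\mathcal{V}$-category; quotienting by $v\sim w$ iff $a(v,w)\ge k$ and $a(w,v)\ge k$ (with $a([v],[w])=a(v,w)$) gives a separated $\mathcal{V}$-category $\mathcal{C}(A,B)$. $T$ is varietal if every $\mathcal{C}(A,B)$ is small (a set). Semantics: a $\mathcal{V}$-category is $(X,a)$, $a:X\times X\to\mathcal{V}$, $k\le a(x,x)$, $a(x,y)\otimes a(y,z)\le a(x,z)$; it is separated if $k\le a(x,y)$ and $k\le a(y,x)$ imply $x=y$; $\mathcal{V}$-functors satisfy $a(x,y)\le b(fx,fy)$; $\mathcal{V}\text{-}\mathsf{Cat}_{\mathsf{sep}}$ is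 the category of small separated $\mathcal{V}$-categories, monoidal with $(X,a)\otimes(Y,b)=(X\times Y,a\otimes b)$ computed pointwise. A $\mathcal{V}\text{-}\mathsf{Cat}_{\mathsf{sep}}$-enriched autonomous category is a symmetric monoidal closed category $\mathcal{C}$ whose hom-sets are separated $\mathcal{V}$-categories such that composition $\mathcal{C}(X,Y)\otimes\mathcal{C}(Y,Z)\to\mathcal{C}(X,Z)$ and the tensor action $\mathcal{C}(X,Y)\otimes\mathcal{C}(X',Y')\to\mathcal{C}(X\otimes X',Y\otimes Y')$ are $\mathcal{V}$-functors, the functors $-\otimes X$ and $X\multimap -$ act by $\mathcal{V}$-functors on homs, and the currying bijections $\mathcal{C}(Y\otimes X,Z)\cong\mathcal{C}(Y,X\multimap Z)$ are $\mathcal{V}$-isomorphisms. Judgements $\Gamma\rhd v:A$ are interpreted as morphisms $\llbracket\Gamma\rrbracket\to\llbracket A\rrbracket$ by the standard categorical interpretation of linear $\lambda$-calculus in autonomous categories (given objects for ground types and morphisms $\llbracket A_1\rrbracket\otimes\cdots\otimes\llbracket A_n\rrbracket\to\llbracket A\rrbracket$ for operation symbols; contexts as left-nested tensors, empty context as $I$). A $\mathcal{V}$-equation $\Gamma\rhd v=_q w:A$ holds (is satisfied) if $a(\llbracket\Gamma\rhd v:A\rrbracket,\llbracket\Gamma\rhd w:A\rrbracket)\ge q$ in the hom-$\mathcal{V}$-category. A model of $T$ is such an interpretation in a $\mathcal{V}\text{-}\mathsf{Cat}_{\mathsf{sep}}$-enriched autonomous category satisfying all axioms in $Ax$. *)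

theory Defs
  imports "HOL-Library.Equipollence" "HOL-Library.Multiset"
begin

section \<open>Quantales\<close>

context complete_lattice
begin

definition way_below :: "'a \<Rightarrow> 'a \<Rightarrow> bool" (infix "\<lless>" 50) where
  "y \<lless> x \<longleftrightarrow> (\<forall>X. x \<le> Sup X \<longrightarrow> (\<exists>A\<subseteq>X. finite A \<and> y \<le> Sup A))"

end

text \<open>
  The tensor of the quantale is written \<open>*\<close> and its unit \<open>k\<close> is written \<open>1\<close>.
\<close>

class continuous_integral_quantale = complete_lattice + comm_monoid_mult +
  assumes mult_Sup: "x * Sup S = Sup ((*) x ` S)"
    and one_eq_top: "1 = top"
    and continuous: "x = Sup {y. way_below y x}"

definition directed :: "'a::order set \<Rightarrow> bool" where
  "directed D \<longleftrightarrow> D \<noteq> {} \<and> (\<forall>x\<in>D. \<forall>y\<in>D. \<exists>z\<in>D. x \<le> z \<and> y \<le> z)"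

definition quantale_basis :: "'v::continuous_integral_quantale set \<Rightarrow> bool" where
  "quantale_basis B \<longleftrightarrow>
     (\<forall>x. directed (B \<inter> {y. y \<lless> x}) \<and> Sup (B \<inter> {y. y \<lless> x}) = x) \<and>
     (\<forall>S. finite S \<longrightarrow> S \<subseteq> B \<longrightarrow> Sup S \<in> B) \<and>
     (\<forall>x\<in>B. \<forall>y\<in>B. x * y \<in> B) \<and>
     1 \<in> B"


section \<open>Categories enriched over a quantale\<close>

definition vcat :: "'a set \<Rightarrow> ('a \<Rightarrow> 'a \<Rightarrow> 'v::continuous_integral_quantale) \<Rightarrow> bool" where
  "vcat X a \<longleftrightarrow>
     (\<forall>x\<in>X. 1 \<le> a x x) \<and>
     (\<forall>x\<in>X. \<forall>y\<in>X. \<forall>z\<in>X. a x y * a y z \<le> a x z)"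

definition sep_vcat :: "'a set \<Rightarrow> ('a \<Rightarrow> 'a \<Rightarrow> 'v::continuous_integral_quantale) \<Rightarrow> bool" where
  "sep_vcat X a \<longleftrightarrow>
     vcat X a \<and> (\<forall>x\<in>X. \<forall>y\<in>X. 1 \<le> a x y \<longrightarrow> 1 \<le> a y x \<longrightarrow> x = y)"

definition vfunctor ::
  "'a set \<Rightarrow> ('a \<Rightarrow> 'a \<Rightarrow> 'v) \<Rightarrow> 'b set \<Rightarrow> ('b \<Rightarrow> 'b \<Rightarrow> 'v::continuous_integral_quantale) \<Rightarrow>
   ('a \<Rightarrow> 'b) \<Rightarrow> bool" where
  "vfunctor X a Y b f \<longleftrightarrow>
     (\<forall>x\<in>X. f x \<in> Y) \<and> (\<forall>x\<in>X. \<forall>x'\<in>X. a x x' \<le> b (f x) (f x'))"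

definition viso ::
  "'a set \<Rightarrow> ('a \<Rightarrow> 'a \<Rightarrow> 'v) \<Rightarrow> 'b set \<Rightarrow> ('b \<Rightarrow> 'b \<Rightarrow> 'v::continuous_integral_quantale) \<Rightarrow>
   ('a \<Rightarrow> 'b) \<Rightarrow> bool" where
  "viso X a Y b f \<longleftrightarrow>
     bij_betw f X Y \<and> vfunctor X a Y b f \<and> vfunctor Y b X a (inv_into X f)"

text \<open>The distance of the tensor of two \<open>\<V>\<close>-categories; its carrier is \<open>X \<times> Y\<close>.\<close>

definition vtensor ::
  "('a \<Rightarrow> 'a \<Rightarrow> 'v) \<Rightarrow> ('b \<Rightarrow> 'b \<Rightarrow> 'v::continuous_integral_quantale) \<Rightarrow>
   'a \<times> 'b \<Rightarrow> 'a \<times> 'b \<Rightarrow> 'v" where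
  "vtensor a b p p' = a (fst p) (fst p') * b (snd p) (snd p')"

text \<open>
  A morphism carries its source, its target and a label from a type \<open>'u\<close>.  Hom-sets are thus
  disjoint, and each of them has the size of some subset of \<open>'u\<close>, whatever the size of the class
  of objects: \<open>'u\<close> plays the role of the universe of sets with respect to which a category is
  locally small.
\<close>

datatype ('o, 'u) arr = Arr (src: 'o) (tgt: 'o) (lbl: 'u)

record ('o, 'u, 'v) acat =
  obj  :: "'o set"
  mor  :: "('o, 'u) arr set"
  ident :: "'o \<Rightarrow> ('o, 'u) arr" ("\<i>\<index>")
  cmp :: "('o, 'u) arr \<Rightarrow> ('o, 'u) arr \<Rightarrow> ('o, 'u) arr" (infixr "\<cdot>\<index>" 55)
  tunit :: "'o" ("\<one>\<index>")
  tobj :: "'o \<Rightarrow> 'o \<Rightarrow> 'o" (infixl "\<odot>\<index>" 70)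
  tmor :: "('o, 'u) arr \<Rightarrow> ('o, 'u) arr \<Rightarrow> ('o, 'u) arr" (infixl "\<otimes>\<index>" 70)
  asc :: "'o \<Rightarrow> 'o \<Rightarrow> 'o \<Rightarrow> ('o, 'u) arr" ("\<a>\<index>")
  lunit :: "'o \<Rightarrow> ('o, 'u) arr" ("\<l>\<index>")
  runit :: "'o \<Rightarrow> ('o, 'u) arr" ("\<r>\<index>")
  swap :: "'o \<Rightarrow> 'o \<Rightarrow> ('o, 'u) arr" ("\<s>\<index>")
  iobj :: "'o \<Rightarrow> 'o \<Rightarrow> 'o"
  imor :: "'o \<Rightarrow> ('o, 'u) arr \<Rightarrow> ('o, 'u) arr"
  curry_at :: "'o \<Rightarrow> 'o \<Rightarrow> 'o \<Rightarrow> ('o, 'u) arr \<Rightarrow> ('o, 'u) arr"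
  hdist :: "('o, 'u) arr \<Rightarrow> ('o, 'u) arr \<Rightarrow> 'v"

definition hom :: "('o, 'u, 'v, 'x) acat_scheme \<Rightarrow> 'o \<Rightarrow> 'o \<Rightarrow> ('o, 'u) arr set" where
  "hom C X Y = {f \<in> mor C. src f = X \<and> tgt f = Y}"

definition inverse_arr ::
  "('o, 'u, 'v, 'x) acat_scheme \<Rightarrow> ('o, 'u) arr \<Rightarrow> ('o, 'u) arr \<Rightarrow> bool" where
  "inverse_arr C f g \<longleftrightarrow>
     f \<in> mor C \<and> g \<in> hom C (tgt f) (src f) \<and>
     cmp C g f = ident C (src f) \<and> cmp C f g = ident C (tgt f)"

definition iso_arr :: "('o, 'u, 'v, 'x) acat_scheme \<Rightarrow> ('o, 'u) arr \<Rightarrow> bool" where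
  "iso_arr C f \<longleftrightarrow> (\<exists>g. inverse_arr C f g)"

definition inv_arr :: "('o, 'u, 'v, 'x) acat_scheme \<Rightarrow> ('o, 'u) arr \<Rightarrow> ('o, 'u) arr" where
  "inv_arr C f = (THE g. inverse_arr C f g)"

locale cat =
  fixes C :: "('o, 'u, 'v::continuous_integral_quantale, 'x) acat_scheme" (structure)
  assumes mor_obj: "f \<in> mor C \<Longrightarrow> src f \<in> obj C \<and> tgt f \<in> obj C"
    and id_hom: "X \<in> obj C \<Longrightarrow> \<i> X \<in> hom C X X"
    and comp_hom: "f \<in> hom C X Y \<Longrightarrow> g \<in> hom C Y Z \<Longrightarrow> g \<cdot> f \<in> hom C X Z"
    and id_comp: "f \<in> hom C X Y \<Longrightarrow> \<i> Y \<cdot> f = f"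
    and comp_id: "f \<in> hom C X Y \<Longrightarrow> f \<cdot> \<i> X = f"
    and comp_assoc: "f \<in> hom C W X \<Longrightarrow> g \<in> hom C X Y \<Longrightarrow> h \<in> hom C Y Z \<Longrightarrow>
      (h \<cdot> g) \<cdot> f = h \<cdot> (g \<cdot> f)"

locale symmetric_monoidal_cat = cat +
  assumes tunit_obj: "\<one> \<in> obj C"
    and tobj_obj: "X \<in> obj C \<Longrightarrow> Y \<in> obj C \<Longrightarrow> X \<odot> Y \<in> obj C"
    and tmor_hom: "f \<in> hom C X Y \<Longrightarrow> g \<in> hom C X' Y' \<Longrightarrow> f \<otimes> g \<in> hom C (X \<odot> X') (Y \<odot> Y')"
    and tmor_id: "X \<in> obj C \<Longrightarrow> Y \<in> obj C \<Longrightarrow> \<i> X \<otimes> \<i> Y = \<i> (X \<odot> Y)"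
    and tmor_comp: "f \<in> hom C X Y \<Longrightarrow> g \<in> hom C Y Z \<Longrightarrow> f' \<in> hom C X' Y' \<Longrightarrow> g' \<in> hom C Y' Z' \<Longrightarrow>
      (g \<cdot> f) \<otimes> (g' \<cdot> f') = (g \<otimes> g') \<cdot> (f \<otimes> f')"
    and assoc_hom: "X \<in> obj C \<Longrightarrow> Y \<in> obj C \<Longrightarrow> Z \<in> obj C \<Longrightarrow>
      \<a> X Y Z \<in> hom C (X \<odot> Y \<odot> Z) (X \<odot> (Y \<odot> Z)) \<and> iso_arr C (\<a> X Y Z)"
    and assoc_nat: "f \<in> hom C X X' \<Longrightarrow> g \<in> hom C Y Y' \<Longrightarrow> h \<in> hom C Z Z' \<Longrightarrow>
      \<a> X' Y' Z' \<cdot> (f \<otimes> g \<otimes> h) = (f \<otimes> (g \<otimes> h)) \<cdot> \<a> X Y Z"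
    and lunit_hom: "X \<in> obj C \<Longrightarrow> \<l> X \<in> hom C (\<one> \<odot> X) X \<and> iso_arr C (\<l> X)"
    and lunit_nat: "f \<in> hom C X Y \<Longrightarrow> \<l> Y \<cdot> (\<i> \<one> \<otimes> f) = f \<cdot> \<l> X"
    and runit_hom: "X \<in> obj C \<Longrightarrow> \<r> X \<in> hom C (X \<odot> \<one>) X \<and> iso_arr C (\<r> X)"
    and runit_nat: "f \<in> hom C X Y \<Longrightarrow> \<r> Y \<cdot> (f \<otimes> \<i> \<one>) = f \<cdot> \<r> X"
    and swap_hom: "X \<in> obj C \<Longrightarrow> Y \<in> obj C \<Longrightarrow> \<s> X Y \<in> hom C (X \<odot> Y) (Y \<odot> X)"
    and swap_nat: "f \<in> hom C X X' \<Longrightarrow> g \<in> hom C Y Y' \<Longrightarrow> \<s> X' Y' \<cdot> (f \<otimes> g) = (g \<otimes> f) \<cdot> \<s> X Y"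
    and swap_swap: "X \<in> obj C \<Longrightarrow> Y \<in> obj C \<Longrightarrow> \<s> Y X \<cdot> \<s> X Y = \<i> (X \<odot> Y)"
    and pentagon: "W \<in> obj C \<Longrightarrow> X \<in> obj C \<Longrightarrow> Y \<in> obj C \<Longrightarrow> Z \<in> obj C \<Longrightarrow>
      \<a> W X (Y \<odot> Z) \<cdot> \<a> (W \<odot> X) Y Z =
      (\<i> W \<otimes> \<a> X Y Z) \<cdot> \<a> W (X \<odot> Y) Z \<cdot> (\<a> W X Y \<otimes> \<i> Z)"
    and triangle: "X \<in> obj C \<Longrightarrow> Y \<in> obj C \<Longrightarrow> (\<i> X \<otimes> \<l> Y) \<cdot> \<a> X \<one> Y = \<r> X \<otimes> \<i> Y"
    and hexagon: "X \<in> obj C \<Longrightarrow> Y \<in> obj C \<Longrightarrow> Z \<in> obj C \<Longrightarrow>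
      \<a> Y Z X \<cdot> \<s> X (Y \<odot> Z) \<cdot> \<a> X Y Z =
      (\<i> Y \<otimes> \<s> X Z) \<cdot> \<a> Y X Z \<cdot> (\<s> X Y \<otimes> \<i> Z)"

text \<open>
  Here \<open>iobj C X Z\<close> is \<open>X \<multimap> Z\<close>, \<open>imor C X g\<close> is \<open>X \<multimap> g\<close>, and \<open>curry_at C X Y Z\<close> is the bijection
  from \<open>C(Y \<otimes> X, Z)\<close> to \<open>C(Y, X \<multimap> Z)\<close>.
\<close>

locale autonomous_cat = symmetric_monoidal_cat +
  assumes iobj_obj: "X \<in> obj C \<Longrightarrow> Z \<in> obj C \<Longrightarrow> iobj C X Z \<in> obj C"
    and imor_hom: "X \<in> obj C \<Longrightarrow> g \<in> hom C Z Z' \<Longrightarrow> imor C X g \<in> hom C (iobj C X Z) (iobj C X Z')"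
    and imor_id: "X \<in> obj C \<Longrightarrow> Z \<in> obj C \<Longrightarrow> imor C X (\<i> Z) = \<i> (iobj C X Z)"
    and imor_comp: "X \<in> obj C \<Longrightarrow> f \<in> hom C Y Z \<Longrightarrow> g \<in> hom C Z Z' \<Longrightarrow>
      imor C X (g \<cdot> f) = imor C X g \<cdot> imor C X f"
    and curry_bij: "X \<in> obj C \<Longrightarrow> Y \<in> obj C \<Longrightarrow> Z \<in> obj C \<Longrightarrow>
      bij_betw (curry_at C X Y Z) (hom C (Y \<odot> X) Z) (hom C Y (iobj C X Z))"
    and curry_nat: "X \<in> obj C \<Longrightarrow> h \<in> hom C Y' Y \<Longrightarrow> f \<in> hom C (Y \<odot> X) Z \<Longrightarrow> g \<in> hom C Z Z' \<Longrightarrow>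
      curry_at C X Y' Z' (g \<cdot> f \<cdot> (h \<otimes> \<i> X)) = imor C X g \<cdot> curry_at C X Y Z f \<cdot> h"

locale enriched_autonomous_cat = autonomous_cat +
  assumes hom_sep_vcat: "X \<in> obj C \<Longrightarrow> Y \<in> obj C \<Longrightarrow> sep_vcat (hom C X Y) (hdist C)"
    and comp_vfunctor: "X \<in> obj C \<Longrightarrow> Y \<in> obj C \<Longrightarrow> Z \<in> obj C \<Longrightarrow>
      vfunctor (hom C X Y \<times> hom C Y Z) (vtensor (hdist C) (hdist C)) (hom C X Z) (hdist C)
        (\<lambda>(f, g). g \<cdot> f)"
    and tmor_vfunctor: "X \<in> obj C \<Longrightarrow> Y \<in> obj C \<Longrightarrow> X' \<in> obj C \<Longrightarrow> Y' \<in> obj C \<Longrightarrow>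
      vfunctor (hom C X Y \<times> hom C X' Y') (vtensor (hdist C) (hdist C))
        (hom C (X \<odot> X') (Y \<odot> Y')) (hdist C) (\<lambda>(f, g). f \<otimes> g)"
    and tensoring_vfunctor: "X \<in> obj C \<Longrightarrow> Y \<in> obj C \<Longrightarrow> Z \<in> obj C \<Longrightarrow>
      vfunctor (hom C Y Z) (hdist C) (hom C (Y \<odot> X) (Z \<odot> X)) (hdist C) (\<lambda>f. f \<otimes> \<i> X)"
    and imor_vfunctor: "X \<in> obj C \<Longrightarrow> Y \<in> obj C \<Longrightarrow> Z \<in> obj C \<Longrightarrow>
      vfunctor (hom C Y Z) (hdist C) (hom C (iobj C X Y) (iobj C X Z)) (hdist C) (imor C X)"
    and curry_viso: "X \<in> obj C \<Longrightarrow> Y \<in> obj C \<Longrightarrow> Z \<in> obj C \<Longrightarrow>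
      viso (hom C (Y \<odot> X) Z) (hdist C) (hom C Y (iobj C X Z)) (hdist C) (curry_at C X Y Z)"

definition eval_at :: "('o, 'u, 'v, 'x) acat_scheme \<Rightarrow> 'o \<Rightarrow> 'o \<Rightarrow> ('o, 'u) arr" where
  "eval_at C X Z =
     inv_into (hom C (tobj C (iobj C X Z) X) Z) (curry_at C X (iobj C X Z) Z) (ident C (iobj C X Z))"

fun ntobj :: "('o, 'u, 'v, 'x) acat_scheme \<Rightarrow> 'o list \<Rightarrow> 'o" where
  "ntobj C [] = tunit C"
| "ntobj C (X # Xs) = foldl (tobj C) X Xs"

fun ntmor :: "('o, 'u, 'v, 'x) acat_scheme \<Rightarrow> ('o, 'u) arr list \<Rightarrow> ('o, 'u) arr" where
  "ntmor C [] = ident C (tunit C)"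
| "ntmor C (f # fs) = foldl (tmor C) f fs"


section \<open>Types and terms\<close>

datatype 'g ty = Ground 'g | TUnit | Tensor "'g ty" "'g ty" | Lolli "'g ty" "'g ty"

text \<open>
  Terms up to renaming of bound variables, in locally nameless style: free variables are named,
  bound variables are indices.  The constructor \<open>PmB\<close> binds two indices in its second argument;
  index 0 is the second component.  The named binders \<open>Lam\<close> and \<open>Pm\<close> below recover the
  usual syntax; dangling indices do not occur in typed terms.
\<close>

type_synonym var = nat

datatype ('g, 'f) tm =
    Var var
  | Bound nat
  | Op 'f "('g, 'f) tm list"
  | Star
  | LetStar "('g, 'f) tm" "('g, 'f) tm"
  | Ten "('g, 'f) tm" "('g, 'f) tm"
  | PmB "('g, 'f) tm" "('g, 'f) tm"
  | LamB "'g ty" "('g, 'f) tm"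
  | App "('g, 'f) tm" "('g, 'f) tm"

primrec bindv :: "nat \<Rightarrow> var \<Rightarrow> ('g, 'f) tm \<Rightarrow> ('g, 'f) tm" where
  "bindv n x (Var y) = (if y = x then Bound n else Var y)"
| "bindv n x (Bound i) = Bound i"
| "bindv n x (Op f vs) = Op f (map (bindv n x) vs)"
| "bindv n x Star = Star"
| "bindv n x (LetStar v w) = LetStar (bindv n x v) (bindv n x w)"
| "bindv n x (Ten v w) = Ten (bindv n x v) (bindv n x w)"
| "bindv n x (PmB v w) = PmB (bindv n x v) (bindv (n + 2) x w)"
| "bindv n x (LamB A v) = LamB A (bindv (n + 1) x v)"
| "bindv n x (App v w) = App (bindv n x v) (bindv n x w)"

definition Lam :: "var \<Rightarrow> 'g ty \<Rightarrow> ('g, 'f) tm \<Rightarrow> ('g, 'f) tm" where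
  "Lam x A v = LamB A (bindv 0 x v)"

text \<open>\<open>Pm v x y w\<close> is \<open>pm v to x \<otimes> y. w\<close>.\<close>

definition Pm :: "('g, 'f) tm \<Rightarrow> var \<Rightarrow> var \<Rightarrow> ('g, 'f) tm \<Rightarrow> ('g, 'f) tm" where
  "Pm v x y w = PmB v (bindv 1 x (bindv 0 y w))"

text \<open>
  Simultaneous substitution.  It is capture-avoiding when the substituted terms have no dangling
  indices.
\<close>

primrec subst :: "(var \<Rightarrow> ('g, 'f) tm) \<Rightarrow> ('g, 'f) tm \<Rightarrow> ('g, 'f) tm" where
  "subst s (Var y) = s y"
| "subst s (Bound i) = Bound i"
| "subst s (Op f vs) = Op f (map (subst s) vs)"
| "subst s Star = Star"
| "subst s (LetStar v w) = LetStar (subst s v) (subst s w)"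
| "subst s (Ten v w) = Ten (subst s v) (subst s w)"
| "subst s (PmB v w) = PmB (subst s v) (subst s w)"
| "subst s (LamB A v) = LamB A (subst s v)"
| "subst s (App v w) = App (subst s v) (subst s w)"

abbreviation subst1 :: "('g, 'f) tm \<Rightarrow> var \<Rightarrow> ('g, 'f) tm \<Rightarrow> ('g, 'f) tm"
  ("_[_ ::= _]" [1000, 0, 0] 1000)
  where "u[x ::= v] \<equiv> subst (Var(x := v)) u"

abbreviation subst2 ::
  "('g, 'f) tm \<Rightarrow> var \<Rightarrow> ('g, 'f) tm \<Rightarrow> var \<Rightarrow> ('g, 'f) tm \<Rightarrow> ('g, 'f) tm"
  ("_[_ ::= _, _ ::= _]" [1000, 0, 0, 0, 0] 1000)
  where "u[x ::= v, y ::= w] \<equiv> subst (Var(x := v, y := w)) u"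

type_synonym 'g ctx = "(var \<times> 'g ty) list"

definition ctx_vars :: "'g ctx \<Rightarrow> var set" where
  "ctx_vars \<Gamma> = fst ` set \<Gamma>"

definition is_ctx :: "'g ctx \<Rightarrow> bool" where
  "is_ctx \<Gamma> \<longleftrightarrow> distinct (map fst \<Gamma>)"

primrec nshuffles :: "'a list list \<Rightarrow> 'a list set" where
  "nshuffles [] = {[]}"
| "nshuffles (xs # xss) = (\<Union>ys\<in>nshuffles xss. shuffles xs ys)"

record ('g, 'f, 'v) vlam_theory =
  ground :: "'g set"
  ops :: "'f set"
  op_args :: "'f \<Rightarrow> 'g ty list"
  op_res :: "'f \<Rightarrow> 'g ty"
  axs :: "('g ctx \<times> ('g, 'f) tm \<times> 'v \<times> ('g, 'f) tm \<times> 'g ty) set"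

inductive typed :: "('g, 'f, 'v) vlam_theory \<Rightarrow> 'g ctx \<Rightarrow> ('g, 'f) tm \<Rightarrow> 'g ty \<Rightarrow> bool"
  for T :: "('g, 'f, 'v) vlam_theory" where
  ty_op: "f \<in> ops T \<Longrightarrow> length \<Gamma>s = length (op_args T f) \<Longrightarrow> length vs = length (op_args T f) \<Longrightarrow>
    (\<forall>i<length (op_args T f). typed T (\<Gamma>s ! i) (vs ! i) (op_args T f ! i)) \<Longrightarrow>
    is_ctx E \<Longrightarrow> E \<in> nshuffles \<Gamma>s \<Longrightarrow> typed T E (Op f vs) (op_res T f)"
| ty_var: "set_ty A \<subseteq> ground T \<Longrightarrow> typed T [(x, A)] (Var x) A"
| ty_star: "typed T [] Star TUnit"
| ty_letstar: "typed T \<Gamma> v TUnit \<Longrightarrow> typed T \<Delta> w A \<Longrightarrow> is_ctx E \<Longrightarrow> E \<in> shuffles \<Gamma> \<Delta> \<Longrightarrow>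
    typed T E (LetStar v w) A"
| ty_pair: "typed T \<Gamma> v A \<Longrightarrow> typed T \<Delta> w B \<Longrightarrow> is_ctx E \<Longrightarrow> E \<in> shuffles \<Gamma> \<Delta> \<Longrightarrow>
    typed T E (Ten v w) (Tensor A B)"
| ty_pm: "typed T \<Gamma> v (Tensor A B) \<Longrightarrow> typed T (\<Delta> @ [(x, A), (y, B)]) w C \<Longrightarrow>
    is_ctx E \<Longrightarrow> E \<in> shuffles \<Gamma> \<Delta> \<Longrightarrow> typed T E (Pm v x y w) C"
| ty_lam: "typed T (\<Gamma> @ [(x, A)]) v B \<Longrightarrow> typed T \<Gamma> (Lam x A v) (Lolli A B)"
| ty_app: "typed T \<Gamma> v (Lolli A B) \<Longrightarrow> typed T \<Delta> w A \<Longrightarrow> is_ctx E \<Longrightarrow> E \<in> shuffles \<Gamma> \<Delta> \<Longrightarrow>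
    typed T E (App v w) B"


section \<open>Theories and their theorems\<close>

definition vequation ::
  "'v set \<Rightarrow> ('g, 'f, 'v) vlam_theory \<Rightarrow>
   'g ctx \<Rightarrow> ('g, 'f) tm \<Rightarrow> 'v \<Rightarrow> ('g, 'f) tm \<Rightarrow> 'g ty \<Rightarrow> bool" where
  "vequation B T \<Gamma> v q w A \<longleftrightarrow> typed T \<Gamma> v A \<and> typed T \<Gamma> w A \<and> q \<in> B"

definition linear_vlam_theory :: "'v set \<Rightarrow> ('g, 'f, 'v) vlam_theory \<Rightarrow> bool" where
  "linear_vlam_theory B T \<longleftrightarrow>
     (\<forall>f\<in>ops T. op_args T f \<noteq> [] \<and>
        (\<forall>A\<in>set (op_args T f). set_ty A \<subseteq> ground T) \<and> set_ty (op_res T f) \<subseteq> ground T) \<and>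
     (\<forall>(\<Gamma>, v, q, w, A)\<in>axs T. vequation B T \<Gamma> v q w A)"

text \<open>
  The equations \<open>lhs = rhs\<close> of the linear \<open>\<lambda>\<close>-calculus, together with the context and type.  The
  freshness conditions say that bound variables are not captured.
\<close>

inductive lam_eq ::
  "('g, 'f, 'v) vlam_theory \<Rightarrow> 'g ctx \<Rightarrow> ('g, 'f) tm \<Rightarrow> ('g, 'f) tm \<Rightarrow> 'g ty \<Rightarrow> bool"
  for T :: "('g, 'f, 'v) vlam_theory" where
  pm_beta: "typed T \<Gamma> v A \<Longrightarrow> typed T \<Delta> w B \<Longrightarrow> typed T (\<Theta> @ [(x, A), (y, B)]) u C \<Longrightarrow>
    is_ctx E \<Longrightarrow> E \<in> nshuffles [\<Gamma>, \<Delta>, \<Theta>] \<Longrightarrow>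
    lam_eq T E (Pm (Ten v w) x y u) (u[x ::= v, y ::= w]) C"
| pm_eta: "typed T \<Gamma> v (Tensor A B) \<Longrightarrow> typed T (\<Delta> @ [(z, Tensor A B)]) u C \<Longrightarrow>
    x \<noteq> y \<Longrightarrow> x \<notin> ctx_vars \<Delta> \<Longrightarrow> y \<notin> ctx_vars \<Delta> \<Longrightarrow> is_ctx E \<Longrightarrow> E \<in> shuffles \<Gamma> \<Delta> \<Longrightarrow>
    lam_eq T E (Pm v x y (u[z ::= Ten (Var x) (Var y)])) (u[z ::= v]) C"
| star_beta: "typed T \<Gamma> v A \<Longrightarrow> lam_eq T \<Gamma> (LetStar Star v) v A"
| star_eta: "typed T \<Gamma> v TUnit \<Longrightarrow> typed T (\<Delta> @ [(z, TUnit)]) w A \<Longrightarrow>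
    is_ctx E \<Longrightarrow> E \<in> shuffles \<Gamma> \<Delta> \<Longrightarrow>
    lam_eq T E (LetStar v (w[z ::= Star])) (w[z ::= v]) A"
| lam_beta: "typed T (\<Gamma> @ [(x, A)]) v B \<Longrightarrow> typed T \<Delta> w A \<Longrightarrow>
    is_ctx E \<Longrightarrow> E \<in> shuffles \<Gamma> \<Delta> \<Longrightarrow>
    lam_eq T E (App (Lam x A v) w) (v[x ::= w]) B"
| lam_eta: "typed T \<Gamma> v (Lolli A B) \<Longrightarrow> x \<notin> ctx_vars \<Gamma> \<Longrightarrow>
    lam_eq T \<Gamma> (Lam x A (App v (Var x))) v (Lolli A B)"
| star_comm: "typed T \<Gamma> v TUnit \<Longrightarrow> typed T \<Delta> w A \<Longrightarrow> typed T (\<Theta> @ [(z, A)]) u C \<Longrightarrow>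
    is_ctx E \<Longrightarrow> E \<in> nshuffles [\<Gamma>, \<Delta>, \<Theta>] \<Longrightarrow>
    lam_eq T E (u[z ::= LetStar v w]) (LetStar v (u[z ::= w])) C"
| pm_comm: "typed T \<Gamma> v (Tensor A B) \<Longrightarrow> typed T (\<Delta> @ [(x, A), (y, B)]) w D \<Longrightarrow>
    typed T (\<Theta> @ [(z, D)]) u C \<Longrightarrow> x \<notin> ctx_vars \<Theta> \<Longrightarrow> y \<notin> ctx_vars \<Theta> \<Longrightarrow>
    is_ctx E \<Longrightarrow> E \<in> nshuffles [\<Gamma>, \<Delta>, \<Theta>] \<Longrightarrow>
    lam_eq T E (u[z ::= Pm v x y w]) (Pm v x y (u[z ::= w])) C"

text \<open>
  \<open>is_theorem B T \<Gamma> v q w A\<close> means that \<open>\<Gamma> \<rhd> v =\<^sub>q w : A\<close> is a theorem of \<open>T\<close>.  Labels of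
  \<open>\<V>\<close>-equations lie in the basis \<open>B\<close>, so the labels \<open>r\<close> in the rules \<open>weak\<close> and \<open>arch\<close> range over
  \<open>B\<close>.
\<close>

inductive is_theorem ::
  "'v::continuous_integral_quantale set \<Rightarrow> ('g, 'f, 'v) vlam_theory \<Rightarrow>
   'g ctx \<Rightarrow> ('g, 'f) tm \<Rightarrow> 'v \<Rightarrow> ('g, 'f) tm \<Rightarrow> 'g ty \<Rightarrow> bool"
  for B :: "'v set" and T :: "('g, 'f, 'v) vlam_theory" where
  ax: "(\<Gamma>, v, q, w, A) \<in> axs T \<Longrightarrow> is_theorem B T \<Gamma> v q w A"
| lam_eq: "lam_eq T \<Gamma> v w A \<Longrightarrow> is_theorem B T \<Gamma> v top w A"
| lam_eq_sym: "lam_eq T \<Gamma> v w A \<Longrightarrow> is_theorem B T \<Gamma> w top v A"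
| refl: "typed T \<Gamma> v A \<Longrightarrow> is_theorem B T \<Gamma> v top v A"
| trans: "is_theorem B T \<Gamma> v q w A \<Longrightarrow> is_theorem B T \<Gamma> w r u A \<Longrightarrow> is_theorem B T \<Gamma> v (q * r) u A"
| weak: "is_theorem B T \<Gamma> v q w A \<Longrightarrow> r \<in> B \<Longrightarrow> r \<le> q \<Longrightarrow> is_theorem B T \<Gamma> v r w A"
| arch: "typed T \<Gamma> v A \<Longrightarrow> typed T \<Gamma> w A \<Longrightarrow> q \<in> B \<Longrightarrow>
    (\<forall>r\<in>B. r \<lless> q \<longrightarrow> is_theorem B T \<Gamma> v r w A) \<Longrightarrow> is_theorem B T \<Gamma> v q w A"
| join: "typed T \<Gamma> v A \<Longrightarrow> typed T \<Gamma> w A \<Longrightarrow> finite Q \<Longrightarrow>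
    (\<forall>q\<in>Q. is_theorem B T \<Gamma> v q w A) \<Longrightarrow> is_theorem B T \<Gamma> v (Sup Q) w A"
| cong_op: "f \<in> ops T \<Longrightarrow> length \<Gamma>s = length (op_args T f) \<Longrightarrow> length vs = length (op_args T f) \<Longrightarrow>
    length qs = length (op_args T f) \<Longrightarrow> length ws = length (op_args T f) \<Longrightarrow>
    (\<forall>i<length (op_args T f).
      is_theorem B T (\<Gamma>s ! i) (vs ! i) (qs ! i) (ws ! i) (op_args T f ! i)) \<Longrightarrow>
    is_ctx E \<Longrightarrow> E \<in> nshuffles \<Gamma>s \<Longrightarrow>
    is_theorem B T E (Op f vs) (prod_list qs) (Op f ws) (op_res T f)"
| cong_pair: "is_theorem B T \<Gamma> v q w A \<Longrightarrow> is_theorem B T \<Delta> v' r w' A' \<Longrightarrow>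
    is_ctx E \<Longrightarrow> E \<in> shuffles \<Gamma> \<Delta> \<Longrightarrow>
    is_theorem B T E (Ten v v') (q * r) (Ten w w') (Tensor A A')"
| cong_pm: "is_theorem B T \<Gamma> v q w (Tensor A A') \<Longrightarrow>
    is_theorem B T (\<Delta> @ [(x, A), (y, A')]) v' r w' C \<Longrightarrow> is_ctx E \<Longrightarrow> E \<in> shuffles \<Gamma> \<Delta> \<Longrightarrow>
    is_theorem B T E (Pm v x y v') (q * r) (Pm w x y w') C"
| cong_letstar: "is_theorem B T \<Gamma> v q w TUnit \<Longrightarrow> is_theorem B T \<Delta> v' r w' A \<Longrightarrow>
    is_ctx E \<Longrightarrow> E \<in> shuffles \<Gamma> \<Delta> \<Longrightarrow>
    is_theorem B T E (LetStar v v') (q * r) (LetStar w w') A"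
| cong_app: "is_theorem B T \<Gamma> v q w (Lolli A A') \<Longrightarrow> is_theorem B T \<Delta> v' r w' A \<Longrightarrow>
    is_ctx E \<Longrightarrow> E \<in> shuffles \<Gamma> \<Delta> \<Longrightarrow>
    is_theorem B T E (App v v') (q * r) (App w w') A'"
| cong_subst: "is_theorem B T (\<Gamma> @ [(x, A)]) v q w A' \<Longrightarrow> is_theorem B T \<Delta> v' r w' A \<Longrightarrow>
    is_ctx E \<Longrightarrow> E \<in> shuffles \<Gamma> \<Delta> \<Longrightarrow>
    is_theorem B T E (v[x ::= v']) (q * r) (w[x ::= w']) A'"
| cong_lam: "is_theorem B T (\<Gamma> @ [(x, A)]) v q w A' \<Longrightarrow>
    is_theorem B T \<Gamma> (Lam x A v) q (Lam x A w) (Lolli A A')"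
| perm: "is_theorem B T \<Gamma> v q w A \<Longrightarrow> mset \<Delta> = mset \<Gamma> \<Longrightarrow> is_theorem B T \<Delta> v q w A"


section \<open>Varietal theories\<close>

text \<open>The variable \<open>x\<close> of the contexts \<open>x : A\<close> is fixed to be the variable \<open>0\<close>.\<close>

definition Val :: "('g, 'f, 'v) vlam_theory \<Rightarrow> 'g ty \<Rightarrow> 'g ty \<Rightarrow> ('g, 'f) tm set" where
  "Val T A A' = {v. typed T [(0, A)] v A'}"

definition val_dist ::
  "'v::continuous_integral_quantale set \<Rightarrow> ('g, 'f, 'v) vlam_theory \<Rightarrow> 'g ty \<Rightarrow> 'g ty \<Rightarrow>
   ('g, 'f) tm \<Rightarrow> ('g, 'f) tm \<Rightarrow> 'v" where
  "val_dist B T A A' v w = Sup {q. is_theorem B T [(0, A)] v q w A'}"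

definition val_quot ::
  "'v::continuous_integral_quantale set \<Rightarrow> ('g, 'f, 'v) vlam_theory \<Rightarrow> 'g ty \<Rightarrow> 'g ty \<Rightarrow>
   ('g, 'f) tm set set" where
  "val_quot B T A A' =
     Val T A A' // {(v, w) \<in> Val T A A' \<times> Val T A A'.
       1 \<le> val_dist B T A A' v w \<and> 1 \<le> val_dist B T A A' w v}"

text \<open>
  A collection is small if it is in bijection with a subset of the type \<open>'u\<close>, the universe of
  sets.  No smallness is imposed on the classes of ground types, operation symbols and axioms.
\<close>

definition varietal ::
  "'v::continuous_integral_quantale set \<Rightarrow> ('g, 'f, 'v) vlam_theory \<Rightarrow> 'u itself \<Rightarrow> bool" where
  "varietal B T U \<longleftrightarrow>
     (\<forall>A A'. set_ty A \<subseteq> ground T \<longrightarrow> set_ty A' \<subseteq> ground T \<longrightarrow>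
        val_quot B T A A' \<lesssim> (UNIV :: 'u set))"


section \<open>Interpretations and models\<close>

record ('o, 'u, 'v, 'g, 'f) interp = "('o, 'u, 'v) acat" +
  ground_obj :: "'g \<Rightarrow> 'o"
  op_mor :: "'f \<Rightarrow> ('o, 'u) arr"

primrec ty_obj :: "('o, 'u, 'v, 'g, 'f) interp \<Rightarrow> 'g ty \<Rightarrow> 'o" where
  "ty_obj M (Ground X) = ground_obj M X"
| "ty_obj M TUnit = tunit M"
| "ty_obj M (Tensor A B) = tobj M (ty_obj M A) (ty_obj M B)"
| "ty_obj M (Lolli A B) = iobj M (ty_obj M A) (ty_obj M B)"

definition ctx_obj :: "('o, 'u, 'v, 'g, 'f) interp \<Rightarrow> 'g ctx \<Rightarrow> 'o" where
  "ctx_obj M \<Gamma> = ntobj M (map (\<lambda>(x, A). ty_obj M A) \<Gamma>)"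

text \<open>
  The isomorphism from the tensor of the interpretations of \<open>\<Gamma>\<close> and \<open>A\<close> to the interpretation
  of \<open>\<Gamma>, x : A\<close>.
\<close>

definition jn :: "('o, 'u, 'v, 'g, 'f) interp \<Rightarrow> 'g ctx \<Rightarrow> 'g ty \<Rightarrow> ('o, 'u) arr" where
  "jn M \<Gamma> A =
     (if \<Gamma> = [] then lunit M (ty_obj M A) else ident M (tobj M (ctx_obj M \<Gamma>) (ty_obj M A)))"

text \<open>
  \<open>shuffle_mor M \<Gamma> \<Delta> E s\<close>: the list \<open>E\<close> is a shuffle of \<open>\<Gamma>\<close> and \<open>\<Delta>\<close>, and \<open>s\<close> is the
  structural isomorphism from the interpretation of \<open>E\<close> to the tensor of the interpretations of
  \<open>\<Gamma>\<close> and \<open>\<Delta>\<close> that carries each variable to its occurrence in \<open>\<Gamma>\<close> or \<open>\<Delta>\<close>.  Any other way of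
  building it from associators, unitors and symmetries gives the same morphism, by coherence.
\<close>

inductive shuffle_mor ::
  "('o, 'u, 'v, 'g, 'f) interp \<Rightarrow> 'g ctx \<Rightarrow> 'g ctx \<Rightarrow> 'g ctx \<Rightarrow> ('o, 'u) arr \<Rightarrow> bool"
  for M :: "('o, 'u, 'v, 'g, 'f) interp" (structure) where
  "shuffle_mor M [] [] [] (inv_arr M (\<l> \<one>))"
| "shuffle_mor M \<Gamma> \<Delta> E s \<Longrightarrow>
   shuffle_mor M (\<Gamma> @ [(x, A)]) \<Delta> (E @ [(x, A)])
     ((jn M \<Gamma> A \<otimes> \<i> (ctx_obj M \<Delta>)) \<cdot>
      inv_arr M (\<a> (ctx_obj M \<Gamma>) (ty_obj M A) (ctx_obj M \<Delta>)) \<cdot>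
      (\<i> (ctx_obj M \<Gamma>) \<otimes> \<s> (ctx_obj M \<Delta>) (ty_obj M A)) \<cdot>
      \<a> (ctx_obj M \<Gamma>) (ctx_obj M \<Delta>) (ty_obj M A) \<cdot>
      (s \<otimes> \<i> (ty_obj M A)) \<cdot>
      inv_arr M (jn M E A))"
| "shuffle_mor M \<Gamma> \<Delta> E s \<Longrightarrow>
   shuffle_mor M \<Gamma> (\<Delta> @ [(x, A)]) (E @ [(x, A)])
     ((\<i> (ctx_obj M \<Gamma>) \<otimes> jn M \<Delta> A) \<cdot>
      \<a> (ctx_obj M \<Gamma>) (ctx_obj M \<Delta>) (ty_obj M A) \<cdot>
      (s \<otimes> \<i> (ty_obj M A)) \<cdot>
      inv_arr M (jn M E A))"

text \<open>The same for the shuffles of \<open>n \<ge> 1\<close> contexts; the tensors are nested to the left.\<close>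

inductive nshuffle_mor ::
  "('o, 'u, 'v, 'g, 'f) interp \<Rightarrow> 'g ctx list \<Rightarrow> 'g ctx \<Rightarrow> ('o, 'u) arr \<Rightarrow> bool"
  for M :: "('o, 'u, 'v, 'g, 'f) interp" (structure) where
  "nshuffle_mor M [\<Gamma>] \<Gamma> (\<i> (ctx_obj M \<Gamma>))"
| "nshuffle_mor M \<Gamma>s D t \<Longrightarrow> shuffle_mor M D \<Delta> E s \<Longrightarrow>
   nshuffle_mor M (\<Gamma>s @ [\<Delta>]) E ((t \<otimes> \<i> (ctx_obj M \<Delta>)) \<cdot> s)"

text \<open>
  \<open>denotes T M \<Gamma> v A m\<close> means that \<open>m\<close> is the morphism obtained by interpreting a derivation of
  \<open>\<Gamma> \<rhd> v : A\<close>.  Contexts have distinct variables, so the derivation is unique up to the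
  choice of the bound variables.
\<close>

inductive denotes ::
  "('g, 'f, 'v) vlam_theory \<Rightarrow> ('o, 'u, 'v, 'g, 'f) interp \<Rightarrow>
   'g ctx \<Rightarrow> ('g, 'f) tm \<Rightarrow> 'g ty \<Rightarrow> ('o, 'u) arr \<Rightarrow> bool"
  for T :: "('g, 'f, 'v) vlam_theory" and M :: "('o, 'u, 'v, 'g, 'f) interp" (structure) where
  den_op: "f \<in> ops T \<Longrightarrow> length \<Gamma>s = length (op_args T f) \<Longrightarrow> length vs = length (op_args T f) \<Longrightarrow>
    length ms = length (op_args T f) \<Longrightarrow>
    (\<forall>i<length (op_args T f). denotes T M (\<Gamma>s ! i) (vs ! i) (op_args T f ! i) (ms ! i)) \<Longrightarrow>
    is_ctx E \<Longrightarrow> nshuffle_mor M \<Gamma>s E s \<Longrightarrow>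
    denotes T M E (Op f vs) (op_res T f) (op_mor M f \<cdot> ntmor M ms \<cdot> s)"
| den_var: "set_ty A \<subseteq> ground T \<Longrightarrow> denotes T M [(x, A)] (Var x) A (\<i> (ty_obj M A))"
| den_star: "denotes T M [] Star TUnit (\<i> \<one>)"
| den_letstar: "denotes T M \<Gamma> v TUnit m \<Longrightarrow> denotes T M \<Delta> w A n \<Longrightarrow>
    is_ctx E \<Longrightarrow> shuffle_mor M \<Gamma> \<Delta> E s \<Longrightarrow>
    denotes T M E (LetStar v w) A (n \<cdot> \<l> (ctx_obj M \<Delta>) \<cdot> (m \<otimes> \<i> (ctx_obj M \<Delta>)) \<cdot> s)"
| den_pair: "denotes T M \<Gamma> v A m \<Longrightarrow> denotes T M \<Delta> w B n \<Longrightarrow>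
    is_ctx E \<Longrightarrow> shuffle_mor M \<Gamma> \<Delta> E s \<Longrightarrow>
    denotes T M E (Ten v w) (Tensor A B) ((m \<otimes> n) \<cdot> s)"
| den_pm: "denotes T M \<Gamma> v (Tensor A B) m \<Longrightarrow> denotes T M (\<Delta> @ [(x, A), (y, B)]) w C n \<Longrightarrow>
    is_ctx E \<Longrightarrow> shuffle_mor M \<Gamma> \<Delta> E s \<Longrightarrow>
    denotes T M E (Pm v x y w) C
      (n \<cdot> jn M (\<Delta> @ [(x, A)]) B \<cdot> (jn M \<Delta> A \<otimes> \<i> (ty_obj M B)) \<cdot>
       inv_arr M (\<a> (ctx_obj M \<Delta>) (ty_obj M A) (ty_obj M B)) \<cdot>
       \<s> (ty_obj M (Tensor A B)) (ctx_obj M \<Delta>) \<cdot>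
       (m \<otimes> \<i> (ctx_obj M \<Delta>)) \<cdot> s)"
| den_lam: "denotes T M (\<Gamma> @ [(x, A)]) v B m \<Longrightarrow>
    denotes T M \<Gamma> (Lam x A v) (Lolli A B)
      (curry_at M (ty_obj M A) (ctx_obj M \<Gamma>) (ty_obj M B) (m \<cdot> jn M \<Gamma> A))"
| den_app: "denotes T M \<Gamma> v (Lolli A B) m \<Longrightarrow> denotes T M \<Delta> w A n \<Longrightarrow>
    is_ctx E \<Longrightarrow> shuffle_mor M \<Gamma> \<Delta> E s \<Longrightarrow>
    denotes T M E (App v w) B (eval_at M (ty_obj M A) (ty_obj M B) \<cdot> (m \<otimes> n) \<cdot> s)"

definition denotation ::
  "('g, 'f, 'v) vlam_theory \<Rightarrow> ('o, 'u, 'v, 'g, 'f) interp \<Rightarrow>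
   'g ctx \<Rightarrow> ('g, 'f) tm \<Rightarrow> 'g ty \<Rightarrow> ('o, 'u) arr" where
  "denotation T M \<Gamma> v A = (THE m. denotes T M \<Gamma> v A m)"

definition holds ::
  "('g, 'f, 'v::continuous_integral_quantale) vlam_theory \<Rightarrow> ('o, 'u, 'v, 'g, 'f) interp \<Rightarrow>
   'g ctx \<Rightarrow> ('g, 'f) tm \<Rightarrow> 'v \<Rightarrow> ('g, 'f) tm \<Rightarrow> 'g ty \<Rightarrow> bool" where
  "holds T M \<Gamma> v q w A \<longleftrightarrow> q \<le> hdist M (denotation T M \<Gamma> v A) (denotation T M \<Gamma> w A)"

definition is_model ::
  "('g, 'f, 'v::continuous_integral_quantale) vlam_theory \<Rightarrow> ('o, 'u, 'v, 'g, 'f) interp \<Rightarrow> bool"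
where
  "is_model T M \<longleftrightarrow>
     enriched_autonomous_cat M \<and>
     (\<forall>X\<in>ground T. ground_obj M X \<in> obj M) \<and>
     (\<forall>f\<in>ops T. op_mor M f \<in>
        hom M (ntobj M (map (ty_obj M) (op_args T f))) (ty_obj M (op_res T f))) \<and>
     (\<forall>(\<Gamma>, v, q, w, A)\<in>axs T. holds T M \<Gamma> v q w A)"

end

theory Submission
 imports Defs
begin

text \<open>
 Soundness: a term uses each of its variables once, so it has a shape, a tensor expression whose
 leaves are those variables, and a morphism from the interpretation of its shape.  By coherence
 the structural isomorphism from the context to the shape does not depend on how it is built;
 hence the interpretation is independent of the derivation, and substitution becomes composition.

 Completeness: the types and the terms in one variable, up to provable equality, form a model.
 A term whose variable has a tensor type is determined, even up to a given label, by its value on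
 a tuple of variables (\<open>pat_ext\<close>, from the \<open>\<eta>\<close>-rules), so each law of the model is checked by letting
 both sides act on such a tuple.  A judgement denotes its own term with the tuple of its context
 substituted, and the Archimedean and join rules turn the distance in the model into a theorem.
\<close>

text \<open>The denotation is a \<open>THE\<close> over an inductive relation whose rules leave open
  how a context is split, which names bound variables get and how a shuffle is built. So uniqueness
  has to come before any equation, and a derivation is not a recursion on its term. It becomes one
  when contexts give way to environments: \<open>hty\<close> types a term, \<open>lin\<close> and
  \<open>uses\<close> record linearity, and \<open>ar\<close> reads a morphism off the term alone,
  with structural isomorphisms only at binders. As this recursion goes under binders, dangling
  indices are leaves on a par with free variables. Equations are then compared from whichever
  arrangement of the context suits the rule at hand. On the syntactic side the homs must embed into
  \<open>'u\<close>; varietality supplies the codes, and arrows are handled through representatives.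
  Choosing one normal form in each class of equal terms turns provable equality into equality, so
  that composites of arrows can be evaluated on tuples by rewriting.\<close>

datatype name = Free var | Bd nat

section \<open>Tensor expressions\<close>

datatype 'l ex = EUnit | Leaf 'l | EJoin "'l ex" "'l ex"

primrec leaves :: "'l ex => 'l multiset" where
 "leaves EUnit = {#}"
| "leaves (Leaf l) = {#l#}"
| "leaves (EJoin d e) = leaves d + leaves e"

primrec esub :: "('l => 'k ex) => 'l ex => 'k ex" where
 "esub h EUnit = EUnit"
| "esub h (Leaf l) = h l"
| "esub h (EJoin d e) = EJoin (esub h d) (esub h e)"

fun njoin :: "'l ex list => 'l ex" where
 "njoin [] = EUnit"
| "njoin (e # es) = foldl EJoin e es"

lemma leaves_esub: "leaves (esub h e) = (\<Sum>l\<in>#leaves e. leaves (h l))"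
 by (induction e) auto

lemma leaves_esub_Leaf: "leaves (esub (%l. Leaf (\<rho> l)) e) = image_mset \<rho> (leaves e)"
 by (induction e) auto

lemma esub_esub: "esub g (esub h e) = esub (%l. esub g (h l)) e"
 by (induction e) auto

lemma esub_Leaf [simp]: "esub Leaf e = e"
 by (induction e) auto

lemma esub_cong: "(\<And>l. l \<in># leaves e ==> g l = h l) ==> esub g e = esub h e"
 by (induction e) auto

lemma esub_ident: "(\<And>l. l \<in># leaves e ==> h l = Leaf l) ==> esub h e = e"
 using esub_cong[of e h Leaf] by simp

lemma foldl_EJoin_leaves: "leaves (foldl EJoin e es) = leaves e + sum_list (map leaves es)"
 by (induction es arbitrary: e) (auto simp: add.assoc)

lemma leaves_njoin [simp]: "leaves (njoin es) = sum_list (map leaves es)"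
 by (cases es) (auto simp: foldl_EJoin_leaves)

lemma esub_njoin: "esub h (njoin es) = njoin (map (esub h) es)"
proof -
 have "esub h (foldl EJoin e es) = foldl EJoin (esub h e) (map (esub h) es)" for e es
  by (induction es arbitrary: e) auto
 then show ?thesis by (cases es) auto
qed

lemma njoin_snoc: "es \<noteq> [] ==> njoin (es @ [e]) = EJoin (njoin es) e"
 by (cases es) auto

section \<open>Shapes of terms, linearity and typing without contexts\<close>

primrec up :: "name => name" where
 "up (Free x) = Free x"
| "up (Bd i) = Bd (Suc i)"

text \<open>Leaving a binder. The leaf of the bound variable is overwritten by the unit instead of
  being deleted, which makes the operation on expressions an instance of \<open>esub\<close>; the
  other indices drop by one.\<close>

fun down :: "name => name ex" where
 "down (Free x) = Leaf (Free x)"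
| "down (Bd 0) = EUnit"
| "down (Bd (Suc i)) = Leaf (Bd i)"

fun push :: "'g ty => (name => 'g ty) => name => 'g ty" where
 "push A E (Free x) = E (Free x)"
| "push A E (Bd 0) = A"
| "push A E (Bd (Suc i)) = E (Bd i)"

text \<open>The arrangement in which a term consumes its names; it becomes the source of the
  morphism \<open>ar\<close>. The body of a binder contributes its own shape, with units in place of
  the bound leaves.\<close>

primrec shape :: "('g, 'f) tm => name ex" where
 "shape (Var x) = Leaf (Free x)"
| "shape (Bound i) = Leaf (Bd i)"
| "shape (Op f vs) = njoin (map shape vs)"
| "shape Star = EUnit"
| "shape (LetStar v w) = EJoin (shape v) (shape w)"
| "shape (Ten v w) = EJoin (shape v) (shape w)"
| "shape (PmB v w) = EJoin (shape v) (esub down (esub down (shape w)))"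
| "shape (LamB A v) = esub down (shape v)"
| "shape (App v w) = EJoin (shape v) (shape w)"

abbreviation uses :: "('g, 'f) tm => name multiset" where
 "uses v \<equiv> leaves (shape v)"

text \<open>Linearity is split in two: here every bound index occurs exactly once in its scope,
  while the names left free are controlled from outside through the multiset \<open>uses\<close>.
  The clause for \<open>Op\<close> goes through \<open>map\<close> to stay primitive
  recursive.\<close>

primrec lin :: "('g, 'f) tm => bool" where
 "lin (Var x) = True"
| "lin (Bound i) = True"
| "lin (Op f vs) = (\<forall>b\<in>set (map lin vs). b)"
| "lin Star = True"
| "lin (LetStar v w) = (lin v & lin w)"
| "lin (Ten v w) = (lin v & lin w)"
| "lin (PmB v w) = (lin v & lin w & count (uses w) (Bd 0) = 1 & count (uses w) (Bd 1) = 1)"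
| "lin (LamB A v) = (lin v & count (uses v) (Bd 0) = 1)"
| "lin (App v w) = (lin v & lin w)"

text \<open>Typing without linearity, against a total environment. No context is split, so the
  relation is a recursion on the term, and the environment changes only under binders. The second
  component of a pair has index 0 and is therefore pushed last.\<close>

primrec hty :: "('g, 'f, 'v) vlam_theory => (name => 'g ty) => ('g, 'f) tm => 'g ty => bool" where
 "hty T E (Var x) C = (C = E (Free x) & set_ty C \<subseteq> ground T)"
| "hty T E (Bound i) C = (C = E (Bd i) & set_ty C \<subseteq> ground T)"
| "hty T E (Op f vs) C =
   (f \<in> ops T & C = op_res T f & list_all2 (%h. h) (map (hty T E) vs) (op_args T f))"
| "hty T E Star C = (C = TUnit)"
| "hty T E (LetStar v w) C = (hty T E v TUnit & hty T E w C)"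
| "hty T E (Ten v w) C = (\<exists>A B. C = Tensor A B & hty T E v A & hty T E w B)"
| "hty T E (PmB v w) C = (\<exists>A B. hty T E v (Tensor A B) & hty T (push B (push A E)) w C)"
| "hty T E (LamB A v) C = (\<exists>B. C = Lolli A B & hty T (push A E) v B)"
| "hty T E (App v w) C = (\<exists>A. hty T E v (Lolli A C) & hty T E w A)"

lemma hty_Op: "hty T E (Op f vs) C \<longleftrightarrow>
 f \<in> ops T & C = op_res T f & length vs = length (op_args T f) &
 (\<forall>i<length vs. hty T E (vs ! i) (op_args T f ! i))"
 by (auto simp: list_all2_conv_all_nth)

lemma hty_unique: "hty T E v A ==> hty T E v A' ==> A = A'"
proof (induction v arbitrary: E A A')
 case (PmB v w)
 then show ?case by simp blast
next
 case (LamB B v)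
 then show ?case by simp blast
next
 case (Ten v w)
 then show ?case by simp blast
next
 case (App v w)
 then show ?case by simp blast
qed auto

lemma down_Free_iff: "Free x \<in># leaves (down l) \<longleftrightarrow> l = Free x"
 by (cases l rule: down.cases) auto

lemma down_Bd_iff: "Bd i \<in># leaves (down l) \<longleftrightarrow> l = Bd (Suc i)"
 by (cases l rule: down.cases) auto

lemma in_leaves_esub: "k \<in># leaves (esub h e) \<longleftrightarrow> (\<exists>l. l \<in># leaves e & k \<in># leaves (h l))"
 by (induction e) auto

lemma in_down: "k \<in># leaves (esub down e) \<longleftrightarrow> up k \<in># leaves e"
 by (cases k) (auto simp: in_leaves_esub down_Free_iff down_Bd_iff)

lemma in_sum_list: "x \<in># sum_list (ms :: 'a multiset list) \<longleftrightarrow> (\<exists>m\<in>set ms. x \<in># m)"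
 by (induction ms) auto

subsection \<open>Renaming\<close>

fun upn :: "(name => name) => name => name" where
 "upn \<rho> (Free x) = up (\<rho> (Free x))"
| "upn \<rho> (Bd 0) = Bd 0"
| "upn \<rho> (Bd (Suc i)) = up (\<rho> (Bd i))"

primrec name_tm :: "name => ('g, 'f) tm" where
 "name_tm (Free x) = Var x"
| "name_tm (Bd i) = Bound i"

text \<open>Free names and dangling indices are renamed alike, so that binding a variable and
  opening a binder are both instances, and their properties reduce to facts about renamings.\<close>

primrec rnm :: "(name => name) => ('g, 'f) tm => ('g, 'f) tm" where
 "rnm \<rho> (Var x) = name_tm (\<rho> (Free x))"
| "rnm \<rho> (Bound i) = name_tm (\<rho> (Bd i))"
| "rnm \<rho> (Op f vs) = Op f (map (rnm \<rho>) vs)"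
| "rnm \<rho> Star = Star"
| "rnm \<rho> (LetStar v w) = LetStar (rnm \<rho> v) (rnm \<rho> w)"
| "rnm \<rho> (Ten v w) = Ten (rnm \<rho> v) (rnm \<rho> w)"
| "rnm \<rho> (PmB v w) = PmB (rnm \<rho> v) (rnm (upn (upn \<rho>)) w)"
| "rnm \<rho> (LamB A v) = LamB A (rnm (upn \<rho>) v)"
| "rnm \<rho> (App v w) = App (rnm \<rho> v) (rnm \<rho> w)"

lemma shape_name_tm [simp]: "shape (name_tm l) = Leaf l"
 by (cases l) auto

lemma lin_name_tm [simp]: "lin (name_tm l)"
 by (cases l) auto

lemma hty_name_tm [simp]: "hty T E (name_tm l) A = (A = E l & set_ty A \<subseteq> ground T)"
 by (cases l) auto

lemma down_up [simp]: "down (up l) = Leaf l"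
 by (cases l) auto

lemma push_up [simp]: "push A E (up l) = E l"
 by (cases l) auto

lemma up_inject [simp]: "up k = up l \<longleftrightarrow> k = l"
 by (cases k; cases l) auto

lemma up_neq [simp]: "up k \<noteq> Bd 0" "Bd 0 \<noteq> up k"
 by (cases k; simp)+

lemma upn_up [simp]: "upn \<rho> (up l) = up (\<rho> l)"
 by (cases l) auto

lemma name_up_cases: obtains "l = Bd 0" | k where "l = up k"
 by (metis down.cases up.simps)

lemma push_cong: "(\<And>l. up l \<in> S ==> E l = E' l) ==> k \<in> S ==> push A E k = push A E' k"
 by (cases k rule: name_up_cases) auto

lemma hty_cong: "(\<And>l. l \<in># uses v ==> E l = E' l) ==> hty T E v A = hty T E' v A"
proof (induction v arbitrary: E E' A)
 case (Op f vs)
 have "hty T E v = hty T E' v" if "v \<in> set vs" for v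
  using that Op.prems by (intro ext Op.IH) (auto simp: in_sum_list)
 then have "map (hty T E) vs = map (hty T E') vs"
  by simp
 then show ?case by (simp only: hty.simps)
next
 case (PmB v w)
 have "hty T E v B = hty T E' v B" for B
  using PmB.prems by (intro PmB.IH) auto
 moreover have "hty T (push B (push A E)) w C = hty T (push B (push A E')) w C" for A B C
  using PmB.prems
  by (intro PmB.IH push_cong[where S = "set_mset (uses w)"]
    push_cong[where S = "set_mset (leaves (esub down (shape w)))"]) (auto simp: in_down)
 ultimately show ?case by simp
next
 case (LamB B v)
 have "hty T (push B E) v C = hty T (push B E') v C" for C
  using LamB.prems
  by (intro LamB.IH push_cong[where S = "set_mset (uses v)"]) (auto simp: in_down)
 then show ?case by simp
next
 case (LetStar v w)
 have "hty T E v C = hty T E' v C" "hty T E w C = hty T E' w C" for C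
  using LetStar.prems by (auto intro!: LetStar.IH)
 then show ?case by simp
next
 case (Ten v w)
 have "hty T E v C = hty T E' v C" "hty T E w C = hty T E' w C" for C
  using Ten.prems by (auto intro!: Ten.IH)
 then show ?case by simp
next
 case (App v w)
 have "hty T E v C = hty T E' v C" "hty T E w C = hty T E' w C" for C
  using App.prems by (auto intro!: App.IH)
 then show ?case by simp
qed auto

lemma push_upn: "push A E (upn \<rho> l) = push A (%l. E (\<rho> l)) l"
 by (cases l rule: name_up_cases) auto

lemma down_upn: "down (upn \<rho> l) = esub (%l. Leaf (\<rho> l)) (down l)"
 by (cases l rule: name_up_cases) auto

lemma shape_rnm: "shape (rnm \<rho> v) = esub (%l. Leaf (\<rho> l)) (shape v)"
proof (induction v arbitrary: \<rho>)
 case (Op f vs)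
 then show ?case by (auto simp: esub_njoin intro!: arg_cong[where f = njoin])
qed (auto simp: esub_esub down_upn)

lemma uses_rnm: "uses (rnm \<rho> v) = image_mset \<rho> (uses v)"
 by (simp add: shape_rnm leaves_esub_Leaf)

lemma hty_rnm: "hty T E (rnm \<rho> v) A = hty T (%l. E (\<rho> l)) v A"
proof (induction v arbitrary: \<rho> E A)
 case (Op f vs)
 have "hty T E (rnm \<rho> v) = hty T (%l. E (\<rho> l)) v" if "v \<in> set vs" for v
  using that by (intro ext Op.IH)
 then have "map (hty T E) (map (rnm \<rho>) vs) = map (hty T (%l. E (\<rho> l))) vs"
  by simp
 then show ?case by (simp only: hty.simps rnm.simps)
next
 case (LamB B v)
 have "push B E \<circ> upn \<rho> = push B (%l. E (\<rho> l))" for E :: "name => 'a ty" and B \<rho>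
  by (auto simp: push_upn)
 with LamB show ?case by (simp add: o_def)
next
 case (PmB v w)
 have "(%l. push B E (upn \<rho> l)) = push B (%l. E (\<rho> l))" for E :: "name => 'a ty" and B \<rho>
  by (auto simp: push_upn)
 with PmB show ?case by simp
qed auto

lemma inj_on_upn:
 assumes "inj_on \<rho> (set_mset (leaves (esub down e)))"
 shows "inj_on (upn \<rho>) (set_mset (leaves e))"
proof (rule inj_onI)
 fix k l assume "k \<in># leaves e" "l \<in># leaves e" "upn \<rho> k = upn \<rho> l"
 then show "k = l"
  using assms by (cases k rule: name_up_cases; cases l rule: name_up_cases)
   (auto simp: inj_on_def in_down)
qed

text \<open>\<open>upn\<close> fixes \<open>Bd 0\<close> and sends every other name to a shifted
  one, so occurrences of the bound index are neither gained nor lost, even when \<rho> is not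
  injective. This is why renaming preserves \<open>lin\<close>.\<close>

lemma count_image_upn [simp]: "count (image_mset (upn \<rho>) M) (Bd 0) = count M (Bd 0)"
proof (induction M)
 case (add l M)
 then show ?case by (cases l rule: name_up_cases) auto
qed auto

lemma count_image_upn2: "count (image_mset (upn (upn \<rho>)) M) (Bd (Suc 0)) = count M (Bd (Suc 0))"
proof (induction M)
 case (add l M)
 have "upn (upn \<rho>) l = Bd (Suc 0) \<longleftrightarrow> l = Bd (Suc 0)"
 proof (cases l rule: name_up_cases)
  case (2 k)
  have "up (upn \<rho> k) = up (Bd 0) \<longleftrightarrow> k = Bd 0"
   by (cases k rule: name_up_cases) (simp_all del: up.simps)
  then show ?thesis using 2 by (cases k) auto
 qed auto
 with add show ?case by auto
qed auto

lemma lin_rnm: "lin (rnm \<rho> v) = lin v"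
proof (induction v arbitrary: \<rho>)
 case (PmB v w)
 then show ?case by (auto simp: uses_rnm count_image_upn2)
qed (auto simp: uses_rnm)

lemma upn_comp: "upn \<rho> (upn \<sigma> l) = upn (%l. \<rho> (\<sigma> l)) l"
 by (cases l rule: name_up_cases) auto

lemma rnm_name_tm [simp]: "rnm \<rho> (name_tm l) = name_tm (\<rho> l)"
 by (cases l) auto

lemma rnm_rnm: "rnm \<rho> (rnm \<sigma> v) = rnm (%l. \<rho> (\<sigma> l)) v"
proof (induction v arbitrary: \<rho> \<sigma>)
 case (LamB A v)
 have "(%l. upn \<rho> (upn \<sigma> l)) = upn (%l. \<rho> (\<sigma> l))" for \<rho> \<sigma> by (simp add: upn_comp fun_eq_iff)
 with LamB show ?case by simp
next
 case (PmB A v)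
 have "(%l. upn \<rho> (upn \<sigma> l)) = upn (%l. \<rho> (\<sigma> l))" for \<rho> \<sigma> by (simp add: upn_comp fun_eq_iff)
 with PmB show ?case by simp
qed auto

lemma upn_cong: "(\<And>l. up l \<in> S ==> \<rho> l = \<sigma> l) ==> k \<in> S ==> upn \<rho> k = upn \<sigma> k"
 by (cases k rule: name_up_cases) auto

lemma rnm_cong: "(\<And>l. l \<in># uses v ==> \<rho> l = \<sigma> l) ==> rnm \<rho> v = rnm \<sigma> v"
proof (induction v arbitrary: \<rho> \<sigma>)
 case (Op f vs)
 have "rnm \<rho> v = rnm \<sigma> v" if "v \<in> set vs" for v
  using that Op.prems by (intro Op.IH) (auto simp: in_sum_list)
 then show ?case by simp
next
 case (PmB v w)
 have "rnm \<rho> v = rnm \<sigma> v"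
  using PmB.prems by (intro PmB.IH) auto
 moreover have "rnm (upn (upn \<rho>)) w = rnm (upn (upn \<sigma>)) w"
  using PmB.prems
  by (intro PmB.IH upn_cong[where S = "set_mset (uses w)"]
    upn_cong[where S = "set_mset (leaves (esub down (shape w)))"]) (auto simp: in_down)
 ultimately show ?case by simp
next
 case (LamB B v)
 have "rnm (upn \<rho>) v = rnm (upn \<sigma>) v"
  using LamB.prems
  by (intro LamB.IH upn_cong[where S = "set_mset (uses v)"]) (auto simp: in_down)
 then show ?case by simp
qed (fastforce+)

lemma rnm_id: "rnm (%l. l) v = v"
proof (induction v)
 case (Op f vs) then show ?case by (simp add: map_idI)
next
 case (PmB v w)
 have "upn (%l. l) = (%l. l)" using name_up_cases upn.simps(2) upn_up by (metis (mono_tags, lifting))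
 with PmB show ?case by simp
next
 case (LamB v w)
 have "upn (%l. l) = (%l. l)" using name_up_cases upn.simps(2) upn_up by (metis (mono_tags, lifting))
 with LamB show ?case by simp
qed auto

section \<open>Binding a variable and opening a binder, as renamings\<close>

definition bnd :: "nat => var => name => name" where
 "bnd n x l = (if l = Free x then Bd n else l)"

definition opn :: "nat => var => name => name" where
 "opn n x l = (if l = Bd n then Free x else l)"

lemma upn_bnd: "upn (bnd n x) = bnd (Suc n) x"
proof
 fix l show "upn (bnd n x) l = bnd (Suc n) x l"
  by (cases l rule: down.cases) (auto simp: bnd_def)
qed

lemma bindv_rnm: "bindv n x v = rnm (bnd n x) v"
 by (induction v arbitrary: n) (auto simp: upn_bnd, auto simp: bnd_def)

text \<open>Rebinding undoes opening when \<open>x\<close> is fresh: otherwise an old occurrence of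
  \<open>x\<close> would be captured as well. This presents an arbitrary body in the form that the
  named binders produce.\<close>

lemma bindv_opn:
 assumes "Free x \<notin># uses v"
 shows "bindv n x (rnm (opn n x) v) = v"
proof -
 have "rnm (bnd n x) (rnm (opn n x) v) = rnm (%l. l) v"
  unfolding rnm_rnm using assms by (intro rnm_cong) (auto simp: bnd_def opn_def)
 then show ?thesis by (simp add: bindv_rnm rnm_id)
qed

lemma size_rnm [simp]: "size (rnm \<rho> v) = size v"
proof (induction v arbitrary: \<rho>)
 case (Var x) show ?case by (cases "\<rho> (Free x)") auto
next
 case (Bound x) show ?case by (cases "\<rho> (Bd x)") auto
next
 case (Op f vs)
 then have "size_list size (map (rnm \<rho>) vs) = size_list size vs"
  by (induction vs) auto
 then show ?case by simp
qed auto


subsection \<open>Typing\<close>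

definition names :: "'g ctx => name multiset" where
 "names G = image_mset (%p. Free (fst p)) (mset G)"

definition env :: "'g ctx => name => 'g ty" where
 "env G l = (case l of Free x => the (map_of G x) | Bd i => TUnit)"

lemma names_simps [simp]:
 "names [] = {#}" "names (p # G) = add_mset (Free (fst p)) (names G)"
 "names (G @ H) = names G + names H"
 by (auto simp: names_def)

lemma names_mset: "mset G = mset H ==> names G = names H"
 by (simp add: names_def)

lemma names_shuffles: "E \<in> shuffles G H ==> names E = names G + names H"
 by (simp add: names_def mset_shuffles)

lemma Free_in_names [simp]: "Free x \<in># names G \<longleftrightarrow> x \<in> ctx_vars G"
 by (auto simp: names_def ctx_vars_def)

lemma in_names: "l \<in># names G \<longleftrightarrow> (\<exists>x\<in>ctx_vars G. l = Free x)"
 by (auto simp: names_def ctx_vars_def)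

lemma Bd_in_names [simp]: "Bd i \<notin># names G"
 by (auto simp: names_def)

lemma count_names_Bd [simp]: "count (names G) (Bd i) = 0"
 using Bd_in_names by (metis count_inI)

definition uniq :: "'a multiset => bool" where
 "uniq M \<longleftrightarrow> (\<forall>l. count M l \<le> 1)"

lemma uniq_simps [simp]:
 "uniq {#}" "uniq (add_mset l M) \<longleftrightarrow> l \<notin># M & uniq M"
proof -
 show "uniq (add_mset l M) \<longleftrightarrow> l \<notin># M & uniq M"
 proof
  assume h: "uniq (add_mset l M)"
  then have "count (add_mset l M) l \<le> 1" by (simp only: uniq_def)
  moreover have "count M k \<le> 1" for k
   using h unfolding uniq_def by (metis count_add_mset le_SucI le_trans nat_le_linear not_less_eq_eq)
  ultimately show "l \<notin># M & uniq M" by (simp add: not_in_iff uniq_def)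
 qed (auto simp: uniq_def not_in_iff)
qed (simp add: uniq_def)

lemma uniq_union [simp]:
 "uniq (M + N) \<longleftrightarrow> uniq M & uniq N & set_mset M \<inter> set_mset N = {}"
 by (induction M) auto

lemma uniq_image: "uniq M ==> inj_on f (set_mset M) ==> uniq (image_mset f M)"
 by (induction M) (auto simp: inj_on_def)

lemma uniq_subset: "uniq M ==> N \<subseteq># M ==> uniq N"
 by (metis subset_mset.add_diff_inverse uniq_union)

lemma uniq_sum_list: "uniq (sum_list Ms) ==> M \<in> set Ms ==> uniq M"
 by (induction Ms) auto

lemma is_ctx_names: "is_ctx G \<longleftrightarrow> uniq (names G)"
 unfolding is_ctx_def by (induction G) (auto simp: ctx_vars_def)

lemma env_in: "is_ctx G ==> (x, A) \<in> set G ==> env G (Free x) = A"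
 by (simp add: env_def is_ctx_def)

lemma env_subset:
 "is_ctx E ==> is_ctx G ==> set G \<subseteq> set E ==> l \<in># names G ==> env E l = env G l"
 by (auto simp: names_def) (metis env_in subsetD)

lemma env_Cons [simp]: "env ((x, A) # G) (Free y) = (if y = x then A else env G (Free y))"
 by (simp add: env_def)

lemma ctx_vars_simps [simp]: "ctx_vars [] = {}" "ctx_vars (p # G) = insert (fst p) (ctx_vars G)"
 "ctx_vars (G @ H) = ctx_vars G \<union> ctx_vars H"
 by (auto simp: ctx_vars_def)

lemma env_append1: "x \<in> ctx_vars G ==> env (G @ H) (Free x) = env G (Free x)"
 by (induction G) auto

lemma env_append2: "x \<notin> ctx_vars G ==> env (G @ H) (Free x) = env H (Free x)"
 by (induction G) auto

lemma finite_ctx_vars [simp]: "finite (ctx_vars G)"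
 by (simp add: ctx_vars_def)

lemma mset_nshuffles: "E \<in> nshuffles Gs ==> mset E = sum_list (map mset Gs)"
 by (induction Gs arbitrary: E) (auto simp: mset_shuffles)

lemma names_nshuffles: "E \<in> nshuffles Gs ==> names E = sum_list (map names Gs)"
 by (induction Gs arbitrary: E) (auto simp: names_shuffles)

lemma set_nshuffles: "E \<in> nshuffles Gs ==> G \<in> set Gs ==> set G \<subseteq> set E"
 by (induction Gs arbitrary: E) (auto simp: set_shuffles, blast)

text \<open>Building a derivation from a term requires a split of the context. Each entry is sent to
  the side on which its name is used; the relative order is kept, so the result is a
  shuffle.\<close>

lemma split_names:
 assumes "names E = M + N"
 shows "\<exists>G H. E \<in> shuffles G H & names G = M & names H = N"
 using assms
proof (induction E arbitrary: M N)
 case Nil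
 then show ?case by (intro exI[of _ "[]"]) auto
next
 case (Cons p E)
 let ?l = "Free (fst p)"
 have "?l \<in># M \<or> ?l \<in># N" using Cons.prems by (metis names_simps(2) union_iff union_single_eq_member)
 then show ?case
 proof
  assume "?l \<in># M"
  then obtain M' where M: "M = add_mset ?l M'" by (meson multi_member_split)
  with Cons.prems have "names E = M' + N" by simp
  then obtain G H where "E \<in> shuffles G H" "names G = M'" "names H = N" using Cons.IH by blast
  then show ?thesis using M
   by (intro exI[of _ "p # G"] exI[of _ H]) (auto intro: Cons_in_shuffles_leftI)
 next
  assume "?l \<in># N"
  then obtain N' where N: "N = add_mset ?l N'" by (meson multi_member_split)
  with Cons.prems have "names E = M + N'" by simp
  then obtain G H where "E \<in> shuffles G H" "names G = M" "names H = N'" using Cons.IH by blast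
  then show ?thesis using N
   by (intro exI[of _ "G"] exI[of _ "p # H"]) (auto intro: Cons_in_shuffles_rightI)
 qed
qed

lemma nsplit_names:
 assumes "names E = sum_list Ms"
 shows "\<exists>Gs. E \<in> nshuffles Gs & map names Gs = Ms"
 using assms
proof (induction Ms arbitrary: E)
 case Nil
 then show ?case by (intro exI[of _ "[]"]) (cases E; auto)
next
 case (Cons M Ms)
 then obtain G H where 1: "E \<in> shuffles G H" "names G = M" "names H = sum_list Ms"
  using split_names[of E M "sum_list Ms"] by auto
 then obtain Gs where "H \<in> nshuffles Gs & map names Gs = Ms" using Cons.IH by blast
 with 1 show ?case by (intro exI[of _ "G # Gs"]) auto
qed

text \<open>A characterisation of \<open>typed\<close> without existential splits: types, linearity
  of bound variables, and each variable of the context used exactly once. \<open>typed_iff\<close>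
  below makes the two interchangeable.\<close>

definition wty :: "('g, 'f, 'v) vlam_theory => 'g ctx => ('g, 'f) tm => 'g ty => bool" where
 "wty T G v A \<longleftrightarrow> is_ctx G & hty T (env G) v A & lin v & uses v = names G"

lemma wty_hty_mono: "wty T G v A ==> is_ctx E ==> set G \<subseteq> set E ==> hty T (env E) v A"
 unfolding wty_def using hty_cong[of v "env E" "env G"] env_subset by metis

lemma count_leaves_down: "count (leaves (esub down e)) k = count (leaves e) (up k)"
proof (induction e)
 case (Leaf l)
 then show ?case by (cases l rule: name_up_cases) (auto simp: eq_commute)
qed auto

lemma count_image_up: "count (image_mset up M) (up k) = count M k" "count (image_mset up M) (Bd 0) = 0"
 by (induction M) auto

lemma leaves_down: "leaves e = replicate_mset (count (leaves e) (Bd 0)) (Bd 0) + image_mset up (leaves (esub down e))"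
proof (rule multiset_eqI)
 fix k show "count (leaves e) k =
  count (replicate_mset (count (leaves e) (Bd 0)) (Bd 0) + image_mset up (leaves (esub down e))) k"
  by (cases k rule: name_up_cases) (simp_all add: count_leaves_down count_image_up)
qed

text \<open>Carries the distinctness of names back under a binder, so that it need only be assumed
  for the whole term.\<close>

lemma uniq_down: "count (leaves e) (Bd 0) \<le> 1 ==> uniq (leaves (esub down e)) ==> uniq (leaves e)"
proof (subst leaves_down)
 assume a: "count (leaves e) (Bd 0) \<le> 1" "uniq (leaves (esub down e))"
 have "uniq (image_mset up (leaves (esub down e)))"
  using a by (intro uniq_image inj_onI) auto
 moreover have "count (leaves e) (Bd 0) = 0 \<or> count (leaves e) (Bd 0) = 1" using a by linarith
 ultimately show "uniq (replicate_mset (count (leaves e) (Bd 0)) (Bd 0) + image_mset up (leaves (esub down e)))"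
  by auto
qed

lemma sum_mset_Leaf_names:
 assumes "\<And>y. y \<in> ctx_vars G ==> f (Free y) = {#Free y#}"
 shows "(\<Sum>l\<in>#names G. f l) = names G"
 using assms by (induction G) auto

lemma uses_LamB_names:
 assumes "uses v = add_mset (Free x) (names G)" "x \<notin> ctx_vars G"
 shows "uses (rnm (bnd 0 x) v) = add_mset (Bd 0) (names G)"
  and "uses (LamB A (rnm (bnd 0 x) v)) = names G"
proof -
 have *: "image_mset (bnd 0 x) (names G) = names G"
  using assms(2) by (induction G) (auto simp: bnd_def)
 then show 1: "uses (rnm (bnd 0 x) v) = add_mset (Bd 0) (names G)"
  using assms by (simp add: uses_rnm bnd_def)
 show "uses (LamB A (rnm (bnd 0 x) v)) = names G"
  using 1 by (simp add: leaves_esub sum_mset_Leaf_names)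
qed

lemma uses_PmB_names:
 assumes "uses v = add_mset (Free x) (add_mset (Free y) (names G))"
  "x \<notin> ctx_vars G" "y \<notin> ctx_vars G" "x \<noteq> y"
 shows "uses (rnm (bnd 1 x) (rnm (bnd 0 y) v)) = add_mset (Bd 1) (add_mset (Bd 0) (names G))"
  and "leaves (esub down (esub down (shape (rnm (bnd 1 x) (rnm (bnd 0 y) v))))) = names G"
proof -
 have *: "image_mset (bnd n z) (names G) = names G" if "z \<notin> ctx_vars G" for z n
  using that by (induction G) (auto simp: bnd_def)
 show 1: "uses (rnm (bnd 1 x) (rnm (bnd 0 y) v)) = add_mset (Bd 1) (add_mset (Bd 0) (names G))"
  using assms by (simp add: uses_rnm * ) (simp add: bnd_def)
 show "leaves (esub down (esub down (shape (rnm (bnd 1 x) (rnm (bnd 0 y) v))))) = names G"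
  using 1 by (simp add: leaves_esub sum_mset_Leaf_names)
qed

lemma typed_wty: "typed T G v A ==> wty T G v A"
proof (induction rule: typed.induct)
 case (ty_op f Gs vs E)
 note E = \<open>E \<in> nshuffles Gs\<close>
 have *: "wty T (Gs ! i) (vs ! i) (op_args T f ! i)" if "i < length vs" for i
  using ty_op that by auto
 have "hty T (env E) (vs ! i) (op_args T f ! i)" if "i < length vs" for i
  using * [OF that] set_nshuffles[OF E, of "Gs ! i"] ty_op that by (auto intro: wty_hty_mono)
 moreover have "map uses vs = map names Gs"
  using * ty_op by (intro nth_equalityI) (auto simp: wty_def)
 then have "sum_list (map uses vs) = names E"
  using names_nshuffles[OF E] by simp
 moreover have "lin v" if "v \<in> set vs" for v
  using * that by (metis in_set_conv_nth wty_def)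
 ultimately show ?case
  unfolding wty_def hty_Op using ty_op by (auto simp: comp_def)
next
 case (ty_var A x)
 then show ?case by (auto simp: wty_def is_ctx_def env_def)
next
 case ty_star
 then show ?case by (auto simp: wty_def is_ctx_def)
next
 case (ty_letstar G v H w A E)
 have "hty T (env E) v TUnit" "hty T (env E) w A"
  using ty_letstar by (auto intro!: wty_hty_mono simp: set_shuffles)
 then show ?case using ty_letstar names_shuffles[of E G H] by (auto simp: wty_def)
next
 case (ty_pair G v A H w B E)
 have "hty T (env E) v A" "hty T (env E) w B"
  using ty_pair by (auto intro!: wty_hty_mono simp: set_shuffles)
 then show ?case using ty_pair names_shuffles[of E G H] by (auto simp: wty_def)
next
 case (ty_app G v A B H w E)
 have "hty T (env E) v (Lolli A B)" "hty T (env E) w A"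
  using ty_app by (auto intro!: wty_hty_mono simp: set_shuffles)
 then show ?case using ty_app names_shuffles[of E G H] by (auto simp: wty_def)
next
 case (ty_lam G x A v B)
 then have x: "x \<notin> ctx_vars G" and u: "uses v = add_mset (Free x) (names G)" and c: "is_ctx G"
  by (auto simp: wty_def is_ctx_names)
 have "hty T (push A (env G)) (rnm (bnd 0 x) v) B = hty T (env (G @ [(x, A)])) v B"
  unfolding hty_rnm using x u
  by (intro hty_cong) (auto simp: bnd_def in_names env_append1 env_append2)
 with ty_lam c u show ?case
  using uses_LamB_names[OF u x] by (auto simp: wty_def Lam_def bindv_rnm lin_rnm)
next
 case (ty_pm G v A B H x y w C E)
 have v: "hty T (env E) v (Tensor A B)"
  using ty_pm by (auto intro!: wty_hty_mono simp: set_shuffles)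
 let ?w = "rnm (bnd 1 x) (rnm (bnd 0 y) w)"
 have xy: "x \<notin> ctx_vars H" "y \<notin> ctx_vars H" "x \<noteq> y"
  and u: "uses w = add_mset (Free x) (add_mset (Free y) (names H))" and c: "is_ctx H"
  using ty_pm by (auto simp: wty_def is_ctx_names)
 have "env E l = env H l" if "l \<in># names H" for l
  using that c ty_pm by (intro env_subset) (auto simp: set_shuffles)
 then have e: "env E (Free z) = env H (Free z)" if "z \<in> ctx_vars H" for z
  using that by auto
 have "hty T (push B (push A (env E))) ?w C = hty T (env (H @ [(x, A), (y, B)])) w C"
  unfolding hty_rnm using xy u e
  by (intro hty_cong) (auto simp: bnd_def in_names env_append1 env_append2)
 with ty_pm c u v show ?case
  using uses_PmB_names[OF u xy] names_shuffles[of E G H]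
  by (auto simp: wty_def Pm_def bindv_rnm lin_rnm)
qed


lemma leaves_down_lin: "count (leaves e) (Bd 0) = 1 ==>
  leaves e = add_mset (Bd 0) (image_mset up (leaves (esub down e)))"
 by (subst leaves_down) simp

lemma image_opn_up_names: "image_mset (opn n x) (image_mset up (names G)) = names G"
 "image_mset (opn n x) (names G) = names G" "image_mset up (names G) = names G"
 by (induction G) (auto simp: opn_def)

lemma fresh_var: "finite X ==> \<exists>x::var. x \<notin> X"
 by (rule ex_new_if_finite) auto

text \<open>Induction on the size and not on the structure, because the body of a binder has to be
  opened with a fresh variable before a rule applies, and the opened body is no subterm; renaming
  preserves the size.\<close>

lemma wty_typed: "wty T G v A ==> typed T G v A"
proof (induction "size v" arbitrary: G v A rule: less_induct)
 case less
 note IH = less.hyps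
 from less.prems have c: "is_ctx G" and h: "hty T (env G) v A" and l: "lin v" and u: "uses v = names G"
  by (auto simp: wty_def)
 \<comment> \<open>The induction hypothesis, repackaged: the types of a subterm are known in the
   environment of \<open>G\<close>, and its context \<open>H\<close> is a part of
   \<open>G\<close>.\<close>
 have sub: "typed T H w C"
  if "size w < size v" "hty T (env G) w C" "lin w" "uses w = names H" "is_ctx H" "set H \<subseteq> set G" for w C H
 proof (rule IH)
  have "hty T (env H) w C \<longleftrightarrow> hty T (env G) w C"
   using that c by (intro hty_cong) (metis env_subset)
  with that show "wty T H w C" by (simp add: wty_def)
 qed fact
 have two: "\<exists>G1 H. G \<in> shuffles G1 H & is_ctx G1 & is_ctx H & set G1 \<subseteq> set G & set H \<subseteq> set G &
   names G1 = M & names H = N" if "names G = M + N" for M N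
 proof -
  from split_names[OF that] obtain G1 H where
   "G \<in> shuffles G1 H" "names G1 = M" "names H = N" by blast
  with c that show ?thesis
   by (intro exI[of _ G1] exI[of _ H]) (auto simp: is_ctx_names set_shuffles)
 qed
 show ?case
 proof (cases v)
  case (Var x)
  with u obtain B where "G = [(x, B)]"
   by (cases G; cases "tl G") auto
  with Var h show ?thesis by (auto simp: env_def intro: ty_var)
 next
  case (Bound i)
  with u have "names G = {#Bd i#}" by simp
  then show ?thesis by (metis Bd_in_names union_single_eq_member)
 next
  case (Op f vs)
  with u have "names G = sum_list (map uses vs)" by (simp add: comp_def)
  then obtain Gs where s: "G \<in> nshuffles Gs" and n: "map names Gs = map uses vs"
   using nsplit_names by blast
  then have len: "length Gs = length vs" by (metis length_map)
  from h Op have f: "f \<in> ops T" "A = op_res T f" "length vs = length (op_args T f)"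
   and hi: "\<forall>i<length vs. hty T (env G) (vs ! i) (op_args T f ! i)"
   by (auto simp only: hty_Op)
  have "typed T (Gs ! i) (vs ! i) (op_args T f ! i)" if i: "i < length vs" for i
  proof (rule sub)
   have "vs ! i \<in> set vs" using i by simp
   then show "size (vs ! i) < size v" using Op by (simp add: less_Suc_eq_le size_list_estimation')
   show "hty T (env G) (vs ! i) (op_args T f ! i)" using hi i by blast
   show "lin (vs ! i)" using l Op i by simp
   show nu: "uses (vs ! i) = names (Gs ! i)" using n i len by (metis nth_map)
   show "set (Gs ! i) \<subseteq> set G" using set_nshuffles[OF s] i len by simp
   have "uniq (sum_list (map names Gs))" using c s by (simp add: is_ctx_names names_nshuffles)
   then show "is_ctx (Gs ! i)" using i len by (auto simp: is_ctx_names intro: uniq_sum_list)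
  qed
  with f s c len Op show ?thesis by (auto intro!: ty_op)
 next
  case Star
  with u h show ?thesis by (cases G) (auto intro: ty_star)
 next
  case (LetStar w1 w2)
  with u have "names G = uses w1 + uses w2" by simp
  from two[OF this] obtain G1 H where g: "G \<in> shuffles G1 H" "is_ctx G1" "is_ctx H"
   "set G1 \<subseteq> set G" "set H \<subseteq> set G" "names G1 = uses w1" "names H = uses w2" by auto
  show ?thesis unfolding LetStar
  proof (rule ty_letstar)
   show "typed T G1 w1 TUnit" using LetStar h g l by (auto intro!: sub)
   show "typed T H w2 A" using LetStar h g l by (auto intro!: sub)
  qed (use g c in auto)
 next
  case (Ten w1 w2)
  with u have "names G = uses w1 + uses w2" by simp
  from two[OF this] obtain G1 H where g: "G \<in> shuffles G1 H" "is_ctx G1" "is_ctx H"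
   "set G1 \<subseteq> set G" "set H \<subseteq> set G" "names G1 = uses w1" "names H = uses w2" by auto
  from h Ten obtain C D where C: "hty T (env G) w1 C" "hty T (env G) w2 D" "A = Tensor C D" by auto
  show ?thesis unfolding Ten \<open>A = Tensor C D\<close>
  proof (rule ty_pair)
   show "typed T G1 w1 C" using Ten C g l by (auto intro!: sub)
   show "typed T H w2 D" using Ten C g l by (auto intro!: sub)
  qed (use g c in auto)
 next
  case (App w1 w2)
  with u have "names G = uses w1 + uses w2" by simp
  from two[OF this] obtain G1 H where g: "G \<in> shuffles G1 H" "is_ctx G1" "is_ctx H"
   "set G1 \<subseteq> set G" "set H \<subseteq> set G" "names G1 = uses w1" "names H = uses w2" by auto
  from h App obtain C where C: "hty T (env G) w1 (Lolli C A)" "hty T (env G) w2 C" by auto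
  show ?thesis unfolding App
  proof (rule ty_app)
   show "typed T G1 w1 (Lolli C A)" using App C g l by (auto intro!: sub)
   show "typed T H w2 C" using App C g l by (auto intro!: sub)
  qed (use g c in auto)
 next
  case (LamB B u')
  \<comment> \<open>A variable outside the context. The body is opened with it, typed by induction,
    and bound again by \<open>bindv_opn\<close>.\<close>
  obtain x where x: "x \<notin> ctx_vars G" using fresh_var finite_ctx_vars by blast
  have d: "leaves (esub down (shape u')) = names G" using u LamB by simp
  have u': "uses u' = add_mset (Bd 0) (names G)"
   using leaves_down_lin[of "shape u'"] l LamB d by (simp add: image_opn_up_names)
  let ?v = "rnm (opn 0 x) u'"
  from h LamB obtain C where C: "A = Lolli B C" "hty T (push B (env G)) u' C" by auto
  have "hty T (env (G @ [(x, B)])) ?v C = hty T (push B (env G)) u' C"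
   unfolding hty_rnm using x
   by (intro hty_cong) (auto simp: u' opn_def in_names env_append1 env_append2)
  then have "typed T (G @ [(x, B)]) ?v C"
   using c l LamB C x
   by (intro IH) (auto simp: wty_def is_ctx_names lin_rnm uses_rnm u' image_opn_up_names, auto simp: opn_def)
  then have "typed T G (Lam x B ?v) (Lolli B C)" by (rule ty_lam)
  moreover have "Free x \<notin># uses u'" using u' x by auto
  ultimately show ?thesis by (simp add: Lam_def bindv_opn LamB C)
 next
  case (PmB w1 w2)
  from h PmB obtain B1 B2 where h1: "hty T (env G) w1 (Tensor B1 B2)"
   and h2: "hty T (push B2 (push B1 (env G))) w2 A" by auto
  from u PmB have "names G = uses w1 + leaves (esub down (esub down (shape w2)))" by simp
  from two[OF this] obtain G1 H where g: "G \<in> shuffles G1 H" "is_ctx G1" "is_ctx H"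
   "set G1 \<subseteq> set G" "set H \<subseteq> set G" "names G1 = uses w1"
   and d: "names H = leaves (esub down (esub down (shape w2)))" by auto
  have "leaves (esub down (shape w2)) = add_mset (Bd 0) (names H)"
   using leaves_down_lin[of "esub down (shape w2)"] l PmB d[symmetric]
   by (simp add: image_opn_up_names count_leaves_down)
  then have u2: "uses w2 = add_mset (Bd 0) (add_mset (Bd 1) (names H))"
   using leaves_down_lin[of "shape w2"] l PmB by (simp add: image_opn_up_names)
  obtain x where x: "x \<notin> ctx_vars H" using fresh_var finite_ctx_vars by blast
  obtain y where y: "y \<notin> insert x (ctx_vars H)"
   using fresh_var finite_ctx_vars by (metis finite_insert)
  let ?v = "rnm (opn 0 y) (rnm (opn 1 x) w2)"
  have e: "env G (Free z) = env H (Free z)" if "z \<in> ctx_vars H" for z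
   using that c g by (intro env_subset) auto
  have "hty T (env (H @ [(x, B1), (y, B2)])) ?v A = hty T (push B2 (push B1 (env G))) w2 A"
   unfolding hty_rnm using x y e
   by (intro hty_cong) (auto simp: u2 opn_def in_names env_append1 env_append2)
  then have v: "typed T (H @ [(x, B1), (y, B2)]) ?v A"
   using c l PmB h2 x y g
   by (intro IH) (auto simp: wty_def is_ctx_names lin_rnm uses_rnm u2 image_opn_up_names, auto simp: opn_def)
  have "typed T G (Pm w1 x y ?v) A"
  proof (rule ty_pm[OF _ v])
   show "typed T G1 w1 (Tensor B1 B2)" using PmB g h1 l by (intro sub) auto
  qed (use g c in auto)
  moreover have "Free x \<notin># uses w2" using u2 x by auto
  moreover have "Free y \<notin># uses (rnm (opn 1 x) w2)" using u2 x y by (auto simp: uses_rnm opn_def in_names)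
  ultimately show ?thesis using PmB by (simp add: Pm_def bindv_opn)
 qed
qed

lemma typed_iff: "typed T G v A \<longleftrightarrow> wty T G v A"
 using typed_wty wty_typed by blast


subsection \<open>Substitution\<close>

definition lc :: "('g, 'f) tm => bool" where
 "lc v \<longleftrightarrow> (\<forall>i. Bd i \<notin># uses v)"

primrec sh :: "(var => ('g, 'f) tm) => name => name ex" where
 "sh s (Free x) = shape (s x)"
| "sh s (Bd i) = Leaf (Bd i)"

lemma esub_down_lc: "lc v ==> esub down (shape v) = shape v"
 by (intro esub_ident) (metis down.simps(1) lc_def name.exhaust)

text \<open>Local closure is what makes substitution commute with leaving a binder: the shape of a
  term without dangling indices is fixed by \<open>down\<close>.\<close>

lemma esub_sh_down: "(\<And>x. Free x \<in># leaves e ==> lc (s x)) ==>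
  esub down (esub (sh s) e) = esub (sh s) (esub down e)"
 unfolding esub_esub
proof (intro esub_cong)
 fix l assume "\<And>x. Free x \<in># leaves e ==> lc (s x)" "l \<in># leaves e"
 then show "esub down (sh s l) = esub (sh s) (down l)"
  by (cases l rule: down.cases) (auto simp: esub_down_lc)
qed

lemma shape_subst: "(\<And>x. Free x \<in># uses v ==> lc (s x)) ==> shape (subst s v) = esub (sh s) (shape v)"
proof (induction v)
 case (Op f vs)
 have "shape (subst s v) = esub (sh s) (shape v)" if "v \<in> set vs" for v
  using that Op.prems by (intro Op.IH) (auto simp: in_sum_list)
 then show ?case by (auto simp: esub_njoin intro!: arg_cong[where f = njoin])
next
 case (PmB v w)
 have "esub down (esub (sh s) (shape w)) = esub (sh s) (esub down (shape w))"
  using PmB.prems by (intro esub_sh_down) (auto simp: in_down)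
 moreover have "esub down (esub (sh s) (esub down (shape w))) = esub (sh s) (esub down (esub down (shape w)))"
  using PmB.prems by (intro esub_sh_down) (auto simp: in_down)
 ultimately show ?case using PmB by (simp add: in_down)
qed (auto simp: esub_sh_down in_down)

lemma hty_push_lc: "lc v ==> hty T (push A E) v C = hty T E v C"
 by (intro hty_cong) (metis down.cases lc_def push.simps(1))

text \<open>\<open>E'\<close> types the term and \<open>E\<close> its instance. They may differ at
  free names, where the substitution acts, but agree at indices; under a binder both are pushed,
  which locally closed terms cannot notice.\<close>

lemma hty_subst:
 assumes "\<And>x. Free x \<in># uses v ==> lc (s x) & hty T E (s x) (E' (Free x))"
  and "\<And>i. Bd i \<in># uses v ==> E (Bd i) = E' (Bd i)"
  and "hty T E' v A"
 shows "hty T E (subst s v) A"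
 using assms
proof (induction v arbitrary: E E' A)
 case (Op f vs)
 have "hty T E (subst s (vs ! i)) (op_args T f ! i)" if i: "i < length vs" for i
 proof (rule Op.IH[OF nth_mem[OF i]])
  have "vs ! i \<in> set vs" using i by simp
  then have "l \<in># uses (vs ! i) ==> l \<in># uses (Op f vs)" for l
   by (auto simp: in_sum_list)
  with Op.prems(1,2) show "Free x \<in># uses (vs ! i) ==> lc (s x) & hty T E (s x) (E' (Free x))"
   and "Bd j \<in># uses (vs ! i) ==> E (Bd j) = E' (Bd j)" for x j by blast+
  show "hty T E' (vs ! i) (op_args T f ! i)" using Op.prems(3) i by (simp add: list_all2_conv_all_nth)
 qed
 then show ?case using Op.prems by (simp add: list_all2_conv_all_nth)
next
 case (LamB B v)
 from LamB.prems(3) obtain C where C: "A = Lolli B C" "hty T (push B E') v C" by auto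
 have "hty T (push B E) (subst s v) C"
 proof (rule LamB.IH[OF _ _ C(2)])
  fix i assume "Bd i \<in># uses v" then show "push B E (Bd i) = push B E' (Bd i)"
   using LamB.prems(2) by (cases i) (auto simp: in_down)
 qed (use LamB.prems(1) in \<open>auto simp: in_down hty_push_lc\<close>)
 with C show ?case by auto
next
 case (PmB v w)
 from PmB.prems(3) obtain B C where C: "hty T E' v (Tensor B C)" "hty T (push C (push B E')) w A" by auto
 have "hty T (push C (push B E)) (subst s w) A"
 proof (rule PmB.IH(2)[OF _ _ C(2)])
  \<comment> \<open>Under the two binders, index \<open>i\<close> stands for index
    \<open>i - 2\<close> outside; the indices 0 and 1 are settled by the case split.\<close>
  fix i assume "Bd i \<in># uses w" then show "push C (push B E) (Bd i) = push C (push B E') (Bd i)"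
   using PmB.prems(2)[of "i - 2"] by (cases i; cases "i - 1") (auto simp: in_down)
 qed (use PmB.prems(1) in \<open>auto simp: in_down hty_push_lc\<close>)
 moreover have "hty T E (subst s v) (Tensor B C)"
  using PmB.prems by (intro PmB.IH(1)[OF _ _ C(1)]) auto
 ultimately show ?case by auto
next
 case (LetStar v w)
 have "hty T E (subst s v) TUnit"
  using LetStar.prems by (intro LetStar.IH(1)[of _ E']) auto
 moreover have "hty T E (subst s w) A"
  using LetStar.prems by (intro LetStar.IH(2)[of _ E']) auto
 ultimately show ?case by simp
next
 case (Ten v w)
 from Ten.prems(3) obtain B C where C: "A = Tensor B C" "hty T E' v B" "hty T E' w C" by auto
 have "hty T E (subst s v) B"
  using Ten.prems by (intro Ten.IH(1)[OF _ _ C(2)]) auto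
 moreover have "hty T E (subst s w) C"
  using Ten.prems by (intro Ten.IH(2)[OF _ _ C(3)]) auto
 ultimately show ?case using C by simp
next
 case (App v w)
 from App.prems(3) obtain B where C: "hty T E' v (Lolli B A)" "hty T E' w B" by auto
 have "hty T E (subst s v) (Lolli B A)"
  using App.prems by (intro App.IH(1)[OF _ _ C(1)]) auto
 moreover have "hty T E (subst s w) B"
  using App.prems by (intro App.IH(2)[OF _ _ C(2)]) auto
 ultimately show ?case by auto
qed auto

lemma count_esub_sh_Bd:
 assumes "\<And>x. Free x \<in># leaves e ==> lc (s x)"
 shows "count (leaves (esub (sh s) e)) (Bd i) = count (leaves e) (Bd i)"
 using assms
proof (induction e)
 case (Leaf l)
 then show ?case by (cases l) (auto simp: lc_def not_in_iff)
qed auto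

lemma lin_subst: "(\<And>x. Free x \<in># uses v ==> lc (s x) & lin (s x)) ==> lin v ==> lin (subst s v)"
proof (induction v)
 case (Op f vs)
 have "lin (subst s v)" if "v \<in> set vs" for v
  using that Op.prems by (intro Op.IH) (auto simp: in_sum_list)
 then show ?case by simp
qed (auto simp: shape_subst count_esub_sh_Bd in_down)

lemma subst_subst: "subst s (subst s' v) = subst (%x. subst s (s' x)) v"
 by (induction v) auto

lemma subst_cong: "(\<And>x. Free x \<in># uses v ==> s x = s' x) ==> subst s v = subst s' v"
proof (induction v)
 case (Op f vs)
 have "subst s v = subst s' v" if "v \<in> set vs" for v
  using that Op.prems by (intro Op.IH) (auto simp: in_sum_list)
 then show ?case by simp
qed (auto simp: in_down)

lemma subst_Var [simp]: "subst Var v = v"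
 by (induction v) (auto simp: map_idI)

lemma subst_ident: "(\<And>x. Free x \<in># uses v ==> s x = Var x) ==> subst s v = v"
 using subst_cong[of v s Var] by simp

lemma wty_lc: "wty T G v A ==> lc v"
 by (auto simp: wty_def lc_def)


lemma uses_subst:
 "(\<And>x. Free x \<in># uses v ==> lc (s x)) ==> uses (subst s v) = (\<Sum>l\<in>#uses v. leaves (sh s l))"
 by (simp add: shape_subst leaves_esub)

lemma sum_mset_uses_names:
 "(\<Sum>l\<in>#names G. f l) = sum_list (map (%p. f (Free (fst p))) G)"
 by (induction G) auto

text \<open>The substitution is simultaneous, hence correct even if the terms put in mention
  variables of the old context. Linearity of the result is pure counting: the names of the terms put
  in must add up to the new context.\<close>

lemma wty_subst:
 assumes v: "wty T G v A"
  and s: "\<And>x C. (x, C) \<in> set G ==> lc (s x) & lin (s x) & hty T (env E) (s x) C"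
  and u: "sum_list (map (%p. uses (s (fst p))) G) = names E" and E: "is_ctx E"
 shows "wty T E (subst s v) A"
proof -
 have in_ctx: "\<exists>C. (x, C) \<in> set G & env G (Free x) = C" if "Free x \<in># uses v" for x
  using that v env_in[of G x] by (fastforce simp: wty_def ctx_vars_def)
 have "hty T (env E) (subst s v) A"
  using v in_ctx s by (intro hty_subst[where E' = "env G"]) (auto simp: wty_def)
 moreover have "lin (subst s v)"
  using v in_ctx s by (intro lin_subst) (auto simp: wty_def)
 moreover have "uses (subst s v) = (\<Sum>l\<in>#uses v. leaves (sh s l))"
  using in_ctx s by (intro uses_subst) blast
 then have "uses (subst s v) = names E"
  using v u by (simp add: wty_def sum_mset_uses_names)
 ultimately show ?thesis using E by (simp add: wty_def)
qed

lemma is_ctx_append [simp]: "is_ctx (G @ H) \<longleftrightarrow> is_ctx G & is_ctx H & ctx_vars G \<inter> ctx_vars H = {}"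
 by (auto simp: is_ctx_def ctx_vars_def)

lemma is_ctx_simps [simp]: "is_ctx []" "is_ctx (p # G) \<longleftrightarrow> fst p \<notin> ctx_vars G & is_ctx G"
 by (auto simp: is_ctx_def ctx_vars_def)

lemma is_ctx_mset: "mset G = mset H ==> is_ctx G \<longleftrightarrow> is_ctx H"
 using names_mset[of G H] by (simp add: is_ctx_names)

lemma wty_perm: "wty T G v A ==> mset H = mset G ==> wty T H v A"
 unfolding wty_def by (metis is_ctx_mset mset_eq_setD names_mset order_refl wty_def wty_hty_mono)

text \<open>\<open>hty\<close> checks the type at every occurrence of a name, hence at every name
  that is used.\<close>

lemma hty_ground: "hty T F v C ==> l \<in># uses v ==> set_ty (F l) \<subseteq> ground T"
proof (induction v arbitrary: F C l)
 case (Op f vs)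
 then obtain i where "i < length vs" "l \<in># uses (vs ! i)" "hty T F (vs ! i) (op_args T f ! i)"
  by (auto simp: in_sum_list in_set_conv_nth list_all2_conv_all_nth)
 then show ?case using Op.IH[of "vs ! i"] by simp
next
 case (LamB B v)
 then show ?case by (auto simp: in_down) (metis push_up subsetD)
next
 case (PmB v w)
 then show ?case by (auto simp: in_down) (metis push_up subsetD)+
qed (auto, blast+)

lemma ctx_varsI: "(x, A) \<in> set G ==> x \<in> ctx_vars G"
 by (force simp: ctx_vars_def)

lemma wty_ground:
 assumes "wty T G v C" "(y, D) \<in> set G"
 shows "set_ty D \<subseteq> ground T"
proof -
 have "env G (Free y) = D" using assms by (auto simp: wty_def env_in)
 moreover have "Free y \<in># uses v" using assms by (auto simp: wty_def intro: ctx_varsI)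
 ultimately show ?thesis using assms(1) unfolding wty_def by (metis hty_ground)
qed

lemma wty_subst1:
 assumes "wty T (G @ [(x, A)]) v C" "wty T H w A" "is_ctx E" "mset E = mset G + mset H"
 shows "wty T E (v[x ::= w]) C"
proof (rule wty_subst[OF assms(1)])
 have "set E = set G \<union> set H" using assms(4) by (metis set_mset_mset set_mset_union)
 then have s: "set G \<subseteq> set E" "set H \<subseteq> set E" by auto
 have x: "x \<notin> ctx_vars G" "is_ctx G" using assms(1) by (auto simp: wty_def)
 have g: "set_ty D \<subseteq> ground T & env E (Free y) = D" if "(y, D) \<in> set G" for y D
  using that s assms(3) wty_ground[OF assms(1), of y D] by (auto intro: env_in)
 fix y D assume yD: "(y, D) \<in> set (G @ [(x, A)])"
 have w: "hty T (env E) w A" using assms(2,3) s by (intro wty_hty_mono)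
 show "lc ((Var(x := w)) y) & lin ((Var(x := w)) y) & hty T (env E) ((Var(x := w)) y) D"
 proof (cases "y = x")
  case True
  with yD x have "D = A" by (auto dest: ctx_varsI)
  with True w assms(2) show ?thesis by (auto simp: wty_lc) (simp add: wty_def)
 next
  case False
  with yD g show ?thesis by (auto simp: lc_def)
 qed
next
 have x: "x \<notin> ctx_vars G" using assms(1) by (auto simp: wty_def)
 have "sum_list (map (%p. uses ((Var(x := w)) (fst p))) G) = names G"
  using x by (induction G) auto
 moreover have "names E = names G + names H" using assms(4) by (simp add: names_def)
 ultimately show "sum_list (map (%p. uses ((Var(x := w)) (fst p))) (G @ [(x, A)])) = names E"
  using assms(2) by (simp add: wty_def)
qed fact

subsection \<open>Symmetric monoidal categories\<close>

lemma hom_iff: "f \<in> hom C X Y \<longleftrightarrow> f \<in> mor C & src f = X & tgt f = Y"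
 by (simp add: hom_def)

context cat
begin

abbreviation arr where "arr f \<equiv> f \<in> mor C"

lemma src_obj [simp]: "arr f ==> src f \<in> obj C"
 and tgt_obj [simp]: "arr f ==> tgt f \<in> obj C"
 using mor_obj by blast+

lemma arr_id [simp]: "X \<in> obj C ==> arr (\<i> X)" "X \<in> obj C ==> src (\<i> X) = X" "X \<in> obj C ==> tgt (\<i> X) = X"
 using id_hom by (auto simp: hom_iff)

lemma arr_comp [simp]:
 "arr f ==> arr g ==> src g = tgt f ==> arr (g \<cdot> f)"
 "arr f ==> arr g ==> src g = tgt f ==> src (g \<cdot> f) = src f"
 "arr f ==> arr g ==> src g = tgt f ==> tgt (g \<cdot> f) = tgt g"
 using comp_hom[of f "src f" "tgt f" g "tgt g"] by (auto simp: hom_iff)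

lemma comp_ident [simp]:
 "arr f ==> tgt f = Y ==> \<i> Y \<cdot> f = f" "arr f ==> src f = X ==> f \<cdot> \<i> X = f"
 using id_comp comp_id by (auto simp: hom_iff)

lemma assoc [simp]:
 "arr f ==> arr g ==> arr h ==> src g = tgt f ==> src h = tgt g ==> (h \<cdot> g) \<cdot> f = h \<cdot> g \<cdot> f"
 using comp_assoc by (auto simp: hom_iff)

text \<open>Composites are kept nested to the right, so an equation for \<open>f \<cdot> g\<close>
  must also be available with a tail \<open>k\<close> behind it.\<close>

lemma comp_k:
 "f \<cdot> g = p ==> arr f ==> arr g ==> src f = tgt g ==> arr k ==> tgt k = src g ==> f \<cdot> g \<cdot> k = p \<cdot> k"
 by auto

lemma inverse_arr_unique:
 assumes "inverse_arr C f g" "inverse_arr C f h"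
 shows "g = h"
proof -
 have "g = g \<cdot> f \<cdot> h" using assms by (auto simp: inverse_arr_def hom_iff)
 also have "... = (g \<cdot> f) \<cdot> h" using assms by (subst assoc) (auto simp: inverse_arr_def hom_iff)
 also have "... = h" using assms by (auto simp: inverse_arr_def hom_iff)
 finally show ?thesis .
qed

lemma inv_arr_eq: "inverse_arr C f g ==> inv_arr C f = g"
 unfolding inv_arr_def using inverse_arr_unique by blast

lemma inverse_inv_arr: "iso_arr C f ==> inverse_arr C f (inv_arr C f)"
 unfolding iso_arr_def using inv_arr_eq by metis

lemma iso_arr_arr: "iso_arr C f ==> arr f"
 by (auto simp: iso_arr_def inverse_arr_def)

lemma inv_arr [simp]:
 assumes "iso_arr C f"
 shows "arr (inv_arr C f)" "src (inv_arr C f) = tgt f" "tgt (inv_arr C f) = src f"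
  "inv_arr C f \<cdot> f = \<i> (src f)" "f \<cdot> inv_arr C f = \<i> (tgt f)"
  "arr k ==> tgt k = src f ==> inv_arr C f \<cdot> f \<cdot> k = k"
  "arr k ==> tgt k = tgt f ==> f \<cdot> inv_arr C f \<cdot> k = k"
proof -
 note i = inverse_inv_arr[OF assms]
 show 1: "arr (inv_arr C f)" "src (inv_arr C f) = tgt f" "tgt (inv_arr C f) = src f"
  "inv_arr C f \<cdot> f = \<i> (src f)" "f \<cdot> inv_arr C f = \<i> (tgt f)"
  using i by (auto simp: inverse_arr_def hom_iff)
 note f = iso_arr_arr[OF assms]
 show "arr k ==> tgt k = src f ==> inv_arr C f \<cdot> f \<cdot> k = k"
  using comp_k[OF 1(4)] 1 f by simp
 show "arr k ==> tgt k = tgt f ==> f \<cdot> inv_arr C f \<cdot> k = k"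
  using comp_k[OF 1(5)] 1 f by simp
qed

lemma inverse_arrI:
 "arr f ==> arr g ==> src g = tgt f ==> tgt g = src f ==> g \<cdot> f = \<i> (src f) ==> f \<cdot> g = \<i> (tgt f) ==> inverse_arr C f g"
 by (auto simp: inverse_arr_def hom_iff)

lemma inverse_iso: "inverse_arr C f g ==> iso_arr C f" "inverse_arr C f g ==> iso_arr C g"
 by (auto simp: inverse_arr_def hom_iff iso_arr_def)

lemma iso_cancel_left:
 assumes "f \<cdot> g = f \<cdot> h" "iso_arr C f" "arr g" "arr h" "tgt g = src f" "tgt h = src f"
 shows "g = h"
proof -
 have "inv_arr C f \<cdot> f \<cdot> g = inv_arr C f \<cdot> f \<cdot> h" using assms(1) by simp
 then show ?thesis using assms(2-) by simp
qed

lemma iso_cancel_right: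
 assumes "g \<cdot> f = h \<cdot> f" "iso_arr C f" "arr g" "arr h" "src g = tgt f" "src h = tgt f"
 shows "g = h"
proof -
 have "(g \<cdot> f) \<cdot> inv_arr C f = (h \<cdot> f) \<cdot> inv_arr C f" using assms(1) by simp
 then show ?thesis using assms(2-) iso_arr_arr[OF assms(2)] by simp
qed

lemma iso_id [simp]: "X \<in> obj C ==> iso_arr C (\<i> X)"
 by (rule inverse_iso(1)[of _ "\<i> X"]) (auto intro: inverse_arrI)

lemma inv_id [simp]: "X \<in> obj C ==> inv_arr C (\<i> X) = \<i> X"
 by (rule inv_arr_eq) (auto intro: inverse_arrI)

lemma iso_comp [simp]: "iso_arr C f ==> iso_arr C g ==> src g = tgt f ==> iso_arr C (g \<cdot> f)"
 by (rule inverse_iso(1)[of _ "inv_arr C f \<cdot> inv_arr C g"], rule inverse_arrI)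
  (auto simp: iso_arr_arr)

lemma iso_inv [simp]: "iso_arr C f ==> iso_arr C (inv_arr C f)"
 using inverse_inv_arr inverse_iso by blast

lemma inv_inv [simp]: "iso_arr C f ==> inv_arr C (inv_arr C f) = f"
 by (rule inv_arr_eq) (auto intro!: inverse_arrI simp: iso_arr_arr)

lemma inv_comp:
 "iso_arr C f ==> iso_arr C g ==> src g = tgt f ==> inv_arr C (g \<cdot> f) = inv_arr C f \<cdot> inv_arr C g"
 by (rule inv_arr_eq, rule inverse_arrI) (auto simp: iso_arr_arr)

end

context symmetric_monoidal_cat
begin

lemma tobj_in [simp]: "X \<in> obj C ==> Y \<in> obj C ==> X \<odot> Y \<in> obj C"
 by (rule tobj_obj)

lemma tunit_in [simp]: "\<one> \<in> obj C" by (rule tunit_obj)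

lemma arr_tmor [simp]:
 "arr f ==> arr g ==> arr (f \<otimes> g)"
 "arr f ==> arr g ==> src (f \<otimes> g) = src f \<odot> src g"
 "arr f ==> arr g ==> tgt (f \<otimes> g) = tgt f \<odot> tgt g"
 using tmor_hom[of f "src f" "tgt f" g "src g" "tgt g"] by (auto simp: hom_iff)

lemma tmor_ident [simp]: "X \<in> obj C ==> Y \<in> obj C ==> \<i> X \<otimes> \<i> Y = \<i> (X \<odot> Y)"
 by (rule tmor_id)

lemma ichg [simp]:
 "arr f ==> arr g ==> arr f' ==> arr g' ==> src g = tgt f ==> src g' = tgt f' ==>
  (g \<otimes> g') \<cdot> (f \<otimes> f') = (g \<cdot> f) \<otimes> (g' \<cdot> f')"
 using tmor_comp by (auto simp: hom_iff)

lemma ichg_k [simp]: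
 "arr f ==> arr g ==> arr f' ==> arr g' ==> src g = tgt f ==> src g' = tgt f' ==> arr k ==>
  tgt k = src f \<odot> src f' ==> (g \<otimes> g') \<cdot> (f \<otimes> f') \<cdot> k = ((g \<cdot> f) \<otimes> (g' \<cdot> f')) \<cdot> k"
 using comp_k[OF ichg] by simp

lemma iso_tmor [simp]: "iso_arr C f ==> iso_arr C g ==> iso_arr C (f \<otimes> g)"
 by (rule inverse_iso(1)[of _ "inv_arr C f \<otimes> inv_arr C g"], rule inverse_arrI)
  (auto simp: iso_arr_arr)

lemma inv_tmor: "iso_arr C f ==> iso_arr C g ==> inv_arr C (f \<otimes> g) = inv_arr C f \<otimes> inv_arr C g"
 by (rule inv_arr_eq, rule inverse_arrI) (auto simp: iso_arr_arr)

lemma arr_asc [simp]: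
 "X \<in> obj C ==> Y \<in> obj C ==> Z \<in> obj C ==> iso_arr C (\<a> X Y Z)"
 "X \<in> obj C ==> Y \<in> obj C ==> Z \<in> obj C ==> arr (\<a> X Y Z)"
 "X \<in> obj C ==> Y \<in> obj C ==> Z \<in> obj C ==> src (\<a> X Y Z) = X \<odot> Y \<odot> Z"
 "X \<in> obj C ==> Y \<in> obj C ==> Z \<in> obj C ==> tgt (\<a> X Y Z) = X \<odot> (Y \<odot> Z)"
 using assoc_hom by (auto simp: hom_iff)

lemma arr_lunit [simp]:
 "X \<in> obj C ==> iso_arr C (\<l> X)" "X \<in> obj C ==> arr (\<l> X)"
 "X \<in> obj C ==> src (\<l> X) = \<one> \<odot> X" "X \<in> obj C ==> tgt (\<l> X) = X"
 using lunit_hom by (auto simp: hom_iff)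

lemma arr_runit [simp]:
 "X \<in> obj C ==> iso_arr C (\<r> X)" "X \<in> obj C ==> arr (\<r> X)"
 "X \<in> obj C ==> src (\<r> X) = X \<odot> \<one>" "X \<in> obj C ==> tgt (\<r> X) = X"
 using runit_hom by (auto simp: hom_iff)

lemma arr_swap [simp]:
 "X \<in> obj C ==> Y \<in> obj C ==> arr (\<s> X Y)"
 "X \<in> obj C ==> Y \<in> obj C ==> src (\<s> X Y) = X \<odot> Y"
 "X \<in> obj C ==> Y \<in> obj C ==> tgt (\<s> X Y) = Y \<odot> X"
 using swap_hom by (auto simp: hom_iff)

lemma swap2 [simp]:
 "X \<in> obj C ==> Y \<in> obj C ==> \<s> Y X \<cdot> \<s> X Y = \<i> (X \<odot> Y)"
 "X \<in> obj C ==> Y \<in> obj C ==> arr k ==> tgt k = X \<odot> Y ==> \<s> Y X \<cdot> \<s> X Y \<cdot> k = k"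
 using swap_swap comp_k[OF swap_swap, of X Y k] by auto

lemma inverse_swap: "X \<in> obj C ==> Y \<in> obj C ==> inverse_arr C (\<s> X Y) (\<s> Y X)"
 by (rule inverse_arrI) auto

lemma iso_swap [simp]: "X \<in> obj C ==> Y \<in> obj C ==> iso_arr C (\<s> X Y)"
 using inverse_swap inverse_iso by blast

lemma inv_swap [simp]: "X \<in> obj C ==> Y \<in> obj C ==> inv_arr C (\<s> X Y) = \<s> Y X"
 using inverse_swap inv_arr_eq by blast

lemma asc_nat:
 "arr f ==> arr g ==> arr h ==>
  \<a> (tgt f) (tgt g) (tgt h) \<cdot> (f \<otimes> g \<otimes> h) = (f \<otimes> (g \<otimes> h)) \<cdot> \<a> (src f) (src g) (src h)"
 using assoc_nat by (auto simp: hom_iff)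

lemma asc_inv_nat:
 assumes "arr f" "arr g" "arr h"
 shows "inv_arr C (\<a> (tgt f) (tgt g) (tgt h)) \<cdot> (f \<otimes> (g \<otimes> h)) =
  (f \<otimes> g \<otimes> h) \<cdot> inv_arr C (\<a> (src f) (src g) (src h))"
proof (rule iso_cancel_left)
 show "\<a> (tgt f) (tgt g) (tgt h) \<cdot> inv_arr C (\<a> (tgt f) (tgt g) (tgt h)) \<cdot> (f \<otimes> (g \<otimes> h)) =
  \<a> (tgt f) (tgt g) (tgt h) \<cdot> (f \<otimes> g \<otimes> h) \<cdot> inv_arr C (\<a> (src f) (src g) (src h))"
  using assms comp_k[OF asc_nat[OF assms], of "inv_arr C (\<a> (src f) (src g) (src h))"] by simp
qed (use assms in auto)

lemma l_nat: "arr f ==> \<l> (tgt f) \<cdot> (\<i> \<one> \<otimes> f) = f \<cdot> \<l> (src f)"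
 using lunit_nat by (auto simp: hom_iff)

lemma r_nat: "arr f ==> \<r> (tgt f) \<cdot> (f \<otimes> \<i> \<one>) = f \<cdot> \<r> (src f)"
 using runit_nat by (auto simp: hom_iff)

lemma l_inv_nat: "arr f ==> (\<i> \<one> \<otimes> f) \<cdot> inv_arr C (\<l> (src f)) = inv_arr C (\<l> (tgt f)) \<cdot> f"
proof (rule iso_cancel_left)
 assume f: "arr f"
 show "\<l> (tgt f) \<cdot> (\<i> \<one> \<otimes> f) \<cdot> inv_arr C (\<l> (src f)) = \<l> (tgt f) \<cdot> inv_arr C (\<l> (tgt f)) \<cdot> f"
  using f comp_k[OF l_nat[OF f], of "inv_arr C (\<l> (src f))"] by simp
qed auto

lemma r_inv_nat: "arr f ==> (f \<otimes> \<i> \<one>) \<cdot> inv_arr C (\<r> (src f)) = inv_arr C (\<r> (tgt f)) \<cdot> f"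
proof (rule iso_cancel_left)
 assume f: "arr f"
 show "\<r> (tgt f) \<cdot> (f \<otimes> \<i> \<one>) \<cdot> inv_arr C (\<r> (src f)) = \<r> (tgt f) \<cdot> inv_arr C (\<r> (tgt f)) \<cdot> f"
  using f comp_k[OF r_nat[OF f], of "inv_arr C (\<r> (src f))"] by simp
qed auto

lemma s_nat: "arr f ==> arr g ==> \<s> (tgt f) (tgt g) \<cdot> (f \<otimes> g) = (g \<otimes> f) \<cdot> \<s> (src f) (src g)"
 using swap_nat by (auto simp: hom_iff)

text \<open>Naturality of the left unitor recovers \<open>f\<close> from
  \<open>\<i> \<one> \<otimes> f\<close> up to isomorphisms.\<close>

lemma unit_tensor_faithful:
 assumes "\<i> \<one> \<otimes> f = \<i> \<one> \<otimes> g" "arr f" "arr g" "src f = src g" "tgt f = tgt g"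
 shows "f = g"
proof (rule iso_cancel_right)
 show "f \<cdot> \<l> (src f) = g \<cdot> \<l> (src f)" using assms l_nat by metis
qed (use assms in auto)

lemma tensor_unit_faithful:
 assumes "f \<otimes> \<i> \<one> = g \<otimes> \<i> \<one>" "arr f" "arr g" "src f = src g" "tgt f = tgt g"
 shows "f = g"
proof (rule iso_cancel_right)
 show "f \<cdot> \<r> (src f) = g \<cdot> \<r> (src f)" using assms r_nat by metis
qed (use assms in auto)

text \<open>One of the unit laws that Kelly showed to be redundant: it follows from the pentagon and
  the triangle after tensoring with the unit, which is faithful.\<close>

lemma lunit_tensor:
 assumes X [simp]: "X \<in> obj C" and Y [simp]: "Y \<in> obj C"
 shows "\<l> (X \<odot> Y) \<cdot> \<a> \<one> X Y = \<l> X \<otimes> \<i> Y"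
proof (rule unit_tensor_faithful)
 show "\<i> \<one> \<otimes> (\<l> (X \<odot> Y) \<cdot> \<a> \<one> X Y) = \<i> \<one> \<otimes> (\<l> X \<otimes> \<i> Y)"
 proof (rule iso_cancel_right)
  \<comment> \<open>An invertible arrow chosen so that the composite contains the right side of the
    pentagon for \<open>\<one>\<close>, \<open>\<one>\<close>, \<open>X\<close>, \<open>Y\<close>;
    it is cancelled at the end.\<close>
  let ?p = "\<a> \<one> (\<one> \<odot> X) Y \<cdot> (\<a> \<one> \<one> X \<otimes> \<i> Y)"
  have "(\<i> \<one> \<otimes> (\<l> (X \<odot> Y) \<cdot> \<a> \<one> X Y)) \<cdot> ?p = (\<i> \<one> \<otimes> \<l> (X \<odot> Y)) \<cdot> (\<i> \<one> \<otimes> \<a> \<one> X Y) \<cdot> ?p"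
   by simp
  also have "... = (\<i> \<one> \<otimes> \<l> (X \<odot> Y)) \<cdot> \<a> \<one> \<one> (X \<odot> Y) \<cdot> \<a> (\<one> \<odot> \<one>) X Y"
   by (subst pentagon) auto
  also have "... = (\<r> \<one> \<otimes> \<i> (X \<odot> Y)) \<cdot> \<a> (\<one> \<odot> \<one>) X Y"
   by (subst comp_k[OF triangle]) auto
  also have "... = \<a> \<one> X Y \<cdot> (\<r> \<one> \<otimes> \<i> X \<otimes> \<i> Y)"
   using asc_nat[of "\<r> \<one>" "\<i> X" "\<i> Y"] by simp
  also have "... = \<a> \<one> X Y \<cdot> (((\<i> \<one> \<otimes> \<l> X) \<cdot> \<a> \<one> \<one> X) \<otimes> \<i> Y)"
   by (subst triangle) auto
  also have "... = \<a> \<one> X Y \<cdot> (\<i> \<one> \<otimes> \<l> X \<otimes> \<i> Y) \<cdot> (\<a> \<one> \<one> X \<otimes> \<i> Y)"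
   by simp
  also have "... = (\<i> \<one> \<otimes> (\<l> X \<otimes> \<i> Y)) \<cdot> ?p"
   using comp_k[OF asc_nat[of "\<i> \<one>" "\<l> X" "\<i> Y"], of "\<a> \<one> \<one> X \<otimes> \<i> Y"] by simp
  finally show "(\<i> \<one> \<otimes> (\<l> (X \<odot> Y) \<cdot> \<a> \<one> X Y)) \<cdot> ?p = (\<i> \<one> \<otimes> (\<l> X \<otimes> \<i> Y)) \<cdot> ?p" .
 qed auto
qed auto

lemma runit_tensor:
 assumes X [simp]: "X \<in> obj C" and Y [simp]: "Y \<in> obj C"
 shows "(\<i> X \<otimes> \<r> Y) \<cdot> \<a> X Y \<one> = \<r> (X \<odot> Y)"
proof (rule tensor_unit_faithful)
 show "((\<i> X \<otimes> \<r> Y) \<cdot> \<a> X Y \<one>) \<otimes> \<i> \<one> = \<r> (X \<odot> Y) \<otimes> \<i> \<one>"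
 proof (rule iso_cancel_left)
  have "\<a> X Y \<one> \<cdot> (\<r> (X \<odot> Y) \<otimes> \<i> \<one>) = \<a> X Y \<one> \<cdot> (\<i> (X \<odot> Y) \<otimes> \<l> \<one>) \<cdot> \<a> (X \<odot> Y) \<one> \<one>"
   by (subst triangle) auto
  also have "... = (\<i> X \<otimes> (\<i> Y \<otimes> \<l> \<one>)) \<cdot> \<a> X Y (\<one> \<odot> \<one>) \<cdot> \<a> (X \<odot> Y) \<one> \<one>"
   using comp_k[OF asc_nat[of "\<i> X" "\<i> Y" "\<l> \<one>"], of "\<a> (X \<odot> Y) \<one> \<one>"] by simp
  also have "... = (\<i> X \<otimes> (\<i> Y \<otimes> \<l> \<one>)) \<cdot> (\<i> X \<otimes> \<a> Y \<one> \<one>) \<cdot> \<a> X (Y \<odot> \<one>) \<one> \<cdot> (\<a> X Y \<one> \<otimes> \<i> \<one>)"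
   by (subst pentagon) auto
  also have "... = (\<i> X \<otimes> ((\<i> Y \<otimes> \<l> \<one>) \<cdot> \<a> Y \<one> \<one>)) \<cdot> \<a> X (Y \<odot> \<one>) \<one> \<cdot> (\<a> X Y \<one> \<otimes> \<i> \<one>)"
   by simp
  also have "... = (\<i> X \<otimes> (\<r> Y \<otimes> \<i> \<one>)) \<cdot> \<a> X (Y \<odot> \<one>) \<one> \<cdot> (\<a> X Y \<one> \<otimes> \<i> \<one>)"
   by (subst triangle) auto
  also have "... = \<a> X Y \<one> \<cdot> (\<i> X \<otimes> \<r> Y \<otimes> \<i> \<one>) \<cdot> (\<a> X Y \<one> \<otimes> \<i> \<one>)"
   using comp_k[OF asc_nat[of "\<i> X" "\<r> Y" "\<i> \<one>"], of "\<a> X Y \<one> \<otimes> \<i> \<one>"] by simp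
  finally show "\<a> X Y \<one> \<cdot> (((\<i> X \<otimes> \<r> Y) \<cdot> \<a> X Y \<one>) \<otimes> \<i> \<one>) = \<a> X Y \<one> \<cdot> (\<r> (X \<odot> Y) \<otimes> \<i> \<one>)"
   by simp
 qed auto
qed auto

text \<open>Naturality of the unitor at itself identifies
  \<open>\<l> (\<one> \<odot> \<one>)\<close> with \<open>\<i> \<one> \<otimes> \<l> \<one>\<close>.
  With \<open>lunit_tensor\<close> this gives the left side of the triangle, whose right side is the
  right unitor.\<close>

lemma lunit_runit: "\<l> \<one> = \<r> \<one>"
proof (rule tensor_unit_faithful)
 have "\<l> (\<one> \<odot> \<one>) = \<i> \<one> \<otimes> \<l> \<one>"
  by (rule iso_cancel_left[of "\<l> \<one>"]) (use l_nat[of "\<l> \<one>"] in auto)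
 then have "\<l> \<one> \<otimes> \<i> \<one> = (\<i> \<one> \<otimes> \<l> \<one>) \<cdot> \<a> \<one> \<one> \<one>"
  using lunit_tensor[of \<one> \<one>] by simp
 then show "\<l> \<one> \<otimes> \<i> \<one> = \<r> \<one> \<otimes> \<i> \<one>" by (simp add: triangle)
qed auto

text \<open>The hexagon for \<open>X\<close>, \<open>\<one>\<close>, \<open>\<one>\<close> collapses
  to the triangle once all unitors are moved through by naturality.\<close>

lemma lunit_swap:
 assumes X [simp]: "X \<in> obj C"
 shows "\<l> X \<cdot> \<s> X \<one> = \<r> X"
proof (rule tensor_unit_faithful)
 show "(\<l> X \<cdot> \<s> X \<one>) \<otimes> \<i> \<one> = \<r> X \<otimes> \<i> \<one>"
 proof (rule iso_cancel_left)
  have "\<s> X \<one> \<cdot> ((\<l> X \<cdot> \<s> X \<one>) \<otimes> \<i> \<one>) = \<s> X \<one> \<cdot> (\<l> X \<otimes> \<i> \<one>) \<cdot> (\<s> X \<one> \<otimes> \<i> \<one>)"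
   by simp
  also have "... = \<s> X \<one> \<cdot> \<l> (X \<odot> \<one>) \<cdot> \<a> \<one> X \<one> \<cdot> (\<s> X \<one> \<otimes> \<i> \<one>)"
   by (subst lunit_tensor[symmetric]) auto
  also have "... = \<l> (\<one> \<odot> X) \<cdot> (\<i> \<one> \<otimes> \<s> X \<one>) \<cdot> \<a> \<one> X \<one> \<cdot> (\<s> X \<one> \<otimes> \<i> \<one>)"
   using comp_k[OF l_nat[of "\<s> X \<one>"], of "\<a> \<one> X \<one> \<cdot> (\<s> X \<one> \<otimes> \<i> \<one>)"] by simp
  also have "... = \<l> (\<one> \<odot> X) \<cdot> \<a> \<one> \<one> X \<cdot> \<s> X (\<one> \<odot> \<one>) \<cdot> \<a> X \<one> \<one>"
   by (subst hexagon) auto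
  also have "... = (\<l> \<one> \<otimes> \<i> X) \<cdot> \<s> X (\<one> \<odot> \<one>) \<cdot> \<a> X \<one> \<one>"
   by (subst comp_k[OF lunit_tensor]) auto
  also have "... = \<s> X \<one> \<cdot> (\<i> X \<otimes> \<l> \<one>) \<cdot> \<a> X \<one> \<one>"
   using comp_k[OF s_nat[of "\<i> X" "\<l> \<one>"], of "\<a> X \<one> \<one>"] by simp
  also have "... = \<s> X \<one> \<cdot> (\<r> X \<otimes> \<i> \<one>)"
   by (subst triangle) auto
  finally show "\<s> X \<one> \<cdot> ((\<l> X \<cdot> \<s> X \<one>) \<otimes> \<i> \<one>) = \<s> X \<one> \<cdot> (\<r> X \<otimes> \<i> \<one>)" .
 qed auto
qed auto

text \<open>This and the next lemma solve the pentagon for the combinations of associators and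
  inverse associators that occur when a factor is pulled out of a product.\<close>

lemma pentagon_inv:
 assumes [simp]: "X \<in> obj C" "Y \<in> obj C" "Z \<in> obj C" "A \<in> obj C"
 shows "(\<a> X Y Z \<otimes> \<i> A) \<cdot> inv_arr C (\<a> (X \<odot> Y) Z A) =
  inv_arr C (\<a> X (Y \<odot> Z) A) \<cdot> (\<i> X \<otimes> inv_arr C (\<a> Y Z A)) \<cdot> \<a> X Y (Z \<odot> A)"
proof (rule iso_cancel_left)
 let ?p = "(\<i> X \<otimes> \<a> Y Z A) \<cdot> \<a> X (Y \<odot> Z) A"
 have "?p \<cdot> (\<a> X Y Z \<otimes> \<i> A) \<cdot> inv_arr C (\<a> (X \<odot> Y) Z A)
  = ((\<i> X \<otimes> \<a> Y Z A) \<cdot> \<a> X (Y \<odot> Z) A \<cdot> (\<a> X Y Z \<otimes> \<i> A)) \<cdot> inv_arr C (\<a> (X \<odot> Y) Z A)"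
  by (simp del: ichg_k)
 also have "... = \<a> X Y (Z \<odot> A)"
  by (subst pentagon[symmetric]) auto
 finally show "?p \<cdot> (\<a> X Y Z \<otimes> \<i> A) \<cdot> inv_arr C (\<a> (X \<odot> Y) Z A) =
  ?p \<cdot> inv_arr C (\<a> X (Y \<odot> Z) A) \<cdot> (\<i> X \<otimes> inv_arr C (\<a> Y Z A)) \<cdot> \<a> X Y (Z \<odot> A)"
  by simp
qed auto

lemma pentagon_mid:
 assumes [simp]: "X \<in> obj C" "Y \<in> obj C" "Z \<in> obj C" "A \<in> obj C"
 shows "\<a> (X \<odot> Y) A Z \<cdot> (inv_arr C (\<a> X Y A) \<otimes> \<i> Z) =
  inv_arr C (\<a> X Y (A \<odot> Z)) \<cdot> (\<i> X \<otimes> \<a> Y A Z) \<cdot> \<a> X (Y \<odot> A) Z"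
proof (rule iso_cancel_right)
 let ?q = "\<a> X Y A \<otimes> \<i> Z"
 show "(\<a> (X \<odot> Y) A Z \<cdot> (inv_arr C (\<a> X Y A) \<otimes> \<i> Z)) \<cdot> ?q =
  (inv_arr C (\<a> X Y (A \<odot> Z)) \<cdot> (\<i> X \<otimes> \<a> Y A Z) \<cdot> \<a> X (Y \<odot> A) Z) \<cdot> ?q"
  using pentagon[of X Y A Z, symmetric] by simp
qed auto

text \<open>The other hexagon, obtained by inverting the given one: the inverse of a symmetry is
  again a symmetry.\<close>

lemma hexagon2:
 assumes [simp]: "X \<in> obj C" "Y \<in> obj C" "A \<in> obj C"
 shows "inv_arr C (\<a> Y X A) \<cdot> \<s> (X \<odot> A) Y =
  (\<s> X Y \<otimes> \<i> A) \<cdot> inv_arr C (\<a> X Y A) \<cdot> (\<i> X \<otimes> \<s> A Y) \<cdot> \<a> X A Y"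
proof -
 have "inv_arr C (\<a> X A Y \<cdot> \<s> Y (X \<odot> A) \<cdot> \<a> Y X A) =
  inv_arr C ((\<i> X \<otimes> \<s> Y A) \<cdot> \<a> X Y A \<cdot> (\<s> Y X \<otimes> \<i> A))"
  by (simp add: hexagon)
 then have "inv_arr C (\<a> Y X A) \<cdot> \<s> (X \<odot> A) Y \<cdot> inv_arr C (\<a> X A Y) =
  (\<s> X Y \<otimes> \<i> A) \<cdot> inv_arr C (\<a> X Y A) \<cdot> (\<i> X \<otimes> \<s> A Y)"
  by (simp add: inv_comp inv_tmor)
 then have "(inv_arr C (\<a> Y X A) \<cdot> \<s> (X \<odot> A) Y \<cdot> inv_arr C (\<a> X A Y)) \<cdot> \<a> X A Y =
  ((\<s> X Y \<otimes> \<i> A) \<cdot> inv_arr C (\<a> X Y A) \<cdot> (\<i> X \<otimes> \<s> A Y)) \<cdot> \<a> X A Y" by simp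
 then show ?thesis by simp
qed

text \<open>Exchanges the last two factors of a left-nested triple. It is the elementary move of the
  merge below, which brings a letter to the outermost place.\<close>

definition rswap where
 "rswap X A Y = inv_arr C (\<a> X Y A) \<cdot> (\<i> X \<otimes> \<s> A Y) \<cdot> \<a> X A Y"

lemma arr_rswap [simp]:
 "X \<in> obj C ==> Y \<in> obj C ==> A \<in> obj C ==> arr (rswap X A Y)"
 "X \<in> obj C ==> Y \<in> obj C ==> A \<in> obj C ==> src (rswap X A Y) = X \<odot> A \<odot> Y"
 "X \<in> obj C ==> Y \<in> obj C ==> A \<in> obj C ==> tgt (rswap X A Y) = X \<odot> Y \<odot> A"
 "X \<in> obj C ==> Y \<in> obj C ==> A \<in> obj C ==> iso_arr C (rswap X A Y)"
 by (simp_all add: rswap_def)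

lemma rswap_nat:
 assumes "arr f" "arr g" "A \<in> obj C"
 shows "rswap (tgt f) A (tgt g) \<cdot> (f \<otimes> \<i> A \<otimes> g) = (f \<otimes> g \<otimes> \<i> A) \<cdot> rswap (src f) A (src g)"
proof -
 have "rswap (tgt f) A (tgt g) \<cdot> (f \<otimes> \<i> A \<otimes> g) =
   inv_arr C (\<a> (tgt f) (tgt g) A) \<cdot> (\<i> (tgt f) \<otimes> \<s> A (tgt g)) \<cdot> (f \<otimes> (\<i> A \<otimes> g)) \<cdot> \<a> (src f) A (src g)"
  using assms asc_nat[of f "\<i> A" g] by (simp add: rswap_def)
 also have "... = inv_arr C (\<a> (tgt f) (tgt g) A) \<cdot> (f \<otimes> (\<s> A (tgt g) \<cdot> (\<i> A \<otimes> g))) \<cdot> \<a> (src f) A (src g)"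
  using assms by simp
 also have "... = inv_arr C (\<a> (tgt f) (tgt g) A) \<cdot> (f \<otimes> (g \<otimes> \<i> A)) \<cdot> (\<i> (src f) \<otimes> \<s> A (src g)) \<cdot> \<a> (src f) A (src g)"
  using assms s_nat[of "\<i> A" g] by simp
 also have "... = (f \<otimes> g \<otimes> \<i> A) \<cdot> rswap (src f) A (src g)"
  using assms comp_k[OF asc_inv_nat[of f g "\<i> A"], of "(\<i> (src f) \<otimes> \<s> A (src g)) \<cdot> \<a> (src f) A (src g)"]
  by (simp add: rswap_def del: ichg_k)
 finally show ?thesis .
qed

lemma rswap_asc_mid:
 assumes [simp]: "X \<in> obj C" "Y \<in> obj C" "Z \<in> obj C" "A \<in> obj C"
 shows "(\<a> X Y Z \<otimes> \<i> A) \<cdot> rswap (X \<odot> Y) A Z \<cdot> (inv_arr C (\<a> X Y A) \<otimes> \<i> Z) =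
  inv_arr C (\<a> X (Y \<odot> Z) A) \<cdot> (\<i> X \<otimes> rswap Y A Z) \<cdot> \<a> X (Y \<odot> A) Z"
proof -
 have "(\<a> X Y Z \<otimes> \<i> A) \<cdot> rswap (X \<odot> Y) A Z \<cdot> (inv_arr C (\<a> X Y A) \<otimes> \<i> Z) =
  (\<a> X Y Z \<otimes> \<i> A) \<cdot> inv_arr C (\<a> (X \<odot> Y) Z A) \<cdot> (\<i> (X \<odot> Y) \<otimes> \<s> A Z) \<cdot>
   \<a> (X \<odot> Y) A Z \<cdot> (inv_arr C (\<a> X Y A) \<otimes> \<i> Z)"
  by (simp add: rswap_def)
 also have "... = inv_arr C (\<a> X (Y \<odot> Z) A) \<cdot> (\<i> X \<otimes> inv_arr C (\<a> Y Z A)) \<cdot> \<a> X Y (Z \<odot> A) \<cdot>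
   (\<i> (X \<odot> Y) \<otimes> \<s> A Z) \<cdot> inv_arr C (\<a> X Y (A \<odot> Z)) \<cdot> (\<i> X \<otimes> \<a> Y A Z) \<cdot> \<a> X (Y \<odot> A) Z"
  by (subst comp_k[OF pentagon_inv], simp_all, subst pentagon_mid, simp_all)
 also have "... = inv_arr C (\<a> X (Y \<odot> Z) A) \<cdot> (\<i> X \<otimes> inv_arr C (\<a> Y Z A)) \<cdot> (\<i> X \<otimes> (\<i> Y \<otimes> \<s> A Z)) \<cdot>
   (\<i> X \<otimes> \<a> Y A Z) \<cdot> \<a> X (Y \<odot> A) Z"
  using comp_k[OF asc_nat[of "\<i> X" "\<i> Y" "\<s> A Z"],
    of "inv_arr C (\<a> X Y (A \<odot> Z)) \<cdot> (\<i> X \<otimes> \<a> Y A Z) \<cdot> \<a> X (Y \<odot> A) Z"] by simp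
 also have "... = inv_arr C (\<a> X (Y \<odot> Z) A) \<cdot> (\<i> X \<otimes> rswap Y A Z) \<cdot> \<a> X (Y \<odot> A) Z"
  by (simp add: rswap_def)
 finally show ?thesis .
qed

text \<open>Moving \<open>A\<close> past \<open>Y\<close> and then past \<open>Z\<close> is moving
  it past their product. The heart is the hexagon; pentagons adjust the bracketing.\<close>

lemma rswap_asc_left:
 assumes [simp]: "X \<in> obj C" "Y \<in> obj C" "Z \<in> obj C" "A \<in> obj C"
 shows "(\<a> X Y Z \<otimes> \<i> A) \<cdot> rswap (X \<odot> Y) A Z \<cdot> (rswap X A Y \<otimes> \<i> Z) =
  rswap X A (Y \<odot> Z) \<cdot> \<a> (X \<odot> A) Y Z"
proof -
 let ?m = "inv_arr C (\<a> X Y A) \<otimes> \<i> Z" and ?k = "(\<i> X \<otimes> \<s> A Y \<otimes> \<i> Z) \<cdot> (\<a> X A Y \<otimes> \<i> Z)"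
 have "(\<a> X Y Z \<otimes> \<i> A) \<cdot> rswap (X \<odot> Y) A Z \<cdot> (rswap X A Y \<otimes> \<i> Z) =
  ((\<a> X Y Z \<otimes> \<i> A) \<cdot> rswap (X \<odot> Y) A Z \<cdot> ?m) \<cdot> ?k"
  by (simp add: rswap_def[of X A Y])
 also have "... = (inv_arr C (\<a> X (Y \<odot> Z) A) \<cdot> (\<i> X \<otimes> rswap Y A Z) \<cdot> \<a> X (Y \<odot> A) Z) \<cdot> ?k"
  by (subst rswap_asc_mid) auto
 also have "... = inv_arr C (\<a> X (Y \<odot> Z) A) \<cdot> (\<i> X \<otimes> rswap Y A Z) \<cdot>
   (\<a> X (Y \<odot> A) Z \<cdot> (\<i> X \<otimes> \<s> A Y \<otimes> \<i> Z)) \<cdot> (\<a> X A Y \<otimes> \<i> Z)"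
  by simp
 also have "... = inv_arr C (\<a> X (Y \<odot> Z) A) \<cdot> (\<i> X \<otimes> rswap Y A Z) \<cdot>
   (\<i> X \<otimes> (\<s> A Y \<otimes> \<i> Z)) \<cdot> \<a> X (A \<odot> Y) Z \<cdot> (\<a> X A Y \<otimes> \<i> Z)"
  using asc_nat[of "\<i> X" "\<s> A Y" "\<i> Z"] by simp
 also have "... = inv_arr C (\<a> X (Y \<odot> Z) A) \<cdot>
   (\<i> X \<otimes> (inv_arr C (\<a> Y Z A) \<cdot> (\<i> Y \<otimes> \<s> A Z) \<cdot> \<a> Y A Z \<cdot> (\<s> A Y \<otimes> \<i> Z))) \<cdot> \<a> X (A \<odot> Y) Z \<cdot> (\<a> X A Y \<otimes> \<i> Z)"
  by (simp add: rswap_def)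
 also have "... = inv_arr C (\<a> X (Y \<odot> Z) A) \<cdot>
   (\<i> X \<otimes> (\<s> A (Y \<odot> Z) \<cdot> \<a> A Y Z)) \<cdot> \<a> X (A \<odot> Y) Z \<cdot> (\<a> X A Y \<otimes> \<i> Z)"
  by (subst hexagon[symmetric]) auto
 also have "... = inv_arr C (\<a> X (Y \<odot> Z) A) \<cdot> (\<i> X \<otimes> \<s> A (Y \<odot> Z)) \<cdot>
   (\<i> X \<otimes> \<a> A Y Z) \<cdot> \<a> X (A \<odot> Y) Z \<cdot> (\<a> X A Y \<otimes> \<i> Z)"
  by simp
 also have "... = inv_arr C (\<a> X (Y \<odot> Z) A) \<cdot> (\<i> X \<otimes> \<s> A (Y \<odot> Z)) \<cdot> \<a> X A (Y \<odot> Z) \<cdot> \<a> (X \<odot> A) Y Z"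
  by (subst pentagon) auto
 also have "... = rswap X A (Y \<odot> Z) \<cdot> \<a> (X \<odot> A) Y Z"
  by (simp add: rswap_def)
 finally show ?thesis .
qed

end

subsection \<open>Coherence\<close>

context symmetric_monoidal_cat
begin

text \<open>The steps of \<open>mga_assoc\<close>. The arrows \<open>p\<close>, \<open>m\<close>,
  \<open>q\<close>, \<open>n\<close> stand for merges that satisfy the associativity law by
  induction, and \<open>A\<close> is the letter that becomes outermost: here it comes from the third
  list, in \<open>merge_y\<close> from the second and in \<open>merge_x\<close> from the
  first.\<close>

lemma merge_z:
 assumes [simp]: "X \<in> obj C" "Y \<in> obj C" "Z \<in> obj C" "A \<in> obj C" "W \<in> obj C" "V \<in> obj C" "U \<in> obj C"
  and [simp]: "arr p" "src p = W \<odot> Z" "tgt p = U" "arr m" "src m = X \<odot> Y" "tgt m = W"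
   "arr q" "src q = X \<odot> V" "tgt q = U" "arr n" "src n = Y \<odot> Z" "tgt n = V"
  and eq: "p \<cdot> (m \<otimes> \<i> Z) = q \<cdot> (\<i> X \<otimes> n) \<cdot> \<a> X Y Z"
 shows "(p \<otimes> \<i> A) \<cdot> inv_arr C (\<a> W Z A) \<cdot> (m \<otimes> \<i> (Z \<odot> A)) =
  (q \<otimes> \<i> A) \<cdot> inv_arr C (\<a> X V A) \<cdot> (\<i> X \<otimes> ((n \<otimes> \<i> A) \<cdot> inv_arr C (\<a> Y Z A))) \<cdot> \<a> X Y (Z \<odot> A)"
proof -
 have "(p \<otimes> \<i> A) \<cdot> inv_arr C (\<a> W Z A) \<cdot> (m \<otimes> \<i> (Z \<odot> A)) =
  (p \<otimes> \<i> A) \<cdot> (m \<otimes> \<i> Z \<otimes> \<i> A) \<cdot> inv_arr C (\<a> (X \<odot> Y) Z A)"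
  using asc_inv_nat[of m "\<i> Z" "\<i> A"] by (simp del: ichg_k)
 also have "... = ((q \<cdot> (\<i> X \<otimes> n) \<cdot> \<a> X Y Z) \<otimes> \<i> A) \<cdot> inv_arr C (\<a> (X \<odot> Y) Z A)"
  by (simp add: eq)
 also have "... = (q \<otimes> \<i> A) \<cdot> (\<i> X \<otimes> n \<otimes> \<i> A) \<cdot> (\<a> X Y Z \<otimes> \<i> A) \<cdot> inv_arr C (\<a> (X \<odot> Y) Z A)"
  by simp
 also have "... = (q \<otimes> \<i> A) \<cdot> ((\<i> X \<otimes> n \<otimes> \<i> A) \<cdot>
   inv_arr C (\<a> X (Y \<odot> Z) A)) \<cdot> (\<i> X \<otimes> inv_arr C (\<a> Y Z A)) \<cdot> \<a> X Y (Z \<odot> A)"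
  by (subst pentagon_inv) (simp_all del: ichg_k)
 also have "... = (q \<otimes> \<i> A) \<cdot> inv_arr C (\<a> X V A) \<cdot> (\<i> X \<otimes> (n \<otimes> \<i> A)) \<cdot>
   (\<i> X \<otimes> inv_arr C (\<a> Y Z A)) \<cdot> \<a> X Y (Z \<odot> A)"
  using asc_inv_nat[of "\<i> X" n "\<i> A", symmetric] by (simp del: ichg_k)
 finally show ?thesis by simp
qed

lemma merge_y:
 assumes [simp]: "X \<in> obj C" "Y \<in> obj C" "Z \<in> obj C" "A \<in> obj C" "W \<in> obj C" "V \<in> obj C" "U \<in> obj C"
  and [simp]: "arr p" "src p = W \<odot> Z" "tgt p = U" "arr m" "src m = X \<odot> Y" "tgt m = W"
   "arr q" "src q = X \<odot> V" "tgt q = U" "arr n" "src n = Y \<odot> Z" "tgt n = V"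
  and eq: "p \<cdot> (m \<otimes> \<i> Z) = q \<cdot> (\<i> X \<otimes> n) \<cdot> \<a> X Y Z"
 shows "(p \<otimes> \<i> A) \<cdot> rswap W A Z \<cdot> (((m \<otimes> \<i> A) \<cdot> inv_arr C (\<a> X Y A)) \<otimes> \<i> Z) =
  (q \<otimes> \<i> A) \<cdot> inv_arr C (\<a> X V A) \<cdot> (\<i> X \<otimes> ((n \<otimes> \<i> A) \<cdot> rswap Y A Z)) \<cdot> \<a> X (Y \<odot> A) Z"
proof -
 have "(p \<otimes> \<i> A) \<cdot> rswap W A Z \<cdot> (((m \<otimes> \<i> A) \<cdot> inv_arr C (\<a> X Y A)) \<otimes> \<i> Z) =
  (p \<otimes> \<i> A) \<cdot> (rswap W A Z \<cdot> (m \<otimes> \<i> A \<otimes> \<i> Z)) \<cdot> (inv_arr C (\<a> X Y A) \<otimes> \<i> Z)"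
  by simp
 also have "... = (p \<otimes> \<i> A) \<cdot> ((m \<otimes> \<i> Z \<otimes> \<i> A) \<cdot> rswap (X \<odot> Y) A Z) \<cdot> (inv_arr C (\<a> X Y A) \<otimes> \<i> Z)"
  using rswap_nat[of m "\<i> Z" A] by simp
 also have "... = ((q \<cdot> (\<i> X \<otimes> n) \<cdot> \<a> X Y Z) \<otimes> \<i> A) \<cdot> rswap (X \<odot> Y) A Z \<cdot> (inv_arr C (\<a> X Y A) \<otimes> \<i> Z)"
  by (simp add: eq)
 also have "... = (q \<otimes> \<i> A) \<cdot> (\<i> X \<otimes> n \<otimes> \<i> A) \<cdot> (\<a> X Y Z \<otimes> \<i> A) \<cdot> rswap (X \<odot> Y) A Z \<cdot> (inv_arr C (\<a> X Y A) \<otimes> \<i> Z)"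
  by simp
 also have "... = (q \<otimes> \<i> A) \<cdot> ((\<i> X \<otimes> n \<otimes> \<i> A) \<cdot>
   inv_arr C (\<a> X (Y \<odot> Z) A)) \<cdot> (\<i> X \<otimes> rswap Y A Z) \<cdot> \<a> X (Y \<odot> A) Z"
  by (subst rswap_asc_mid) (simp_all del: ichg_k)
 also have "... = (q \<otimes> \<i> A) \<cdot> inv_arr C (\<a> X V A) \<cdot> (\<i> X \<otimes> (n \<otimes> \<i> A)) \<cdot>
   (\<i> X \<otimes> rswap Y A Z) \<cdot> \<a> X (Y \<odot> A) Z"
  using asc_inv_nat[of "\<i> X" n "\<i> A", symmetric] by (simp del: ichg_k)
 finally show ?thesis by simp
qed

lemma merge_x:
 assumes [simp]: "X \<in> obj C" "Y \<in> obj C" "Z \<in> obj C" "A \<in> obj C" "W \<in> obj C" "V \<in> obj C" "U \<in> obj C"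
  and [simp]: "arr p" "src p = W \<odot> Z" "tgt p = U" "arr m" "src m = X \<odot> Y" "tgt m = W"
   "arr q" "src q = X \<odot> V" "tgt q = U" "arr n" "src n = Y \<odot> Z" "tgt n = V"
  and eq: "p \<cdot> (m \<otimes> \<i> Z) = q \<cdot> (\<i> X \<otimes> n) \<cdot> \<a> X Y Z"
 shows "(p \<otimes> \<i> A) \<cdot> rswap W A Z \<cdot> (((m \<otimes> \<i> A) \<cdot> rswap X A Y) \<otimes> \<i> Z) =
  (q \<otimes> \<i> A) \<cdot> rswap X A V \<cdot> (\<i> (X \<odot> A) \<otimes> n) \<cdot> \<a> (X \<odot> A) Y Z"
proof -
 have "(p \<otimes> \<i> A) \<cdot> rswap W A Z \<cdot> (((m \<otimes> \<i> A) \<cdot> rswap X A Y) \<otimes> \<i> Z) =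
  (p \<otimes> \<i> A) \<cdot> (rswap W A Z \<cdot> (m \<otimes> \<i> A \<otimes> \<i> Z)) \<cdot> (rswap X A Y \<otimes> \<i> Z)"
  by simp
 also have "... = (p \<otimes> \<i> A) \<cdot> ((m \<otimes> \<i> Z \<otimes> \<i> A) \<cdot> rswap (X \<odot> Y) A Z) \<cdot> (rswap X A Y \<otimes> \<i> Z)"
  using rswap_nat[of m "\<i> Z" A] by simp
 also have "... = ((q \<cdot> (\<i> X \<otimes> n) \<cdot> \<a> X Y Z) \<otimes> \<i> A) \<cdot> rswap (X \<odot> Y) A Z \<cdot> (rswap X A Y \<otimes> \<i> Z)"
  by (simp add: eq)
 also have "... = (q \<otimes> \<i> A) \<cdot> (\<i> X \<otimes> n \<otimes> \<i> A) \<cdot> (\<a> X Y Z \<otimes> \<i> A) \<cdot> rswap (X \<odot> Y) A Z \<cdot> (rswap X A Y \<otimes> \<i> Z)"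
  by simp
 also have "... = (q \<otimes> \<i> A) \<cdot> ((\<i> X \<otimes> n \<otimes> \<i> A) \<cdot> rswap X A (Y \<odot> Z)) \<cdot> \<a> (X \<odot> A) Y Z"
  by (subst rswap_asc_left) simp_all
 also have "... = (q \<otimes> \<i> A) \<cdot> (rswap X A V \<cdot> (\<i> X \<otimes> \<i> A \<otimes> n)) \<cdot> \<a> (X \<odot> A) Y Z"
  using rswap_nat[of "\<i> X" n A] by simp
 finally show ?thesis by simp
qed

text \<open>The step of \<open>mga_swap\<close>: \<open>hexagon2\<close> resolves the symmetry of
  \<open>X \<odot> A\<close> with \<open>Y\<close> into the one of \<open>X\<close> with
  \<open>Y\<close> and an \<open>rswap\<close>.\<close>

lemma merge_swap:
 assumes [simp]: "X \<in> obj C" "Y \<in> obj C" "A \<in> obj C"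
  and [simp]: "arr m'" "src m' = Y \<odot> X" "arr m" "src m = X \<odot> Y"
  and eq: "m' \<cdot> \<s> X Y = m"
 shows "((m' \<otimes> \<i> A) \<cdot> inv_arr C (\<a> Y X A)) \<cdot> \<s> (X \<odot> A) Y = (m \<otimes> \<i> A) \<cdot> rswap X A Y"
proof -
 have "((m' \<otimes> \<i> A) \<cdot> inv_arr C (\<a> Y X A)) \<cdot> \<s> (X \<odot> A) Y =
  (m' \<otimes> \<i> A) \<cdot> inv_arr C (\<a> Y X A) \<cdot> \<s> (X \<odot> A) Y" by simp
 also have "... = (m' \<otimes> \<i> A) \<cdot> (\<s> X Y \<otimes> \<i> A) \<cdot> rswap X A Y"
  by (subst hexagon2) (simp_all add: rswap_def del: ichg_k)
 also have "... = ((m' \<cdot> \<s> X Y) \<otimes> \<i> A) \<cdot> rswap X A Y" by simp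
 finally show ?thesis by (simp only: eq)
qed

section \<open>Structural morphisms between tensor expressions\<close>

primrec ob where
 "ob I EUnit = \<one>"
| "ob I (Leaf l) = I l"
| "ob I (EJoin d e) = ob I d \<odot> ob I e"

definition wfe :: "('l => 'a) => 'l ex => bool" where
 "wfe I e \<longleftrightarrow> (\<forall>l\<in>#leaves e. I l \<in> obj C)"

lemma wfe_simps [simp]:
 "wfe I EUnit" "wfe I (Leaf l) \<longleftrightarrow> I l \<in> obj C" "wfe I (EJoin d e) \<longleftrightarrow> wfe I d & wfe I e"
 by (auto simp: wfe_def)

lemma ob_obj [simp]: "wfe I e ==> ob I e \<in> obj C"
 by (induction e) auto

text \<open>The relation records the two expressions besides the arrow, because different
  expressions may denote the same object. Coherence is a statement about the expressions.\<close>

inductive str for I where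
 str_id: "wfe I e ==> str I e e (\<i> (ob I e))"
| str_comp: "str I e f x ==> str I f g y ==> str I e g (y \<cdot> x)"
| str_ten: "str I e f x ==> str I e' f' y ==> str I (EJoin e e') (EJoin f f') (x \<otimes> y)"
| str_asc: "wfe I d ==> wfe I e ==> wfe I f ==>
  str I (EJoin (EJoin d e) f) (EJoin d (EJoin e f)) (\<a> (ob I d) (ob I e) (ob I f))"
| str_asc_inv: "wfe I d ==> wfe I e ==> wfe I f ==>
  str I (EJoin d (EJoin e f)) (EJoin (EJoin d e) f) (inv_arr C (\<a> (ob I d) (ob I e) (ob I f)))"
| str_l: "wfe I e ==> str I (EJoin EUnit e) e (\<l> (ob I e))"
| str_l_inv: "wfe I e ==> str I e (EJoin EUnit e) (inv_arr C (\<l> (ob I e)))"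
| str_r: "wfe I e ==> str I (EJoin e EUnit) e (\<r> (ob I e))"
| str_r_inv: "wfe I e ==> str I e (EJoin e EUnit) (inv_arr C (\<r> (ob I e)))"
| str_swap: "wfe I d ==> wfe I e ==> str I (EJoin d e) (EJoin e d) (\<s> (ob I d) (ob I e))"

lemma str_wf: "str I e f x ==> wfe I e & wfe I f & leaves f = leaves e"
 by (induction rule: str.induct) auto

lemma str_arr: "str I e f x ==> iso_arr C x & arr x & src x = ob I e & tgt x = ob I f"
 by (induction rule: str.induct) (auto dest: str_wf)

lemma str_inv: "str I e f x ==> str I f e (inv_arr C x)"
proof (induction rule: str.induct)
 case (str_comp e f x g y)
 with str_arr[OF str_comp.hyps(1)] str_arr[OF str_comp.hyps(2)] show ?case
  by (subst inv_comp) (auto intro: str.intros)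
next
 case (str_ten e f x e' f' y)
 with str_arr[OF str_ten.hyps(1)] str_arr[OF str_ten.hyps(2)] show ?case
  by (subst inv_tmor) (auto intro: str.intros)
qed (auto intro: str.intros)

section \<open>Normal forms: words sorted by a rank on the letters\<close>

fun mgl :: "('l => nat) => 'l list => 'l list => 'l list" where
 "mgl rk [] ys = ys"
| "mgl rk xs [] = xs"
| "mgl rk (x # xs) (y # ys) =
   (if rk x > rk y then x # mgl rk xs (y # ys) else y # mgl rk (x # xs) ys)"

text \<open>The head of a list is the outermost, rightmost factor, so that the comparison of heads
  in \<open>mgl\<close> fits left nesting. The innermost factor is always the unit.\<close>

primrec nob where
 "nob I [] = \<one>"
| "nob I (x # xs) = nob I xs \<odot> I x"

text \<open>The structural arrow behind one merge. A winning letter of the first list is moved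
  outermost by \<open>rswap\<close>; one of the second list only needs rebracketing.\<close>

fun mga :: "('l => 'a) => ('l => nat) => 'l list => 'l list => ('a, 'b) arr" where
 "mga I rk [] ys = \<l> (nob I ys)"
| "mga I rk (x # xs) [] = \<r> (nob I (x # xs))"
| "mga I rk (x # xs) (y # ys) =
   (if rk x > rk y
   then (mga I rk xs (y # ys) \<otimes> \<i> (I x)) \<cdot> rswap (nob I xs) (I x) (nob I (y # ys))
   else (mga I rk (x # xs) ys \<otimes> \<i> (I y)) \<cdot> inv_arr C (\<a> (nob I (x # xs)) (nob I ys) (I y)))"

lemma mgl_Nil2 [simp]: "mgl rk xs [] = xs" by (cases xs) auto

lemma mga_Nil2 [simp]: "mga I rk xs [] = \<r> (nob I xs)"
 by (cases xs) (auto simp: lunit_runit)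

lemma set_mgl [simp]: "set (mgl rk xs ys) = set xs \<union> set ys"
 by (induction rk xs ys rule: mgl.induct) auto

definition lok :: "('l => 'a) => 'l list => bool" where
 "lok I xs \<longleftrightarrow> (\<forall>x\<in>set xs. I x \<in> obj C)"

lemma lok_simps [simp]:
 "lok I []" "lok I (x # xs) \<longleftrightarrow> I x \<in> obj C & lok I xs"
 "lok I (mgl rk xs ys) \<longleftrightarrow> lok I xs & lok I ys"
 by (auto simp: lok_def)

lemma nob_obj [simp]: "lok I xs ==> nob I xs \<in> obj C"
 by (induction xs) auto

lemma mga_arr:
 assumes "lok I xs" "lok I ys"
 shows "arr (mga I rk xs ys) & iso_arr C (mga I rk xs ys) & src (mga I rk xs ys) = nob I xs \<odot> nob I ys &
  tgt (mga I rk xs ys) = nob I (mgl rk xs ys)"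
 using assms by (induction I rk xs ys rule: mga.induct) auto

lemma mga_arr_simps [simp]:
 assumes "lok I xs" "lok I ys"
 shows "arr (mga I rk xs ys)" "iso_arr C (mga I rk xs ys)" "src (mga I rk xs ys) = nob I xs \<odot> nob I ys"
  "tgt (mga I rk xs ys) = nob I (mgl rk xs ys)"
 using mga_arr[OF assms] by auto

text \<open>A tie always goes to the list further right, so both bracketings select the same one of
  the three heads.\<close>

lemma mgl_assoc: "mgl rk (mgl rk xs ys) zs = mgl rk xs (mgl rk ys zs)"
proof (induction "length xs + length ys + length zs" arbitrary: xs ys zs rule: less_induct)
 case less
 show ?case
 proof (cases xs; cases ys; cases zs)
  fix x xs' y ys' z zs' assume "xs = x # xs'" "ys = y # ys'" "zs = z # zs'"
  then show ?thesis
   using less[of xs' ys zs] less[of xs ys' zs] less[of xs ys zs'] by auto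
 qed auto
qed

text \<open>Induction on the total length. The winning head is outermost on both sides, and
  \<open>merge_z\<close>, \<open>merge_y\<close>, \<open>merge_x\<close> reduce the claim to shorter
  lists; empty lists give the unit laws \<open>lunit_tensor\<close>, \<open>triangle\<close> and
  \<open>runit_tensor\<close>.\<close>

lemma mga_assoc:
 assumes "lok I xs" "lok I ys" "lok I zs"
 shows "mga I rk (mgl rk xs ys) zs \<cdot> (mga I rk xs ys \<otimes> \<i> (nob I zs)) =
  mga I rk xs (mgl rk ys zs) \<cdot> (\<i> (nob I xs) \<otimes> mga I rk ys zs) \<cdot> \<a> (nob I xs) (nob I ys) (nob I zs)"
 using assms
proof (induction "length xs + length ys + length zs" arbitrary: xs ys zs rule: less_induct)
 case less
 note prems [simp] = less.prems
 consider "xs = []" | "xs \<noteq> []" "ys = []" | "xs \<noteq> []" "ys \<noteq> []" "zs = []"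
  | x xs' y ys' z zs' where "xs = x # xs'" "ys = y # ys'" "zs = z # zs'"
  by (metis list.exhaust)
 then show ?case
 proof cases
  case 1
  have "\<l> (nob I (mgl rk ys zs)) \<cdot> (\<i> \<one> \<otimes> mga I rk ys zs) \<cdot> \<a> \<one> (nob I ys) (nob I zs) =
    mga I rk ys zs \<cdot> \<l> (nob I ys \<odot> nob I zs) \<cdot> \<a> \<one> (nob I ys) (nob I zs)"
   using comp_k[OF l_nat[of "mga I rk ys zs"], of "\<a> \<one> (nob I ys) (nob I zs)"] by simp
  then show ?thesis using 1 by (simp add: lunit_tensor)
 next
  case 2
  then show ?thesis by (simp add: triangle)
 next
  case 3
  have "\<r> (nob I (mgl rk xs ys)) \<cdot> (mga I rk xs ys \<otimes> \<i> \<one>) = mga I rk xs ys \<cdot> \<r> (nob I xs \<odot> nob I ys)"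
   using r_nat[of "mga I rk xs ys"] by simp
  then show ?thesis using 3 by (simp add: runit_tensor)
 next
  case 4
  note l4 = 4
  have o: "I x \<in> obj C" "I y \<in> obj C" "I z \<in> obj C" using prems by (auto simp: l4)
  have ih: "mga I rk (mgl rk as bs) cs \<cdot> (mga I rk as bs \<otimes> \<i> (nob I cs)) =
   mga I rk as (mgl rk bs cs) \<cdot> (\<i> (nob I as) \<otimes> mga I rk bs cs) \<cdot> \<a> (nob I as) (nob I bs) (nob I cs)"
   if "length as + length bs + length cs < length xs + length ys + length zs"
    "lok I as" "lok I bs" "lok I cs" for as bs cs
   using that by (intro less.hyps) auto
  \<comment> \<open>Which head wins, with ties resolved to the right as in
    \<open>mgl\<close>.\<close>
  consider "rk x \<le> rk z" "rk y \<le> rk z" | "rk z < rk y" "rk x \<le> rk y" | "rk z < rk x" "rk y < rk x"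
   by linarith
  then show ?thesis
  proof cases
   case 1
   have W: "mgl rk xs ys \<noteq> []" "rk (hd (mgl rk xs ys)) \<le> rk z" using 1 l4 by auto
   then have "mga I rk (mgl rk xs ys) (z # zs') = (mga I rk (mgl rk xs ys) zs' \<otimes> \<i> (I z)) \<cdot>
     inv_arr C (\<a> (nob I (mgl rk xs ys)) (nob I zs') (I z))"
    by (cases "mgl rk xs ys") auto
   moreover have "mgl rk ys zs = z # mgl rk ys zs'" "mgl rk xs (z # mgl rk ys zs') = z # mgl rk xs (mgl rk ys zs')"
    using 1 l4 by auto
   moreover have "mga I rk ys zs = (mga I rk ys zs' \<otimes> \<i> (I z)) \<cdot> inv_arr C (\<a> (nob I ys) (nob I zs') (I z))"
    using 1 l4 by auto
   moreover have "mga I rk xs (z # mgl rk ys zs') = (mga I rk xs (mgl rk ys zs') \<otimes> \<i> (I z)) \<cdot>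
     inv_arr C (\<a> (nob I xs) (nob I (mgl rk ys zs')) (I z))"
    using 1 l4 by auto
   moreover have s: "lok I zs'" using prems by (simp add: l4)
   have "(mga I rk (mgl rk xs ys) zs' \<otimes> \<i> (I z)) \<cdot>
     inv_arr C (\<a> (nob I (mgl rk xs ys)) (nob I zs') (I z)) \<cdot> (mga I rk xs ys \<otimes> \<i> (nob I zs' \<odot> I z)) =
    (mga I rk xs (mgl rk ys zs') \<otimes> \<i> (I z)) \<cdot> inv_arr C (\<a> (nob I xs) (nob I (mgl rk ys zs')) (I z)) \<cdot>
    (\<i> (nob I xs) \<otimes> ((mga I rk ys zs' \<otimes> \<i> (I z)) \<cdot> inv_arr C (\<a> (nob I ys) (nob I zs') (I z)))) \<cdot>
    \<a> (nob I xs) (nob I ys) (nob I zs' \<odot> I z)"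
    using s o by (intro merge_z[where U = "nob I (mgl rk (mgl rk xs ys) zs')"] ih) (auto simp: l4(3) mgl_assoc)
   ultimately show ?thesis using s o by (simp add: l4(3) del: ichg_k ichg)
  next
   case 2
   have "mga I rk (mgl rk xs ys) zs = (mga I rk (mgl rk xs ys') zs \<otimes> \<i> (I y)) \<cdot>
     rswap (nob I (mgl rk xs ys')) (I y) (nob I zs)"
    using 2 l4 by auto
   moreover have "mgl rk ys zs = y # mgl rk ys' zs"
    using 2 l4 by auto
   moreover have "mga I rk ys zs = (mga I rk ys' zs \<otimes> \<i> (I y)) \<cdot> rswap (nob I ys') (I y) (nob I zs)"
    using 2 l4 by auto
   moreover have "mga I rk xs (y # mgl rk ys' zs) = (mga I rk xs (mgl rk ys' zs) \<otimes> \<i> (I y)) \<cdot>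
     inv_arr C (\<a> (nob I xs) (nob I (mgl rk ys' zs)) (I y))"
    using 2 l4 by auto
   moreover have "mga I rk xs ys = (mga I rk xs ys' \<otimes> \<i> (I y)) \<cdot>
     inv_arr C (\<a> (nob I xs) (nob I ys') (I y))"
    using 2 l4 by auto
   moreover have s: "lok I ys'" using prems by (simp add: l4)
   have "(mga I rk (mgl rk xs ys') zs \<otimes> \<i> (I y)) \<cdot> rswap (nob I (mgl rk xs ys')) (I y) (nob I zs) \<cdot>
     (((mga I rk xs ys' \<otimes> \<i> (I y)) \<cdot> inv_arr C (\<a> (nob I xs) (nob I ys') (I y))) \<otimes> \<i> (nob I zs)) =
    (mga I rk xs (mgl rk ys' zs) \<otimes> \<i> (I y)) \<cdot> inv_arr C (\<a> (nob I xs) (nob I (mgl rk ys' zs)) (I y)) \<cdot>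
    (\<i> (nob I xs) \<otimes> ((mga I rk ys' zs \<otimes> \<i> (I y)) \<cdot> rswap (nob I ys') (I y) (nob I zs))) \<cdot>
    \<a> (nob I xs) (nob I ys' \<odot> I y) (nob I zs)"
    using s o by (intro merge_y[where U = "nob I (mgl rk (mgl rk xs ys') zs)"] ih) (auto simp: l4(2) mgl_assoc)
   ultimately show ?thesis using s o by (simp add: l4(2) del: ichg_k ichg)
  next
   case 3
   have "mga I rk (mgl rk xs ys) zs = (mga I rk (mgl rk xs' ys) zs \<otimes> \<i> (I x)) \<cdot>
     rswap (nob I (mgl rk xs' ys)) (I x) (nob I zs)"
    using 3 l4 by auto
   moreover have V: "mgl rk ys zs \<noteq> []" "rk (hd (mgl rk ys zs)) < rk x" using 3 l4 by auto
   then have "mga I rk xs (mgl rk ys zs) = (mga I rk xs' (mgl rk ys zs) \<otimes> \<i> (I x)) \<cdot>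
     rswap (nob I xs') (I x) (nob I (mgl rk ys zs))"
    using l4(1) by (cases "mgl rk ys zs") auto
   moreover have "mga I rk xs ys = (mga I rk xs' ys \<otimes> \<i> (I x)) \<cdot> rswap (nob I xs') (I x) (nob I ys)"
    using 3 l4 by auto
   moreover have s: "lok I xs'" using prems by (simp add: l4)
   have "(mga I rk (mgl rk xs' ys) zs \<otimes> \<i> (I x)) \<cdot> rswap (nob I (mgl rk xs' ys)) (I x) (nob I zs) \<cdot>
     (((mga I rk xs' ys \<otimes> \<i> (I x)) \<cdot> rswap (nob I xs') (I x) (nob I ys)) \<otimes> \<i> (nob I zs)) =
    (mga I rk xs' (mgl rk ys zs) \<otimes> \<i> (I x)) \<cdot> rswap (nob I xs') (I x) (nob I (mgl rk ys zs)) \<cdot>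
    (\<i> (nob I xs' \<odot> I x) \<otimes> mga I rk ys zs) \<cdot> \<a> (nob I xs' \<odot> I x) (nob I ys) (nob I zs)"
    using s o by (intro merge_x[where U = "nob I (mgl rk (mgl rk xs' ys) zs)"] ih) (auto simp: l4(1) mgl_assoc)
   ultimately show ?thesis using s o by (simp add: l4(1) del: ichg_k ichg)
  qed
 qed
qed

lemma mgl_comm:
 "(\<And>x y. x \<in> set xs ==> y \<in> set ys ==> rk x \<noteq> rk y) ==> mgl rk xs ys = mgl rk ys xs"
 by (induction rk xs ys rule: mgl.induct) (fastforce dest: linorder_neqE_nat)+

text \<open>Distinct ranks make the merged word independent of the order of the two lists
  (\<open>mgl_comm\<close>), so both composites end in the same object.\<close>

lemma mga_swap:
 assumes "lok I xs" "lok I ys"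
  and "\<And>x y. x \<in> set xs ==> y \<in> set ys ==> rk x \<noteq> rk y"
 shows "mga I rk ys xs \<cdot> \<s> (nob I xs) (nob I ys) = mga I rk xs ys"
 using assms
proof (induction "length xs + length ys" arbitrary: xs ys rule: less_induct)
 case less
 note prems [simp] = less.prems
 consider "xs = []" | "ys = []" | x xs' y ys' where "xs = x # xs'" "ys = y # ys'"
  by (metis list.exhaust)
 then show ?case
 proof cases
  case 1
  have "\<r> (nob I ys) \<cdot> \<s> \<one> (nob I ys) = \<l> (nob I ys)"
   using lunit_swap[of "nob I ys", symmetric] by simp
  then show ?thesis using 1 by simp
 next
  case 2
  then show ?thesis by (simp add: lunit_swap)
 next
  case 3
  note l3 = 3
  have o: "I x \<in> obj C" "I y \<in> obj C" using prems by (auto simp: l3)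
  have "rk x \<noteq> rk y" using less.prems(3)[of x y] l3 by simp
  then consider "rk x > rk y" | "rk y > rk x" by linarith
  then show ?thesis
  proof cases
   case 1
   have s: "lok I xs'" using prems l3 by simp
   have "mga I rk ys xs' \<cdot> \<s> (nob I xs') (nob I ys) = mga I rk xs' ys"
    using l3 less.prems by (intro less.hyps) auto
   then have "((mga I rk ys xs' \<otimes> \<i> (I x)) \<cdot> inv_arr C (\<a> (nob I ys) (nob I xs') (I x))) \<cdot>
     \<s> (nob I xs' \<odot> I x) (nob I ys) = (mga I rk xs' ys \<otimes> \<i> (I x)) \<cdot> rswap (nob I xs') (I x) (nob I ys)"
    using s o by (intro merge_swap) auto
   then show ?thesis using 1 l3 by simp
  next
   case 2
   have s: "lok I ys'" using prems l3 by simp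
   have "mga I rk ys' xs \<cdot> \<s> (nob I xs) (nob I ys') = mga I rk xs ys'"
    using l3 less.prems by (intro less.hyps) auto
   \<comment> \<open>The symmetry is involutive, so the induction hypothesis can be turned around;
     then \<open>merge_swap\<close> applies with the lists exchanged, and its result is turned
     around again.\<close>
   then have "mga I rk xs ys' \<cdot> \<s> (nob I ys') (nob I xs) = mga I rk ys' xs"
    using s o by (auto simp flip: \<open>_ = mga I rk xs ys'\<close>)
   then have "((mga I rk xs ys' \<otimes> \<i> (I y)) \<cdot> inv_arr C (\<a> (nob I xs) (nob I ys') (I y))) \<cdot>
     \<s> (nob I ys' \<odot> I y) (nob I xs) = (mga I rk ys' xs \<otimes> \<i> (I y)) \<cdot> rswap (nob I ys') (I y) (nob I xs)"
    using s o by (intro merge_swap) auto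
   then have "mga I rk xs ys \<cdot> \<s> (nob I ys) (nob I xs) = mga I rk ys xs"
    using 2 l3 by simp
   then have "(mga I rk xs ys \<cdot> \<s> (nob I ys) (nob I xs)) \<cdot> \<s> (nob I xs) (nob I ys) =
    mga I rk ys xs \<cdot> \<s> (nob I xs) (nob I ys)" by simp
   then show ?thesis by simp
  qed
 qed
qed


primrec nl :: "('l => nat) => 'l ex => 'l list" where
 "nl rk EUnit = []"
| "nl rk (Leaf l) = [l]"
| "nl rk (EJoin d e) = mgl rk (nl rk d) (nl rk e)"

text \<open>The arrow that normalises an expression. A leaf passes through an inverse unitor because
  its word carries the innermost unit.\<close>

primrec ka :: "('l => 'a) => ('l => nat) => 'l ex => ('a, 'b) arr" where
 "ka I rk EUnit = \<i> \<one>"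
| "ka I rk (Leaf l) = inv_arr C (\<l> (I l))"
| "ka I rk (EJoin d e) = mga I rk (nl rk d) (nl rk e) \<cdot> (ka I rk d \<otimes> ka I rk e)"

lemma set_nl [simp]: "set (nl rk e) = set_mset (leaves e)"
 by (induction e) auto

lemma lok_nl [simp]: "wfe I e ==> lok I (nl rk e)"
 by (simp add: lok_def wfe_def)

lemma ka_arr: "wfe I e ==> iso_arr C (ka I rk e) & src (ka I rk e) = ob I e & tgt (ka I rk e) = nob I (nl rk e)"
 by (induction e) (auto simp: iso_arr_arr)

lemma ka_arr_simps [simp]:
 assumes "wfe I e"
 shows "arr (ka I rk e)" "iso_arr C (ka I rk e)" "src (ka I rk e) = ob I e" "tgt (ka I rk e) = nob I (nl rk e)"
 using ka_arr[OF assms, of rk] iso_arr_arr by auto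

lemma iso_move:
 assumes "g \<cdot> x = h" "iso_arr C x" "arr g" "src g = tgt x"
 shows "h \<cdot> inv_arr C x = g"
 using assms iso_arr_arr[OF assms(2)] by auto

lemma ka_asc:
 assumes [simp]: "wfe I d" "wfe I e" "wfe I f"
 shows "ka I rk (EJoin d (EJoin e f)) \<cdot> \<a> (ob I d) (ob I e) (ob I f) = ka I rk (EJoin (EJoin d e) f)"
proof -
 let ?k = "ka I rk" and ?n = "nl rk" and ?m = "mga I rk"
 have "ka I rk (EJoin d (EJoin e f)) \<cdot> \<a> (ob I d) (ob I e) (ob I f) =
  ?m (?n d) (mgl rk (?n e) (?n f)) \<cdot> (\<i> (nob I (?n d)) \<otimes> ?m (?n e) (?n f)) \<cdot>
   (?k d \<otimes> (?k e \<otimes> ?k f)) \<cdot> \<a> (ob I d) (ob I e) (ob I f)"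
  by simp
 also have "... = ?m (?n d) (mgl rk (?n e) (?n f)) \<cdot> (\<i> (nob I (?n d)) \<otimes> ?m (?n e) (?n f)) \<cdot>
   \<a> (nob I (?n d)) (nob I (?n e)) (nob I (?n f)) \<cdot> (?k d \<otimes> ?k e \<otimes> ?k f)"
  using asc_nat[of "?k d" "?k e" "?k f", symmetric] by (simp del: ichg_k)
 also have "... = (?m (?n d) (mgl rk (?n e) (?n f)) \<cdot> (\<i> (nob I (?n d)) \<otimes> ?m (?n e) (?n f)) \<cdot>
   \<a> (nob I (?n d)) (nob I (?n e)) (nob I (?n f))) \<cdot> (?k d \<otimes> ?k e \<otimes> ?k f)"
  by (simp add: mgl_assoc)
 also have "... = (?m (mgl rk (?n d) (?n e)) (?n f) \<cdot> (?m (?n d) (?n e) \<otimes> \<i> (nob I (?n f)))) \<cdot> (?k d \<otimes> ?k e \<otimes> ?k f)"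
  by (subst mga_assoc) auto
 also have "... = ka I rk (EJoin (EJoin d e) f)"
  by simp
 finally show ?thesis .
qed

lemma ka_l: "wfe I e ==> ka I rk e \<cdot> \<l> (ob I e) = ka I rk (EJoin EUnit e)"
 using l_nat[of "ka I rk e"] by simp

lemma ka_r: "wfe I e ==> ka I rk e \<cdot> \<r> (ob I e) = ka I rk (EJoin e EUnit)"
 using r_nat[of "ka I rk e"] by simp

text \<open>Structural morphisms keep the normal form and commute with normalisation, generator by
  generator. The associator amounts to \<open>mga_assoc\<close>; the symmetry amounts to
  \<open>mga_swap\<close>, and there the leaves must have distinct ranks.\<close>

lemma str_ka:
 assumes "str I e f x" "uniq (leaves e)" "inj_on rk (set_mset (leaves e))"
 shows "nl rk e = nl rk f & ka I rk f \<cdot> x = ka I rk e"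
 using assms
proof (induction rule: str.induct)
 case (str_comp e f x g y)
 note w = str_wf[OF str_comp.hyps(1)] str_wf[OF str_comp.hyps(2)] str_arr[OF str_comp.hyps(1)] str_arr[OF str_comp.hyps(2)]
 have "ka I rk g \<cdot> y \<cdot> x = (ka I rk g \<cdot> y) \<cdot> x" using w by simp
 also have "... = ka I rk e" using str_comp w by simp
 finally show ?case using str_comp w by simp
next
 case (str_ten e f x e' f' y)
 note w = str_wf[OF str_ten.hyps(1)] str_wf[OF str_ten.hyps(2)] str_arr[OF str_ten.hyps(1)] str_arr[OF str_ten.hyps(2)]
 then show ?case using str_ten by (auto simp: inj_on_def)
next
 case (str_asc d e f)
 then show ?case using ka_asc[of I d e f rk] by (simp add: mgl_assoc)
next
 case (str_asc_inv d e f)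
 then show ?case using iso_move[OF ka_asc[of I d e f rk]] by (simp add: mgl_assoc)
next
 case (str_l e)
 then show ?case using ka_l[of I e rk] by simp
next
 case (str_l_inv e)
 then show ?case using iso_move[OF ka_l[of I e rk]] by simp
next
 case (str_r e)
 then show ?case using ka_r[of I e rk] by simp
next
 case (str_r_inv e)
 then show ?case using iso_move[OF ka_r[of I e rk]] by simp
next
 case (str_swap d e)
 have rk: "rk x \<noteq> rk y" if "x \<in># leaves d" "y \<in># leaves e" for x y
  using str_swap that by (auto simp: inj_on_def)
 have "ka I rk (EJoin e d) \<cdot> \<s> (ob I d) (ob I e) =
  mga I rk (nl rk e) (nl rk d) \<cdot> \<s> (nob I (nl rk d)) (nob I (nl rk e)) \<cdot> (ka I rk d \<otimes> ka I rk e)"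
  using s_nat[of "ka I rk d" "ka I rk e"] str_swap by simp
 also have "... = ka I rk (EJoin d e)"
  using str_swap rk comp_k[OF mga_swap[of I "nl rk d" "nl rk e" rk], of "ka I rk d \<otimes> ka I rk e"] by simp
 finally show ?case using rk mgl_comm[of "nl rk d" "nl rk e" rk] by simp
qed simp

text \<open>Mac Lane's coherence theorem for symmetric monoidal categories.\<close>

theorem str_unique:
 assumes "str I e f x" "str I e f y" "uniq (leaves e)"
 shows "x = y"
proof -
 \<comment> \<open>The finitely many leaves can be ranked injectively. Both arrows then agree after
   the isomorphism \<open>ka I rk f\<close>.\<close>
 obtain rk where rk: "inj_on (rk :: _ => nat) (set_mset (leaves e))"
  using finite_imp_inj_to_nat_seg[of "set_mset (leaves e)"] by auto
 have "ka I rk f \<cdot> x = ka I rk f \<cdot> y"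
  using str_ka[OF assms(1,3) rk] str_ka[OF assms(2,3) rk] by simp
 then show ?thesis
  using str_wf[OF assms(1)] str_arr[OF assms(1)] str_arr[OF assms(2)]
  by (intro iso_cancel_left[of "ka I rk f" x y]) auto
qed

section \<open>Existence of structural morphisms, and the canonical one\<close>

lemma str_empty: "wfe I e ==> leaves e = {#} ==> \<exists>x. str I e EUnit x"
proof (induction e)
 case (EJoin d e)
 then obtain x y where xy: "str I d EUnit x" "str I e EUnit y" by auto
 have "str I (EJoin d e) (EJoin EUnit EUnit) (x \<otimes> y)" using xy by (rule str_ten)
 moreover have "str I (EJoin EUnit EUnit) EUnit (\<l> (ob I EUnit))" by (rule str_l) simp
 ultimately show ?case by (blast intro: str_comp)
next
 case EUnit
 then show ?case using str_id[of I EUnit] by auto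
qed auto

text \<open>Any leaf can be moved to the far right. \<open>str_exists\<close> does this on both
  sides with the same leaf and removes it, by induction on the multiset of leaves.\<close>

lemma str_pull: "wfe I e ==> l \<in># leaves e ==> \<exists>d x. str I e (EJoin d (Leaf l)) x"
proof (induction e)
 case (Leaf k)
 then show ?case using str_l_inv[of I "Leaf k"] by auto
next
 case (EJoin e f)
 then consider "l \<in># leaves e" | "l \<in># leaves f" by auto
 then show ?case
 proof cases
  case 1
  then obtain d x where x: "str I e (EJoin d (Leaf l)) x" using EJoin by auto
  then have w: "wfe I d" "I l \<in> obj C" "wfe I f" using str_wf[OF x] EJoin.prems by auto
  have "str I (EJoin e f) (EJoin (EJoin d (Leaf l)) f) (x \<otimes> \<i> (ob I f))"
   using w x by (intro str_ten str_id) auto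
  moreover have "str I (EJoin (EJoin d (Leaf l)) f) (EJoin f (EJoin d (Leaf l))) (\<s> (ob I (EJoin d (Leaf l))) (ob I f))"
   using w by (intro str_swap) auto
  moreover have "str I (EJoin f (EJoin d (Leaf l))) (EJoin (EJoin f d) (Leaf l)) (inv_arr C (\<a> (ob I f) (ob I d) (ob I (Leaf l))))"
   using w by (intro str_asc_inv) auto
  ultimately show ?thesis by (blast intro: str_comp)
 next
  case 2
  then obtain d x where x: "str I f (EJoin d (Leaf l)) x" using EJoin by auto
  then have w: "wfe I d" "I l \<in> obj C" "wfe I e" using str_wf[OF x] EJoin.prems by auto
  have "str I (EJoin e f) (EJoin e (EJoin d (Leaf l))) (\<i> (ob I e) \<otimes> x)"
   using w x by (intro str_ten str_id) auto
  moreover have "str I (EJoin e (EJoin d (Leaf l))) (EJoin (EJoin e d) (Leaf l)) (inv_arr C (\<a> (ob I e) (ob I d) (ob I (Leaf l))))"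
   using w by (intro str_asc_inv) auto
  ultimately show ?thesis by (blast intro: str_comp)
 qed
qed auto

lemma str_exists: "wfe I e ==> leaves e = leaves f ==> \<exists>x. str I e f x"
proof (induction "leaves e" arbitrary: e f)
 case empty
 then have "wfe I f" by (simp add: wfe_def)
 with empty obtain x y where "str I e EUnit x" "str I f EUnit y" using str_empty by metis
 then show ?case by (blast intro: str_comp str_inv)
next
 case (add l M)
 have wf: "wfe I f" "wfe I e" using add.prems by (auto simp: wfe_def)
 have l: "l \<in># leaves e" "l \<in># leaves f" using add(2) add.prems by (metis union_single_eq_member)+
 obtain d x where x: "str I e (EJoin d (Leaf l)) x" using str_pull[OF wf(2) l(1)] by auto
 obtain d' y where y: "str I f (EJoin d' (Leaf l)) y" using str_pull[OF wf(1) l(2)] by auto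
 have e: "leaves e = add_mset l M" "leaves f = add_mset l M" using add(2) add.prems(2) by simp_all
 have "leaves (EJoin d (Leaf l)) = leaves e" "leaves (EJoin d' (Leaf l)) = leaves f"
  using str_wf[OF x] str_wf[OF y] by blast+
 then have d: "leaves d = M" "leaves d' = M" unfolding e by simp_all
 have wd: "wfe I d" using str_wf[OF x] by simp
 then obtain z where "str I d d' z" using add(1)[OF d(1)[symmetric] wd, of d'] d by metis
 then have "str I (EJoin d (Leaf l)) (EJoin d' (Leaf l)) (z \<otimes> \<i> (ob I (Leaf l)))"
  using str_wf[OF x] by (intro str_ten str_id) auto
 then show ?case using x y by (blast intro: str_comp str_inv)
qed

text \<open>The rearrangement of one expression into another. The choice is forced by
  \<open>str_unique\<close> when the leaves are distinct, which explains the hypotheses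
  \<open>uniq\<close> that accompany it.\<close>

definition can :: "('l => 'a) => 'l ex => 'l ex => ('a, 'b) arr" where
 "can I e f = (SOME x. str I e f x)"

lemma str_can: "wfe I e ==> leaves e = leaves f ==> str I e f (can I e f)"
 unfolding can_def by (rule someI_ex) (rule str_exists)

lemma can_eq: "str I e f x ==> uniq (leaves e) ==> can I e f = x"
 using str_can[of I e f] str_unique[of I e f] str_wf[of I e f x] by simp

lemma can_arr [simp]:
 assumes "wfe I e" "leaves e = leaves f"
 shows "arr (can I e f)" "src (can I e f) = ob I e" "tgt (can I e f) = ob I f"
 using str_arr[OF str_can[OF assms]] by auto

lemma can_refl [simp]: "wfe I e ==> uniq (leaves e) ==> can I e e = \<i> (ob I e)"
 by (rule can_eq) (auto intro: str_id)

lemma can_can: "wfe I e ==> leaves e = leaves f ==> leaves f = leaves g ==> uniq (leaves e) ==>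
  can I f g \<cdot> can I e f = can I e g"
 by (rule can_eq[symmetric], rule str_comp[OF str_can str_can]) (auto simp: wfe_def)

lemma can_ten: "wfe I e ==> leaves e = leaves f ==> wfe I e' ==> leaves e' = leaves f' ==> uniq (leaves e + leaves e') ==>
  can I e f \<otimes> can I e' f' = can I (EJoin e e') (EJoin f f')"
 by (rule can_eq[symmetric], rule str_ten[OF str_can str_can]) auto

section \<open>Naturality of structural morphisms in the leaves\<close>

primrec earr :: "('l => ('a, 'b) arr) => 'l ex => ('a, 'b) arr" where
 "earr g EUnit = \<i> \<one>"
| "earr g (Leaf l) = g l"
| "earr g (EJoin d e) = earr g d \<otimes> earr g e"

lemma earr_arr:
 assumes "\<And>l. l \<in># leaves e ==> arr (g l) & src (g l) = ob I' (h l) & tgt (g l) = I l"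
 shows "arr (earr g e) & src (earr g e) = ob I' (esub h e) & tgt (earr g e) = ob I e"
 using assms by (induction e) auto

lemma wfe_esub: "(\<And>l. l \<in># leaves e ==> wfe I (h l)) ==> wfe I (esub h e)"
 by (induction e) auto

text \<open>Naturality, also when a leaf \<open>l\<close> is refined into a whole expression
  \<open>h l\<close> over other leaves. In this form it describes what substitution does to a
  rearrangement.\<close>

lemma str_esub:
 assumes "str I e f x"
  and "\<And>l. l \<in># leaves e ==> arr (g l) & src (g l) = ob I' (h l) & tgt (g l) = I l & wfe I' (h l)"
 shows "\<exists>y. str I' (esub h e) (esub h f) y & x \<cdot> earr g e = earr g f \<cdot> y"
 using assms
proof (induction rule: str.induct)
 case (str_id e)
 note a = earr_arr[of e g I' h I]
 from str_id show ?case
  by (intro exI[of _ "\<i> (ob I' (esub h e))"]) (use a in \<open>auto intro!: str.str_id wfe_esub\<close>)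
next
 case (str_comp e f x g' y)
 note w = str_wf[OF str_comp.hyps(1)] str_arr[OF str_comp.hyps(1)] str_arr[OF str_comp.hyps(2)]
 from str_comp obtain x' where x': "str I' (esub h e) (esub h f) x'" "x \<cdot> earr g e = earr g f \<cdot> x'" by blast
 from str_comp w obtain y' where y': "str I' (esub h f) (esub h g') y'" "y \<cdot> earr g f = earr g g' \<cdot> y'" by metis
 have a: "arr (earr g k) & src (earr g k) = ob I' (esub h k) & tgt (earr g k) = ob I k" if "leaves k = leaves e" for k
  using str_comp.prems that by (intro earr_arr) auto
 have "leaves g' = leaves e" using w str_wf[OF str_comp.hyps(2)] by simp
 note a' = a[OF HOL.refl] a[OF this] a[of f]
 have "(y \<cdot> x) \<cdot> earr g e = y \<cdot> earr g f \<cdot> x'" using w a' x' str_arr[OF x'(1)] by simp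
 also have "... = (y \<cdot> earr g f) \<cdot> x'" using w a' str_arr[OF x'(1)] by simp
 also have "... = earr g g' \<cdot> y' \<cdot> x'" using w a' y' str_arr[OF x'(1)] str_arr[OF y'(1)] by simp
 finally show ?case using str.str_comp[OF x'(1) y'(1)] by blast
next
 case (str_ten e f x e' f' y)
 note w = str_wf[OF str_ten.hyps(1)] str_wf[OF str_ten.hyps(2)] str_arr[OF str_ten.hyps(1)] str_arr[OF str_ten.hyps(2)]
 from str_ten obtain x' where x': "str I' (esub h e) (esub h f) x'" "x \<cdot> earr g e = earr g f \<cdot> x'" by auto
 from str_ten obtain y' where y': "str I' (esub h e') (esub h f') y'" "y \<cdot> earr g e' = earr g f' \<cdot> y'" by auto
 have a: "arr (earr g k) & src (earr g k) = ob I' (esub h k) & tgt (earr g k) = ob I k" if "leaves k \<subseteq># leaves e + leaves e'" for k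
  using str_ten.prems mset_subset_eqD[OF that] by (intro earr_arr) (simp add: str_ten.prems)
 have "(x \<otimes> y) \<cdot> earr g (EJoin e e') = earr g (EJoin f f') \<cdot> (x' \<otimes> y')"
  using w x' y' a[of e] a[of e'] a[of f] a[of f'] str_arr[OF x'(1)] str_arr[OF y'(1)] by simp
 then show ?case using str.str_ten[OF x'(1) y'(1)] by auto
next
 case (str_asc d e f)
 have a: "arr (earr g k) & src (earr g k) = ob I' (esub h k) & tgt (earr g k) = ob I k & wfe I' (esub h k)" if "k \<in> {d, e, f}" for k
  using str_asc.prems that by (auto intro!: earr_arr[THEN conjunct1] earr_arr[THEN conjunct2, THEN conjunct1] earr_arr[THEN conjunct2, THEN conjunct2] wfe_esub)
 have "str I' (esub h (EJoin (EJoin d e) f)) (esub h (EJoin d (EJoin e f))) (\<a> (ob I' (esub h d)) (ob I' (esub h e)) (ob I' (esub h f)))"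
  using a by (simp add: str.str_asc)
 then show ?case using asc_nat[of "earr g d" "earr g e" "earr g f"] a by (intro exI) auto
next
 case (str_asc_inv d e f)
 have a: "arr (earr g k) & src (earr g k) = ob I' (esub h k) & tgt (earr g k) = ob I k & wfe I' (esub h k)" if "k \<in> {d, e, f}" for k
  using str_asc_inv.prems that by (auto intro!: earr_arr[THEN conjunct1] earr_arr[THEN conjunct2, THEN conjunct1] earr_arr[THEN conjunct2, THEN conjunct2] wfe_esub)
 have "str I' (esub h (EJoin d (EJoin e f))) (esub h (EJoin (EJoin d e) f)) (inv_arr C (\<a> (ob I' (esub h d)) (ob I' (esub h e)) (ob I' (esub h f))))"
  using a by (simp add: str.str_asc_inv)
 then show ?case using asc_inv_nat[of "earr g d" "earr g e" "earr g f"] a by (intro exI) auto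
next
 case (str_l e)
 have a: "arr (earr g e) & src (earr g e) = ob I' (esub h e) & tgt (earr g e) = ob I e" "wfe I' (esub h e)"
  using str_l.prems by (auto intro!: earr_arr[THEN conjunct1] earr_arr[THEN conjunct2, THEN conjunct1] earr_arr[THEN conjunct2, THEN conjunct2] wfe_esub)
 then show ?case using str.str_l[OF a(2)] l_nat[of "earr g e"] by auto
next
 case (str_l_inv e)
 have a: "arr (earr g e) & src (earr g e) = ob I' (esub h e) & tgt (earr g e) = ob I e" "wfe I' (esub h e)"
  using str_l_inv.prems by (auto intro!: earr_arr[THEN conjunct1] earr_arr[THEN conjunct2, THEN conjunct1] earr_arr[THEN conjunct2, THEN conjunct2] wfe_esub)
 then show ?case using str.str_l_inv[OF a(2)] l_inv_nat[of "earr g e"] by (auto intro!: exI)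
next
 case (str_r e)
 have a: "arr (earr g e) & src (earr g e) = ob I' (esub h e) & tgt (earr g e) = ob I e" "wfe I' (esub h e)"
  using str_r.prems by (auto intro!: earr_arr[THEN conjunct1] earr_arr[THEN conjunct2, THEN conjunct1] earr_arr[THEN conjunct2, THEN conjunct2] wfe_esub)
 then show ?case using str.str_r[OF a(2)] r_nat[of "earr g e"] by auto
next
 case (str_r_inv e)
 have a: "arr (earr g e) & src (earr g e) = ob I' (esub h e) & tgt (earr g e) = ob I e" "wfe I' (esub h e)"
  using str_r_inv.prems by (auto intro!: earr_arr[THEN conjunct1] earr_arr[THEN conjunct2, THEN conjunct1] earr_arr[THEN conjunct2, THEN conjunct2] wfe_esub)
 then show ?case using str.str_r_inv[OF a(2)] r_inv_nat[of "earr g e"] by (auto intro!: exI)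
next
 case (str_swap d e)
 have a: "arr (earr g k) & src (earr g k) = ob I' (esub h k) & tgt (earr g k) = ob I k & wfe I' (esub h k)" if "k \<in> {d, e}" for k
  using str_swap.prems that by (auto intro!: earr_arr[THEN conjunct1] earr_arr[THEN conjunct2, THEN conjunct1] earr_arr[THEN conjunct2, THEN conjunct2] wfe_esub)
 have "str I' (esub h (EJoin d e)) (esub h (EJoin e d)) (\<s> (ob I' (esub h d)) (ob I' (esub h e)))"
  using a by (simp add: str.str_swap)
 then show ?case using s_nat[of "earr g d" "earr g e"] a by (intro exI) auto
qed


lemma can_esub:
 assumes "wfe I e" "leaves e = leaves f" "uniq (leaves e)" "uniq (leaves (esub h e))"
  and "\<And>l. l \<in># leaves e ==> arr (g l) & src (g l) = ob I' (h l) & tgt (g l) = I l & wfe I' (h l)"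
 shows "can I e f \<cdot> earr g e = earr g f \<cdot> can I' (esub h e) (esub h f)"
 using str_esub[OF str_can[OF assms(1,2)] assms(5)] can_eq assms(4) by auto

lemma earr_ident: "wfe I e ==> (\<And>l. l \<in># leaves e ==> g l = \<i> (I l)) ==> earr g e = \<i> (ob I e)"
 by (induction e) auto

lemma ob_esub: "ob I (esub h e) = ob (%l. ob I (h l)) e"
 by (induction e) auto

lemma ob_cong: "(\<And>l. l \<in># leaves e ==> I l = I' l) ==> ob I e = ob I' e"
 by (induction e) auto

lemma earr_cong: "(\<And>l. l \<in># leaves e ==> g l = g' l) ==> earr g e = earr g' e"
 by (induction e) auto

lemma earr_esub_Leaf: "earr g (esub (%l. Leaf (\<rho> l)) e) = earr (%l. g (\<rho> l)) e"
 by (induction e) auto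

text \<open>Naturality at identities: a structural arrow depends on the objects at the leaves and
  not on their names.\<close>

lemma str_rename:
 assumes x: "str I e f x" and \<rho>: "\<And>l. l \<in># leaves e ==> I' (\<rho> l) = I l"
 shows "str I' (esub (%l. Leaf (\<rho> l)) e) (esub (%l. Leaf (\<rho> l)) f) x"
proof -
 note w = str_wf[OF x] and a = str_arr[OF x]
 have "\<exists>y. str I' (esub (%l. Leaf (\<rho> l)) e) (esub (%l. Leaf (\<rho> l)) f) y &
   x \<cdot> earr (%l. \<i> (I l)) e = earr (%l. \<i> (I l)) f \<cdot> y"
  using w by (intro str_esub[OF x]) (auto simp: \<rho> wfe_def)
 then obtain y where y: "str I' (esub (%l. Leaf (\<rho> l)) e) (esub (%l. Leaf (\<rho> l)) f) y"
   "x \<cdot> earr (%l. \<i> (I l)) e = earr (%l. \<i> (I l)) f \<cdot> y" by blast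
 have "earr (%l. \<i> (I l)) e = \<i> (ob I e)" "earr (%l. \<i> (I l)) f = \<i> (ob I f)"
  using w by (auto intro!: earr_ident)
 moreover have "ob I' (esub (%l. Leaf (\<rho> l)) f) = ob I f"
  using w by (simp add: ob_esub) (intro ob_cong, auto simp: \<rho>)
 ultimately have "x = y" using y a str_arr[OF y(1)] by simp
 with y show ?thesis by simp
qed

lemma can_rename:
 assumes "wfe I e" "leaves e = leaves f" "uniq (leaves e)" "inj_on \<rho> (set_mset (leaves e))"
  and "\<And>l. l \<in># leaves e ==> I' (\<rho> l) = I l"
 shows "can I' (esub (%l. Leaf (\<rho> l)) e) (esub (%l. Leaf (\<rho> l)) f) = can I e f"
 using str_rename[OF str_can[OF assms(1,2)], of I' \<rho>] assms(3-)
 by (intro can_eq) (auto simp: leaves_esub_Leaf intro: uniq_image)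

end

subsection \<open>Interpretation of terms\<close>

lemma leaves_down_lin2: "count (leaves e) (Bd 0) = 1 ==> count (leaves e) (Bd 1) = 1 ==>
  leaves e = add_mset (Bd 0) (add_mset (Bd 1) (image_mset up (image_mset up (leaves (esub down (esub down e))))))"
 using leaves_down_lin[of e] leaves_down_lin[of "esub down e"] count_leaves_down[of e "Bd 0"] by simp

abbreviation lift :: "name ex => name ex" where
 "lift e \<equiv> esub (%l. Leaf (up l)) e"

fun ty1 :: "'g ty => 'g ty" where
 "ty1 (Tensor A B) = A" | "ty1 (Lolli A B) = A" | "ty1 A = A"

fun ty2 :: "'g ty => 'g ty" where
 "ty2 (Tensor A B) = B" | "ty2 (Lolli A B) = B" | "ty2 A = A"

definition tyof :: "('g, 'f, 'v) vlam_theory => (name => 'g ty) => ('g, 'f) tm => 'g ty" where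
 "tyof T E v = (THE A. hty T E v A)"

lemma tyof_eq: "hty T E v A ==> tyof T E v = A"
 unfolding tyof_def using hty_unique by blast

text \<open>The invariant for recursion on terms: as in \<open>wty\<close>, but dangling indices are
  allowed, so it passes to the bodies of binders. Distinct names keep every \<open>can\<close>
  determined.\<close>

definition okt :: "('g, 'f, 'v) vlam_theory => (name => 'g ty) => ('g, 'f) tm => 'g ty => bool" where
 "okt T E v A \<longleftrightarrow> hty T E v A & lin v & uniq (uses v)"

lemma okt_LetStar: "okt T E (LetStar v w) A ==> okt T E v TUnit & okt T E w A"
 by (auto simp: okt_def)

lemma okt_Ten: "okt T E (Ten v w) C ==> \<exists>A B. C = Tensor A B & okt T E v A & okt T E w B"
 by (auto simp: okt_def)

lemma okt_App: "okt T E (App v w) B ==> \<exists>A. okt T E v (Lolli A B) & okt T E w A"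
 by (auto simp: okt_def)

lemma okt_LamB: "okt T E (LamB A v) C ==> \<exists>B. C = Lolli A B & okt T (push A E) v B"
 using uniq_down[of "shape v"] by (auto simp: okt_def)

lemma okt_PmB: "okt T E (PmB v w) C ==> \<exists>A B. okt T E v (Tensor A B) & okt T (push B (push A E)) w C"
 using uniq_down[of "shape w"] uniq_down[of "esub down (shape w)"] count_leaves_down[of "shape w" "Bd 0"]
 by (auto simp: okt_def)

lemma okt_Op: "okt T E (Op f vs) C ==> f \<in> ops T & C = op_res T f & length vs = length (op_args T f) &
  (\<forall>i<length vs. okt T E (vs ! i) (op_args T f ! i))"
 unfolding okt_def hty_Op by (auto intro: uniq_sum_list)

lemma okt_wty: "wty T G v A ==> okt T (env G) v A"
 by (auto simp: wty_def okt_def is_ctx_names)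

text \<open>In \<open>hty\<close> the annotation of an abstraction is not checked by itself.
  Linearity helps: the bound variable occurs in the body, and its type is checked there.\<close>

lemma hty_res_ground:
 assumes ops: "\<And>f. f \<in> ops T ==> set_ty (op_res T f) \<subseteq> ground T"
 shows "hty T E v A ==> lin v ==> set_ty A \<subseteq> ground T"
proof (induction v arbitrary: E A)
 case (Op f vs)
 then show ?case by (simp add: ops)
next
 case (LamB B v)
 then obtain C where C: "A = Lolli B C" "hty T (push B E) v C" by auto
 moreover have "set_ty C \<subseteq> ground T" using LamB.IH[OF C(2)] LamB.prems by simp
 moreover have "Bd 0 \<in># uses v" using LamB.prems(2) by (intro count_inI) auto
 from hty_ground[OF C(2) this] have "set_ty B \<subseteq> ground T" by simp
 ultimately show ?case using C by simp
qed (fastforce+)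

text \<open>Satisfaction of the axioms of the theory is left out on purpose: the syntactic category
  enters this locale before it is known to satisfy them.\<close>

locale lam_interp = enriched_autonomous_cat M
 for M :: "('o, 'u, 'v::continuous_integral_quantale, 'g, 'f) interp" (structure) +
 fixes T :: "('g, 'f, 'v) vlam_theory"
 assumes ground_in: "X \<in> ground T ==> ground_obj M X \<in> obj M"
  and op_mor_hom: "f \<in> ops T ==>
   op_mor M f \<in> hom M (ntobj M (map (ty_obj M) (op_args T f))) (ty_obj M (op_res T f))"
  and op_args_nonempty: "f \<in> ops T ==> op_args T f \<noteq> []"
  and op_args_ground: "f \<in> ops T ==> A \<in> set (op_args T f) ==> set_ty A \<subseteq> ground T"
  and op_res_ground: "f \<in> ops T ==> set_ty (op_res T f) \<subseteq> ground T"
begin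

lemma iobj_in [simp]: "X \<in> obj M ==> Z \<in> obj M ==> iobj M X Z \<in> obj M"
 by (rule iobj_obj)

lemma ty_obj_in [simp]: "set_ty A \<subseteq> ground T ==> ty_obj M A \<in> obj M"
 by (induction A) (auto simp: ground_in)

definition om :: "(name => 'g ty) => name => 'o" where
 "om E l = ty_obj M (E l)"

lemma om_push_up [simp]: "om (push A E) (up l) = om E l"
 by (simp add: om_def)

lemma om_push_Bd [simp]: "om (push A E) (Bd 0) = ty_obj M A" "om (push A E) (Bd (Suc i)) = om E (Bd i)"
 "om (push A E) (Free x) = om E (Free x)"
 by (simp_all add: om_def)

lemma ob_lift [simp]: "ob (om (push A E)) (lift e) = ob (om E) e"
 by (simp add: ob_esub)

lemma wfe_lift [simp]: "wfe (om (push A E)) (lift e) \<longleftrightarrow> wfe (om E) e"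
 by (auto simp: wfe_def leaves_esub_Leaf)

lemma ntobj_njoin: "ob I (njoin es) = ntobj M (map (ob I) es)"
proof -
 have "ob I (foldl EJoin e es) = foldl (tobj M) (ob I e) (map (ob I) es)" for e es
  by (induction es arbitrary: e) auto
 then show ?thesis by (cases es) auto
qed

lemma earr_njoin: "earr g (njoin es) = ntmor M (map (earr g) es)"
proof -
 have "earr g (foldl EJoin e es) = foldl (tmor M) (earr g e) (map (earr g) es)" for e es
  by (induction es arbitrary: e) auto
 then show ?thesis by (cases es) auto
qed

lemma ntmor_arr:
 assumes "\<And>m. m \<in> set ms ==> arr m"
 shows "arr (ntmor M ms) & src (ntmor M ms) = ntobj M (map src ms) & tgt (ntmor M ms) = ntobj M (map tgt ms)"
proof -
 have "arr m ==> (\<And>m. m \<in> set ms ==> arr m) ==> arr (foldl (tmor M) m ms) &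
  src (foldl (tmor M) m ms) = foldl (tobj M) (src m) (map src ms) &
  tgt (foldl (tmor M) m ms) = foldl (tobj M) (tgt m) (map tgt ms)" for m ms
  by (induction ms arbitrary: m) auto
 then show ?thesis using assms by (cases ms) auto
qed

lemma ntmor_comp:
 assumes "length ms = length ns" "\<And>m. m \<in> set ms ==> arr m" "\<And>m. m \<in> set ns ==> arr m"
  "map src ms = map tgt ns"
 shows "ntmor M (map2 (%m n. m \<cdot> n) ms ns) = ntmor M ms \<cdot> ntmor M ns"
proof -
 have "foldl (tmor M) (m \<cdot> n) (map2 (%m n. m \<cdot> n) ms ns) = foldl (tmor M) m ms \<cdot> foldl (tmor M) n ns"
  if "length ms = length ns" "arr m" "arr n" "src m = tgt n" "\<And>m. m \<in> set ms ==> arr m"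
   "\<And>m. m \<in> set ns ==> arr m" "map src ms = map tgt ns" for m n ms ns
  using that
 proof (induction ms ns arbitrary: m n rule: list_induct2)
  case (Cons m' ms n' ns)
  have "foldl (tmor M) ((m \<otimes> m') \<cdot> (n \<otimes> n')) (map2 (%m n. m \<cdot> n) ms ns) =
   foldl (tmor M) (m \<otimes> m') ms \<cdot> foldl (tmor M) (n \<otimes> n') ns"
   using Cons.prems by (intro Cons.IH) auto
  then show ?case using Cons.prems by simp
 qed simp
 then show ?thesis using assms by (cases ms; cases ns) auto
qed

text \<open>Neither contexts nor shuffles occur: the source is the object of the shape. Only at a
  binder is a structural morphism needed, to gather the bound leaves in one place.
  \<open>Bd 1\<close> precedes \<open>Bd 0\<close> because index 0 is the second component.\<close>

primrec ar :: "(name => 'g ty) => ('g, 'f) tm => ('o, 'u) arr" where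
 "ar E (Var x) = \<i> (om E (Free x))"
| "ar E (Bound i) = \<i> (om E (Bd i))"
| "ar E (Op f vs) = op_mor M f \<cdot> ntmor M (map (ar E) vs)"
| "ar E Star = \<i> \<one>"
| "ar E (LetStar v w) = \<l> (tgt (ar E w)) \<cdot> (ar E v \<otimes> ar E w)"
| "ar E (Ten v w) = ar E v \<otimes> ar E w"
| "ar E (PmB v w) = (let A = ty1 (tyof T E v); B = ty2 (tyof T E v); E' = push B (push A E);
   D = esub down (esub down (shape w)) in
   ar E' w \<cdot> can (om E') (EJoin (EJoin (Leaf (Bd 1)) (Leaf (Bd 0))) (lift (lift D))) (shape w) \<cdot>
   (ar E v \<otimes> \<i> (ob (om E) D)))"
| "ar E (LamB A v) = (let E' = push A E; D = esub down (shape v) in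
   curry_at M (ty_obj M A) (ob (om E) D) (tgt (ar E' v))
    (ar E' v \<cdot> can (om E') (EJoin (lift D) (Leaf (Bd 0))) (shape v)))"
| "ar E (App v w) = eval_at M (tgt (ar E w)) (ty_obj M (ty2 (tyof T E v))) \<cdot> (ar E v \<otimes> ar E w)"

lemma curry_arr:
 assumes "X \<in> obj M" "arr f" "src f = Y \<odot> X" "Y \<in> obj M"
 shows "arr (curry_at M X Y (tgt f) f) & src (curry_at M X Y (tgt f) f) = Y & tgt (curry_at M X Y (tgt f) f) = iobj M X (tgt f)"
 using bij_betwE[OF curry_bij[of X Y "tgt f"]] assms by (auto simp: hom_iff)

lemma eval_arr [simp]:
 assumes [simp]: "X \<in> obj M" "Z \<in> obj M"
 shows "arr (eval_at M X Z)" "src (eval_at M X Z) = iobj M X Z \<odot> X" "tgt (eval_at M X Z) = Z"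
  "curry_at M X (iobj M X Z) Z (eval_at M X Z) = \<i> (iobj M X Z)"
proof -
 let ?c = "curry_at M X (iobj M X Z) Z"
 have "bij_betw ?c (hom M (iobj M X Z \<odot> X) Z) (hom M (iobj M X Z) (iobj M X Z))"
  by (rule curry_bij) auto
 moreover have "\<i> (iobj M X Z) \<in> hom M (iobj M X Z) (iobj M X Z)" by (rule id_hom) simp
 ultimately have "eval_at M X Z \<in> hom M (iobj M X Z \<odot> X) Z" "?c (eval_at M X Z) = \<i> (iobj M X Z)"
  unfolding eval_at_def bij_betw_def by (auto intro: inv_into_into f_inv_into_f)
 then show "arr (eval_at M X Z)" "src (eval_at M X Z) = iobj M X Z \<odot> X" "tgt (eval_at M X Z) = Z"
  "curry_at M X (iobj M X Z) Z (eval_at M X Z) = \<i> (iobj M X Z)"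
  by (auto simp: hom_iff)
qed

lemma curry_comp:
 assumes "X \<in> obj M" "arr f" "src f = Y \<odot> X" "arr h" "tgt h = Y"
 shows "curry_at M X (src h) (tgt f) (f \<cdot> (h \<otimes> \<i> X)) = curry_at M X Y (tgt f) f \<cdot> h"
proof -
 have Y: "Y \<in> obj M" using assms tgt_obj by blast
 have "curry_at M X (src h) (tgt f) (\<i> (tgt f) \<cdot> f \<cdot> (h \<otimes> \<i> X)) = imor M X (\<i> (tgt f)) \<cdot> curry_at M X Y (tgt f) f \<cdot> h"
  using assms Y by (intro curry_nat) (auto simp: hom_iff)
 then show ?thesis using assms Y curry_arr[of X f Y] by (simp add: imor_id)
qed

text \<open>The \<beta>-law of the adjunction: both sides have the same currying, and currying is
  injective.\<close>

lemma eval_curry: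
 assumes [simp]: "X \<in> obj M" "arr f" "src f = Y \<odot> X" "Y \<in> obj M"
 shows "eval_at M X (tgt f) \<cdot> (curry_at M X Y (tgt f) f \<otimes> \<i> X) = f"
proof -
 let ?g = "eval_at M X (tgt f) \<cdot> (curry_at M X Y (tgt f) f \<otimes> \<i> X)"
 note c [simp] = curry_arr[of X f Y, simplified]
 have "curry_at M X Y (tgt f) ?g = curry_at M X Y (tgt f) f"
  using curry_comp[of X "eval_at M X (tgt f)" "iobj M X (tgt f)" "curry_at M X Y (tgt f) f"] by simp
 moreover have "?g \<in> hom M (Y \<odot> X) (tgt f)" "f \<in> hom M (Y \<odot> X) (tgt f)" by (auto simp: hom_iff)
 ultimately show ?thesis
  using curry_bij[of X Y "tgt f"] by (auto simp: bij_betw_def dest: inj_onD)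
qed

lemma curry_eval:
 assumes [simp]: "X \<in> obj M" "arr h" "tgt h = iobj M X Z" "Z \<in> obj M"
 shows "curry_at M X (src h) Z (eval_at M X Z \<cdot> (h \<otimes> \<i> X)) = h"
 using curry_comp[of X "eval_at M X Z" "iobj M X Z" h] by simp

lemma hty_in_obj: "hty T E v A ==> wfe (om E) (shape v)"
 unfolding wfe_def om_def using hty_ground ty_obj_in by metis

lemma hty_res_ground': "hty T E v A ==> lin v ==> set_ty A \<subseteq> ground T"
 using hty_res_ground op_res_ground by blast

lemma okt_obj: "okt T E v A ==> ty_obj M A \<in> obj M"
 using hty_res_ground'[of E v A] by (simp add: okt_def)

lemma leaves_lam: "count (leaves e) (Bd 0) = 1 ==>
  leaves (EJoin (lift (esub down e)) (Leaf (Bd 0))) = leaves e"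
 using leaves_down_lin[of e] by (simp add: leaves_esub_Leaf)

lemma leaves_pm: "count (leaves e) (Bd 0) = 1 ==> count (leaves e) (Bd 1) = 1 ==>
  leaves (EJoin (EJoin (Leaf (Bd 1)) (Leaf (Bd 0))) (lift (lift (esub down (esub down e))))) = leaves e"
 using leaves_down_lin2[of e] by (simp add: leaves_esub_Leaf)

lemma wfe_leaves: "wfe I e ==> leaves e = leaves f ==> wfe I f"
 by (simp add: wfe_def)

lemma ar_arr:
 assumes "okt T E v A"
 shows "arr (ar E v) & src (ar E v) = ob (om E) (shape v) & tgt (ar E v) = ty_obj M A"
 using assms
proof (induction v arbitrary: E A)
 case (Var x)
 then show ?case by (auto simp: okt_def om_def)
next
 case (Bound i)
 then show ?case by (auto simp: okt_def om_def)
next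
 case (Op f vs)
 note o = okt_Op[OF Op.prems]
 have a: "arr (ar E (vs ! i)) & src (ar E (vs ! i)) = ob (om E) (shape (vs ! i)) & tgt (ar E (vs ! i)) = ty_obj M (op_args T f ! i)"
  if "i < length vs" for i
  using o that by (intro Op.IH) auto
 have "map src (map (ar E) vs) = map (ob (om E)) (map shape vs)" "map tgt (map (ar E) vs) = map (ty_obj M) (op_args T f)"
  by (rule nth_equalityI; use a o in simp)+
 moreover have "arr m" if "m \<in> set (map (ar E) vs)" for m
  using a that by (auto simp: in_set_conv_nth)
 ultimately show ?case
  using ntmor_arr[of "map (ar E) vs"] o op_mor_hom[of f]
  by (simp add: hom_iff ntobj_njoin del: map_map)
next
 case Star
 then show ?case by (auto simp: okt_def)
next
 case (LetStar v w)
 note o = okt_LetStar[OF LetStar.prems]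
 then show ?case using LetStar.IH(1)[of E TUnit] LetStar.IH(2)[of E A] okt_obj[of E w A] by auto
next
 case (Ten v w)
 then show ?case using Ten.IH[of E] okt_Ten[OF Ten.prems] by auto
next
 case (PmB v w)
 from okt_PmB[OF PmB.prems] obtain B C where
  B: "okt T E v (Tensor B C)" "okt T (push C (push B E)) w A" by blast
 have c: "count (uses w) (Bd 0) = 1" "count (uses w) (Bd 1) = 1" using PmB.prems by (auto simp: okt_def)
 have w: "wfe (om (push C (push B E))) (shape w)" using B by (auto simp: okt_def intro: hty_in_obj)
 have w': "wfe (om (push C (push B E))) (EJoin (EJoin (Leaf (Bd 1)) (Leaf (Bd 0))) (lift (lift (esub down (esub down (shape w))))))"
  using wfe_leaves[OF w leaves_pm[OF c, symmetric]] .
 note l = leaves_pm[OF c]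
 have t: "tyof T E v = Tensor B C" using B by (auto simp: okt_def tyof_eq)
 show ?case
  using PmB.IH(1)[OF B(1)] PmB.IH(2)[OF B(2)] can_arr[OF w' l] w'
  by (simp add: Let_def t)
next
 case (LamB B v)
 from okt_LamB[OF LamB.prems] obtain C where
  B: "A = Lolli B C" "okt T (push B E) v C" by blast
 have c: "count (uses v) (Bd 0) = 1" using LamB.prems by (auto simp: okt_def)
 have w: "wfe (om (push B E)) (shape v)" using B by (auto simp: okt_def intro: hty_in_obj)
 have w': "wfe (om (push B E)) (EJoin (lift (esub down (shape v))) (Leaf (Bd 0)))"
  using wfe_leaves[OF w leaves_lam[OF c, symmetric]] .
 note l = leaves_lam[OF c]
 note IH = LamB.IH[OF B(2)]
 let ?f = "ar (push B E) v \<cdot> can (om (push B E)) (EJoin (lift (esub down (shape v))) (Leaf (Bd 0))) (shape v)"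
 have f: "arr ?f" "src ?f = ob (om E) (esub down (shape v)) \<odot> ty_obj M B" "tgt ?f = ty_obj M C"
  using IH can_arr[OF w' l] by auto
 show ?case using curry_arr[of "ty_obj M B" ?f "ob (om E) (esub down (shape v))"] f IH B w'
  by (simp add: Let_def)
next
 case (App v w)
 from okt_App[OF App.prems] obtain B where B: "okt T E v (Lolli B A)" "okt T E w B" by blast
 then have t: "tyof T E v = Lolli B A" by (auto simp: okt_def tyof_eq)
 have "set_ty (Lolli B A) \<subseteq> ground T" using B hty_res_ground' unfolding okt_def by blast
 then show ?case using App.IH(1)[OF B(1)] App.IH(2)[OF B(2)] by (simp add: t)
qed

lemma ar_arr_simps:
 assumes "okt T E v A"
 shows "arr (ar E v)" "src (ar E v) = ob (om E) (shape v)" "tgt (ar E v) = ty_obj M A"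
 using ar_arr[OF assms] by auto


lemma down_rename: "esub down (esub (%l. Leaf (upn \<rho> l)) e) = esub (%l. Leaf (\<rho> l)) (esub down e)"
 by (simp add: esub_esub down_upn)

lemma lift_rename: "lift (esub (%l. Leaf (\<rho> l)) e) = esub (%l. Leaf (upn \<rho> l)) (lift e)"
 by (simp add: esub_esub)

lemma ob_rename: "(\<And>l. l \<in># leaves e ==> E' (\<rho> l) = E l) ==> ob (om E') (esub (%l. Leaf (\<rho> l)) e) = ob (om E) e"
 unfolding ob_esub by (intro ob_cong) (simp add: om_def)

text \<open>Independence of the names of variables, whether free or dangling. Injectivity keeps the
  leaves distinct, so that \<open>can_rename\<close> applies at every binder.\<close>

lemma ar_rnm:
 assumes "okt T E v A" "inj_on \<rho> (set_mset (uses v))" "\<And>l. l \<in># uses v ==> E' (\<rho> l) = E l"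
 shows "ar E' (rnm \<rho> v) = ar E v"
 using assms
proof (induction v arbitrary: E E' A \<rho>)
 case (Var x)
 then show ?case by (cases "\<rho> (Free x)") (auto simp: om_def)
next
 case (Bound x)
 then show ?case by (cases "\<rho> (Bd x)") (auto simp: om_def)
next
 case (Op f vs)
 note o = okt_Op[OF Op.prems(1)]
 have "ar E' (rnm \<rho> (vs ! i)) = ar E (vs ! i)" if i: "i < length vs" for i
 proof (rule Op.IH[OF nth_mem[OF i]])
  show "okt T E (vs ! i) (op_args T f ! i)" using o i by blast
  have s: "set_mset (uses (vs ! i)) \<subseteq> set_mset (uses (Op f vs))"
   using nth_mem[OF i] by (auto simp: in_sum_list)
  show "inj_on \<rho> (set_mset (uses (vs ! i)))" using Op.prems(2) s by (rule inj_on_subset)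
  show "\<And>l. l \<in># uses (vs ! i) ==> E' (\<rho> l) = E l" using Op.prems(3) s by blast
 qed
 then have "map (ar E') (map (rnm \<rho>) vs) = map (ar E) vs" by (intro nth_equalityI) auto
 then show ?case by (simp only: ar.simps rnm.simps)
next
 case (LetStar v w)
 then show ?case using LetStar.IH[of E _ \<rho> E'] okt_LetStar[OF LetStar.prems(1)] by (auto simp: inj_on_Un)
next
 case (Ten v w)
 then show ?case using Ten.IH[of E _ \<rho> E'] okt_Ten[OF Ten.prems(1)] by (auto simp: inj_on_Un)
next
 case (App v w)
 from okt_App[OF App.prems(1)] obtain B where B: "okt T E v (Lolli B A)" "okt T E w B" by blast
 have "hty T E' (rnm \<rho> v) C = hty T E v C" for C
  unfolding hty_rnm using App.prems(3) by (intro hty_cong) auto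
 then have "tyof T E' (rnm \<rho> v) = tyof T E v" by (simp add: tyof_def)
 moreover have "ar E' (rnm \<rho> v) = ar E v" "ar E' (rnm \<rho> w) = ar E w"
  using App.prems by (auto intro!: App.IH(1)[OF B(1)] App.IH(2)[OF B(2)] simp: inj_on_Un)
 ultimately show ?case by simp
next
 case (LamB B v)
 from okt_LamB[OF LamB.prems(1)] obtain C where
  B: "A = Lolli B C" "okt T (push B E) v C" by blast
 have c: "count (uses v) (Bd 0) = 1" using LamB.prems by (auto simp: okt_def)
 have w: "wfe (om (push B E)) (shape v)" using B by (auto simp: okt_def intro: hty_in_obj)
 have w': "wfe (om (push B E)) (EJoin (lift (esub down (shape v))) (Leaf (Bd 0)))"
  using wfe_leaves[OF w leaves_lam[OF c, symmetric]] .
 have u: "uniq (uses v)" using B by (auto simp: okt_def)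
 have inj: "inj_on (upn \<rho>) (set_mset (uses v))" using LamB.prems(2) by (intro inj_on_upn) simp
 have e: "push B E' (upn \<rho> l) = push B E l" if "l \<in># uses v" for l
  using that LamB.prems(3) by (cases l rule: name_up_cases) (auto simp: in_down)
 have ih: "ar (push B E') (rnm (upn \<rho>) v) = ar (push B E) v"
  using B inj e by (intro LamB.IH) auto
 have d: "lift (esub down (shape (rnm (upn \<rho>) v))) = esub (%l. Leaf (upn \<rho> l)) (lift (esub down (shape v)))"
  by (simp only: shape_rnm down_rename lift_rename)
 have "can (om (push B E')) (esub (%l. Leaf (upn \<rho> l)) (EJoin (lift (esub down (shape v))) (Leaf (Bd 0))))
   (esub (%l. Leaf (upn \<rho> l)) (shape v)) =
  can (om (push B E)) (EJoin (lift (esub down (shape v))) (Leaf (Bd 0))) (shape v)"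
  using w' u inj e leaves_lam[OF c] by (intro can_rename) (auto simp: om_def simp del: leaves.simps)
 then have can: "can (om (push B E')) (EJoin (lift (esub down (shape (rnm (upn \<rho>) v)))) (Leaf (Bd 0))) (shape (rnm (upn \<rho>) v)) =
  can (om (push B E)) (EJoin (lift (esub down (shape v))) (Leaf (Bd 0))) (shape v)"
  unfolding d by (simp add: shape_rnm)
 have "ob (om E') (esub down (shape (rnm (upn \<rho>) v))) = ob (om E) (esub down (shape v))"
  unfolding shape_rnm down_rename using LamB.prems(3) by (intro ob_rename) simp
 then show ?case using ih can by (simp add: Let_def)
next
 case (PmB v w)
 from okt_PmB[OF PmB.prems(1)] obtain B C where
  B: "okt T E v (Tensor B C)" "okt T (push C (push B E)) w A" by blast
 have c: "count (uses w) (Bd 0) = 1" "count (uses w) (Bd 1) = 1" using PmB.prems by (auto simp: okt_def)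
 let ?E = "push C (push B E)" and ?E' = "push C (push B E')" and ?\<rho> = "upn (upn \<rho>)"
 let ?D = "esub down (esub down (shape w))" and ?D' = "esub down (esub down (shape (rnm (upn (upn \<rho>)) w)))"
 let ?K = "%D. EJoin (EJoin (Leaf (Bd 1)) (Leaf (Bd 0))) (lift (lift D))"
 have w: "wfe (om ?E) (shape w)" using B by (auto simp: okt_def intro: hty_in_obj)
 have w': "wfe (om ?E) (?K ?D)"
  using wfe_leaves[OF w leaves_pm[OF c, symmetric]] .
 have u: "uniq (uses w)" using B by (auto simp: okt_def)
 have inj: "inj_on ?\<rho> (set_mset (uses w))" using PmB.prems(2) by (intro inj_on_upn) (simp add: inj_on_Un)
 have e: "?E' (?\<rho> l) = ?E l" if "l \<in># uses w" for l
 proof (cases l rule: name_up_cases)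
  case (2 k)
  then show ?thesis using that PmB.prems(3) by (cases k rule: name_up_cases) (auto simp: in_down simp del: up.simps)
 qed simp
 have ih: "ar ?E' (rnm ?\<rho> w) = ar ?E w"
  using B inj e by (intro PmB.IH(2)) auto
 have ih1: "ar E' (rnm \<rho> v) = ar E v"
  using B PmB.prems by (intro PmB.IH(1)) (auto simp: inj_on_Un)
 have d: "?K ?D' = esub (%l. Leaf (?\<rho> l)) (?K ?D)"
  by (simp add: shape_rnm down_rename lift_rename del: up.simps)
   (metis One_nat_def up.simps(2) upn.simps(2) upn_up)
 have "can (om ?E') (esub (%l. Leaf (?\<rho> l)) (?K ?D)) (esub (%l. Leaf (?\<rho> l)) (shape w)) =
  can (om ?E) (?K ?D) (shape w)"
  using w' u inj e leaves_pm[OF c] by (intro can_rename) (auto simp: om_def simp del: leaves.simps)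
 then have can: "can (om ?E') (?K ?D') (shape (rnm ?\<rho> w)) = can (om ?E) (?K ?D) (shape w)"
  unfolding d by (simp add: shape_rnm)
 have ob: "ob (om E') ?D' = ob (om E) ?D"
  unfolding shape_rnm down_rename using PmB.prems(3) by (intro ob_rename) simp
 have t: "tyof T E v = Tensor B C" using B by (auto simp: okt_def tyof_eq)
 have "hty T E' (rnm \<rho> v) X = hty T E v X" for X
  unfolding hty_rnm using PmB.prems(3) by (intro hty_cong) auto
 then have "tyof T E' (rnm \<rho> v) = Tensor B C" using t by (simp add: tyof_def)
 then show ?case using ih ih1 can ob t by (simp add: Let_def)
qed auto

lemma ar_cong:
 assumes "okt T E v A" "\<And>l. l \<in># uses v ==> E' l = E l"
 shows "ar E' v = ar E v"
 using ar_rnm[of E v A "%l. l" E'] assms by (simp add: rnm_id)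

lemma okt_cong: "(\<And>l. l \<in># uses v ==> E' l = E l) ==> okt T E' v A = okt T E v A"
 unfolding okt_def using hty_cong[of v E' E T A] by auto

lemma okt_push_lc: "lc v ==> okt T (push B E) v A = okt T E v A"
 by (simp add: okt_def hty_push_lc)

lemma ar_push_lc: "lc v ==> okt T E v A ==> ar (push B E) v = ar E v"
proof (rule ar_cong)
 fix l assume "lc v" "l \<in># uses v"
 then show "push B E l = E l" by (cases l) (auto simp: lc_def)
qed

section \<open>Substitution is composition\<close>

primrec sa :: "(name => 'g ty) => (var => ('g, 'f) tm) => name => ('o, 'u) arr" where
 "sa E s (Free x) = ar E (s x)"
| "sa E s (Bd i) = \<i> (om E (Bd i))"

lemma lift_lc: "lc v ==> lift (shape v) = shape v"
 by (intro esub_ident) (metis lc_def name.exhaust up.simps(1))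

lemma esub_sh_lift: "(\<And>x. Free x \<in># leaves e ==> lc (s x)) ==> lift (esub (sh s) e) = esub (sh s) (lift e)"
 unfolding esub_esub
proof (intro esub_cong)
 fix l assume "\<And>x. Free x \<in># leaves e ==> lc (s x)" "l \<in># leaves e"
 then show "lift (sh s l) = esub (sh s) (Leaf (up l))"
  by (cases l) (auto simp: lift_lc)
qed

text \<open>What has to hold at one leaf: a free name receives a locally closed term of its type,
  and an index, which substitution does not touch, has the same type on both sides.\<close>

primrec sok :: "(name => 'g ty) => (name => 'g ty) => (var => ('g, 'f) tm) => name => bool" where
 "sok E E' s (Free x) = (lc (s x) & okt T E (s x) (E' (Free x)))"
| "sok E E' s (Bd i) = (E (Bd i) = E' (Bd i))"

lemma sok_up [simp]: "sok (push B E) (push B E') s (up l) = sok E E' s l"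
 by (cases l) (auto simp: okt_push_lc)

lemma Free_in_lift: "Free x \<in># leaves (lift e) \<longleftrightarrow> Free x \<in># leaves e"
proof (induction e)
 case (Leaf l)
 then show ?case by (cases l) auto
qed auto

lemma sok_push: "(\<And>l. l \<in># leaves (esub down e) ==> sok E E' s l) ==> l \<in># leaves e ==>
  sok (push B E) (push B E') s l"
 by (cases l rule: name_up_cases) (auto simp: in_down)

lemma sa_up: "sok E E' s l ==> sa (push B E) s (up l) = sa E s l"
 by (cases l) (auto simp: ar_push_lc)

lemma okt_subst:
 assumes "okt T E' v A" "\<And>l. l \<in># uses v ==> sok E E' s l" and "uniq (uses (subst s v))"
 shows "okt T E (subst s v) A"
proof -
 have "lc (s x) & okt T E (s x) (E' (Free x))" if "Free x \<in># uses v" for x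
  using assms(2)[OF that] by simp
 moreover have "E (Bd i) = E' (Bd i)" if "Bd i \<in># uses v" for i
  using assms(2)[OF that] by simp
 ultimately show ?thesis
  using assms(1,3) hty_subst[of v s T E E' A] lin_subst[of v s] unfolding okt_def by blast
qed

lemma sa_arr:
 assumes "om E' l \<in> obj M" "sok E E' s l"
 shows "arr (sa E s l) & src (sa E s l) = ob (om E) (sh s l) & tgt (sa E s l) = om E' l & wfe (om E) (sh s l)"
proof (cases l)
 case (Free x)
 then show ?thesis using assms(2) ar_arr[of E "s x"] hty_in_obj by (auto simp: om_def okt_def)
next
 case (Bd i)
 then show ?thesis using assms by (simp add: om_def)
qed

lemma earr_sa:
 assumes "wfe (om E') e" "\<And>l. l \<in># leaves e ==> sok E E' s l"
 shows "arr (earr (sa E s) e)" "src (earr (sa E s) e) = ob (om E) (esub (sh s) e)"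
  "tgt (earr (sa E s) e) = ob (om E') e" "wfe (om E) (esub (sh s) e)"
proof -
 have "arr (sa E s l) & src (sa E s l) = ob (om E) (sh s l) & tgt (sa E s l) = om E' l & wfe (om E) (sh s l)"
  if "l \<in># leaves e" for l
  using that assms by (intro sa_arr) (auto simp: wfe_def)
 then show "arr (earr (sa E s) e)" "src (earr (sa E s) e) = ob (om E) (esub (sh s) e)"
  "tgt (earr (sa E s) e) = ob (om E') e" "wfe (om E) (esub (sh s) e)"
  using earr_arr[of e "sa E s" "om E" "sh s" "om E'"] by (auto intro!: wfe_esub)
qed

lemma can_sa:
 assumes "wfe (om E') e" "leaves e = leaves f" "uniq (leaves f)" "uniq (leaves (esub (sh s) f))"
  and "\<And>l. l \<in># leaves f ==> sok E E' s l"
 shows "can (om E') e f \<cdot> earr (sa E s) e = earr (sa E s) f \<cdot> can (om E) (esub (sh s) e) (esub (sh s) f)"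
proof (rule can_esub)
 show "uniq (leaves (esub (sh s) e))" using assms(2,4) by (simp add: leaves_esub)
 show "arr (sa E s l) & src (sa E s l) = ob (om E) (sh s l) & tgt (sa E s l) = om E' l & wfe (om E) (sh s l)"
  if "l \<in># leaves e" for l
  using that assms by (intro sa_arr) (auto simp: wfe_def)
qed (use assms in auto)

lemma okt_wfe: "okt T E v A ==> wfe (om E) (shape v)"
 by (auto simp: okt_def intro: hty_in_obj)

lemma uniq_subst_binder:
 assumes "count (leaves e) (Bd 0) = 1" "\<And>x. Free x \<in># leaves e ==> lc (s x)"
  and "uniq (leaves (esub (sh s) (esub down e)))"
 shows "uniq (leaves (esub (sh s) e))"
 by (rule uniq_down) (use assms in \<open>auto simp: count_esub_sh_Bd esub_sh_down\<close>)

text \<open>The tensor of the denotations put in is arranged as the shape demands. At constructors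
  it splits by interchange; at binders naturality moves it past the rearrangement, with identities
  at the bound leaves.\<close>

lemma ar_subst:
 assumes "okt T E' v A" "\<And>l. l \<in># uses v ==> sok E E' s l" and "uniq (uses (subst s v))"
 shows "ar E (subst s v) = ar E' v \<cdot> earr (sa E s) (shape v)"
 using assms
proof (induction v arbitrary: E E' A)
 case (Var x)
 then show ?case using ar_arr[of E "s x"] by (auto simp: om_def)
next
 case (Bound i)
 then show ?case by (auto simp: om_def okt_def)
next
 case Star
 show ?case by simp
next
 case (LetStar v w)
 have o': "okt T E' v TUnit" "okt T E' w A" using okt_LetStar[OF LetStar.prems(1)] by auto
 have s: "sok E E' s l" if "l \<in># uses v \<or> l \<in># uses w" for l using LetStar.prems(2) that by auto
 have u: "uniq (uses (subst s v))" "uniq (uses (subst s w))" using LetStar.prems(3) by auto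
 have 1: "ar E (subst s v) = ar E' v \<cdot> earr (sa E s) (shape v)"
  using s u by (intro LetStar.IH(1)[OF o'(1)]) auto
 have 2: "ar E (subst s w) = ar E' w \<cdot> earr (sa E s) (shape w)"
  using s u by (intro LetStar.IH(2)[OF o'(2)]) auto
 note a = earr_sa[OF okt_wfe[OF o'(1)], of E s] earr_sa[OF okt_wfe[OF o'(2)], of E s]
 show ?case using 1 2 a s ar_arr[OF o'(1)] ar_arr[OF o'(2)] okt_obj[OF o'(2)] by simp
next
 case (Ten v w)
 obtain B C where o': "okt T E' v B" "okt T E' w C" using okt_Ten[OF Ten.prems(1)] by auto
 have s: "sok E E' s l" if "l \<in># uses v \<or> l \<in># uses w" for l using Ten.prems(2) that by auto
 have u: "uniq (uses (subst s v))" "uniq (uses (subst s w))" using Ten.prems(3) by auto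
 have 1: "ar E (subst s v) = ar E' v \<cdot> earr (sa E s) (shape v)"
  using s u by (intro Ten.IH(1)[OF o'(1)]) auto
 have 2: "ar E (subst s w) = ar E' w \<cdot> earr (sa E s) (shape w)"
  using s u by (intro Ten.IH(2)[OF o'(2)]) auto
 note a = earr_sa[OF okt_wfe[OF o'(1)], of E s] earr_sa[OF okt_wfe[OF o'(2)], of E s]
 show ?case using 1 2 a s ar_arr[OF o'(1)] ar_arr[OF o'(2)] by simp
next
 case (App v w)
 obtain B where o': "okt T E' v (Lolli B A)" "okt T E' w B" using okt_App[OF App.prems(1)] by auto
 have s: "sok E E' s l" if "l \<in># uses v \<or> l \<in># uses w" for l using App.prems(2) that by auto
 have u: "uniq (uses (subst s v))" "uniq (uses (subst s w))" using App.prems(3) by auto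
 have 1: "ar E (subst s v) = ar E' v \<cdot> earr (sa E s) (shape v)"
  using s u by (intro App.IH(1)[OF o'(1)]) auto
 have 2: "ar E (subst s w) = ar E' w \<cdot> earr (sa E s) (shape w)"
  using s u by (intro App.IH(2)[OF o'(2)]) auto
 note a = earr_sa[OF okt_wfe[OF o'(1)], of E s] earr_sa[OF okt_wfe[OF o'(2)], of E s]
 have "okt T E (subst s v) (Lolli B A)" using s u by (intro okt_subst[OF o'(1)]) auto
 then have t: "tyof T E (subst s v) = Lolli B A" "tyof T E' v = Lolli B A"
  using o' by (auto simp: okt_def tyof_eq)
 have "set_ty A \<subseteq> ground T" using o'(1) hty_res_ground'[of E' v "Lolli B A"] by (auto simp: okt_def)
 then show ?case using 1 2 a s ar_arr[OF o'(1)] ar_arr[OF o'(2)] t okt_obj[OF o'(2)] by simp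
next
 case (Op f vs)
 note o = okt_Op[OF Op.prems(1)]
 have so: "sok E E' s l" if "v \<in> set vs" "l \<in># uses v" for v l
  using that Op.prems(2) by (auto simp: in_sum_list)
 have ok: "\<exists>B. okt T E' v B" if "v \<in> set vs" for v
  using that o by (metis in_set_conv_nth)
 have a: "arr (earr (sa E s) (shape v))" "src (earr (sa E s) (shape v)) = ob (om E) (esub (sh s) (shape v))"
   "tgt (earr (sa E s) (shape v)) = ob (om E') (shape v)"
  if "v \<in> set vs" for v
  using ok[OF that] so[OF that] earr_sa okt_wfe by metis+
 have b: "arr (ar E' v)" "src (ar E' v) = ob (om E') (shape v)" if "v \<in> set vs" for v
  using ok[OF that] ar_arr by metis+
 have "ar E (subst s (vs ! i)) = ar E' (vs ! i) \<cdot> earr (sa E s) (shape (vs ! i))" if i: "i < length vs" for i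
 proof (rule Op.IH[OF nth_mem[OF i]])
  have m: "vs ! i \<in> set vs" using i by simp
  show "okt T E' (vs ! i) (op_args T f ! i)" using o i by blast
  show "\<And>l. l \<in># uses (vs ! i) ==> sok E E' s l" using so[OF m] .
  have "uniq (sum_list (map uses (map (subst s) vs)))" using Op.prems(3) by (simp add: comp_def)
  then show "uniq (uses (subst s (vs ! i)))" by (rule uniq_sum_list) (use m in auto)
 qed
 then have "map (ar E) (map (subst s) vs) =
   map2 (%m n. m \<cdot> n) (map (ar E') vs) (map (earr (sa E s)) (map shape vs))"
  by (intro nth_equalityI) auto
 moreover have "ntmor M (map2 (%m n. m \<cdot> n) (map (ar E') vs) (map (earr (sa E s)) (map shape vs))) =
   ntmor M (map (ar E') vs) \<cdot> ntmor M (map (earr (sa E s)) (map shape vs))"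
  using a b by (intro ntmor_comp) auto
 ultimately have *: "ntmor M (map (ar E) (map (subst s) vs)) = ntmor M (map (ar E') vs) \<cdot> ntmor M (map (earr (sa E s)) (map shape vs))"
  by simp
 have r: "arr (ntmor M (map (ar E') vs)) & src (ntmor M (map (ar E') vs)) = ntobj M (map src (map (ar E') vs)) &
   tgt (ntmor M (map (ar E') vs)) = ntobj M (map tgt (map (ar E') vs))"
  using b by (intro ntmor_arr) auto
 have r': "arr (ntmor M (map (earr (sa E s)) (map shape vs))) & src (ntmor M (map (earr (sa E s)) (map shape vs))) = ntobj M (map src (map (earr (sa E s)) (map shape vs))) &
   tgt (ntmor M (map (earr (sa E s)) (map shape vs))) = ntobj M (map tgt (map (earr (sa E s)) (map shape vs)))"
  using a by (intro ntmor_arr) auto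
 have m: "map tgt (map (earr (sa E s)) (map shape vs)) = map src (map (ar E') vs)" using a b by auto
 have "tgt (ar E' (vs ! i)) = ty_obj M (op_args T f ! i)" if "i < length vs" for i
  using o that ar_arr by blast
 then have "map tgt (map (ar E') vs) = map (ty_obj M) (op_args T f)"
  using o by (intro nth_equalityI) auto
 then show ?case using * r r' m op_mor_hom[of f] o by (simp add: hom_iff earr_njoin del: map_map)
next
 case (LamB B v)
 from okt_LamB[OF LamB.prems(1)] obtain C where B: "A = Lolli B C" "okt T (push B E') v C" by blast
 let ?F = "push B E" and ?F' = "push B E'" and ?D = "esub down (shape v)"
 let ?K = "EJoin (lift ?D) (Leaf (Bd 0))" and ?K' = "%D. EJoin (lift (esub (sh s) D)) (Leaf (Bd 0))"
 have c: "count (uses v) (Bd 0) = 1" using LamB.prems by (auto simp: okt_def)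
 note w = okt_wfe[OF B(2)] and L = leaves_lam[OF c]
 have w': "wfe (om ?F') ?K" using wfe_leaves[OF w L[symmetric]] .
 have u: "uniq (uses v)" using B by (auto simp: okt_def)
 have soD: "sok E E' s l" if "l \<in># leaves ?D" for l using that LamB.prems(2) by simp
 then have so: "sok ?F ?F' s l" if "l \<in># uses v" for l using that sok_push by blast
 then have lc: "lc (s x)" if "Free x \<in># uses v" for x using that by fastforce
 have sh: "shape (subst s v) = esub (sh s) (shape v)" using lc by (intro shape_subst)
 have dn: "esub down (esub (sh s) (shape v)) = esub (sh s) ?D" using lc by (intro esub_sh_down)
 have "lift (esub (sh s) ?D) = esub (sh s) (lift ?D)" using lc by (intro esub_sh_lift) (simp add: in_down)
 then have up: "esub (sh s) ?K = ?K' ?D" by simp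
 have us: "uniq (leaves (esub (sh s) (shape v)))"
  by (rule uniq_subst_binder[of "shape v" s, OF c]) (use LamB.prems(3) lc in \<open>auto simp: sh dn\<close>)
 have ih: "ar ?F (subst s v) = ar ?F' v \<cdot> earr (sa ?F s) (shape v)"
  using so us by (intro LamB.IH[OF B(2)]) (auto simp: sh)
 have "earr (sa ?F s) (lift ?D) = earr (sa E s) ?D"
  unfolding earr_esub_Leaf using soD sa_up by (intro earr_cong) blast
 then have K: "earr (sa ?F s) ?K = earr (sa E s) ?D \<otimes> \<i> (ty_obj M B)" by simp
 \<comment> \<open>The rearrangement under the binder is natural: the denotations of the terms put
   in move from the body to the part outside the bound leaf.\<close>
 have nat: "can (om ?F') ?K (shape v) \<cdot> (earr (sa E s) ?D \<otimes> \<i> (ty_obj M B)) =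
   earr (sa ?F s) (shape v) \<cdot> can (om ?F) (?K' ?D) (esub (sh s) (shape v))"
  using can_sa[OF w' L u us so] unfolding K up .
 note av = ar_arr_simps[OF B(2)]
 note ae = earr_sa[OF w so]
 have wD: "wfe (om E') ?D" using w' by simp
 note aD = earr_sa[OF wD soD]
 have tB: "ty_obj M B \<in> obj M" using w' by simp
 note cK = can_arr[OF w' L]
 have "wfe (om ?F) (esub (sh s) ?K)" using so by (intro earr_sa(4)[OF w']) (simp only: L)
 then have wK: "wfe (om ?F) (?K' ?D)" unfolding up .
 have lK: "leaves (?K' ?D) = leaves (esub (sh s) (shape v))"
  unfolding up[symmetric] leaves_esub L ..
 note cK2 = can_arr[OF wK lK]
 let ?f = "ar ?F' v \<cdot> can (om ?F') ?K (shape v)"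
 have "ar E (subst s (LamB B v)) = curry_at M (ty_obj M B) (ob (om E) (esub (sh s) ?D)) (ty_obj M C)
   ((ar ?F' v \<cdot> earr (sa ?F s) (shape v)) \<cdot> can (om ?F) (?K' ?D) (esub (sh s) (shape v)))"
  using ih av ae by (simp add: Let_def sh dn)
 also have "(ar ?F' v \<cdot> earr (sa ?F s) (shape v)) \<cdot> can (om ?F) (?K' ?D) (esub (sh s) (shape v)) =
   ar ?F' v \<cdot> can (om ?F') ?K (shape v) \<cdot> (earr (sa E s) ?D \<otimes> \<i> (ty_obj M B))"
  using nat av ae cK2 by simp
 also have "... = ?f \<cdot> (earr (sa E s) ?D \<otimes> \<i> (ty_obj M B))"
  using av cK aD tB by simp
 also have "curry_at M (ty_obj M B) (ob (om E) (esub (sh s) ?D)) (ty_obj M C) ... =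
   curry_at M (ty_obj M B) (ob (om E') ?D) (ty_obj M C) ?f \<cdot> earr (sa E s) ?D"
  using curry_comp[of "ty_obj M B" ?f "ob (om E') ?D" "earr (sa E s) ?D"] av cK aD tB by simp
 finally show ?case using av by (simp add: Let_def)
next
 case (PmB v w)
 from okt_PmB[OF PmB.prems(1)] obtain B C where
  B: "okt T E' v (Tensor B C)" "okt T (push C (push B E')) w A" by blast
 let ?F = "push C (push B E)" and ?F' = "push C (push B E')" and ?D = "esub down (esub down (shape w))"
 let ?K = "%D. EJoin (EJoin (Leaf (Bd 1)) (Leaf (Bd 0))) (lift (lift D))"
 have c: "count (uses w) (Bd 0) = 1" "count (uses w) (Bd 1) = 1" using PmB.prems by (auto simp: okt_def)
 then have c1: "count (leaves (esub down (shape w))) (Bd 0) = 1" by (simp add: count_leaves_down)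
 note w = okt_wfe[OF B(2)] and L = leaves_pm[OF c]
 have w': "wfe (om ?F') (?K ?D)" using wfe_leaves[OF w L[symmetric]] .
 have u: "uniq (uses w)" using B by (auto simp: okt_def)
 have sov: "sok E E' s l" if "l \<in># uses v" for l using that PmB.prems(2) by simp
 have soD: "sok E E' s l" if "l \<in># leaves ?D" for l using that PmB.prems(2) by simp
 have so1: "sok (push B E) (push B E') s l" if "l \<in># leaves (esub down (shape w))" for l
  using soD that by (rule sok_push)
 have so: "sok ?F ?F' s l" if "l \<in># uses w" for l using so1 that by (rule sok_push)
 have lc: "lc (s x)" if "Free x \<in># uses w" for x using so[OF that] by simp
 have lc1: "lc (s x)" if "Free x \<in># leaves (esub down (shape w))" for x using so1[OF that] by simp
 have lc2: "lc (s x)" if "Free x \<in># leaves ?D" for x using soD[OF that] by simp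
 have sh: "shape (subst s w) = esub (sh s) (shape w)" using lc by (intro shape_subst)
 have dn1: "esub down (esub (sh s) (shape w)) = esub (sh s) (esub down (shape w))"
  using lc by (intro esub_sh_down)
 have dn: "esub down (esub down (esub (sh s) (shape w))) = esub (sh s) ?D"
  unfolding dn1 using lc1 by (intro esub_sh_down)
 \<comment> \<open>Lifting twice commutes with the substitution, as the terms put in are locally
   closed; so the arrangement used for \<open>Pm\<close> is stable under substitution.\<close>
 have l1: "lift (esub (sh s) ?D) = esub (sh s) (lift ?D)" using lc2 by (rule esub_sh_lift)
 have l2: "lift (esub (sh s) (lift ?D)) = esub (sh s) (lift (lift ?D))"
  using lc2 by (intro esub_sh_lift) (simp add: Free_in_lift)
 have up: "esub (sh s) (?K ?D) = ?K (esub (sh s) ?D)"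
  unfolding l1 l2 by simp
 have us: "uniq (uses (subst s v))" "uniq (leaves (esub (sh s) (shape w)))"
 proof -
  show "uniq (uses (subst s v))" using PmB.prems(3) by simp
  have "uniq (leaves (esub (sh s) ?D))" using PmB.prems(3) by (simp add: sh dn)
  then have "uniq (leaves (esub (sh s) (esub down (shape w))))" using uniq_subst_binder[of "esub down (shape w)" s, OF c1] lc1 by blast
  then show "uniq (leaves (esub (sh s) (shape w)))" using uniq_subst_binder[of "shape w" s, OF c(1)] lc by blast
 qed
 have ih: "ar ?F (subst s w) = ar ?F' w \<cdot> earr (sa ?F s) (shape w)"
  using so us by (intro PmB.IH(2)[OF B(2)]) (auto simp: sh)
 have ih1: "ar E (subst s v) = ar E' v \<cdot> earr (sa E s) (shape v)"
  using sov us by (intro PmB.IH(1)[OF B(1)])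
 have "earr (sa ?F s) (lift (lift ?D)) = earr (sa E s) ?D"
  unfolding earr_esub_Leaf
 proof (rule earr_cong)
  fix l assume "l \<in># leaves ?D"
  then have "sok E E' s l" "sok (push B E) (push B E') s (up l)" using soD by auto
  then show "sa ?F s (up (up l)) = sa E s l" using sa_up by metis
 qed
 then have K: "earr (sa ?F s) (?K ?D) = \<i> (ty_obj M B) \<otimes> \<i> (ty_obj M C) \<otimes> earr (sa E s) ?D"
  by (simp add: om_def)
 have nat: "can (om ?F') (?K ?D) (shape w) \<cdot> (\<i> (ty_obj M B) \<otimes> \<i> (ty_obj M C) \<otimes> earr (sa E s) ?D) =
   earr (sa ?F s) (shape w) \<cdot> can (om ?F) (?K (esub (sh s) ?D)) (esub (sh s) (shape w))"
  using can_sa[OF w' L u us(2) so] unfolding K up .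
 note av = ar_arr_simps[OF B(1)] and aw = ar_arr_simps[OF B(2)]
 note ae = earr_sa[OF w so] and aev = earr_sa[OF okt_wfe[OF B(1)] sov]
 have wD: "wfe (om E') ?D" using w' by simp
 note aD = earr_sa[OF wD soD]
 have tB: "ty_obj M B \<in> obj M" "ty_obj M C \<in> obj M" using w' by (auto simp: om_def)
 note cK = can_arr[OF w' L]
 have "wfe (om ?F) (esub (sh s) (?K ?D))" using so by (intro earr_sa(4)[OF w']) (simp only: L)
 then have wK: "wfe (om ?F) (?K (esub (sh s) ?D))" unfolding up .
 have lK: "leaves (?K (esub (sh s) ?D)) = leaves (esub (sh s) (shape w))"
  unfolding up[symmetric] leaves_esub L ..
 note cK2 = can_arr[OF wK lK]
 have o1: "ob (om ?F) (?K (esub (sh s) ?D)) = ty_obj M B \<odot> ty_obj M C \<odot> ob (om E) (esub (sh s) ?D)"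
  "ob (om ?F') (?K ?D) = ty_obj M B \<odot> ty_obj M C \<odot> ob (om E') ?D"
  by (simp_all add: om_def)
 have "okt T E (subst s v) (Tensor B C)" using sov us by (intro okt_subst[OF B(1)])
 then have t: "tyof T E (subst s v) = Tensor B C" "tyof T E' v = Tensor B C"
  using B by (auto simp: okt_def tyof_eq)
 have "ar E (subst s (PmB v w)) =
   (ar ?F' w \<cdot> earr (sa ?F s) (shape w)) \<cdot> can (om ?F) (?K (esub (sh s) ?D)) (esub (sh s) (shape w)) \<cdot>
   ((ar E' v \<cdot> earr (sa E s) (shape v)) \<otimes> \<i> (ob (om E) (esub (sh s) ?D)))"
  using ih ih1 t by (simp add: Let_def sh dn)
 also have "... = ar ?F' w \<cdot> (earr (sa ?F s) (shape w) \<cdot> can (om ?F) (?K (esub (sh s) ?D)) (esub (sh s) (shape w))) \<cdot>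
   ((ar E' v \<cdot> earr (sa E s) (shape v)) \<otimes> \<i> (ob (om E) (esub (sh s) ?D)))"
  using aw ae cK2 av aev aD o1 by simp
 also have "... = ar ?F' w \<cdot> can (om ?F') (?K ?D) (shape w) \<cdot> (\<i> (ty_obj M B) \<otimes> \<i> (ty_obj M C) \<otimes> earr (sa E s) ?D) \<cdot>
   ((ar E' v \<cdot> earr (sa E s) (shape v)) \<otimes> \<i> (ob (om E) (esub (sh s) ?D)))"
  unfolding nat[symmetric] using aw cK av aev aD o1 tB by simp
 also have "... = ar ?F' w \<cdot> can (om ?F') (?K ?D) (shape w) \<cdot> (ar E' v \<otimes> \<i> (ob (om E') ?D)) \<cdot>
   (earr (sa E s) (shape v) \<otimes> earr (sa E s) ?D)"
  using av aev aD tB wD okt_wfe[OF B(1)] by simp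
 also have "... = (ar ?F' w \<cdot> can (om ?F') (?K ?D) (shape w) \<cdot> (ar E' v \<otimes> \<i> (ob (om E') ?D))) \<cdot>
   (earr (sa E s) (shape v) \<otimes> earr (sa E s) ?D)"
  using aw cK av aev aD o1 tB wD by simp
 finally show ?case using t by (simp add: Let_def)
qed

end

subsection \<open>Shuffles\<close>

lemma Cons_in_shufflesE:
 assumes "z # zs \<in> shuffles xs ys"
 obtains xs' where "xs = z # xs'" "zs \<in> shuffles xs' ys" | ys' where "ys = z # ys'" "zs \<in> shuffles xs ys'"
 using assms unfolding Cons_in_shuffles_iff by (metis list.collapse)

text \<open>\<open>shuffle_mor\<close> grows at the right end of the lists, whereas
  \<open>shuffles\<close> is defined by their heads. These rules and
  \<open>snoc_in_shufflesE\<close> mediate between the two.\<close>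

lemma shuffles_snocI:
 "zs \<in> shuffles xs ys ==> zs @ [z] \<in> shuffles (xs @ [z]) ys"
 "zs \<in> shuffles xs ys ==> zs @ [z] \<in> shuffles xs (ys @ [z])"
proof -
 show 1: "zs \<in> shuffles xs ys ==> zs @ [z] \<in> shuffles (xs @ [z]) ys" for xs ys
 proof (induction zs arbitrary: xs ys)
  case (Cons a zs)
  then show ?case by (fastforce simp: Cons_in_shuffles_iff)
 qed auto
 show "zs \<in> shuffles xs ys ==> zs @ [z] \<in> shuffles xs (ys @ [z])"
  using 1 shuffles_commutes by metis
qed

lemma rev_shuffles: "zs \<in> shuffles xs ys ==> rev zs \<in> shuffles (rev xs) (rev ys)"
proof (induction zs arbitrary: xs ys)
 case (Cons a zs)
 from Cons.prems show ?case
  by (cases rule: Cons_in_shufflesE) (simp_all add: Cons.IH shuffles_snocI)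
qed auto

lemma snoc_in_shufflesE:
 assumes "zs @ [z] \<in> shuffles xs ys"
 obtains xs' where "xs = xs' @ [z]" "zs \<in> shuffles xs' ys" | ys' where "ys = ys' @ [z]" "zs \<in> shuffles xs ys'"
proof -
 have "z # rev zs \<in> shuffles (rev xs) (rev ys)" using rev_shuffles[OF assms] by simp
 then show ?thesis
 proof (cases rule: Cons_in_shufflesE)
  case (1 xs')
  then show ?thesis using that(1)[of "rev xs'"] rev_shuffles[of "rev zs" xs' "rev ys"] by (simp add: rev_eq_Cons_iff)
 next
  case (2 ys')
  then show ?thesis using that(2)[of "rev ys'"] rev_shuffles[of "rev zs" "rev xs" ys'] by (simp add: rev_eq_Cons_iff)
 qed
qed

text \<open>Needed because \<open>nshuffles\<close> folds from the right and
  \<open>nshuffle_mor\<close> from the left; \<open>nshuffles_snoc\<close> draws the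
  conclusion.\<close>

lemma shuffles_assoc:
 "(\<exists>y\<in>shuffles as bs. zs \<in> shuffles y cs) \<longleftrightarrow> (\<exists>y\<in>shuffles bs cs. zs \<in> shuffles as y)"
proof (induction zs arbitrary: as bs cs)
 case Nil
 show ?case by auto
next
 case (Cons z zs)
 have L: "(\<exists>y\<in>shuffles as bs. z # zs \<in> shuffles y cs) \<longleftrightarrow>
  (\<exists>as'. as = z # as' & (\<exists>y\<in>shuffles as' bs. zs \<in> shuffles y cs)) \<or>
  (\<exists>bs'. bs = z # bs' & (\<exists>y\<in>shuffles as bs'. zs \<in> shuffles y cs)) \<or>
  (\<exists>cs'. cs = z # cs' & (\<exists>y\<in>shuffles as bs. zs \<in> shuffles y cs'))" (is "?l \<longleftrightarrow> ?r")
 proof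
  assume ?l
  then obtain y where "y \<in> shuffles as bs" "z # zs \<in> shuffles y cs" by blast
  then show ?r by (cases y) (auto simp: Cons_in_shuffles_iff neq_Nil_conv)
 next
  assume ?r
  then show ?l
   by (elim disjE exE conjE bexE) (auto intro: Cons_in_shuffles_leftI Cons_in_shuffles_rightI)
 qed
 have R: "(\<exists>y\<in>shuffles bs cs. z # zs \<in> shuffles as y) \<longleftrightarrow>
  (\<exists>as'. as = z # as' & (\<exists>y\<in>shuffles bs cs. zs \<in> shuffles as' y)) \<or>
  (\<exists>bs'. bs = z # bs' & (\<exists>y\<in>shuffles bs' cs. zs \<in> shuffles as y)) \<or>
  (\<exists>cs'. cs = z # cs' & (\<exists>y\<in>shuffles bs cs'. zs \<in> shuffles as y))" (is "?l \<longleftrightarrow> ?r")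
 proof
  assume ?l
  then obtain y where "y \<in> shuffles bs cs" "z # zs \<in> shuffles as y" by blast
  then show ?r by (cases y) (auto simp: Cons_in_shuffles_iff neq_Nil_conv)
 next
  assume ?r
  then show ?l
   by (elim disjE exE conjE bexE) (auto intro: Cons_in_shuffles_leftI Cons_in_shuffles_rightI)
 qed
 show ?case unfolding L R Cons.IH ..
qed

lemma nshuffles_snoc: "E \<in> nshuffles (Gs @ [H]) \<longleftrightarrow> (\<exists>D\<in>nshuffles Gs. E \<in> shuffles D H)"
proof (induction Gs arbitrary: E)
 case (Cons G Gs)
 have "E \<in> nshuffles ((G # Gs) @ [H]) \<longleftrightarrow> (\<exists>D\<in>nshuffles Gs. \<exists>y\<in>shuffles D H. E \<in> shuffles G y)"
  unfolding Bex_def append_Cons nshuffles.simps UN_iff by (simp add: Cons.IH Bex_def) blast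
 also have "... \<longleftrightarrow> (\<exists>D\<in>nshuffles Gs. \<exists>y\<in>shuffles G D. E \<in> shuffles y H)"
  by (simp add: shuffles_assoc)
 finally show ?case by auto
qed auto

lemma shuffle_mor_shuffles: "shuffle_mor M G H E s ==> E \<in> shuffles G H"
 by (induction rule: shuffle_mor.induct) (auto intro: shuffles_snocI)

lemma shuffles_shuffle_mor: "E \<in> shuffles G H ==> \<exists>s. shuffle_mor M G H E s"
proof (induction E arbitrary: G H rule: rev_induct)
 case Nil
 then show ?case using shuffle_mor.intros(1)[of M] by auto
next
 case (snoc p E)
 obtain x A where p: "p = (x, A)" by (cases p)
 from snoc.prems show ?case
 proof (cases rule: snoc_in_shufflesE)
  case (1 G')
  with snoc.IH obtain s where "shuffle_mor M G' H E s" by blast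
  then show ?thesis unfolding p 1(1) using shuffle_mor.intros(2) by blast
 next
  case (2 H')
  with snoc.IH obtain s where "shuffle_mor M G H' E s" by blast
  then show ?thesis unfolding p 2(1) using shuffle_mor.intros(3) by blast
 qed
qed

lemma nshuffle_mor_nshuffles: "nshuffle_mor M Gs E s ==> Gs \<noteq> [] & E \<in> nshuffles Gs"
 by (induction rule: nshuffle_mor.induct) (auto simp: nshuffles_snoc dest: shuffle_mor_shuffles)

lemma nshuffles_nshuffle_mor: "E \<in> nshuffles Gs ==> Gs \<noteq> [] ==> \<exists>s. nshuffle_mor M Gs E s"
proof (induction Gs arbitrary: E rule: rev_induct)
 case (snoc H Gs)
 from snoc.prems obtain D where D: "D \<in> nshuffles Gs" "E \<in> shuffles D H" by (auto simp: nshuffles_snoc)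
 show ?case
 proof (cases "Gs = []")
  case True
  with D have "E = H" by simp
  then show ?thesis using True nshuffle_mor.intros(1)[of M H] by auto
 next
  case False
  with snoc.IH D obtain t where "nshuffle_mor M Gs D t" by blast
  moreover obtain s where "shuffle_mor M D H E s" using shuffles_shuffle_mor D by blast
  ultimately show ?thesis using nshuffle_mor.intros(2) by blast
 qed
qed simp

lemma denotes_typed: "denotes T M G v A m ==> typed T G v A"
proof (induction rule: denotes.induct)
 case (den_op f Gs vs ms E s)
 then show ?case using nshuffle_mor_nshuffles[of M Gs E s] by (intro ty_op[of f T Gs]) auto
qed (auto intro: typed.intros dest: shuffle_mor_shuffles)

text \<open>The inductive \<open>nshuffle_mor\<close> starts from a single context, so operations
  must have at least one argument.\<close>

lemma typed_denotes:
 assumes "typed T G v A" "\<And>f. f \<in> ops T ==> op_args T f \<noteq> []"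
 shows "\<exists>m. denotes T M G v A m"
 using assms(1)
proof (induction rule: typed.induct)
 case (ty_op f Gs vs E)
 then have "\<forall>i<length (op_args T f). \<exists>m. denotes T M (Gs ! i) (vs ! i) (op_args T f ! i) m" by blast
 then obtain mf where mf: "\<forall>i<length (op_args T f). denotes T M (Gs ! i) (vs ! i) (op_args T f ! i) (mf i)" by metis
 have "Gs \<noteq> []" using ty_op assms(2)[of f] by auto
 then obtain s where "nshuffle_mor M Gs E s" using nshuffles_nshuffle_mor ty_op by blast
 then have "denotes T M E (Op f vs) (op_res T f) (cmp M (op_mor M f) (cmp M (ntmor M (map mf [0..<length (op_args T f)])) s))"
  using ty_op mf by (intro den_op[of f T Gs]) auto
 then show ?case by blast
next
 case (ty_letstar G v H w A E)
 then obtain m n s where "denotes T M G v TUnit m" "denotes T M H w A n" "shuffle_mor M G H E s"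
  using shuffles_shuffle_mor by metis
 then show ?case using ty_letstar(3) den_letstar by blast
next
 case (ty_pair G v A H w B E)
 then obtain m n s where "denotes T M G v A m" "denotes T M H w B n" "shuffle_mor M G H E s"
  using shuffles_shuffle_mor by metis
 then show ?case using ty_pair(3) den_pair by blast
next
 case (ty_app G v A B H w E)
 then obtain m n s where "denotes T M G v (Lolli A B) m" "denotes T M H w A n" "shuffle_mor M G H E s"
  using shuffles_shuffle_mor by metis
 then show ?case using ty_app(3) den_app by blast
next
 case (ty_pm G v A B H x y w C E)
 then obtain m n s where "denotes T M G v (Tensor A B) m" "denotes T M (H @ [(x, A), (y, B)]) w C n"
   "shuffle_mor M G H E s"
  using shuffles_shuffle_mor by metis
 then show ?case using ty_pm(3) den_pm by blast
next
 case (ty_var A x)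
 then show ?case using den_var by blast
next
 case ty_star
 show ?case using den_star by blast
next
 case (ty_lam G x A v B)
 then show ?case using den_lam by blast
qed

section \<open>Contexts as tensor expressions, and shuffles as rearrangements\<close>

definition ce :: "'g ctx => name ex" where
 "ce G = njoin (map (%p. Leaf (Free (fst p))) G)"

lemma leaves_ce [simp]: "leaves (ce G) = names G"
 unfolding ce_def by (simp add: comp_def) (induction G; simp)

lemma ce_simps [simp]: "ce [] = EUnit" "ce [p] = Leaf (Free (fst p))"
 by (simp_all add: ce_def)

lemma ce_snoc: "G \<noteq> [] ==> ce (G @ [p]) = EJoin (ce G) (Leaf (Free (fst p)))"
 by (simp add: ce_def njoin_snoc)

lemma esub_ce_ident: "(\<And>x. x \<in> ctx_vars G ==> h (Free x) = Leaf (Free x)) ==> esub h (ce G) = ce G"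
 by (intro esub_ident) (auto simp: in_names)

context lam_interp
begin

text \<open>The environment extends the context. It remains free elsewhere, and this freedom is used
  at binders, where it is changed at the bound variables.\<close>

definition agr :: "(name => 'g ty) => 'g ctx => bool" where
 "agr F G \<longleftrightarrow> (\<forall>p\<in>set G. F (Free (fst p)) = snd p & set_ty (snd p) \<subseteq> ground T)"

lemma agr_simps [simp]: "agr F []" "agr F (p # G) \<longleftrightarrow> F (Free (fst p)) = snd p & set_ty (snd p) \<subseteq> ground T & agr F G"
 "agr F (G @ H) \<longleftrightarrow> agr F G & agr F H"
 by (auto simp: agr_def)

lemma agr_subset: "agr F E ==> set G \<subseteq> set E ==> agr F G"
 unfolding agr_def by blast

lemma agr_shuffles: "E \<in> shuffles G H ==> agr F E \<longleftrightarrow> agr F G & agr F H"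
 unfolding agr_def by (auto simp: set_shuffles)

lemma agr_env: "wty T G v A ==> agr (env G) G"
 unfolding agr_def using wty_ground env_in wty_def by (metis prod.collapse)

lemma agr_okt: "wty T G v A ==> agr F G ==> okt T F v A"
proof -
 assume w: "wty T G v A" and a: "agr F G"
 have "F l = env G l" if "l \<in># uses v" for l
 proof -
  have "l \<in># names G" using w that by (simp add: wty_def)
  then obtain x B where "l = Free x" "(x, B) \<in> set G" by (auto simp: in_names ctx_vars_def)
  then show ?thesis using a w env_in[of G x B] by (auto simp: agr_def wty_def)
 qed
 then show ?thesis using okt_wty[OF w] okt_cong by blast
qed

lemma ctx_obj_ce: "agr F G ==> ctx_obj M G = ob (om F) (ce G)"
proof -
 assume "agr F G"
 then have "map (%(x, A). ty_obj M A) G = map (ob (om F)) (map (%p. Leaf (Free (fst p))) G)"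
  by (auto simp: agr_def om_def)
 then show ?thesis by (simp only: ctx_obj_def ce_def ntobj_njoin)
qed

lemma wfe_ce: "agr F G ==> wfe (om F) (ce G)"
 unfolding wfe_def by (auto simp: names_def agr_def om_def)

lemma str_jn:
 assumes "agr F (G @ [(x, A)])"
 shows "str (om F) (EJoin (ce G) (Leaf (Free x))) (ce (G @ [(x, A)])) (jn M G A)"
proof (cases "G = []")
 case True
 then show ?thesis using assms str_l[of "om F" "Leaf (Free x)"] by (simp add: jn_def om_def)
next
 case False
 then show ?thesis
  using assms str_id[of "om F" "EJoin (ce G) (Leaf (Free x))"] wfe_ce[of F G] ctx_obj_ce[of F G]
  by (simp add: jn_def ce_snoc om_def)
qed

lemma str_shuffle: "shuffle_mor M G H E s ==> agr F E ==> str (om F) (ce E) (EJoin (ce G) (ce H)) s"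
proof (induction rule: shuffle_mor.induct)
 case 1
 show ?case using str_l_inv[of "om F" EUnit] by simp
next
 case (2 G H E s x A)
 note sh = shuffle_mor_shuffles[OF 2(1)]
 have ag: "agr F G" "agr F H" "agr F E" using 2(3) agr_shuffles[OF sh] by auto
 note o = ctx_obj_ce[OF ag(1)] ctx_obj_ce[OF ag(2)] ctx_obj_ce[OF ag(3)]
 note w = wfe_ce[OF ag(1)] wfe_ce[OF ag(2)] wfe_ce[OF ag(3)]
 have A: "ty_obj M A = ob (om F) (Leaf (Free x))" "wfe (om F) (Leaf (Free x))" using 2(3) by (auto simp: om_def)
 have j: "str (om F) (EJoin (ce G) (Leaf (Free x))) (ce (G @ [(x, A)])) (jn M G A)"
  "str (om F) (ce (E @ [(x, A)])) (EJoin (ce E) (Leaf (Free x))) (inv_arr M (jn M E A))"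
  using 2(3) ag by (auto intro!: str_jn str_inv)
 show ?case unfolding o A(1)
  apply (rule str_comp[OF _ str_ten[OF j(1) str_id]])
   apply (rule str_comp[OF _ str_asc_inv])
    apply (rule str_comp[OF _ str_ten[OF str_id str_swap]])
      apply (rule str_comp[OF _ str_asc])
       apply (rule str_comp[OF _ str_ten[OF 2(2) str_id]])
        apply (rule j(2))
  using w A ag by auto
next
 case (3 G H E s x A)
 note sh = shuffle_mor_shuffles[OF 3(1)]
 have ag: "agr F G" "agr F H" "agr F E" using 3(3) agr_shuffles[OF sh] by auto
 note o = ctx_obj_ce[OF ag(1)] ctx_obj_ce[OF ag(2)] ctx_obj_ce[OF ag(3)]
 note w = wfe_ce[OF ag(1)] wfe_ce[OF ag(2)] wfe_ce[OF ag(3)]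
 have A: "ty_obj M A = ob (om F) (Leaf (Free x))" "wfe (om F) (Leaf (Free x))" using 3(3) by (auto simp: om_def)
 have j: "str (om F) (EJoin (ce H) (Leaf (Free x))) (ce (H @ [(x, A)])) (jn M H A)"
  "str (om F) (ce (E @ [(x, A)])) (EJoin (ce E) (Leaf (Free x))) (inv_arr M (jn M E A))"
  using 3(3) ag by (auto intro!: str_jn str_inv)
 show ?case unfolding o A(1)
  apply (rule str_comp[OF _ str_ten[OF str_id j(1)]])
   apply (rule str_comp[OF _ str_asc])
    apply (rule str_comp[OF _ str_ten[OF 3(2) str_id]])
     apply (rule j(2))
  using w A ag by auto
qed

lemma str_nshuffle: "nshuffle_mor M Gs E s ==> agr F E ==> str (om F) (ce E) (njoin (map ce Gs)) s"
proof (induction rule: nshuffle_mor.induct)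
 case (1 G)
 then show ?case using str_id[of "om F" "ce G"] wfe_ce[of F G] ctx_obj_ce[of F G] by simp
next
 case (2 Gs D t H E s)
 have ag: "agr F D" "agr F H" using 2 agr_shuffles[OF shuffle_mor_shuffles[OF 2(2)]] by auto
 have "njoin (map ce (Gs @ [H])) = EJoin (njoin (map ce Gs)) (ce H)"
  using nshuffle_mor_nshuffles[OF 2(1)] by (simp add: njoin_snoc)
 then show ?case using 2 ag
  by (auto intro!: str_comp[OF str_shuffle[OF 2(2)] str_ten[OF _ str_id]] simp: ctx_obj_ce wfe_ce)
qed

text \<open>\<open>shuffle_mor\<close> is composed of structural morphisms, so coherence identifies
  it with the canonical rearrangement, whichever derivation produced it.\<close>

lemma can_shuffle:
 "shuffle_mor M G H E s ==> agr F E ==> is_ctx E ==> s = can (om F) (ce E) (EJoin (ce G) (ce H))"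
 using can_eq[OF str_shuffle] by (simp add: is_ctx_names)

end

subsection \<open>Denotations\<close>

lemma bnd_neq [simp]: "y \<noteq> x ==> bnd n x (Free y) = Free y" "bnd n x (Free x) = Bd n" "bnd n x (Bd i) = Bd i"
 by (auto simp: bnd_def)

context lam_interp
begin

lemma agr_eq: "agr F G ==> agr F' G ==> y \<in> ctx_vars G ==> F' (Free y) = F (Free y)"
 unfolding agr_def ctx_vars_def by (metis imageE)

lemma can_ident_ten:
 assumes "wfe I e" "wfe I d" "leaves e = leaves f" "uniq (leaves e + leaves d)"
 shows "can I e f \<otimes> \<i> (ob I d) = can I (EJoin e d) (EJoin f d)"
  and "\<i> (ob I d) \<otimes> can I e f = can I (EJoin d e) (EJoin d f)"
proof -
 have "can I d d = \<i> (ob I d)" using assms by simp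
 then show "can I e f \<otimes> \<i> (ob I d) = can I (EJoin e d) (EJoin f d)"
  "\<i> (ob I d) \<otimes> can I e f = can I (EJoin d e) (EJoin d f)"
  using can_ten[of I e f d d] can_ten[of I d d e f] assms by (auto simp: Int_commute)
qed

text \<open>Translates between the index \<open>Bd 0\<close>, over which \<open>ar\<close>
  abstracts, and the named variable \<open>x\<close> of the typing rule. The renaming is injective
  on the body, so both read the same arrow, and all rearrangements collapse into one by
  coherence.\<close>

lemma ar_Lam:
 assumes w: "wty T (G @ [(x, A)]) v B" and F: "agr F G" and F': "agr F' (G @ [(x, A)])"
 shows "ar F (Lam x A v) \<cdot> can (om F) (ce G) (shape (Lam x A v)) =
  curry_at M (ty_obj M A) (ob (om F) (ce G)) (ty_obj M B)
   (ar F' v \<cdot> can (om F') (EJoin (ce G) (Leaf (Free x))) (shape v))"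
proof -
 let ?v = "rnm (bnd 0 x) v" and ?G = "push A F"
 let ?D = "esub down (shape ?v)"
 have x: "x \<notin> ctx_vars G" and c: "is_ctx G" using w by (auto simp: wty_def)
 have u: "uses v = add_mset (Free x) (names G)" using w by (simp add: wty_def)
 have "wty T G (Lam x A v) (Lolli A B)" using w typed_iff ty_lam by metis
 then have ok: "okt T F (LamB A ?v) (Lolli A B)" using F by (auto simp: Lam_def bindv_rnm intro: agr_okt)
 then have ok1: "okt T ?G ?v B" using okt_LamB by blast
 have okv: "okt T F' v B" using agr_okt[OF w F'] .
 have fr: "F' (Free y) = F (Free y)" if "y \<in> ctx_vars G" for y
  using F F' that by (auto intro: agr_eq)
 have GF: "?G (bnd 0 x l) = F' l" if "l \<in># uses v" for l
  using that u fr F' x by (cases "l = Free x") (auto simp: in_names bnd_def)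
 have inj: "inj_on (bnd 0 x) (set_mset (uses v))"
  using u x by (auto simp: inj_on_def bnd_def in_names)
 have arv: "ar ?G ?v = ar F' v" using okv inj GF by (intro ar_rnm)
 have lD: "leaves ?D = names G" and luv: "uses ?v = add_mset (Bd 0) (names G)"
  using uses_LamB_names[OF u x] by simp_all
 have cc: "count (uses ?v) (Bd 0) = 1" using luv by simp
 let ?K = "EJoin (lift ?D) (Leaf (Bd 0))"
 note L = leaves_lam[OF cc]
 have wv: "wfe (om ?G) (shape ?v)" using okt_wfe[OF ok1] .
 have wK: "wfe (om ?G) ?K" using wfe_leaves[OF wv L[symmetric]] .
 have wD: "wfe (om F) ?D" using wK by simp
 have uG: "uniq (names G)" using c is_ctx_names by blast
 have wc: "wfe (om F) (ce G)" using wfe_ce[OF F] .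
 have lc: "lift (ce G) = ce G" by (rule esub_ce_ident) simp
 have 1: "can (om F) (ce G) ?D = can (om ?G) (ce G) (lift ?D)"
  using can_rename[of "om F" "ce G" ?D up "om ?G"] wc lD uG lc by (simp add: inj_on_def)
 have wc': "wfe (om ?G) (ce G)" using wc wfe_lift[of A F "ce G"] lc by simp
 have obc: "ob (om ?G) (ce G) = ob (om F) (ce G)" using ob_lift[of A F "ce G"] lc by simp
 have tA: "ty_obj M A \<in> obj M" using wK by simp
 have 2: "can (om F) (ce G) ?D \<otimes> \<i> (ty_obj M A) = can (om ?G) (EJoin (ce G) (Leaf (Bd 0))) ?K"
  unfolding 1 using can_ident_ten(1)[of "om ?G" "ce G" "Leaf (Bd 0)" "lift ?D"] wc' tA lD uG
  by (simp add: leaves_esub_Leaf image_opn_up_names)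
 have 3: "can (om ?G) ?K (shape ?v) \<cdot> can (om ?G) (EJoin (ce G) (Leaf (Bd 0))) ?K =
  can (om ?G) (EJoin (ce G) (Leaf (Bd 0))) (shape ?v)"
  using wc' tA L luv uG by (intro can_can) simp_all
 have eG: "esub (%l. Leaf (bnd 0 x l)) (ce G) = ce G"
  using x by (intro esub_ce_ident) (auto simp: bnd_def)
 have wF': "wfe (om F') (EJoin (ce G) (Leaf (Free x)))"
  using wfe_ce[of F' G] F' by (simp add: om_def)
 have "can (om ?G) (esub (%l. Leaf (bnd 0 x l)) (EJoin (ce G) (Leaf (Free x)))) (esub (%l. Leaf (bnd 0 x l)) (shape v)) =
  can (om F') (EJoin (ce G) (Leaf (Free x))) (shape v)"
  using wF' u uG x inj GF by (intro can_rename) (auto simp: om_def)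
 then have 4: "can (om ?G) (EJoin (ce G) (Leaf (Bd 0))) (shape ?v) = can (om F') (EJoin (ce G) (Leaf (Free x))) (shape v)"
  by (simp add: eG shape_rnm)
 let ?f = "ar ?G ?v \<cdot> can (om ?G) ?K (shape ?v)"
 note av = ar_arr_simps[OF ok1] and cK = can_arr[OF wK L]
 have cD: "arr (can (om F) (ce G) ?D)" "src (can (om F) (ce G) ?D) = ob (om F) (ce G)" "tgt (can (om F) (ce G) ?D) = ob (om F) ?D"
  using can_arr[OF wc, of ?D] lD by simp_all
 have "ar F (Lam x A v) \<cdot> can (om F) (ce G) (shape (Lam x A v)) =
  curry_at M (ty_obj M A) (ob (om F) ?D) (tgt ?f) ?f \<cdot> can (om F) (ce G) ?D"
  using av cK by (simp add: Lam_def bindv_rnm Let_def)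
 also have "... = curry_at M (ty_obj M A) (ob (om F) (ce G)) (tgt ?f) (?f \<cdot> (can (om F) (ce G) ?D \<otimes> \<i> (ty_obj M A)))"
  using curry_comp[of "ty_obj M A" ?f "ob (om F) ?D" "can (om F) (ce G) ?D"] av cK cD tA by simp
 also have "?f \<cdot> (can (om F) (ce G) ?D \<otimes> \<i> (ty_obj M A)) = ar ?G ?v \<cdot> can (om ?G) ?K (shape ?v) \<cdot> (can (om F) (ce G) ?D \<otimes> \<i> (ty_obj M A))"
  using av cK cD tA by simp
 also have "... = ar F' v \<cdot> can (om F') (EJoin (ce G) (Leaf (Free x))) (shape v)"
  unfolding 2 3 4 arv ..
 finally show ?thesis using av cK by simp
qed

lemma can_can_arr:
 "wfe I e ==> leaves e = leaves f ==> leaves f = leaves g ==> uniq (leaves e) ==> arr h ==> src h = ob I g ==>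
  (h \<cdot> can I f g) \<cdot> can I e f = h \<cdot> can I e g"
proof -
 assume a: "wfe I e" "leaves e = leaves f" "leaves f = leaves g" "uniq (leaves e)" "arr h" "src h = ob I g"
 then have "wfe I f" by (simp add: wfe_def)
 then show ?thesis using a can_can[of I e f g] by simp
qed

text \<open>The analogue of \<open>ar_Lam\<close> for two bound variables, from the arrangement with
  \<open>G\<close> next to \<open>H\<close>: the pair produced by \<open>v\<close> takes the place
  of the leaves \<open>x\<close> and \<open>y\<close>.\<close>

lemma ar_Pm:
 assumes wv: "wty T G v (Tensor A B)" and w: "wty T (H @ [(x, A), (y, B)]) w C"
  and F: "agr F G" "agr F H" and F': "agr F' (H @ [(x, A), (y, B)])" and dis: "ctx_vars G \<inter> ctx_vars H = {}"
 shows "ar F (Pm v x y w) \<cdot> can (om F) (EJoin (ce G) (ce H)) (shape (Pm v x y w)) =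
  ar F' w \<cdot> can (om F') (EJoin (EJoin (Leaf (Free x)) (Leaf (Free y))) (ce H)) (shape w) \<cdot>
   ((ar F v \<cdot> can (om F) (ce G) (shape v)) \<otimes> \<i> (ob (om F) (ce H)))"
proof -
 let ?\<rho> = "%l. bnd (Suc 0) x (bnd 0 y l)"
 let ?w = "rnm ?\<rho> w" and ?G = "push B (push A F)"
 let ?D = "esub down (esub down (shape ?w))"
 have w'': "rnm (bnd (Suc 0) x) (rnm (bnd 0 y) w) = ?w" by (simp add: rnm_rnm)
 have xy: "x \<notin> ctx_vars H" "y \<notin> ctx_vars H" "x \<noteq> y" and c: "is_ctx H" using w by (auto simp: wty_def)
 have u: "uses w = add_mset (Free x) (add_mset (Free y) (names H))" using w by (simp add: wty_def)
 have "is_ctx (G @ H)" using wv c dis by (auto simp: wty_def)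
 then have "wty T (G @ H) (Pm v x y w) C"
 proof -
  have "G @ H \<in> shuffles G H"
   by (induction G) (auto intro: Cons_in_shuffles_leftI)
  with \<open>is_ctx (G @ H)\<close> show ?thesis using wv w typed_iff ty_pm by metis
 qed
 then have ok: "okt T F (PmB v ?w) C" using F by (auto simp: Pm_def bindv_rnm rnm_rnm dest!: agr_okt)
 then obtain A' B' where ok': "okt T F v (Tensor A' B')" "okt T (push B' (push A' F)) ?w C" using okt_PmB by blast
 have okv: "okt T F v (Tensor A B)" using agr_okt[OF wv F(1)] .
 then have "A' = A" "B' = B" using ok'(1) hty_unique by (fastforce simp: okt_def)+
 then have ok1: "okt T ?G ?w C" using ok' by simp
 have okw: "okt T F' w C" using agr_okt[OF w F'] .
 have fr: "F' (Free z) = F (Free z)" if "z \<in> ctx_vars H" for z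
  using F F' that by (auto intro: agr_eq)
 have \<rho>: "?\<rho> (Free x) = Bd (Suc 0)" "?\<rho> (Free y) = Bd 0" "\<And>z. z \<in> ctx_vars H ==> ?\<rho> (Free z) = Free z"
  using xy by (auto simp: bnd_def)
 have GF: "?G (?\<rho> l) = F' l" if "l \<in># uses w" for l
  using that u fr F' \<rho> by (auto simp: in_names simp del: bnd_neq)
 have inj: "inj_on ?\<rho> (set_mset (uses w))"
  using u xy by (auto simp: inj_on_def bnd_def in_names split: if_splits)
 have arw: "ar ?G ?w = ar F' w" using okw inj GF by (intro ar_rnm)
 have lD: "leaves ?D = names H" and luv: "uses ?w = add_mset (Bd (Suc 0)) (add_mset (Bd 0) (names H))"
  using uses_PmB_names[OF u xy] by (simp_all only: w'' One_nat_def)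
 have cc: "count (uses ?w) (Bd 0) = 1" "count (uses ?w) (Bd (Suc 0)) = 1" using luv by simp_all
 let ?P = "EJoin (Leaf (Bd (Suc 0))) (Leaf (Bd 0))"
 let ?K = "%D. EJoin ?P (lift (lift D))"
 have lll: "leaves (lift (lift ?D)) = names H"
  by (simp add: leaves_esub_Leaf lD image_opn_up_names)
 have L: "leaves (?K ?D) = uses ?w" using leaves_pm[of "shape ?w"] cc by simp
 have ww: "wfe (om ?G) (shape ?w)" using okt_wfe[OF ok1] .
 have wK: "wfe (om ?G) (?K ?D)" using wfe_leaves[OF ww L[symmetric]] .
 have wD: "wfe (om F) ?D" using wK by simp
 have uG: "uniq (names H)" using c is_ctx_names by blast
 have wc: "wfe (om F) (ce H)" "wfe (om F) (ce G)" using wfe_ce F by blast+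
 have lc: "lift (ce H) = ce H" by (rule esub_ce_ident) simp
 have 1: "can (om F) (ce H) ?D = can (om ?G) (ce H) (lift (lift ?D))"
  using can_rename[of "om F" "ce H" ?D up "om (push A F)"] can_rename[of "om (push A F)" "ce H" "lift ?D" up "om ?G"]
   wc lD uG lc wfe_lift[of A F "ce H"] by (simp add: inj_on_def leaves_esub_Leaf image_opn_up_names)
 have wc': "wfe (om ?G) (ce H)" using wc wfe_lift[of A F "ce H"] wfe_lift[of B "push A F" "ce H"] lc by simp
 have obc: "ob (om ?G) (ce H) = ob (om F) (ce H)" using ob_lift[of A F "ce H"] ob_lift[of B "push A F" "ce H"] lc by simp
 have tAB: "ty_obj M A \<in> obj M" "ty_obj M B \<in> obj M" using F' by auto
 have om: "om ?G (Bd (Suc 0)) = ty_obj M A" "om ?G (Bd 0) = ty_obj M B" by (simp_all add: om_def)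
 have 2: "\<i> (ty_obj M A \<odot> ty_obj M B) \<otimes> can (om F) (ce H) ?D = can (om ?G) (EJoin ?P (ce H)) (?K ?D)"
  unfolding 1 using can_ident_ten(2)[of "om ?G" "ce H" ?P "lift (lift ?D)"] wc' tAB lll uG om
  by simp
 have 3: "can (om ?G) (?K ?D) (shape ?w) \<cdot> can (om ?G) (EJoin ?P (ce H)) (?K ?D) =
  can (om ?G) (EJoin ?P (ce H)) (shape ?w)"
  using wc' tAB om L luv uG by (intro can_can) simp_all
 have eG: "esub (%l. Leaf (?\<rho> l)) (ce H) = ce H"
  using \<rho> by (intro esub_ce_ident) simp
 let ?Q = "EJoin (EJoin (Leaf (Free x)) (Leaf (Free y))) (ce H)"
 have wF': "wfe (om F') ?Q"
  using wfe_ce[of F' H] F' by (simp add: om_def)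
 have "can (om ?G) (esub (%l. Leaf (?\<rho> l)) ?Q) (esub (%l. Leaf (?\<rho> l)) (shape w)) = can (om F') ?Q (shape w)"
 proof (rule can_rename[OF wF'])
  have QL: "leaves ?Q = uses w" by (simp add: u)
  show "leaves ?Q = uses w" "inj_on ?\<rho> (set_mset (leaves ?Q))" unfolding QL by (fact HOL.refl inj)+
  show "uniq (leaves ?Q)" using uG xy by simp
  show "om ?G (?\<rho> l) = om F' l" if "l \<in># leaves ?Q" for l
   using GF[of l] that unfolding QL om_def by simp
 qed
 then have 4: "can (om ?G) (EJoin ?P (ce H)) (shape ?w) = can (om F') ?Q (shape w)"
  using eG \<rho> by (simp add: shape_rnm)
 note av = ar_arr_simps[OF okv] and aw = ar_arr_simps[OF ok1] and cK = can_arr[OF wK L]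
 have cD: "arr (can (om F) (ce H) ?D)" "src (can (om F) (ce H) ?D) = ob (om F) (ce H)" "tgt (can (om F) (ce H) ?D) = ob (om F) ?D"
  using can_arr[OF wc(1), of ?D] lD by simp_all
 have uv: "uses v = names G" using wv by (simp add: wty_def)
 have cv: "arr (can (om F) (ce G) (shape v))" "src (can (om F) (ce G) (shape v)) = ob (om F) (ce G)"
  "tgt (can (om F) (ce G) (shape v)) = ob (om F) (shape v)"
  using can_arr[OF wc(2), of "shape v"] uv by simp_all
 have obK: "ob (om ?G) (?K ?D) = (ty_obj M A \<odot> ty_obj M B) \<odot> ob (om F) ?D" using om by simp
 have t: "tyof T F v = Tensor A B" using okv by (simp add: okt_def tyof_eq)
 have un: "uniq (names G + names H)" using \<open>is_ctx (G @ H)\<close> by (simp add: is_ctx_names)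
 have "can (om F) (EJoin (ce G) (ce H)) (EJoin (shape v) ?D) = can (om F) (ce G) (shape v) \<otimes> can (om F) (ce H) ?D"
  using wc uv lD un by (intro can_ten[symmetric]) auto
 then have "ar F (Pm v x y w) \<cdot> can (om F) (EJoin (ce G) (ce H)) (shape (Pm v x y w)) =
   (ar ?G ?w \<cdot> can (om ?G) (?K ?D) (shape ?w) \<cdot> (ar F v \<otimes> \<i> (ob (om F) ?D))) \<cdot> (can (om F) (ce G) (shape v) \<otimes> can (om F) (ce H) ?D)"
  using t by (simp add: Pm_def bindv_rnm rnm_rnm Let_def)
 also have "... = ar ?G ?w \<cdot> can (om ?G) (?K ?D) (shape ?w) \<cdot> ((ar F v \<cdot> can (om F) (ce G) (shape v)) \<otimes> can (om F) (ce H) ?D)"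
  using aw av cK cD cv obK wD by simp
 also have "... = ar ?G ?w \<cdot> (can (om ?G) (?K ?D) (shape ?w) \<cdot> (\<i> (ty_obj M A \<odot> ty_obj M B) \<otimes> can (om F) (ce H) ?D)) \<cdot>
   ((ar F v \<cdot> can (om F) (ce G) (shape v)) \<otimes> \<i> (ob (om F) (ce H)))"
  using aw av cK cD cv obK tAB wc by simp
 finally show ?thesis unfolding 2 3 4 arw .
qed

text \<open>The right side mentions no derivation, so this yields uniqueness of denotations. In each
  case the shuffle and the rearrangements of the premises compose to a single
  \<open>can\<close>.\<close>

lemma denotes_ar: "denotes T M G v A m ==> agr F G ==> m = ar F v \<cdot> can (om F) (ce G) (shape v)"
proof (induction arbitrary: F rule: denotes.induct)
 case (den_var A x)
 then show ?case by (simp add: om_def)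
next
 case den_star
 show ?case by simp
next
 case (den_pair G v A m H w B n E s)
 have w: "wty T G v A" "wty T H w B" using den_pair denotes_typed typed_iff by blast+
 have F: "agr F G" "agr F H" using den_pair.prems agr_shuffles[OF shuffle_mor_shuffles[OF den_pair.hyps(4)]] by auto
 note s = can_shuffle[OF den_pair.hyps(4) den_pair.prems den_pair.hyps(3)]
 note o = agr_okt[OF w(1) F(1)] agr_okt[OF w(2) F(2)]
 have n: "names E = names G + names H" using names_shuffles[OF shuffle_mor_shuffles[OF den_pair.hyps(4)]] .
 have u: "uses v = names G" "uses w = names H" using w by (auto simp: wty_def)
 have un: "uniq (names G + names H)" using den_pair.hyps(3) n by (simp add: is_ctx_names)
 note wc = wfe_ce[OF F(1)] wfe_ce[OF F(2)] wfe_ce[OF den_pair.prems]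
 note a = ar_arr_simps[OF o(1)] ar_arr_simps[OF o(2)]
 have "(m \<otimes> n) \<cdot> s = (ar F v \<otimes> ar F w) \<cdot> (can (om F) (ce G) (shape v) \<otimes> can (om F) (ce H) (shape w)) \<cdot> s"
  using den_pair.IH(1)[OF F(1)] den_pair.IH(2)[OF F(2)] a wc u n by (simp add: s)
 also have "... = (ar F v \<otimes> ar F w) \<cdot> can (om F) (ce E) (EJoin (shape v) (shape w))"
  using wc u un n by (simp add: s can_ten can_can)
 finally show ?case by simp
next
 case (den_letstar G v m H w A n E s)
 have w: "wty T G v TUnit" "wty T H w A" using den_letstar denotes_typed typed_iff by blast+
 have F: "agr F G" "agr F H" using den_letstar.prems agr_shuffles[OF shuffle_mor_shuffles[OF den_letstar.hyps(4)]] by auto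
 note s = can_shuffle[OF den_letstar.hyps(4) den_letstar.prems den_letstar.hyps(3)]
 note o = agr_okt[OF w(1) F(1)] agr_okt[OF w(2) F(2)]
 have n: "names E = names G + names H" using names_shuffles[OF shuffle_mor_shuffles[OF den_letstar.hyps(4)]] .
 have u: "uses v = names G" "uses w = names H" using w by (auto simp: wty_def)
 have un: "uniq (names G + names H)" using den_letstar.hyps(3) n by (simp add: is_ctx_names)
 note wc = wfe_ce[OF F(1)] wfe_ce[OF F(2)] wfe_ce[OF den_letstar.prems]
 note a = ar_arr_simps[OF o(1)] ar_arr_simps[OF o(2)] okt_obj[OF o(2)]
 let ?n = "ar F w \<cdot> can (om F) (ce H) (shape w)" and ?m = "ar F v \<cdot> can (om F) (ce G) (shape v)"
 have aw: "arr ?n" "src ?n = ctx_obj M H" "tgt ?n = ty_obj M A" "arr ?m" "src ?m = ob (om F) (ce G)" "tgt ?m = \<one>"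
  using a wc u ctx_obj_ce[OF F(2)] by auto
 have ss: "arr s" "tgt s = ob (om F) (ce G) \<odot> ctx_obj M H" unfolding s using wc n ctx_obj_ce[OF F(2)] by auto
 have mn: "m = ?m" "n = ?n" using den_letstar.IH(1)[OF F(1)] den_letstar.IH(2)[OF F(2)] by auto
 have co: "ctx_obj M H \<in> obj M" using ctx_obj_ce[OF F(2)] wc by simp
 \<comment> \<open>The rule \<open>den_letstar\<close> runs \<open>n\<close> after the unitor,
   \<open>ar\<close> before it; naturality of the unitor exchanges them.\<close>
 have "n \<cdot> \<l> (ctx_obj M H) \<cdot> (m \<otimes> \<i> (ctx_obj M H)) \<cdot> s =
  (\<l> (ty_obj M A) \<cdot> (\<i> \<one> \<otimes> ?n)) \<cdot> (?m \<otimes> \<i> (ctx_obj M H)) \<cdot> s"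
  unfolding mn using l_nat[of ?n] comp_k[OF l_nat[of ?n, symmetric], of "(?m \<otimes> \<i> (ctx_obj M H)) \<cdot> s"] aw ss co a(7) by simp
 also have "... = \<l> (ty_obj M A) \<cdot> (?m \<otimes> ?n) \<cdot> s"
  using aw ss co a(7) by simp
 also have "... = \<l> (ty_obj M A) \<cdot> (ar F v \<otimes> ar F w) \<cdot> (can (om F) (ce G) (shape v) \<otimes> can (om F) (ce H) (shape w)) \<cdot> s"
  using a wc u n by (simp add: s)
 also have "... = \<l> (ty_obj M A) \<cdot> (ar F v \<otimes> ar F w) \<cdot> can (om F) (ce E) (EJoin (shape v) (shape w))"
  using wc u un n by (simp add: s can_ten can_can)
 finally show ?case using a wc u n un by simp
next
 case (den_app G v A B m H w n E s)
 have w: "wty T G v (Lolli A B)" "wty T H w A" using den_app denotes_typed typed_iff by blast+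
 have F: "agr F G" "agr F H" using den_app.prems agr_shuffles[OF shuffle_mor_shuffles[OF den_app.hyps(4)]] by auto
 note s = can_shuffle[OF den_app.hyps(4) den_app.prems den_app.hyps(3)]
 note o = agr_okt[OF w(1) F(1)] agr_okt[OF w(2) F(2)]
 have n: "names E = names G + names H" using names_shuffles[OF shuffle_mor_shuffles[OF den_app.hyps(4)]] .
 have u: "uses v = names G" "uses w = names H" using w by (auto simp: wty_def)
 have un: "uniq (names G + names H)" using den_app.hyps(3) n by (simp add: is_ctx_names)
 note wc = wfe_ce[OF F(1)] wfe_ce[OF F(2)] wfe_ce[OF den_app.prems]
 note a = ar_arr_simps[OF o(1)] ar_arr_simps[OF o(2)] okt_obj[OF o(2)]
 have "set_ty (Lolli A B) \<subseteq> ground T" using o(1) hty_res_ground' unfolding okt_def by blast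
 then have B: "ty_obj M B \<in> obj M" by simp
 have t: "tyof T F v = Lolli A B" using o(1) by (simp add: okt_def tyof_eq)
 have "(m \<otimes> n) \<cdot> s = (ar F v \<otimes> ar F w) \<cdot> (can (om F) (ce G) (shape v) \<otimes> can (om F) (ce H) (shape w)) \<cdot> s"
  using den_app.IH(1)[OF F(1)] den_app.IH(2)[OF F(2)] a wc u n by (simp add: s)
 also have "... = (ar F v \<otimes> ar F w) \<cdot> can (om F) (ce E) (EJoin (shape v) (shape w))"
  using wc u un n by (simp add: s can_ten can_can)
 finally show ?case using t a B wc u n by simp
next
 case (den_op f Gs vs ms E s)
 have sh: "E \<in> nshuffles Gs" using nshuffle_mor_nshuffles[OF den_op.hyps(6)] by blast
 have F: "agr F (Gs ! i)" if "i < length (op_args T f)" for i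
  using set_nshuffles[OF sh] that den_op.hyps(2) den_op.prems agr_subset by (metis nth_mem)
 have w: "wty T (Gs ! i) (vs ! i) (op_args T f ! i)" if "i < length (op_args T f)" for i
  using den_op.IH that denotes_typed typed_iff by blast
 let ?c = "map2 (%G v. can (om F) (ce G) (shape v)) Gs vs"
 note len = den_op(2,3,4)
 have o: "okt T F (vs ! i) (op_args T f ! i)" if "i < length (op_args T f)" for i
  using agr_okt w F that by blast
 note oa = ar_arr[OF o]
 have u: "map uses vs = map names Gs" using w len by (intro nth_equalityI) (auto simp: wty_def)
 have ms: "ms = map2 (%m n. m \<cdot> n) (map (ar F) vs) ?c"
  using den_op.IH F len by (intro nth_equalityI) auto
 have cn: "arr (can (om F) (ce (Gs ! i)) (shape (vs ! i))) & src (can (om F) (ce (Gs ! i)) (shape (vs ! i))) = ob (om F) (ce (Gs ! i)) &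
   tgt (can (om F) (ce (Gs ! i)) (shape (vs ! i))) = ob (om F) (shape (vs ! i))"
  if "i < length (op_args T f)" for i
  using can_arr[OF wfe_ce[OF F[OF that]], of "shape (vs ! i)"] w[OF that] by (simp add: wty_def)
 have "ntmor M ms = ntmor M (map (ar F) vs) \<cdot> ntmor M ?c"
  unfolding ms
 proof (rule ntmor_comp)
  show "map src (map (ar F) vs) = map tgt ?c"
   using oa cn len by (intro nth_equalityI) auto
 qed (use oa cn len in \<open>auto simp: in_set_conv_nth set_zip\<close>)
 moreover have "str (om F) (njoin (map ce Gs)) (njoin (map shape vs)) (ntmor M ?c)"
 proof -
  \<comment> \<open>Generalised to arbitrary accumulators, since \<open>njoin\<close> and
    \<open>ntmor\<close> are left folds.\<close>
  have "str (om F) (foldl EJoin d (map ce Gs)) (foldl EJoin d' (map shape vs))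
    (foldl (tmor M) m (map2 (%G v. can (om F) (ce G) (shape v)) Gs vs))"
   if "str (om F) d d' m" "length Gs = length vs" "\<forall>i<length vs. str (om F) (ce (Gs ! i)) (shape (vs ! i)) (can (om F) (ce (Gs ! i)) (shape (vs ! i)))"
   for d d' m Gs vs
   using that(2,1,3)
  proof (induction Gs vs arbitrary: d d' m rule: list_induct2)
   case (Cons G Gs v vs)
   show ?case unfolding list.map zip_Cons_Cons foldl.simps prod.case
    using Cons.prems by (intro Cons.IH str_ten) (auto simp: nth_Cons split: nat.splits)
  qed simp
  note fold = this
  have st: "\<forall>i<length vs. str (om F) (ce (Gs ! i)) (shape (vs ! i)) (can (om F) (ce (Gs ! i)) (shape (vs ! i)))"
  proof (intro allI impI)
   fix i assume "i < length vs"
   then have i: "i < length (op_args T f)" using len by simp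
   show "str (om F) (ce (Gs ! i)) (shape (vs ! i)) (can (om F) (ce (Gs ! i)) (shape (vs ! i)))"
    using str_can[OF wfe_ce[OF F[OF i]]] w[OF i] by (simp add: wty_def)
  qed
  show ?thesis
  proof (cases Gs)
   case Nil
   then show ?thesis using len str_id[of "om F" EUnit] by (cases vs) auto
  next
   case (Cons G Gs')
   then obtain v vs' where vs: "vs = v # vs'" using len by (cases vs) auto
   have "str (om F) (ce G) (shape v) (can (om F) (ce G) (shape v))" using st Cons vs by fastforce
   moreover have "length Gs' = length vs'" using len Cons vs by simp
   moreover have "\<forall>i<length vs'. str (om F) (ce (Gs' ! i)) (shape (vs' ! i)) (can (om F) (ce (Gs' ! i)) (shape (vs' ! i)))"
    using st Cons vs by fastforce
   ultimately show ?thesis using fold Cons vs by simp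
  qed
 qed
 then have "str (om F) (ce E) (njoin (map shape vs)) (ntmor M ?c \<cdot> s)"
  using str_comp[OF str_nshuffle[OF den_op.hyps(6) den_op.prems]] by blast
 then have "can (om F) (ce E) (njoin (map shape vs)) = ntmor M ?c \<cdot> s"
  by (rule can_eq) (use den_op.hyps(5) in \<open>simp add: is_ctx_names\<close>)
 moreover have as: "arr s & tgt s = ob (om F) (njoin (map ce Gs))"
  using str_arr[OF str_nshuffle[OF den_op.hyps(6) den_op.prems]] by simp
 moreover have ac: "arr (ntmor M ?c) & src (ntmor M ?c) = ob (om F) (njoin (map ce Gs)) & tgt (ntmor M ?c) = ob (om F) (njoin (map shape vs))"
 proof -
  have "map src ?c = map (ob (om F)) (map ce Gs)" "map tgt ?c = map (ob (om F)) (map shape vs)"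
   by (rule nth_equalityI; use cn len in simp)+
  moreover have "arr m" if "m \<in> set ?c" for m using that cn len by (auto simp: in_set_conv_nth set_zip)
  ultimately show ?thesis using ntmor_arr[of ?c] by (simp only: ntobj_njoin)
 qed
 moreover have aa: "arr (ntmor M (map (ar F) vs)) & src (ntmor M (map (ar F) vs)) = ob (om F) (njoin (map shape vs)) &
   tgt (ntmor M (map (ar F) vs)) = ntobj M (map (ty_obj M) (op_args T f))"
 proof -
  have "map src (map (ar F) vs) = map (ob (om F)) (map shape vs)" "map tgt (map (ar F) vs) = map (ty_obj M) (op_args T f)"
   by (rule nth_equalityI; use oa len in simp)+
  moreover have "arr m" if "m \<in> set (map (ar F) vs)" for m using that oa len by (auto simp: in_set_conv_nth)
  ultimately show ?thesis using ntmor_arr[of "map (ar F) vs"] by (simp only: ntobj_njoin)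
 qed
 ultimately show ?case using op_mor_hom[OF den_op(1)] by (simp add: hom_iff)
next
 case (den_lam G x A v B m)
 have w: "wty T (G @ [(x, A)]) v B" using den_lam.hyps denotes_typed typed_iff by blast
 let ?F = "F(Free x := A)"
 have x: "x \<notin> ctx_vars G" using w by (auto simp: wty_def)
 have "set_ty A \<subseteq> ground T" using wty_ground[OF w, of x A] by simp
 then have F': "agr ?F (G @ [(x, A)])" using den_lam.prems x by (auto simp: agr_def ctx_vars_def)
 have st: "str (om ?F) (EJoin (ce G) (Leaf (Free x))) (ce (G @ [(x, A)])) (jn M G A)" by (rule str_jn[OF F'])
 have c: "is_ctx (G @ [(x, A)])" using w by (simp add: wty_def)
 then have j: "jn M G A = can (om ?F) (EJoin (ce G) (Leaf (Free x))) (ce (G @ [(x, A)]))"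
  using can_eq[OF st] by (simp add: is_ctx_names)
 have u: "uses v = add_mset (Free x) (names G)" using w by (simp add: wty_def)
 have "wfe (om ?F) (EJoin (ce G) (Leaf (Free x)))" using str_wf[OF st] by blast
 then have "m \<cdot> jn M G A = ar ?F v \<cdot> can (om ?F) (EJoin (ce G) (Leaf (Free x))) (shape v)"
  unfolding j den_lam.IH[OF F'] using u c ar_arr_simps[OF agr_okt[OF w F']]
  by (intro can_can_arr) (auto simp: is_ctx_names)
 then show ?case using ar_Lam[OF w den_lam.prems F'] ctx_obj_ce[OF den_lam.prems] by simp
next
 case (den_pm G v A B m H x y w C n E s)
 have wv: "wty T G v (Tensor A B)" and w: "wty T (H @ [(x, A), (y, B)]) w C"
  using den_pm.hyps denotes_typed typed_iff by blast+
 note sh = shuffle_mor_shuffles[OF den_pm.hyps(4)]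
 have F: "agr F G" "agr F H" using den_pm.prems agr_shuffles[OF sh] by auto
 let ?F = "F(Free x := A, Free y := B)"
 have x: "x \<notin> ctx_vars H" "y \<notin> ctx_vars H" "x \<noteq> y" using w by (auto simp: wty_def)
 have gA: "set_ty A \<subseteq> ground T" "set_ty B \<subseteq> ground T" using wty_ground[OF w, of x A] wty_ground[OF w, of y B] by simp_all
 then have F': "agr ?F (H @ [(x, A), (y, B)])" using F x by (auto simp: agr_def ctx_vars_def)
 have c: "is_ctx (H @ [(x, A), (y, B)])" using w by (simp add: wty_def)
 have F'': "agr ?F (H @ [(x, A)])" "agr ?F H" using F' by simp_all
 have co: "ctx_obj M H = ob (om ?F) (ce H)" by (rule ctx_obj_ce[OF F''(2)])
 have tA: "ty_obj M A = ob (om ?F) (Leaf (Free x))" "ty_obj M B = ob (om ?F) (Leaf (Free y))" using x by (auto simp: om_def)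
 have wt: "wfe (om ?F) (Leaf (Free x))" "wfe (om ?F) (Leaf (Free y))" "wfe (om ?F) (ce H)"
  using gA x wfe_ce[OF F''(2)] by (auto simp: om_def)
 let ?Q = "EJoin (EJoin (Leaf (Free x)) (Leaf (Free y))) (ce H)"
 have j1: "str (om ?F) (EJoin (ce H) (Leaf (Free x))) (ce (H @ [(x, A)])) (jn M H A)" by (rule str_jn[OF F''(1)])
 have j2: "str (om ?F) (EJoin (ce (H @ [(x, A)])) (Leaf (Free y))) (ce (H @ [(x, A), (y, B)])) (jn M (H @ [(x, A)]) B)"
  using str_jn[of ?F "H @ [(x, A)]" y B] F' by simp
 \<comment> \<open>The purely structural part of \<open>den_pm\<close> between the scrutinee and the
   body: it turns a pair beside the context \<open>H\<close> into the context extended by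
   \<open>x\<close> and \<open>y\<close>.\<close>
 let ?X = "jn M (H @ [(x, A)]) B \<cdot> (jn M H A \<otimes> \<i> (ty_obj M B)) \<cdot>
    inv_arr M (\<a> (ctx_obj M H) (ty_obj M A) (ty_obj M B)) \<cdot> \<s> (ty_obj M (Tensor A B)) (ctx_obj M H)"
 have st: "str (om ?F) ?Q (ce (H @ [(x, A), (y, B)])) ?X"
  unfolding co ty_obj.simps tA ob.simps(3)[symmetric]
  apply (rule str_comp[OF _ j2])
  apply (rule str_comp[OF _ str_ten[OF j1 str_id]])
   apply (rule str_comp[OF _ str_asc_inv])
    apply (rule str_swap)
  using wt by auto
 have X: "?X = can (om ?F) ?Q (ce (H @ [(x, A), (y, B)]))"
  using can_eq[OF st] c by (simp add: is_ctx_names)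
 have u: "uses w = add_mset (Free x) (add_mset (Free y) (names H))" "uses v = names G" using w wv by (auto simp: wty_def)
 note s = can_shuffle[OF den_pm.hyps(4) den_pm.prems den_pm.hyps(3)]
 have n: "names E = names G + names H" using names_shuffles[OF sh] .
 have un: "uniq (names G + names H)" using den_pm.hyps(3) n by (simp add: is_ctx_names)
 note wc = wfe_ce[OF F(1)] wfe_ce[OF F(2)] wfe_ce[OF den_pm.prems] and wQ = str_wf[OF st, THEN conjunct1]
 have m: "m = ar F v \<cdot> can (om F) (ce G) (shape v)" using den_pm.IH(1)[OF F(1)] .
 have nX: "n \<cdot> ?X = ar ?F w \<cdot> can (om ?F) ?Q (shape w)"
  unfolding X den_pm.IH(2)[OF F'] using u c ar_arr_simps[OF agr_okt[OF w F']] wQ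
  by (intro can_can_arr) (auto simp: is_ctx_names)
 note aw = ar_arr_simps[OF agr_okt[OF w F']] and av = ar_arr_simps[OF agr_okt[OF wv F(1)]]
 have an: "arr n & src n = ob (om ?F) (ce (H @ [(x, A), (y, B)]))"
  unfolding den_pm.IH(2)[OF F'] using aw wfe_ce[OF F'] u by simp
 note aX = str_arr[OF st]
 have am: "arr m & src m = ob (om F) (ce G) & tgt m = ty_obj M A \<odot> ty_obj M B" unfolding m using av wc u by simp
 have co': "ctx_obj M H = ob (om F) (ce H)" by (rule ctx_obj_ce[OF F(2)])
 have as: "arr s & src s = ob (om F) (ce E) & tgt s = ob (om F) (ce G) \<odot> ctx_obj M H" unfolding s using wc n co' by simp
 have tt: "ty_obj M A \<in> obj M" "ty_obj M B \<in> obj M" "ctx_obj M H \<in> obj M" using gA co' wc by auto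
 have aj: "arr (jn M H A) & src (jn M H A) = ctx_obj M H \<odot> ty_obj M A & tgt (jn M H A) = ob (om ?F) (ce (H @ [(x, A)]))"
  using str_arr[OF j1] unfolding co tA by simp
 have aj2: "arr (jn M (H @ [(x, A)]) B) & src (jn M (H @ [(x, A)]) B) = ob (om ?F) (ce (H @ [(x, A)])) \<odot> ty_obj M B &
   tgt (jn M (H @ [(x, A)]) B) = ob (om ?F) (ce (H @ [(x, A), (y, B)]))"
  using str_arr[OF j2] unfolding tA by simp
 have "n \<cdot> jn M (H @ [(x, A)]) B \<cdot> (jn M H A \<otimes> \<i> (ty_obj M B)) \<cdot>
    inv_arr M (\<a> (ctx_obj M H) (ty_obj M A) (ty_obj M B)) \<cdot> \<s> (ty_obj M (Tensor A B)) (ctx_obj M H) \<cdot>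
    (m \<otimes> \<i> (ctx_obj M H)) \<cdot> s = (n \<cdot> ?X) \<cdot> (m \<otimes> \<i> (ctx_obj M H)) \<cdot> s"
  using an am as tt aj aj2 by simp
 also have "... = (ar F (Pm v x y w) \<cdot> can (om F) (EJoin (ce G) (ce H)) (shape (Pm v x y w))) \<cdot> s"
 proof -
  have dis: "ctx_vars G \<inter> ctx_vars H = {}" using un unfolding uniq_union by (metis Free_in_names disjoint_iff)
  have "arr (ar ?F w)" "arr (can (om ?F) ?Q (shape w))" "src (ar ?F w) = tgt (can (om ?F) ?Q (shape w))"
   "src (can (om ?F) ?Q (shape w)) = (ty_obj M A \<odot> ty_obj M B) \<odot> ctx_obj M H"
   using aw can_arr[OF wQ, of "shape w"] u by (auto simp: co tA)
  then show ?thesis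
   unfolding nX ar_Pm[OF wv w F F' dis] m[symmetric] co'[symmetric]
   using am as tt by simp
 qed
 also have "... = ar F (Pm v x y w) \<cdot> can (om F) (ce E) (shape (Pm v x y w))"
 proof -
  have "typed T E (Pm v x y w) C" using sh wv w den_pm.hyps(3) typed_iff ty_pm by metis
  then have wp: "wty T E (Pm v x y w) C" by (simp add: typed_iff)
  then have "uses (Pm v x y w) = names E" by (simp add: wty_def)
  then show ?thesis unfolding s using ar_arr_simps[OF agr_okt[OF wp den_pm.prems]] n un wc
   by (intro can_can_arr) simp_all
 qed
 finally show ?case .
qed

end

subsection \<open>Typing up to exchange\<close>

lemma append_in_shuffles: "G @ H \<in> shuffles G H"
 by (induction G) (auto intro: Cons_in_shuffles_leftI)

lemma is_ctx_sub: "is_ctx E ==> mset G \<subseteq># mset E ==> is_ctx G"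
 unfolding is_ctx_names names_def using uniq_subset image_mset_subseteq_mono by blast

lemma typed_perm: "typed T G v A ==> mset H = mset G ==> typed T H v A"
 using typed_iff wty_perm by metis

lemma typed_is_ctx: "typed T G v A ==> is_ctx G"
 by (simp add: typed_iff wty_def)

text \<open>With exchange at hand only the multiset of a context counts, so that plain concatenation
  can serve as the shuffle. The same device gives the rules for the other constructors.\<close>

lemma typed_Ten:
 assumes "typed T G v A" "typed T H w B" "is_ctx E" "mset E = mset G + mset H"
 shows "typed T E (Ten v w) (Tensor A B)"
proof (rule typed_perm)
 have "is_ctx (G @ H)" using assms is_ctx_mset[of "G @ H" E] by simp
 then show "typed T (G @ H) (Ten v w) (Tensor A B)" using assms append_in_shuffles ty_pair by metis
qed (use assms in simp)

lemma typed_LetStar: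
 assumes "typed T G v TUnit" "typed T H w B" "is_ctx E" "mset E = mset G + mset H"
 shows "typed T E (LetStar v w) B"
proof (rule typed_perm)
 have "is_ctx (G @ H)" using assms is_ctx_mset[of "G @ H" E] by simp
 then show "typed T (G @ H) (LetStar v w) B" using assms append_in_shuffles ty_letstar by metis
qed (use assms in simp)

lemma typed_App:
 assumes "typed T G v (Lolli A B)" "typed T H w A" "is_ctx E" "mset E = mset G + mset H"
 shows "typed T E (App v w) B"
proof (rule typed_perm)
 have "is_ctx (G @ H)" using assms is_ctx_mset[of "G @ H" E] by simp
 then show "typed T (G @ H) (App v w) B" using assms append_in_shuffles ty_app by metis
qed (use assms in simp)

lemma typed_Pm:
 assumes "typed T G v (Tensor A B)" "typed T H' w C" "mset H' = mset H + {#(x, A), (y, B)#}"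
  "is_ctx E" "mset E = mset G + mset H"
 shows "typed T E (Pm v x y w) C"
proof (rule typed_perm)
 have "is_ctx (G @ H)" using assms is_ctx_mset[of "G @ H" E] by simp
 moreover have "typed T (H @ [(x, A), (y, B)]) w C" by (rule typed_perm[OF assms(2)]) (simp add: assms(3))
 ultimately show "typed T (G @ H) (Pm v x y w) C" using assms append_in_shuffles ty_pm by metis
qed (use assms in simp)

lemma image_mset_sum_list: "image_mset h (sum_list (map k xs)) = sum_list (map (%x. image_mset h (k x)) xs)"
 by (induction xs) auto

lemma typed_subst:
 assumes v: "typed T G v A"
  and s: "\<And>x C. (x, C) \<in> set G ==> typed T (D x) (s x) C"
  and m: "mset E = sum_list (map (%p. mset (D (fst p))) G)" and E: "is_ctx E"
 shows "typed T E (subst s v) A"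
 unfolding typed_iff
proof (rule wty_subst)
 show "wty T G v A" using v typed_iff by blast
 have s': "wty T (D x) (s x) C" if "(x, C) \<in> set G" for x C using s[OF that] typed_iff by blast
 have sub: "set (D x) \<subseteq> set E" if x: "x \<in> ctx_vars G" for x
 proof -
  obtain p where "p \<in> set G" "fst p = x" using x unfolding ctx_vars_def by blast
  then have "mset (D x) \<in> set (map (%p. mset (D (fst p))) G)" by auto
  then have "q \<in># mset E" if "q \<in> set (D x)" for q
   unfolding m in_sum_list using that by (metis set_mset_mset)
  then show ?thesis by auto
 qed
 show "lc (s x) & lin (s x) & hty T (env E) (s x) C" if "(x, C) \<in> set G" for x C
  using s'[OF that] wty_lc[OF s'[OF that]] wty_hty_mono[OF s'[OF that] E sub[OF ctx_varsI[OF that]]]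
  by (simp add: wty_def)
 have "map (%p. uses (s (fst p))) G = map (%p. names (D (fst p))) G"
  using s' unfolding wty_def by (metis (no_types, lifting) map_eq_conv prod.collapse)
 moreover have "names E = image_mset (%p. Free (fst p)) (sum_list (map (%p. mset (D (fst p))) G))"
  by (simp add: names_def m)
 ultimately show "sum_list (map (%p. uses (s (fst p))) G) = names E"
  by (simp add: image_mset_sum_list names_def cong: map_cong)
qed fact

lemma typed_ground: "typed T G v C ==> (y, D) \<in> set G ==> set_ty D \<subseteq> ground T"
 using wty_ground typed_iff by metis

lemma typed_subst1:
 assumes "typed T G' v C" "mset G' = add_mset (x, A) (mset G)" "typed T H w A" "is_ctx E" "mset E = mset G + mset H"
 shows "typed T E (v[x ::= w]) C"
 unfolding typed_iff
 by (rule wty_subst1[of T G x A v C H w E]) (use assms typed_perm[OF assms(1), of "G @ [(x, A)]"] in \<open>simp_all add: typed_iff\<close>)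

lemma typed_subst2:
 assumes u: "typed T (J @ [(x, A), (y, B)]) u C" and v: "typed T G v A" and w: "typed T H w B"
  and E: "is_ctx E" "mset E = mset G + mset H + mset J"
 shows "typed T E (u[x ::= v, y ::= w]) C"
proof (rule typed_subst[OF u])
 have xy: "x \<noteq> y" "x \<notin> ctx_vars J" "y \<notin> ctx_vars J" using typed_is_ctx[OF u] by auto
 let ?D = "%z. if z = x then G else if z = y then H else [(z, the (map_of J z))]"
 show "typed T (?D z) ((Var(x := v, y := w)) z) D" if "(z, D) \<in> set (J @ [(x, A), (y, B)])" for z D
 proof -
  from that consider "z = x" "D = A" | "z = y" "D = B" | "z \<noteq> x" "z \<noteq> y" "(z, D) \<in> set J"
   using xy by (auto dest: ctx_varsI)
  then show ?thesis
  proof cases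
   case 3
   then have "map_of J z = Some D" using typed_is_ctx[OF u] by (simp add: is_ctx_def)
   then show ?thesis using 3 ty_var[of D T z] typed_ground[OF u, of z D] by simp
  qed (use v w xy in auto)
 qed
 have "sum_list (map (%p. mset (?D (fst p))) J') = mset J'" if "set J' \<subseteq> set J" for J'
  using that
 proof (induction J')
  case (Cons p J')
  then have "map_of J (fst p) = Some (snd p)" "fst p \<in> ctx_vars J"
   using typed_is_ctx[OF u] by (auto simp: is_ctx_def ctx_vars_def)
  then show ?case using Cons xy by auto
 qed simp
 from this[OF order_refl] show "mset E = sum_list (map (%p. mset (?D (fst p))) (J @ [(x, A), (y, B)]))"
  using E xy by (simp add: ac_simps)
qed fact

lemma typed_res_ground:
 "(\<And>f. f \<in> ops T ==> set_ty (op_res T f) \<subseteq> ground T) ==> typed T G v A ==> set_ty A \<subseteq> ground T"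
 unfolding typed_iff wty_def using hty_res_ground by blast

lemma lam_eq_typed:
 assumes ops: "\<And>f. f \<in> ops T ==> set_ty (op_res T f) \<subseteq> ground T" and "lam_eq T E v w C"
 shows "typed T E v C & typed T E w C"
 using assms(2)
proof cases
 case (pm_beta G v' A H w' B J x y u)
 have m: "mset E = mset G + mset H + mset J" using mset_nshuffles[OF pm_beta(7)] by (simp add: ac_simps)
 have c: "is_ctx (G @ H)" by (rule is_ctx_sub[OF pm_beta(6)]) (simp add: m)
 have "typed T (G @ H) (Ten v' w') (Tensor A B)" by (rule typed_Ten[OF pm_beta(3,4) c]) simp
 then show ?thesis unfolding pm_beta(1,2)
  using typed_Pm[OF _ pm_beta(5)] typed_subst2[OF pm_beta(5,3,4)] pm_beta(6) m by simp
next
 case (pm_eta G v' A B H z u x y)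
 have m: "mset E = mset G + mset H" using mset_shuffles[OF pm_eta(9)] .
 have g: "set_ty (Tensor A B) \<subseteq> ground T" using typed_ground[OF pm_eta(4), of z "Tensor A B"] by simp
 then have t: "typed T [(x, A), (y, B)] (Ten (Var x) (Var y)) (Tensor A B)"
  using pm_eta(5) by (intro typed_Ten[of T "[(x, A)]" _ _ "[(y, B)]"] ty_var) auto
 have c: "is_ctx (H @ [(x, A), (y, B)])" using typed_is_ctx[OF pm_eta(4)] pm_eta(5-7) by auto
 have "typed T (H @ [(x, A), (y, B)]) (u[z ::= Ten (Var x) (Var y)]) C"
  by (rule typed_subst1[OF pm_eta(4) _ t c]) simp_all
 then show ?thesis unfolding pm_eta(1,2)
  using typed_Pm[OF pm_eta(3)] typed_subst1[OF pm_eta(4) _ pm_eta(3,8)] pm_eta(8) m by (simp add: ac_simps)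
next
 case star_beta
 then show ?thesis using typed_LetStar[OF ty_star] typed_is_ctx by fastforce
next
 case (star_eta G v' H z w')
 have m: "mset E = mset G + mset H" using mset_shuffles[OF star_eta(6)] .
 have c: "is_ctx H" using typed_is_ctx[OF star_eta(4)] by auto
 have "typed T H (w'[z ::= Star]) C" by (rule typed_subst1[OF star_eta(4) _ ty_star c]) simp_all
 then show ?thesis unfolding star_eta(1,2)
  using typed_LetStar[OF star_eta(3)] typed_subst1[OF star_eta(4) _ star_eta(3,5)] star_eta(5) m by (simp add: ac_simps)
next
 case (lam_beta G x A v' H w')
 have m: "mset E = mset G + mset H" using mset_shuffles[OF lam_beta(6)] .
 show ?thesis unfolding lam_beta(1,2)
  using typed_App[OF ty_lam[OF lam_beta(3)] lam_beta(4,5) m] typed_subst1[OF lam_beta(3) _ lam_beta(4,5)] m by simp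
next
 case (lam_eta A B x)
 have "typed T (E @ [(x, A)]) (App w (Var x)) B"
 proof (rule typed_App[OF lam_eta(3)])
  \<comment> \<open>The variable rule asks that \<open>A\<close> be built over the ground types.
    This is known only from the type of \<open>w\<close>, hence the hypothesis on the result types
    of operations.\<close>
  have "set_ty (Lolli A B) \<subseteq> ground T" by (rule typed_res_ground[OF ops lam_eta(3)])
  then show "typed T [(x, A)] (Var x) A" by (intro ty_var) auto
  show "is_ctx (E @ [(x, A)])" using typed_is_ctx[OF lam_eta(3)] lam_eta(4) by simp
 qed simp
 then show ?thesis unfolding lam_eta(1,2) using ty_lam lam_eta(3) by blast
next
 case (star_comm G v' H w' A J z u)
 have m: "mset E = mset G + mset H + mset J" using mset_nshuffles[OF star_comm(7)] by (simp add: ac_simps)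
 have c: "is_ctx (G @ H)" "is_ctx (H @ J)" by (rule is_ctx_sub[OF star_comm(6)]; simp add: m)+
 have "typed T (G @ H) (LetStar v' w') A" by (rule typed_LetStar[OF star_comm(3,4) c(1)]) simp
 moreover have "typed T (H @ J) (u[z ::= w']) C" by (rule typed_subst1[OF star_comm(5) _ star_comm(4) c(2)]) (simp_all add: ac_simps)
 ultimately show ?thesis unfolding star_comm(1,2)
  using typed_LetStar[OF star_comm(3) _ star_comm(6)] typed_subst1[OF star_comm(5) _ _ star_comm(6)] m by (simp add: ac_simps)
next
 case (pm_comm G v' A B H x y w' D J z u)
 have m: "mset E = mset G + mset H + mset J" using mset_nshuffles[OF pm_comm(9)] by (simp add: ac_simps)
 have c: "is_ctx (G @ H)" "is_ctx (H @ J)" by (rule is_ctx_sub[OF pm_comm(8)]; simp add: m)+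
 have t: "typed T (G @ H) (Pm v' x y w') D" by (rule typed_Pm[OF pm_comm(3,4) _ c(1)]) simp_all
 have c': "is_ctx (H @ J @ [(x, A), (y, B)])" using c(2) typed_is_ctx[OF pm_comm(4)] pm_comm(6,7) by auto
 have "typed T (H @ J @ [(x, A), (y, B)]) (u[z ::= w']) C" by (rule typed_subst1[OF pm_comm(5) _ pm_comm(4) c']) (simp_all add: ac_simps)
 then show ?thesis unfolding pm_comm(1,2)
  using typed_Pm[OF pm_comm(3) _ _ pm_comm(8), of "H @ J @ [(x, A), (y, B)]" "u[z ::= w']" C "H @ J"] typed_subst1[OF pm_comm(5) _ t pm_comm(8)] m by (simp add: ac_simps)
qed

subsection \<open>Soundness\<close>

context symmetric_monoidal_cat
begin

lemma lunit_unit_tensor: "X \<in> obj C ==> \<l> (\<one> \<odot> X) = \<i> \<one> \<otimes> \<l> X"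
 by (rule iso_cancel_left[of "\<l> X"]) (use l_nat[of "\<l> X"] in auto)

end

context lam_interp
begin

text \<open>The denotation read from an arbitrary arrangement \<open>e\<close> of the variables.
  Working from the arrangement that an equation suggests avoids most associativity;
  \<open>Dn_pre\<close> changes from one to another.\<close>

definition Dn :: "(name => 'g ty) => name ex => ('g, 'f) tm => ('o, 'u) arr" where
 "Dn F e v = ar F v \<cdot> can (om F) e (shape v)"

definition dok :: "(name => 'g ty) => name ex => ('g, 'f) tm => 'g ty => bool" where
 "dok F e v A \<longleftrightarrow> okt T F v A & wfe (om F) e & leaves e = uses v"

lemma Dn_arr:
 assumes "dok F e v A"
 shows "arr (Dn F e v)" "src (Dn F e v) = ob (om F) e" "tgt (Dn F e v) = ty_obj M A"
 using assms ar_arr_simps[of F v A] can_arr[of "om F" e "shape v"] by (auto simp: Dn_def dok_def)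

lemma Dn_pre: "dok F e v A ==> leaves d = leaves e ==> Dn F d v = Dn F e v \<cdot> can (om F) d e"
 unfolding Dn_def dok_def
 by (intro can_can_arr[symmetric]) (auto simp: ar_arr_simps okt_def wfe_def)

lemma dok_wty: "wty T G v A ==> agr F G ==> dok F (ce G) v A"
 by (auto simp: dok_def wfe_ce intro: agr_okt) (simp add: wty_def)

lemma dok_join: "dok F e v A ==> wfe (om F) e"
 by (simp add: dok_def)

lemma Dn_join:
 assumes v: "dok F e v A" and w: "dok F d w B" and u: "uniq (leaves e + leaves d)"
 shows "(ar F v \<otimes> ar F w) \<cdot> can (om F) (EJoin e d) (EJoin (shape v) (shape w)) = Dn F e v \<otimes> Dn F d w"
proof -
 have "can (om F) (EJoin e d) (EJoin (shape v) (shape w)) = can (om F) e (shape v) \<otimes> can (om F) d (shape w)"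
  using v w u by (intro can_ten[symmetric]) (auto simp: dok_def)
 then show ?thesis using v w ar_arr_simps[of F v A] ar_arr_simps[of F w B]
   can_arr[of "om F" e "shape v"] can_arr[of "om F" d "shape w"] by (simp add: Dn_def dok_def)
qed

lemma can_join_arr:
 assumes v: "dok F e v A" and w: "dok F d w B"
 shows "arr (can (om F) (EJoin e d) (EJoin (shape v) (shape w)))"
  "src (can (om F) (EJoin e d) (EJoin (shape v) (shape w))) = ob (om F) e \<odot> ob (om F) d"
  "tgt (can (om F) (EJoin e d) (EJoin (shape v) (shape w))) = ob (om F) (shape v) \<odot> ob (om F) (shape w)"
 using can_arr[of "om F" "EJoin e d" "EJoin (shape v) (shape w)"] assms by (auto simp: dok_def)

lemma Dn_Ten:
 assumes "dok F e v A" "dok F d w B" "uniq (leaves e + leaves d)"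
 shows "Dn F (EJoin e d) (Ten v w) = Dn F e v \<otimes> Dn F d w"
 using Dn_join[OF assms] by (simp add: Dn_def[of F "EJoin e d"])

lemma Dn_LetStar:
 assumes "dok F e v TUnit" "dok F d w B" "uniq (leaves e + leaves d)"
 shows "Dn F (EJoin e d) (LetStar v w) = \<l> (ty_obj M B) \<cdot> (Dn F e v \<otimes> Dn F d w)"
 using assms can_join_arr[OF assms(1,2)] ar_arr_simps[of F v TUnit] ar_arr_simps[of F w B] okt_obj[of F w B]
 unfolding Dn_join[OF assms, symmetric] by (simp add: Dn_def[of F "EJoin e d"] dok_def)

lemma Dn_App:
 assumes "dok F e v (Lolli A B)" "dok F d w A" "uniq (leaves e + leaves d)"
 shows "Dn F (EJoin e d) (App v w) = eval_at M (ty_obj M A) (ty_obj M B) \<cdot> (Dn F e v \<otimes> Dn F d w)"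
proof -
 have "tyof T F v = Lolli A B" using assms(1) by (simp add: dok_def okt_def tyof_eq)
 moreover have "set_ty (Lolli A B) \<subseteq> ground T" using assms(1) hty_res_ground' unfolding dok_def okt_def by blast
 ultimately show ?thesis
  using assms can_join_arr[OF assms(1,2)] ar_arr_simps[of F v "Lolli A B"] ar_arr_simps[of F w A]
  unfolding Dn_join[OF assms, symmetric] by (simp add: Dn_def[of F "EJoin e d"] dok_def)
qed

lemma Dn_Lam:
 assumes "wty T (G @ [(x, A)]) v B" "agr F G" "agr F' (G @ [(x, A)])"
 shows "Dn F (ce G) (Lam x A v) =
  curry_at M (ty_obj M A) (ob (om F) (ce G)) (ty_obj M B) (Dn F' (EJoin (ce G) (Leaf (Free x))) v)"
 using ar_Lam[OF assms] by (simp add: Dn_def)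

lemma wty_ce: "wty T G v A ==> uses v = names G"
 by (simp add: wty_def)

lemma ob_agr: "agr F G ==> agr F' G ==> ob (om F') (ce G) = ob (om F) (ce G)"
 using ctx_obj_ce by metis

lemma Dn_Pm:
 assumes v: "dok F e v (Tensor A B)" and wv: "wty T G v (Tensor A B)" "agr F G"
  and w: "wty T (H @ [(x, A), (y, B)]) w C" and F: "agr F H" and F': "agr F' (H @ [(x, A), (y, B)])"
  and dis: "uniq (leaves e + names H)"
 shows "Dn F (EJoin e (ce H)) (Pm v x y w) =
  Dn F' (EJoin (EJoin (Leaf (Free x)) (Leaf (Free y))) (ce H)) w \<cdot> (Dn F e v \<otimes> \<i> (ob (om F) (ce H)))"
proof -
 let ?Q = "EJoin (EJoin (Leaf (Free x)) (Leaf (Free y))) (ce H)"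
 have le: "leaves e = names G" using v wv by (simp add: dok_def wty_def)
 have dis': "ctx_vars G \<inter> ctx_vars H = {}" using dis unfolding le uniq_union by (metis Free_in_names disjoint_iff)
 have v': "dok F (ce G) v (Tensor A B)" using dok_wty wv by blast
 have "is_ctx (G @ H)" using wv(1) w dis' by (auto simp: wty_def)
 then have "typed T (G @ H) (Pm v x y w) C"
  by (intro typed_Pm[of T G v A B "H @ [(x, A), (y, B)]"]) (use wv w in \<open>simp_all add: typed_iff\<close>)
 then have pm: "wty T (G @ H) (Pm v x y w) C" by (simp add: typed_iff)
 then have "okt T F (Pm v x y w) C" using F wv(2) by (intro agr_okt[OF pm]) simp
 then have d: "dok F (EJoin (ce G) (ce H)) (Pm v x y w) C"
  using wty_ce[OF pm] wfe_ce F wv(2) by (simp add: dok_def)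
 have w': "dok F' ?Q w C"
  using wfe_ce[OF F'] wty_ce[OF w] agr_okt[OF w F'] F' wfe_ce[of F' H] by (simp add: dok_def om_def)
 have x: "om F' (Free x) = ty_obj M A" "om F' (Free y) = ty_obj M B" using F' by (auto simp: om_def)
 have "Dn F (EJoin e (ce H)) (Pm v x y w) = Dn F (EJoin (ce G) (ce H)) (Pm v x y w) \<cdot> can (om F) (EJoin e (ce H)) (EJoin (ce G) (ce H))"
  by (rule Dn_pre[OF d]) (simp add: le)
 also have "can (om F) (EJoin e (ce H)) (EJoin (ce G) (ce H)) = can (om F) e (ce G) \<otimes> \<i> (ob (om F) (ce H))"
  using v F dis le by (intro can_ident_ten(1)[symmetric]) (auto simp: dok_def wfe_ce)
 also have "Dn F (EJoin (ce G) (ce H)) (Pm v x y w) = Dn F' ?Q w \<cdot> (Dn F (ce G) v \<otimes> \<i> (ob (om F) (ce H)))"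
  using ar_Pm[OF wv(1) w wv(2) F F' dis'] Dn_arr[OF w'] Dn_arr[OF v']
   ar_arr_simps[OF agr_okt[OF w F']] can_arr[of "om F'" ?Q "shape w"] w' ob_agr[of F H F'] F F' x wfe_ce[OF F]
  by (simp add: Dn_def dok_def)
 also have "... \<cdot> (can (om F) e (ce G) \<otimes> \<i> (ob (om F) (ce H))) =
   Dn F' ?Q w \<cdot> ((Dn F (ce G) v \<cdot> can (om F) e (ce G)) \<otimes> \<i> (ob (om F) (ce H)))"
  using Dn_arr[OF w'] Dn_arr[OF v'] can_arr[of "om F" e "ce G"] dok_join[OF v] le ob_agr[of F H F'] F F' x wfe_ce[OF F]
  by simp
 also have "Dn F (ce G) v \<cdot> can (om F) e (ce G) = Dn F e v"
  using Dn_pre[OF v', of e] le by simp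
 finally show ?thesis .
qed

lemma Dn_subst:
 assumes u: "okt T F' u A" and s: "\<And>l. l \<in># uses u ==> sok F F' s l"
  and Q: "leaves Q = uses u" "wfe (om F') Q" and un: "uniq (leaves (esub (sh s) Q))"
 shows "Dn F (esub (sh s) Q) (subst s u) = Dn F' Q u \<cdot> earr (sa F s) Q"
proof -
 have lc: "lc (s x)" if "Free x \<in># uses u" for x using s[OF that] by simp
 have sh: "shape (subst s u) = esub (sh s) (shape u)" using lc by (intro shape_subst)
 have l: "leaves (esub (sh s) Q) = leaves (esub (sh s) (shape u))" by (simp add: leaves_esub Q)
 have "ar F (subst s u) = ar F' u \<cdot> earr (sa F s) (shape u)"
  using u s un by (intro ar_subst) (simp_all add: sh l)
 moreover have "can (om F') Q (shape u) \<cdot> earr (sa F s) Q = earr (sa F s) (shape u) \<cdot> can (om F) (esub (sh s) Q) (esub (sh s) (shape u))"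
  using u un s Q by (intro can_sa) (auto simp: okt_def l)
 moreover note earr_sa[OF okt_wfe[OF u] s] earr_sa[OF Q(2), of F s]
 moreover note ar_arr_simps[OF u] can_arr[OF Q(2,1)] can_arr[OF _ l, of "om F"]
 ultimately show ?thesis using s Q by (simp add: Dn_def sh)
qed

lemma esub_sh_ce: "(\<And>x. x \<in> ctx_vars J ==> s x = Var x) ==> esub (sh s) (ce J) = ce J"
 by (rule esub_ce_ident) simp

lemma earr_sa_ce: "(\<And>x. x \<in> ctx_vars J ==> s x = Var x) ==> agr F J ==> earr (sa F s) (ce J) = \<i> (ob (om F) (ce J))"
 by (rule earr_ident) (auto simp: wfe_ce in_names)

lemma sok_Var:
 assumes "agr F J" "agr F' J" "s x = Var x" "x \<in> ctx_vars J"
 shows "sok F F' s (Free x)"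
proof -
 obtain A where "(x, A) \<in> set J" using assms(4) by (auto simp: ctx_vars_def)
 then have "F (Free x) = A" "F' (Free x) = A" "set_ty A \<subseteq> ground T"
  using assms(1,2) unfolding agr_def by fastforce+
 then show ?thesis using assms(3) by (simp add: lc_def okt_def)
qed

text \<open>Two arrangements are provided because \<open>LetStar\<close> and \<open>Pm\<close> have
  the scrutinee to the left of the remaining context, while an abstraction has its variable to the
  right.\<close>

lemma Dn_subst1:
 assumes u: "wty T (J @ [(z, A)]) u C" and F: "agr F J" and F': "agr F' (J @ [(z, A)])"
  and v: "dok F d v A" "lc v" and un: "uniq (leaves d + names J)"
 shows "Dn F (EJoin d (ce J)) (u[z ::= v]) = Dn F' (EJoin (Leaf (Free z)) (ce J)) u \<cdot> (Dn F d v \<otimes> \<i> (ob (om F) (ce J)))"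
  and "Dn F (EJoin (ce J) d) (u[z ::= v]) = Dn F' (EJoin (ce J) (Leaf (Free z))) u \<cdot> (\<i> (ob (om F) (ce J)) \<otimes> Dn F d v)"
  and "okt T F (u[z ::= v]) C" and "uses (u[z ::= v]) = leaves d + names J"
proof -
 let ?s = "Var(z := v)"
 have z: "z \<notin> ctx_vars J" using u by (auto simp: wty_def)
 then have sv: "?s x = Var x" if "x \<in> ctx_vars J" for x using that by auto
 have uu: "uses u = add_mset (Free z) (names J)" using u by (simp add: wty_def)
 have FF: "agr F' J" "F' (Free z) = A" "set_ty A \<subseteq> ground T" using F' by auto
 have s: "sok F F' ?s l" if "l \<in># uses u" for l
 proof (cases "l = Free z")
  case True
  then show ?thesis using v FF by (simp add: dok_def)
 next
  case False
  with that uu obtain x where x: "l = Free x" "x \<in> ctx_vars J" by (auto simp: in_names)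
  then show ?thesis using sok_Var[of F J F' ?s x] F FF sv x(2) by simp
 qed
 note okt = agr_okt[OF u F']
 have wf: "wfe (om F') (Leaf (Free z))" "wfe (om F') (ce J)" using FF wfe_ce by (auto simp: om_def)
 note e = esub_sh_ce[of J ?s, OF sv] and g = earr_sa_ce[of J ?s F, OF sv F]
 have lv: "leaves d = uses v" "wfe (om F) d" using v by (auto simp: dok_def)
 have wT: "wfe (om F) (ce J)" using wfe_ce[OF F] .
 have t: "arr (can (om F) d (shape v))" "src (can (om F) d (shape v)) = ob (om F) d" "tgt (can (om F) d (shape v)) = ob (om F) (shape v)"
  using can_arr[OF lv(2,1)] by auto
 have av: "arr (ar F v)" "src (ar F v) = ob (om F) (shape v)" "tgt (ar F v) = ty_obj M A"
  using v ar_arr_simps[of F v A] by (auto simp: dok_def)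
 have wv: "wfe (om F) (shape v)" using lv by (simp add: wfe_def)
 have sh: "shape (subst ?s u) = esub (sh ?s) (shape u)" using s by (intro shape_subst) fastforce
 have ul: "uses (subst ?s u) = uses v + names J"
 proof -
  have "uses (subst ?s u) = leaves (esub (sh ?s) (EJoin (Leaf (Free z)) (ce J)))"
   unfolding sh leaves_esub uu by (simp add: leaves_esub)
  then show ?thesis using e by simp
 qed
 then show "uses (u[z ::= v]) = leaves d + names J" using lv by simp
 show ok: "okt T F (u[z ::= v]) C" using okt s un lv ul by (intro okt_subst[OF okt]) auto
 let ?Q = "EJoin (Leaf (Free z)) (ce J)" and ?Q' = "EJoin (ce J) (Leaf (Free z))"
 have oa: "ob (om F') (ce J) = ob (om F) (ce J)" "om F' (Free z) = ty_obj M A" using ob_agr[OF F FF(1)] FF by (auto simp: om_def)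
 have dQ: "dok F' ?Q u C" "dok F' ?Q' u C" using okt uu wf by (auto simp: dok_def)
 have "Dn F (EJoin (shape v) (ce J)) (subst ?s u) = Dn F' ?Q u \<cdot> (ar F v \<otimes> \<i> (ob (om F) (ce J)))"
  using Dn_subst[OF okt s, of ?Q] uu wf un lv e g by simp
 moreover have "Dn F (EJoin d (ce J)) (subst ?s u) = Dn F (EJoin (shape v) (ce J)) (subst ?s u) \<cdot> can (om F) (EJoin d (ce J)) (EJoin (shape v) (ce J))"
  using ok ul wT wv lv by (intro Dn_pre[of _ _ _ C]) (auto simp: dok_def)
 moreover have "can (om F) (EJoin d (ce J)) (EJoin (shape v) (ce J)) = can (om F) d (shape v) \<otimes> \<i> (ob (om F) (ce J))"
  using lv wT un by (intro can_ident_ten(1)[symmetric]) auto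
 ultimately show "Dn F (EJoin d (ce J)) (u[z ::= v]) = Dn F' ?Q u \<cdot> (Dn F d v \<otimes> \<i> (ob (om F) (ce J)))"
  using Dn_arr[OF dQ(1)] av t oa wT by (simp add: Dn_def[of F d v])
 have "Dn F (EJoin (ce J) (shape v)) (subst ?s u) = Dn F' ?Q' u \<cdot> (\<i> (ob (om F) (ce J)) \<otimes> ar F v)"
  using Dn_subst[OF okt s, of ?Q'] uu wf un lv e g by (simp add: Int_commute)
 moreover have "Dn F (EJoin (ce J) d) (subst ?s u) = Dn F (EJoin (ce J) (shape v)) (subst ?s u) \<cdot> can (om F) (EJoin (ce J) d) (EJoin (ce J) (shape v))"
  using ok ul wT wv lv by (intro Dn_pre[of _ _ _ C]) (auto simp: dok_def)
 moreover have "can (om F) (EJoin (ce J) d) (EJoin (ce J) (shape v)) = \<i> (ob (om F) (ce J)) \<otimes> can (om F) d (shape v)"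
  using lv wT un by (intro can_ident_ten(2)[symmetric]) auto
 ultimately show "Dn F (EJoin (ce J) d) (u[z ::= v]) = Dn F' ?Q' u \<cdot> (\<i> (ob (om F) (ce J)) \<otimes> Dn F d v)"
  using Dn_arr[OF dQ(2)] av t oa wT by (simp add: Dn_def[of F d v])
qed

lemma Dn_subst2:
 assumes u: "wty T (J @ [(x, A), (y, B)]) u C" and F: "agr F J" and F': "agr F' (J @ [(x, A), (y, B)])"
  and v: "dok F d v A" "lc v" and w: "dok F e w B" "lc w" and un: "uniq (leaves d + leaves e + names J)"
 shows "Dn F (EJoin (EJoin d e) (ce J)) (u[x ::= v, y ::= w]) =
  Dn F' (EJoin (EJoin (Leaf (Free x)) (Leaf (Free y))) (ce J)) u \<cdot> ((Dn F d v \<otimes> Dn F e w) \<otimes> \<i> (ob (om F) (ce J)))"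
proof -
 let ?s = "Var(x := v, y := w)"
 have z: "x \<notin> ctx_vars J" "y \<notin> ctx_vars J" "x \<noteq> y" using u by (auto simp: wty_def)
 then have sv: "?s a = Var a" if "a \<in> ctx_vars J" for a using that by auto
 have uu: "uses u = add_mset (Free x) (add_mset (Free y) (names J))" using u by (simp add: wty_def)
 have FF: "agr F' J" "F' (Free x) = A" "F' (Free y) = B" "set_ty A \<subseteq> ground T" "set_ty B \<subseteq> ground T" using F' by auto
 have s: "sok F F' ?s l" if l: "l \<in># uses u" for l
 proof -
  consider "l = Free x" | "l = Free y" | a where "l = Free a" "a \<in> ctx_vars J" using l uu by (auto simp: in_names)
  then show ?thesis
  proof cases
   case (3 a)
   then show ?thesis using sok_Var[of F J F' ?s a] F FF sv by simp
  qed (use v w FF z in \<open>auto simp: dok_def\<close>)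
 qed
 note okt = agr_okt[OF u F']
 note e = esub_sh_ce[of J ?s, OF sv] and g = earr_sa_ce[of J ?s F, OF sv F]
 let ?Q = "EJoin (EJoin (Leaf (Free x)) (Leaf (Free y))) (ce J)"
 have wf: "wfe (om F') ?Q" using FF wfe_ce by (auto simp: om_def)
 have lv: "leaves d = uses v" "wfe (om F) d" "leaves e = uses w" "wfe (om F) e" using v w by (auto simp: dok_def)
 have wT: "wfe (om F) (ce J)" using wfe_ce[OF F] .
 have wv: "wfe (om F) (shape v)" "wfe (om F) (shape w)" using lv by (auto simp: wfe_def)
 have sh: "shape (subst ?s u) = esub (sh ?s) (shape u)" using s by (intro shape_subst) fastforce
 have ul: "uses (subst ?s u) = uses v + uses w + names J"
 proof -
  have "uses (subst ?s u) = leaves (esub (sh ?s) ?Q)"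
   unfolding sh leaves_esub uu by (simp add: leaves_esub)
  then show ?thesis using e z by simp
 qed
 have ok: "okt T F (subst ?s u) C" using okt s un lv ul by (intro okt_subst[OF okt]) auto
 have oa: "ob (om F') (ce J) = ob (om F) (ce J)" "om F' (Free x) = ty_obj M A" "om F' (Free y) = ty_obj M B" using ob_agr[OF F FF(1)] FF by (auto simp: om_def)
 have dQ: "dok F' ?Q u C" using okt uu wf by (auto simp: dok_def)
 let ?R = "EJoin (EJoin (shape v) (shape w)) (ce J)"
 have "Dn F ?R (subst ?s u) = Dn F' ?Q u \<cdot> ((ar F v \<otimes> ar F w) \<otimes> \<i> (ob (om F) (ce J)))"
  using Dn_subst[OF okt s, of ?Q] uu wf un lv e g z by simp
 moreover have "Dn F (EJoin (EJoin d e) (ce J)) (subst ?s u) = Dn F ?R (subst ?s u) \<cdot> can (om F) (EJoin (EJoin d e) (ce J)) ?R"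
  using ok ul wT wv lv by (intro Dn_pre[of _ _ _ C]) (auto simp: dok_def)
 moreover have "can (om F) (EJoin (EJoin d e) (ce J)) ?R = can (om F) (EJoin d e) (EJoin (shape v) (shape w)) \<otimes> \<i> (ob (om F) (ce J))"
  using lv wT un by (intro can_ident_ten(1)[symmetric]) auto
 moreover have "uniq (leaves d + leaves e)" using un by simp
 moreover have av: "arr (ar F v)" "src (ar F v) = ob (om F) (shape v)" "tgt (ar F v) = ty_obj M A"
   "arr (ar F w)" "src (ar F w) = ob (om F) (shape w)" "tgt (ar F w) = ty_obj M B"
  using v w ar_arr_simps[of F v A] ar_arr_simps[of F w B] by (auto simp: dok_def)
 ultimately show ?thesis
  using Dn_arr[OF dQ] oa wT Dn_join[OF v(1) w(1), symmetric] can_join_arr[OF v(1) w(1)] by simp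
qed

lemma Dn_cong:
 assumes "dok F e v A" "\<And>l. l \<in># uses v ==> F' l = F l"
 shows "Dn F' e v = Dn F e v"
proof -
 have "can (om F') e (shape v) = can (om F) e (shape v)"
  using can_rename[of "om F" e "shape v" "%l. l" "om F'"] assms by (simp add: dok_def okt_def om_def)
 then show ?thesis using ar_cong[of F v A F'] assms by (simp add: Dn_def dok_def)
qed

lemma Dn_eqI:
 assumes "wty T E v C" "wty T E w C" "agr F E" "wfe (om F) e" "leaves e = names E" "Dn F e v = Dn F e w"
 shows "Dn F (ce E) v = Dn F (ce E) w"
proof -
 have "dok F e v C" "dok F e w C" using assms agr_okt by (auto simp: dok_def wty_def)
 then show ?thesis using Dn_pre[of F e v C "ce E"] Dn_pre[of F e w C "ce E"] assms by simp
qed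

end

text \<open>Monotonicity is distributivity over the two-element set whose join is its larger
  element.\<close>

lemma quantale_mult_mono:
 fixes a b c d :: "'v::continuous_integral_quantale"
 assumes "a \<le> b" "c \<le> d"
 shows "a * c \<le> b * d"
proof -
 have mono: "x * a \<le> x * b" if "a \<le> b" for x a b :: 'v
 proof -
  have "Sup {a, b} = b" using that by (simp add: sup.absorb2)
  then have "x * b = Sup ((*) x ` {a, b})" using mult_Sup[of x "{a, b}"] by simp
  then show ?thesis by (metis Sup_upper image_eqI insertI1)
 qed
 have "a * c \<le> a * d" using mono assms by blast
 also have "... = d * a" by (simp add: mult.commute)
 also have "... \<le> d * b" using mono assms by blast
 finally show ?thesis by (simp add: mult.commute)
qed

lemma theorem_typed:
 assumes th: "linear_vlam_theory B T" and "is_theorem B T G v q w A"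
 shows "typed T G v A & typed T G w A"
 using assms(2)
proof (induction rule: is_theorem.induct)
 case (ax G v q w A)
 then show ?case using th by (fastforce simp: linear_vlam_theory_def vequation_def)
next
 case (lam_eq G v w A)
 then show ?case using lam_eq_typed th by (metis linear_vlam_theory_def)
next
 case (lam_eq_sym G v w A)
 then show ?case using lam_eq_typed th by (metis linear_vlam_theory_def)
next
 case (cong_op f Gs vs qs ws E)
 then show ?case using ty_op[of f T Gs vs E] ty_op[of f T Gs ws E] by simp
next
 case (cong_subst G x A v q w A' H v' r w' E)
 have m: "mset E = mset G + mset H" using mset_shuffles[OF cong_subst.hyps(4)] .
 show ?case using typed_subst1[of T "G @ [(x, A)]" _ A' x A G H _ E] cong_subst m by simp
next
 case (perm G v q w A H)
 then show ?case using typed_perm by metis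
qed (auto intro: typed.intros)

section \<open>Soundness of the equations of the linear \<lambda>-calculus\<close>

context lam_interp
begin

lemma denotation_Dn: "wty T G v A ==> agr F G ==> denotation T M G v A = Dn F (ce G) v"
proof -
 assume w: "wty T G v A" and F: "agr F G"
 obtain m where "denotes T M G v A m" using typed_denotes w op_args_nonempty typed_iff by metis
 moreover have "n = Dn F (ce G) v" if "denotes T M G v A n" for n
  using denotes_ar[OF that F] by (simp add: Dn_def)
 ultimately show ?thesis unfolding denotation_def by (intro the_equality) auto
qed

lemma denotes_denotation: "denotes T M G v A m ==> denotation T M G v A = m"
 using denotation_Dn denotes_ar agr_env denotes_typed typed_iff unfolding Dn_def by metis

lemma denotation_hom:
 assumes "typed T G v A"
 shows "denotation T M G v A \<in> hom M (ctx_obj M G) (ty_obj M A)"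
proof -
 have w: "wty T G v A" using assms typed_iff by blast
 show ?thesis
  using denotation_Dn[OF w agr_env[OF w]] Dn_arr[OF dok_wty[OF w agr_env[OF w]]] ctx_obj_ce[OF agr_env[OF w]]
  by (simp add: hom_iff)
qed

lemma typed_denotation: "typed T G v A ==> denotes T M G v A (denotation T M G v A)"
 using typed_denotes op_args_nonempty denotes_denotation by metis

abbreviation dn :: "'g ctx => ('g, 'f) tm => 'g ty => ('o, 'u) arr" where
 "dn \<equiv> denotation T M"

text \<open>Common preparations for the equations. By the fifth fact it is enough to compare both
  sides from any one arrangement of the context.\<close>

lemma lam_eq_pre:
 assumes "lam_eq T E v w C"
 shows "wty T E v C" "wty T E w C" "agr (env E) E" "uniq (names E)"
  "leaves e = names E ==> Dn (env E) e v = Dn (env E) e w ==> dn E v C = dn E w C"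
  "mset G \<subseteq># mset E ==> agr (env E) G"
proof -
 show ty: "wty T E v C" "wty T E w C" using lam_eq_typed[OF op_res_ground assms] typed_iff by blast+
 show F: "agr (env E) E" using agr_env[OF ty(1)] .
 show "uniq (names E)" using ty by (auto simp: wty_def is_ctx_names)
 show "dn E v C = dn E w C"
  if "leaves e = names E" "Dn (env E) e v = Dn (env E) e w"
 proof -
  have "wfe (om (env E)) e" using that(1) wfe_ce[OF F] by (simp add: wfe_def)
  then show ?thesis using Dn_eqI[OF ty F _ that] denotation_Dn[OF _ F] ty by metis
 qed
 show "agr (env E) G" if "mset G \<subseteq># mset E"
  using agr_subset[OF F] set_mset_mono[OF that] by simp
qed

lemma pm_beta_sound:
 assumes eq: "lam_eq T E v w C"
  and pm_beta: "v = Pm (Ten v' w') x y u" "w = u[x ::= v', y ::= w']" "typed T G v' A" "typed T H w' B"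
   "typed T (J @ [(x, A), (y, B)]) u C" "is_ctx E" "E \<in> nshuffles [G, H, J]"
 shows "dn E v C = dn E w C"
proof -
 define F where "F = env E"
 note ty = lam_eq_pre(1,2)[OF eq] and cE = lam_eq_pre(4)[OF eq]
  and F = lam_eq_pre(3)[OF eq, folded F_def] and suff = lam_eq_pre(5)[OF eq, folded F_def] and sub = lam_eq_pre(6)[OF eq, folded F_def]
 have m: "mset E = mset G + mset H + mset J" using mset_nshuffles[OF pm_beta(7)] by (simp add: ac_simps)
 then have n: "names E = names G + names H + names J" by (simp add: names_def)
 have G: "agr F G" "agr F H" "agr F J" by (rule sub; simp add: m)+
 have c: "is_ctx (G @ H)" by (rule is_ctx_sub[OF pm_beta(6)]) (simp add: m)
 have wt: "wty T G v' A" "wty T H w' B" "wty T (J @ [(x, A), (y, B)]) u C" using pm_beta typed_iff by blast+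
 have t: "wty T (G @ H) (Ten v' w') (Tensor A B)"
  unfolding typed_iff[symmetric] by (rule typed_Ten[OF pm_beta(3,4) c]) simp
 note d = dok_wty[OF wt(1) G(1)] dok_wty[OF wt(2) G(2)]
 define F1 where "F1 = F(Free x := A, Free y := B)"
 have xy: "x \<noteq> y" "x \<notin> ctx_vars J" "y \<notin> ctx_vars J" using wt(3) by (auto simp: wty_def)
 have F': "agr F1 (J @ [(x, A), (y, B)])"
  using G(3) xy wty_ground[OF wt(3), of x A] wty_ground[OF wt(3), of y B] by (auto simp: F1_def agr_def ctx_vars_def)
 have un: "uniq (names G + names H + names J)" using cE n by simp
 have dt: "dok F (EJoin (ce G) (ce H)) (Ten v' w') (Tensor A B)"
  using dok_wty[OF t] G wfe_ce by (simp add: dok_def)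
 show ?thesis
 proof (rule suff)
  show "leaves (EJoin (EJoin (ce G) (ce H)) (ce J)) = names E" by (simp add: n)
  have "Dn F (EJoin (EJoin (ce G) (ce H)) (ce J)) (Pm (Ten v' w') x y u) =
   Dn F1 (EJoin (EJoin (Leaf (Free x)) (Leaf (Free y))) (ce J)) u \<cdot>
    (Dn F (EJoin (ce G) (ce H)) (Ten v' w') \<otimes> \<i> (ob (om F) (ce J)))"
   using G un by (intro Dn_Pm[OF dt t _ wt(3) G(3) F']) simp_all
  also have "Dn F (EJoin (ce G) (ce H)) (Ten v' w') = Dn F (ce G) v' \<otimes> Dn F (ce H) w'"
   using un by (intro Dn_Ten[OF d]) simp
  finally show "Dn F (EJoin (EJoin (ce G) (ce H)) (ce J)) v = Dn F (EJoin (EJoin (ce G) (ce H)) (ce J)) w"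
   unfolding pm_beta(1,2)
   using Dn_subst2[OF wt(3) G(3) F' d(1) wty_lc[OF wt(1)] d(2) wty_lc[OF wt(2)]] un by simp
 qed
qed

lemma pm_eta_sound:
 assumes eq: "lam_eq T E v w C"
  and pm_eta: "v = Pm v' x y (u[z ::= Ten (Var x) (Var y)])" "w = u[z ::= v']" "typed T G v' (Tensor A B)"
   "typed T (H @ [(z, Tensor A B)]) u C" "x \<noteq> y" "x \<notin> ctx_vars H" "y \<notin> ctx_vars H" "is_ctx E" "E \<in> shuffles G H"
 shows "dn E v C = dn E w C"
proof -
 define F where "F = env E"
 note ty = lam_eq_pre(1,2)[OF eq] and cE = lam_eq_pre(4)[OF eq]
  and F = lam_eq_pre(3)[OF eq, folded F_def] and suff = lam_eq_pre(5)[OF eq, folded F_def] and sub = lam_eq_pre(6)[OF eq, folded F_def]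
 have m: "mset E = mset G + mset H" using mset_shuffles[OF pm_eta(9)] .
 then have n: "names E = names G + names H" by (simp add: names_def)
 have G: "agr F G" "agr F H" by (rule sub; simp add: m)+
 have wt: "wty T G v' (Tensor A B)" "wty T (H @ [(z, Tensor A B)]) u C" using pm_eta typed_iff by blast+
 have g: "set_ty (Tensor A B) \<subseteq> ground T" using wty_ground[OF wt(2), of z "Tensor A B"] by simp
 then have t: "typed T [(x, A), (y, B)] (Ten (Var x) (Var y)) (Tensor A B)"
  using pm_eta(5) by (intro typed_Ten[of T "[(x, A)]" _ _ "[(y, B)]"] ty_var) auto
 have c: "is_ctx (H @ [(x, A), (y, B)])" using typed_is_ctx[OF pm_eta(4)] pm_eta(5-7) by auto
 have "typed T (H @ [(x, A), (y, B)]) (u[z ::= Ten (Var x) (Var y)]) C"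
  by (rule typed_subst1[OF pm_eta(4) _ t c]) simp_all
 then have wu: "wty T (H @ [(x, A), (y, B)]) (u[z ::= Ten (Var x) (Var y)]) C" using typed_iff by blast
 let ?G = "F(Free x := A, Free y := B)" and ?F = "F(Free z := Tensor A B)"
 have G': "agr ?G (H @ [(x, A), (y, B)])" "agr ?G H"
  using G(2) pm_eta(5-7) g by (auto simp: agr_def ctx_vars_def)
 have z: "z \<notin> ctx_vars H" using wt by (auto simp: wty_def)
 then have F': "agr ?F (H @ [(z, Tensor A B)])" using G(2) g by (auto simp: agr_def ctx_vars_def)
 have un: "uniq (names G + names H)" using cE n by simp
 note d = dok_wty[OF wt(1) G(1)]
 let ?P = "EJoin (Leaf (Free x)) (Leaf (Free y))"
 have wtt: "wty T [(x, A), (y, B)] (Ten (Var x) (Var y)) (Tensor A B)" using t typed_iff by blast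
 have oP: "om ?G (Free x) = ty_obj M A" "om ?G (Free y) = ty_obj M B" using pm_eta(5) by (auto simp: om_def)
 have dP: "dok ?G ?P (Ten (Var x) (Var y)) (Tensor A B)"
  using agr_okt[OF wtt, of ?G] G' oP g by (simp add: dok_def)
 \<comment> \<open>The tuple of the two variables denotes an identity, so substituting it for
   \<open>z\<close> merely replaces one leaf by two.\<close>
 have DP: "Dn ?G ?P (Ten (Var x) (Var y)) = \<i> (ty_obj M A \<odot> ty_obj M B)"
  using oP g pm_eta(5) by (simp add: Dn_def)
 have F'z: "om ?F (Free z) = ty_obj M A \<odot> ty_obj M B" by (simp add: om_def)
 have oD: "ob (om ?G) (ce H) = ob (om F) (ce H)" "ob (om ?F) (ce H) = ob (om F) (ce H)"
  using ob_agr[OF G(2) G'(2)] ob_agr[OF G(2), of ?F] F' by simp_all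
 have du: "dok ?F (EJoin (Leaf (Free z)) (ce H)) u C"
  using agr_okt[OF wt(2) F'] wty_ce[OF wt(2)] F' wfe_ce[of ?F H] by (simp add: dok_def om_def)
 note au = Dn_arr[OF du]
 have "Dn ?G (EJoin ?P (ce H)) (u[z ::= Ten (Var x) (Var y)]) =
   Dn ?F (EJoin (Leaf (Free z)) (ce H)) u \<cdot> (Dn ?G ?P (Ten (Var x) (Var y)) \<otimes> \<i> (ob (om ?G) (ce H)))"
  using c un wty_lc[OF wtt] by (intro Dn_subst1(1)[OF wt(2) G'(2) F' dP]) (auto simp: is_ctx_names)
 also have "... = Dn ?F (EJoin (Leaf (Free z)) (ce H)) u"
  unfolding DP oD(1) using au g wfe_ce[OF G(2)] F'z oD by simp
 finally have e: "Dn ?G (EJoin ?P (ce H)) (u[z ::= Ten (Var x) (Var y)]) = Dn ?F (EJoin (Leaf (Free z)) (ce H)) u" .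
 show ?thesis
 proof (rule suff)
  show "leaves (EJoin (ce G) (ce H)) = names E" by (simp add: n)
  show "Dn F (EJoin (ce G) (ce H)) v = Dn F (EJoin (ce G) (ce H)) w"
   unfolding pm_eta(1,2)
   using Dn_Pm[OF d wt(1) G(1) wu G(2) G'(1)] Dn_subst1(1)[OF wt(2) G(2) F' d wty_lc[OF wt(1)]] un e by simp
 qed
qed

lemma star_beta_sound:
 assumes eq: "lam_eq T E v w C"
  and star_beta: "v = LetStar Star w" "typed T E w C"
 shows "dn E v C = dn E w C"
proof -
 define F where "F = env E"
 note ty = lam_eq_pre(1,2)[OF eq] and cE = lam_eq_pre(4)[OF eq]
  and F = lam_eq_pre(3)[OF eq, folded F_def] and suff = lam_eq_pre(5)[OF eq, folded F_def] and sub = lam_eq_pre(6)[OF eq, folded F_def]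
 have d: "dok F (ce E) w C" using dok_wty ty(2) F by blast
 have s: "dok F EUnit Star TUnit" by (simp add: dok_def okt_def)
 show ?thesis
 proof (rule suff)
  show "leaves (EJoin EUnit (ce E)) = names E" by simp
  have "Dn F (EJoin EUnit (ce E)) w = Dn F (ce E) w \<cdot> can (om F) (EJoin EUnit (ce E)) (ce E)"
   by (rule Dn_pre[OF d]) simp
  moreover have "can (om F) (EJoin EUnit (ce E)) (ce E) = \<l> (ob (om F) (ce E))"
   using cE wfe_ce[OF F] by (intro can_eq str_l) simp_all
  moreover have "Dn F EUnit Star = \<i> \<one>" by (simp add: Dn_def)
  ultimately show "Dn F (EJoin EUnit (ce E)) v = Dn F (EJoin EUnit (ce E)) w"
   unfolding star_beta(1)
   using Dn_LetStar[OF s d] cE l_nat[of "Dn F (ce E) w"] Dn_arr[OF d] by simp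
 qed
qed

lemma star_eta_sound:
 assumes eq: "lam_eq T E v w C"
  and star_eta: "v = LetStar v' (w'[z ::= Star])" "w = w'[z ::= v']" "typed T G v' TUnit" "typed T (H @ [(z, TUnit)]) w' C"
   "is_ctx E" "E \<in> shuffles G H"
 shows "dn E v C = dn E w C"
proof -
 define F where "F = env E"
 note ty = lam_eq_pre(1,2)[OF eq] and cE = lam_eq_pre(4)[OF eq]
  and F = lam_eq_pre(3)[OF eq, folded F_def] and suff = lam_eq_pre(5)[OF eq, folded F_def] and sub = lam_eq_pre(6)[OF eq, folded F_def]
 have m: "mset E = mset G + mset H" using mset_shuffles[OF star_eta(6)] .
 then have n: "names E = names G + names H" by (simp add: names_def)
 have G: "agr F G" "agr F H" by (rule sub; simp add: m)+
 have wt: "wty T G v' TUnit" "wty T (H @ [(z, TUnit)]) w' C" using star_eta typed_iff by blast+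
 have un: "uniq (names G + names H)" using cE n by simp
 note d = dok_wty[OF wt(1) G(1)]
 let ?F = "F(Free z := TUnit)"
 have z: "z \<notin> ctx_vars H" using wt by (auto simp: wty_def)
 then have F': "agr ?F (H @ [(z, TUnit)])" using G(2) by (auto simp: agr_def ctx_vars_def)
 have s: "dok F EUnit Star TUnit" "lc Star" by (simp_all add: dok_def okt_def lc_def)
 have wD: "wfe (om F) (ce H)" using wfe_ce G by blast
 have oD: "ob (om ?F) (ce H) = ob (om F) (ce H)" using ob_agr[OF G(2), of ?F] F' by simp
 let ?Q = "EJoin (Leaf (Free z)) (ce H)"
 have du: "dok ?F ?Q w' C"
  using agr_okt[OF wt(2) F'] wty_ce[OF wt(2)] F' wfe_ce[of ?F H] by (simp add: dok_def om_def)
 have au: "arr (Dn ?F ?Q w')" "src (Dn ?F ?Q w') = \<one> \<odot> ob (om F) (ce H)" "tgt (Dn ?F ?Q w') = ty_obj M C"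
  using Dn_arr[OF du] by (simp_all add: oD) (simp add: om_def)
 have sub1: "Dn F (EJoin EUnit (ce H)) (w'[z ::= Star]) = Dn ?F ?Q w'"
  "okt T F (w'[z ::= Star]) C" "uses (w'[z ::= Star]) = names H"
  using Dn_subst1[OF wt(2) G(2) F' s] un au wD by (simp_all add: Dn_def[of F EUnit Star])
 then have ds: "dok F (EJoin EUnit (ce H)) (w'[z ::= Star]) C" "dok F (ce H) (w'[z ::= Star]) C" using wD by (simp_all add: dok_def)
 have "can (om F) (ce H) (EJoin EUnit (ce H)) = inv_arr M (\<l> (ob (om F) (ce H)))"
  using un wD by (intro can_eq str_l_inv) simp_all
 then have D: "Dn F (ce H) (w'[z ::= Star]) = Dn ?F ?Q w' \<cdot> inv_arr M (\<l> (ob (om F) (ce H)))"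
  using Dn_pre[OF ds(1), of "ce H"] sub1 by simp
 note av = Dn_arr[OF d, simplified]
 have tC: "ty_obj M C \<in> obj M" using au tgt_obj by metis
 show ?thesis
 proof (rule suff)
  show "leaves (EJoin (ce G) (ce H)) = names E" by (simp add: n)
  have "Dn F (EJoin (ce G) (ce H)) (LetStar v' (w'[z ::= Star])) =
   \<l> (ty_obj M C) \<cdot> (Dn F (ce G) v' \<otimes> (Dn ?F ?Q w' \<cdot> inv_arr M (\<l> (ob (om F) (ce H)))))"
   using Dn_LetStar[OF d ds(2)] un D by simp
  also have "... = (\<l> (ty_obj M C) \<cdot> (\<i> \<one> \<otimes> Dn ?F ?Q w')) \<cdot> (Dn F (ce G) v' \<otimes> inv_arr M (\<l> (ob (om F) (ce H))))"
   using au av wD tC by simp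
  also have "... = (Dn ?F ?Q w' \<cdot> \<l> (\<one> \<odot> ob (om F) (ce H))) \<cdot> (Dn F (ce G) v' \<otimes> inv_arr M (\<l> (ob (om F) (ce H))))"
   using l_nat[of "Dn ?F ?Q w'"] au by simp
  \<comment> \<open>The unitor of \<open>\<one> \<odot> X\<close> is the unitor of \<open>X\<close>
    tensored with the unit, so it cancels against the inverse unitor of the unit put in for
    \<open>z\<close>.\<close>
  also have "... = Dn ?F ?Q w' \<cdot> (Dn F (ce G) v' \<otimes> \<i> (ob (om F) (ce H)))"
   using au av wD by (simp add: lunit_unit_tensor)
  finally show "Dn F (EJoin (ce G) (ce H)) v = Dn F (EJoin (ce G) (ce H)) w"
   unfolding star_eta(1,2) using Dn_subst1(1)[OF wt(2) G(2) F' d wty_lc[OF wt(1)]] un by simp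
 qed
qed

lemma lam_beta_sound:
 assumes eq: "lam_eq T E v w C"
  and lam_beta: "v = App (Lam x A v') w'" "w = v'[x ::= w']" "typed T (G @ [(x, A)]) v' C" "typed T H w' A"
   "is_ctx E" "E \<in> shuffles G H"
 shows "dn E v C = dn E w C"
proof -
 define F where "F = env E"
 note ty = lam_eq_pre(1,2)[OF eq] and cE = lam_eq_pre(4)[OF eq]
  and F = lam_eq_pre(3)[OF eq, folded F_def] and suff = lam_eq_pre(5)[OF eq, folded F_def] and sub = lam_eq_pre(6)[OF eq, folded F_def]
 have m: "mset E = mset G + mset H" using mset_shuffles[OF lam_beta(6)] .
 then have n: "names E = names G + names H" by (simp add: names_def)
 have G: "agr F G" "agr F H" by (rule sub; simp add: m)+
 have wt: "wty T (G @ [(x, A)]) v' C" "wty T H w' A" using lam_beta typed_iff by blast+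
 have un: "uniq (names G + names H)" using cE n by simp
 note d = dok_wty[OF wt(2) G(2)]
 let ?F = "F(Free x := A)"
 have x: "x \<notin> ctx_vars G" using wt by (auto simp: wty_def)
 have gA: "set_ty A \<subseteq> ground T" using wty_ground[OF wt(1), of x A] by simp
 then have F': "agr ?F (G @ [(x, A)])" using x G(1) by (auto simp: agr_def ctx_vars_def)
 have "wty T G (Lam x A v') (Lolli A C)" using lam_beta(3) ty_lam typed_iff by metis
 then have dL: "dok F (ce G) (Lam x A v') (Lolli A C)" using dok_wty G by blast
 let ?Q = "EJoin (ce G) (Leaf (Free x))"
 have du: "dok ?F ?Q v' C"
  using agr_okt[OF wt(1) F'] wty_ce[OF wt(1)] F' wfe_ce[of ?F G] by (simp add: dok_def om_def)
 have oG: "ob (om ?F) (ce G) = ob (om F) (ce G)" using ob_agr[OF G(1), of ?F] F' by simp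
 have au: "arr (Dn ?F ?Q v')" "src (Dn ?F ?Q v') = ob (om F) (ce G) \<odot> ty_obj M A" "tgt (Dn ?F ?Q v') = ty_obj M C"
  using Dn_arr[OF du] by (simp_all add: oG) (simp add: om_def)
 have wG: "wfe (om F) (ce G)" "ty_obj M A \<in> obj M" using wfe_ce G gA by auto
 have tC: "ty_obj M C \<in> obj M" using au tgt_obj by metis
 let ?c = "curry_at M (ty_obj M A) (ob (om F) (ce G)) (ty_obj M C) (Dn ?F ?Q v')"
 have ac: "arr ?c" "src ?c = ob (om F) (ce G)" "tgt ?c = iobj M (ty_obj M A) (ty_obj M C)"
  using curry_arr[of "ty_obj M A" "Dn ?F ?Q v'" "ob (om F) (ce G)"] au wG by auto
 note aw = Dn_arr[OF d]
 show ?thesis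
 proof (rule suff)
  show "leaves (EJoin (ce G) (ce H)) = names E" by (simp add: n)
  have "Dn F (EJoin (ce G) (ce H)) (App (Lam x A v') w') = eval_at M (ty_obj M A) (ty_obj M C) \<cdot> (?c \<otimes> Dn F (ce H) w')"
   using Dn_App[OF dL d] un Dn_Lam[OF wt(1) G(1) F'] by simp
  also have "... = (eval_at M (ty_obj M A) (ty_obj M C) \<cdot> (?c \<otimes> \<i> (ty_obj M A))) \<cdot> (\<i> (ob (om F) (ce G)) \<otimes> Dn F (ce H) w')"
   using ac aw wG tC by simp
  also have "... = Dn ?F ?Q v' \<cdot> (\<i> (ob (om F) (ce G)) \<otimes> Dn F (ce H) w')"
   using eval_curry[of "ty_obj M A" "Dn ?F ?Q v'" "ob (om F) (ce G)"] au wG by simp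
  finally show "Dn F (EJoin (ce G) (ce H)) v = Dn F (EJoin (ce G) (ce H)) w"
   unfolding lam_beta(1,2) using Dn_subst1(2)[OF wt(1) G(1) F' d wty_lc[OF wt(2)]] un by (simp add: Int_commute)
 qed
qed

lemma lam_eta_sound:
 assumes eq: "lam_eq T E v w C"
  and lam_eta: "v = Lam x A (App w (Var x))" "C = Lolli A B" "typed T E w (Lolli A B)" "x \<notin> ctx_vars E"
 shows "dn E v C = dn E w C"
proof -
 define F where "F = env E"
 note ty = lam_eq_pre(1,2)[OF eq] and cE = lam_eq_pre(4)[OF eq]
  and F = lam_eq_pre(3)[OF eq, folded F_def] and suff = lam_eq_pre(5)[OF eq, folded F_def] and sub = lam_eq_pre(6)[OF eq, folded F_def]
 have x: "x \<notin> ctx_vars E" by fact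
 have g: "set_ty (Lolli A B) \<subseteq> ground T" using typed_res_ground[OF op_res_ground lam_eta(3)] by simp
 have d: "dok F (ce E) w (Lolli A B)" using dok_wty[OF ty(2) F] lam_eta by simp
 let ?F = "F(Free x := A)"
 have F': "agr ?F (E @ [(x, A)])" using F x g by (auto simp: agr_def ctx_vars_def)
 have uw: "uses w = names E" using ty by (simp add: wty_def)
 have okw: "okt T ?F w (Lolli A B)" using agr_okt[OF ty(2), of ?F] F' lam_eta(2) by simp
 then have d': "dok ?F (ce E) w (Lolli A B)" using uw wfe_ce F' by (simp add: dok_def)
 have dx: "dok ?F (Leaf (Free x)) (Var x) A" using g by (simp add: dok_def okt_def om_def)
 have wa: "wty T (E @ [(x, A)]) (App w (Var x)) B"
  unfolding typed_iff[symmetric]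
  using lam_eta(3) typed_is_ctx[OF lam_eta(3)] x g ty_var[of A T x] by (intro typed_App[of T E w A B "[(x, A)]"]) auto
 have oE: "ob (om ?F) (ce E) = ob (om F) (ce E)" using ob_agr[OF F, of ?F] F' by simp
 have "Dn ?F (EJoin (ce E) (Leaf (Free x))) (App w (Var x)) =
   eval_at M (ty_obj M A) (ty_obj M B) \<cdot> (Dn ?F (ce E) w \<otimes> Dn ?F (Leaf (Free x)) (Var x))"
  using cE x by (intro Dn_App[OF d' dx]) simp
 also have "Dn ?F (Leaf (Free x)) (Var x) = \<i> (ty_obj M A)" using g by (simp add: Dn_def om_def)
 also have "Dn ?F (ce E) w = Dn F (ce E) w" using x uw by (intro Dn_cong[OF d]) (auto simp: in_names)
 finally have a: "Dn ?F (EJoin (ce E) (Leaf (Free x))) (App w (Var x)) =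
   eval_at M (ty_obj M A) (ty_obj M B) \<cdot> (Dn F (ce E) w \<otimes> \<i> (ty_obj M A))" .
 show ?thesis
 proof (rule suff)
  show "leaves (ce E) = names E" by simp
  show "Dn F (ce E) v = Dn F (ce E) w"
   unfolding lam_eta(1) Dn_Lam[OF wa F F'] a
   using curry_eval[of "ty_obj M A" "Dn F (ce E) w" "ty_obj M B"] Dn_arr[OF d] g by simp
 qed
qed

text \<open>By the \<beta>-law already proved, a substitution denotes the same as an application of
  an abstraction. Congruence and distance bounds for substitution thereby reduce to those for
  application.\<close>

lemma subst_sound:
 assumes u: "typed T (J @ [(z, A)]) u C" and w: "typed T H w A" and E: "is_ctx E" "shuffle_mor M J H E s"
 shows "dn E (u[z ::= w]) C =
  eval_at M (ty_obj M A) (ty_obj M C) \<cdot> (dn J (Lam z A u) (Lolli A C) \<otimes> dn H w A) \<cdot> s"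
proof -
 note l = lam_beta[OF u w E(1) shuffle_mor_shuffles[OF E(2)]]
 have "dn E (App (Lam z A u) w) C = dn E (u[z ::= w]) C"
  by (rule lam_beta_sound[OF l HOL.refl HOL.refl u w E(1) shuffle_mor_shuffles[OF E(2)]])
 then show ?thesis
  using denotes_denotation[OF den_app[OF typed_denotation[OF ty_lam[OF u]] typed_denotation[OF w] E]] by simp
qed

lemma subst_sound_cong:
 assumes "typed T (J @ [(z, A)]) u C" "typed T H w A" "typed T H w' A" "is_ctx E" "E \<in> shuffles J H"
  "dn H w A = dn H w' A"
 shows "dn E (u[z ::= w]) C = dn E (u[z ::= w']) C"
proof -
 obtain s where "shuffle_mor M J H E s" using shuffles_shuffle_mor assms(5) by blast
 then show ?thesis using subst_sound[OF assms(1,2,4)] subst_sound[OF assms(1,3,4)] assms(6) by simp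
qed

lemma subst1_Pm:
 assumes "typed T (H @ [(x, A), (y, B)]) w C" "p \<notin> ctx_vars H"
 shows "(Pm (Var p) x y w)[p ::= v] = Pm v x y w"
proof -
 have "Free p \<notin># uses (bindv 1 x (bindv 0 y w))"
  using assms by (auto simp: typed_iff wty_def bindv_rnm uses_rnm bnd_def split: if_splits name.splits)
 then have "(bindv 1 x (bindv 0 y w))[p ::= v] = bindv 1 x (bindv 0 y w)" by (intro subst_ident) auto
 then show ?thesis by (simp add: Pm_def fun_upd_same del: fun_upd_apply)
qed

lemma subst1_subst1:
 assumes "typed T (J @ [(z, A)]) u C" "p \<notin> ctx_vars J"
 shows "(u[z ::= w])[p ::= v] = u[z ::= w[p ::= v]]"
 unfolding subst_subst
proof (rule subst_cong)
 fix y assume "Free y \<in># uses u"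
 then have "y = z \<or> y \<in> ctx_vars J" using assms(1) by (auto simp: typed_iff wty_def)
 then show "subst (Var(p := v)) ((Var(z := w)) y) = (Var(z := w[p ::= v])) y" using assms(2) by (auto simp del: fun_upd_apply simp: fun_upd_def)
qed

text \<open>The commuting conversions follow from the \<open>\<eta>\<close>-rules: both sides are instances of a term in which
 the scrutinee is a variable.\<close>

lemma lam_eq_sound:
 assumes "lam_eq T E v w C"
 shows "dn E v C = dn E w C"
 using assms
proof cases
 case (pm_beta G v' A H w' B J x y u)
 then show ?thesis by (rule pm_beta_sound[OF assms])
next
 case (pm_eta G v' A B H z u x y)
 then show ?thesis by (rule pm_eta_sound[OF assms])
next
 case star_beta
 then show ?thesis by (rule star_beta_sound[OF assms])
next
 case (star_eta G v' H z w')
 then show ?thesis by (rule star_eta_sound[OF assms])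
next
 case (lam_beta G x A v' H w')
 then show ?thesis by (rule lam_beta_sound[OF assms])
next
 case (lam_eta A B x)
 then show ?thesis by (rule lam_eta_sound[OF assms])
next
 case (star_comm G v' H w' A J z u)
 obtain D where D: "E \<in> shuffles G D" "D \<in> shuffles J H" using star_comm(7) by (auto simp: shuffles_commutes)
 have m: "mset D = mset J + mset H" "mset E = mset G + mset D" using mset_shuffles D by blast+
 have c: "is_ctx D" by (rule is_ctx_sub[OF star_comm(6)]) (simp add: m(2))
 obtain p where p: "p \<notin> ctx_vars D" using fresh_var[of "ctx_vars D"] by auto
 have cv: "ctx_vars D = ctx_vars J \<union> ctx_vars H" using set_shuffles[OF D(2)] by (auto simp: ctx_vars_def)
 \<comment> \<open>The scrutinee is replaced by a fresh variable \<open>p\<close>; the \<eta>-rule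
   is then applied to \<open>u[z ::= ?l]\<close> with \<open>p\<close> as its distinguished
   variable.\<close>
 let ?l = "LetStar (Var p) w'"
 have w: "w'[p ::= a] = w'" for a using p cv star_comm(4) by (intro subst_ident) (auto simp: typed_iff wty_def)
 have l: "typed T (H @ [(p, TUnit)]) ?l A" by (rule typed_LetStar[OF ty_var star_comm(4)]) (use p cv typed_is_ctx[OF star_comm(4)] in auto)
 have u': "typed T (D @ [(p, TUnit)]) (u[z ::= ?l]) C"
  by (rule typed_subst1[OF star_comm(5) _ l]) (use p c m in auto)
 have s: "(u[z ::= ?l])[p ::= a] = u[z ::= LetStar a w']" for a
  using subst1_subst1[OF star_comm(5)] p cv w by (simp add: fun_upd_same del: fun_upd_apply)
 have ls: "typed T H (LetStar Star w') A" by (rule typed_LetStar[OF ty_star star_comm(4)]) (use typed_is_ctx[OF star_comm(4)] in auto)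
 have t: "typed T D (u[z ::= LetStar Star w']) C" "typed T D (u[z ::= w']) C"
  using typed_subst1[OF star_comm(5) _ ls c, where G = J] typed_subst1[OF star_comm(5) _ star_comm(4) c, where G = J] m by simp_all
 note se = star_eta[OF star_comm(3) u' star_comm(6) D(1)]
 have 1: "dn E (LetStar v' (u[z ::= LetStar Star w'])) C = dn E v C"
  using star_eta_sound[OF se HOL.refl HOL.refl star_comm(3) u' star_comm(6) D(1)] unfolding s star_comm(1) .
 have 2: "dn D (u[z ::= LetStar Star w']) C = dn D (u[z ::= w']) C"
  \<comment> \<open>At the value \<open>Star\<close> the inner \<open>LetStar\<close> disappears by
    \<open>star_beta\<close>, applied beneath the substitution for \<open>z\<close>.\<close>
  by (rule subst_sound_cong[OF star_comm(5) ls star_comm(4) c D(2) star_beta_sound[OF star_beta[OF star_comm(4)] HOL.refl star_comm(4)]])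
 obtain s' where s': "shuffle_mor M G D E s'" using shuffles_shuffle_mor D(1) by blast
 note dl = denotes_denotation[OF den_letstar[OF typed_denotation[OF star_comm(3)] typed_denotation star_comm(6) s']]
 show ?thesis unfolding 1[symmetric] star_comm(2) dl[OF t(1)] dl[OF t(2)] 2 ..
next
 case (pm_comm G v' A B H x y w' F J z u)
 obtain D where D: "E \<in> shuffles G D" "D \<in> shuffles J H" using pm_comm(9) by (auto simp: shuffles_commutes)
 have m: "mset D = mset J + mset H" "mset E = mset G + mset D" using mset_shuffles D by blast+
 have c: "is_ctx D" by (rule is_ctx_sub[OF pm_comm(8)]) (simp add: m(2))
 obtain p where p: "p \<notin> ctx_vars D" using fresh_var[of "ctx_vars D"] by auto
 have cv: "ctx_vars D = ctx_vars J \<union> ctx_vars H" using set_shuffles[OF D(2)] by (auto simp: ctx_vars_def)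
 let ?xy = "[(x, A), (y, B)]" and ?p = "Ten (Var x) (Var y)" and ?l = "Pm (Var p) x y w'"
 have cw: "is_ctx (H @ ?xy)" using typed_is_ctx[OF pm_comm(4)] .
 then have xy: "x \<noteq> y" "x \<notin> ctx_vars D" "y \<notin> ctx_vars D" using pm_comm(6,7) cv by auto
 have g: "set_ty A \<subseteq> ground T" "set_ty B \<subseteq> ground T" using typed_ground[OF pm_comm(4), of x A] typed_ground[OF pm_comm(4), of y B] by auto
 have l: "typed T (H @ [(p, Tensor A B)]) ?l F"
  by (rule typed_Pm[OF ty_var pm_comm(4), where H = H]) (use p cv cw g in auto)
 have u': "typed T (D @ [(p, Tensor A B)]) (u[z ::= ?l]) C"
  by (rule typed_subst1[OF pm_comm(5) _ l]) (use p c m in auto)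
 have s: "(u[z ::= ?l])[p ::= a] = u[z ::= Pm a x y w']" for a
  using subst1_subst1[OF pm_comm(5)] subst1_Pm[OF pm_comm(4)] p cv by simp
 have tp: "typed T ?xy ?p (Tensor A B)" by (rule typed_Ten[OF ty_var[OF g(1)] ty_var[OF g(2)]]) (use xy in auto)
 have lp: "typed T (H @ ?xy) (Pm ?p x y w') F" by (rule typed_Pm[OF tp pm_comm(4), where H = H]) (use cw in auto)
 have cD: "is_ctx (D @ ?xy)" using c xy by auto
 have t: "typed T (D @ ?xy) (u[z ::= Pm ?p x y w']) C" "typed T (D @ ?xy) (u[z ::= w']) C"
  using typed_subst1[OF pm_comm(5) _ lp cD, where G = J] typed_subst1[OF pm_comm(5) _ pm_comm(4) cD, where G = J] m by simp_all
 note pe = pm_eta[OF pm_comm(3) u' xy pm_comm(8) D(1)]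
 have 1: "dn E (Pm v' x y (u[z ::= Pm ?p x y w'])) C = dn E v C"
  using pm_eta_sound[OF pe HOL.refl HOL.refl pm_comm(3) u' xy pm_comm(8) D(1)] unfolding s pm_comm(1) .
 have n: "H @ ?xy \<in> nshuffles [[(x, A)], [(y, B)], H]"
  using shuffles_snocI(1)[of H "[]" H "(y, B)"] shuffles_snocI(2)[OF shuffles_snocI(1)[of H "[]" H "(x, A)"], of "(y, B)"] by auto
 have ww: "w'[x ::= Var x, y ::= Var y] = w'" by (simp add: fun_upd_idem)
 note pb = pm_beta[OF ty_var[OF g(1)] ty_var[OF g(2)] pm_comm(4) cw n]
 \<comment> \<open>The instance at the pair of variables reduces by \<open>pm_beta\<close> to
   \<open>w'\<close> itself, as the substitution of \<open>x\<close> and \<open>y\<close> for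
   themselves is trivial.\<close>
 have 3: "dn (H @ ?xy) (Pm ?p x y w') F = dn (H @ ?xy) w' F"
  using pm_beta_sound[OF pb HOL.refl HOL.refl ty_var[OF g(1)] ty_var[OF g(2)] pm_comm(4) cw n] unfolding ww .
 have "D @ ?xy \<in> shuffles J (H @ ?xy)"
  using shuffles_snocI(2)[OF shuffles_snocI(2)[OF D(2), of "(x, A)"], of "(y, B)"] by simp
 from subst_sound_cong[OF pm_comm(5) lp pm_comm(4) cD this 3]
 have 2: "dn (D @ ?xy) (u[z ::= Pm ?p x y w']) C = dn (D @ ?xy) (u[z ::= w']) C" .
 obtain s' where s': "shuffle_mor M G D E s'" using shuffles_shuffle_mor D(1) by blast
 note dl = denotes_denotation[OF den_pm[OF typed_denotation[OF pm_comm(3)] typed_denotation pm_comm(8) s']]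
 show ?thesis unfolding 1[symmetric] pm_comm(2) dl[OF t(1)] dl[OF t(2)] 2 ..
qed

end

section \<open>Bounds on distances of composites and tensors\<close>

context enriched_autonomous_cat
begin

lemma hd_comp:
 assumes "f \<in> hom C X Y" "f' \<in> hom C X Y" "g \<in> hom C Y Z" "g' \<in> hom C Y Z"
 shows "hdist C f f' * hdist C g g' \<le> hdist C (g \<cdot> f) (g' \<cdot> f')"
proof -
 have "X \<in> obj C" "Y \<in> obj C" "Z \<in> obj C" using assms by (auto simp: hom_iff)
 from comp_vfunctor[OF this] assms show ?thesis
  by (fastforce simp: vfunctor_def vtensor_def)
qed

lemma hd_ten:
 assumes "f \<in> hom C X Y" "f' \<in> hom C X Y" "g \<in> hom C X' Y'" "g' \<in> hom C X' Y'"
 shows "hdist C f f' * hdist C g g' \<le> hdist C (f \<otimes> g) (f' \<otimes> g')"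
proof -
 have "X \<in> obj C" "Y \<in> obj C" "X' \<in> obj C" "Y' \<in> obj C" using assms by (auto simp: hom_iff)
 from tmor_vfunctor[OF this] assms show ?thesis
  by (fastforce simp: vfunctor_def vtensor_def)
qed

lemma hd_refl: "f \<in> hom C X Y ==> 1 \<le> hdist C f f"
 using hom_sep_vcat[of X Y] by (auto simp: sep_vcat_def vcat_def hom_iff)

lemma hd_trans:
 "f \<in> hom C X Y ==> g \<in> hom C X Y ==> h \<in> hom C X Y ==> hdist C f g * hdist C g h \<le> hdist C f h"
 using hom_sep_vcat[of X Y] by (auto simp: sep_vcat_def vcat_def hom_iff)

text \<open>The fixed factor has self-distance at least 1, the unit of the quantale, and so costs
  nothing. The same holds for \<open>hd_post\<close>.\<close>

lemma hd_pre:
 assumes "q \<le> hdist C f f'" "s \<in> hom C X Y" "f \<in> hom C Y Z" "f' \<in> hom C Y Z"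
 shows "q \<le> hdist C (f \<cdot> s) (f' \<cdot> s)"
proof -
 have "1 * q \<le> hdist C s s * hdist C f f'" using hd_refl[OF assms(2)] assms(1) by (rule quantale_mult_mono)
 also have "... \<le> hdist C (f \<cdot> s) (f' \<cdot> s)" using assms by (intro hd_comp)
 finally show ?thesis by simp
qed

lemma hd_post:
 assumes "q \<le> hdist C f f'" "g \<in> hom C Y Z" "f \<in> hom C X Y" "f' \<in> hom C X Y"
 shows "q \<le> hdist C (g \<cdot> f) (g \<cdot> f')"
proof -
 have "q * 1 \<le> hdist C f f' * hdist C g g" using assms(1) hd_refl[OF assms(2)] by (rule quantale_mult_mono)
 also have "... \<le> hdist C (g \<cdot> f) (g \<cdot> f')" using assms by (intro hd_comp)
 finally show ?thesis by simp
qed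

lemma hd_tenI:
 assumes "q \<le> hdist C f f'" "r \<le> hdist C g g'"
  "f \<in> hom C X Y" "f' \<in> hom C X Y" "g \<in> hom C X' Y'" "g' \<in> hom C X' Y'"
 shows "q * r \<le> hdist C (f \<otimes> g) (f' \<otimes> g')"
 using quantale_mult_mono[OF assms(1,2)] hd_ten[OF assms(3-)] by (rule order_trans)

lemma hd_compI:
 assumes "q \<le> hdist C f f'" "r \<le> hdist C g g'"
  "f \<in> hom C X Y" "f' \<in> hom C X Y" "g \<in> hom C Y Z" "g' \<in> hom C Y Z"
 shows "q * r \<le> hdist C (g \<cdot> f) (g' \<cdot> f')"
 using quantale_mult_mono[OF assms(1,2)] hd_comp[OF assms(3-)] by (rule order_trans)

lemma hom_comp: "f \<in> hom C X Y ==> g \<in> hom C Y Z ==> g \<cdot> f \<in> hom C X Z"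
 by (rule comp_hom)

end

section \<open>Soundness of the rules for theorems\<close>

context lam_interp
begin

lemma shuffle_mor_hom:
 assumes "shuffle_mor M G H E s" "agr F E"
 shows "s \<in> hom M (ctx_obj M E) (ctx_obj M G \<odot> ctx_obj M H)"
proof -
 have "agr F G" "agr F H" using assms agr_shuffles[OF shuffle_mor_shuffles[OF assms(1)]] by auto
 then show ?thesis using str_arr[OF str_shuffle[OF assms]] assms(2) by (simp add: hom_iff ctx_obj_ce)
qed

lemma nshuffle_mor_hom:
 assumes "nshuffle_mor M Gs E s" "agr F E"
 shows "s \<in> hom M (ctx_obj M E) (ntobj M (map (ctx_obj M) Gs))"
proof -
 have "agr F G" if "G \<in> set Gs" for G
  using that agr_subset[OF assms(2)] set_nshuffles nshuffle_mor_nshuffles[OF assms(1)] by blast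
 then have "map (ctx_obj M) Gs = map (ob (om F)) (map ce Gs)" by (simp add: ctx_obj_ce)
 then show ?thesis using str_arr[OF str_nshuffle[OF assms]] assms(2) by (simp add: hom_iff ctx_obj_ce ntobj_njoin del: map_map)
qed

lemma hd_ntmor:
 assumes "length ms = length Xs" "length ns = length Xs" "length Ys = length Xs" "length qs = length Xs"
  and "\<And>i. i < length Xs ==> ms ! i \<in> hom M (Xs ! i) (Ys ! i) & ns ! i \<in> hom M (Xs ! i) (Ys ! i) & qs ! i \<le> hdist M (ms ! i) (ns ! i)"
 shows "ntmor M ms \<in> hom M (ntobj M Xs) (ntobj M Ys) & ntmor M ns \<in> hom M (ntobj M Xs) (ntobj M Ys) &
  prod_list qs \<le> hdist M (ntmor M ms) (ntmor M ns)"
proof -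
 have *: "foldl (tmor M) m ms \<in> hom M (foldl (tobj M) X Xs) (foldl (tobj M) Y Ys) &
   foldl (tmor M) n ns \<in> hom M (foldl (tobj M) X Xs) (foldl (tobj M) Y Ys) &
   q * prod_list qs \<le> hdist M (foldl (tmor M) m ms) (foldl (tmor M) n ns)"
  if "m \<in> hom M X Y" "n \<in> hom M X Y" "q \<le> hdist M m n"
   "length ms = length Xs" "length ns = length Xs" "length Ys = length Xs" "length qs = length Xs"
   "\<And>i. i < length Xs ==> ms ! i \<in> hom M (Xs ! i) (Ys ! i) & ns ! i \<in> hom M (Xs ! i) (Ys ! i) & qs ! i \<le> hdist M (ms ! i) (ns ! i)"
  for m n X Y q ms ns Xs Ys qs
  using that
 proof (induction Xs arbitrary: m n X Y q ms ns Ys qs)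
  case (Cons X' Xs)
  obtain m' ms' n' ns' Y' Ys' q' qs' where eq: "ms = m' # ms'" "ns = n' # ns'" "Ys = Y' # Ys'" "qs = q' # qs'"
   using Cons.prems(4-7) by (metis length_Suc_conv list.size(4) add.right_neutral add_Suc_right)
  have h: "m' \<in> hom M X' Y'" "n' \<in> hom M X' Y'" "q' \<le> hdist M m' n'" using Cons.prems(8)[of 0] by (auto simp: eq)
  have "foldl (tmor M) (m \<otimes> m') ms' \<in> hom M (foldl (tobj M) (X \<odot> X') Xs) (foldl (tobj M) (Y \<odot> Y') Ys') &
   foldl (tmor M) (n \<otimes> n') ns' \<in> hom M (foldl (tobj M) (X \<odot> X') Xs) (foldl (tobj M) (Y \<odot> Y') Ys') &
   (q * q') * prod_list qs' \<le> hdist M (foldl (tmor M) (m \<otimes> m') ms') (foldl (tmor M) (n \<otimes> n') ns')"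
  proof (rule Cons.IH)
   show "m \<otimes> m' \<in> hom M (X \<odot> X') (Y \<odot> Y')" "n \<otimes> n' \<in> hom M (X \<odot> X') (Y \<odot> Y')"
    using Cons.prems(1,2) h by (auto intro: tmor_hom)
   show "q * q' \<le> hdist M (m \<otimes> m') (n \<otimes> n')" using Cons.prems(1-3) h by (intro hd_tenI)
   show "ms' ! i \<in> hom M (Xs ! i) (Ys' ! i) & ns' ! i \<in> hom M (Xs ! i) (Ys' ! i) & qs' ! i \<le> hdist M (ms' ! i) (ns' ! i)"
    if "i < length Xs" for i using Cons.prems(8)[of "Suc i"] that by (auto simp: eq)
  qed (use Cons.prems eq in auto)
  then show ?case by (simp add: eq mult.assoc)
 qed simp
 show ?thesis
 proof (cases Xs)
  case Nil
  then show ?thesis using assms id_hom[of \<one>] hd_refl[of "\<i> \<one>"] by simp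
 next
  case (Cons X Xs')
  obtain m ms' n ns' Y Ys' q qs' where eq: "ms = m # ms'" "ns = n # ns'" "Ys = Y # Ys'" "qs = q # qs'"
   using assms(1-4) unfolding Cons by (metis length_Suc_conv list.size(4) add.right_neutral add_Suc_right)
  have h: "m \<in> hom M X Y" "n \<in> hom M X Y" "q \<le> hdist M m n" using assms(5)[of 0] by (auto simp: eq Cons)
  have "ms' ! i \<in> hom M (Xs' ! i) (Ys' ! i) & ns' ! i \<in> hom M (Xs' ! i) (Ys' ! i) & qs' ! i \<le> hdist M (ms' ! i) (ns' ! i)"
   if "i < length Xs'" for i using assms(5)[of "Suc i"] that by (auto simp: eq Cons)
  with *[OF h, of ms' Xs' ns' Ys' qs'] assms(1-4) show ?thesis by (simp add: eq Cons)
 qed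
qed

lemma jn_hom:
 assumes "agr F (G @ [(x, A)])"
 shows "jn M G A \<in> hom M (ctx_obj M G \<odot> ty_obj M A) (ctx_obj M (G @ [(x, A)]))"
proof -
 have F: "agr F G" "set_ty A \<subseteq> ground T" "F (Free x) = A" using assms by auto
 then show ?thesis using str_arr[OF str_jn[OF assms]] ctx_obj_ce[OF F(1)] ctx_obj_ce[OF assms] by (simp add: hom_iff om_def)
qed

text \<open>Currying does not decrease the values of \<open>hdist\<close>. Kept apart because it
  serves both \<open>cong_lam\<close> and, through \<open>subst_sound\<close>,
  \<open>cong_subst\<close>.\<close>

lemma hd_Lam:
 assumes ty: "typed T (G @ [(x, A)]) v A'" "typed T (G @ [(x, A)]) w A'"
  and q: "q \<le> hdist M (dn (G @ [(x, A)]) v A') (dn (G @ [(x, A)]) w A')"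
 shows "q \<le> hdist M (dn G (Lam x A v) (Lolli A A')) (dn G (Lam x A w) (Lolli A A'))"
proof -
 have wt: "wty T (G @ [(x, A)]) v A'" using ty(1) typed_iff by blast
 note d = ty[THEN typed_denotation] and h = ty[THEN denotation_hom]
 note d1 = den_lam[OF d(1)] and d2 = den_lam[OF d(2)]
 have F': "agr (env (G @ [(x, A)])) (G @ [(x, A)])" using agr_env[OF wt] .
 then have F: "agr (env (G @ [(x, A)])) G" "set_ty A \<subseteq> ground T" "env (G @ [(x, A)]) (Free x) = A" by auto
 have j: "jn M G A \<in> hom M (ctx_obj M G \<odot> ty_obj M A) (ctx_obj M (G @ [(x, A)]))"
  by (rule jn_hom[OF F'])
 have o: "ty_obj M A \<in> obj M" "ctx_obj M G \<in> obj M" "ty_obj M A' \<in> obj M"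
  using F ctx_obj_ce[OF F(1)] wfe_ce[OF F(1)] h(1) mor_obj[of "dn (G @ [(x, A)]) v A'"] by (auto simp: hom_def)
 have "q \<le> hdist M (dn (G @ [(x, A)]) v A' \<cdot> jn M G A) (dn (G @ [(x, A)]) w A' \<cdot> jn M G A)"
  using q j h by (rule hd_pre)
 also have "... \<le> hdist M (curry_at M (ty_obj M A) (ctx_obj M G) (ty_obj M A') (dn (G @ [(x, A)]) v A' \<cdot> jn M G A))
   (curry_at M (ty_obj M A) (ctx_obj M G) (ty_obj M A') (dn (G @ [(x, A)]) w A' \<cdot> jn M G A))"
  using curry_viso[OF o] hom_comp[OF j h(1)] hom_comp[OF j h(2)] by (auto simp: viso_def vfunctor_def)
 finally show ?thesis unfolding denotes_denotation[OF d1] denotes_denotation[OF d2] .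
qed

lemma theorem_sound:
 assumes th: "linear_vlam_theory B T" and B: "quantale_basis B"
  and ax: "\<And>G v q w A. (G, v, q, w, A) \<in> axs T ==> holds T M G v q w A"
  and "is_theorem B T G v q w A"
 shows "q \<le> hdist M (dn G v A) (dn G w A)"
 using assms(4)
proof (induction rule: is_theorem.induct)
 case (ax G v q w A)
 then show ?case using assms(3) by (simp add: holds_def)
next
 case (lam_eq G v w A)
 then show ?case
  using lam_eq_sound[OF lam_eq] hd_refl[OF denotation_hom] lam_eq_typed[OF op_res_ground lam_eq] by (simp flip: one_eq_top)
next
 case (lam_eq_sym G v w A)
 then show ?case
  using lam_eq_sound[OF lam_eq_sym] hd_refl[OF denotation_hom] lam_eq_typed[OF op_res_ground lam_eq_sym] by (simp flip: one_eq_top)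
next
 case (refl G v A)
 then show ?case using hd_refl[OF denotation_hom] by (simp flip: one_eq_top)
next
 case (trans G v q w A r u)
 then have "typed T G v A" "typed T G w A" "typed T G u A" using theorem_typed[OF th] by blast+
 then show ?case
  using quantale_mult_mono[OF trans.IH] hd_trans[OF denotation_hom denotation_hom denotation_hom] order_trans by blast
next
 case (weak G v q w A r)
 then show ?case by (meson order_trans)
next
 case (arch G v A w q)
 \<comment> \<open>The Archimedean rule is sound because \<open>q\<close> is the join of the basis
   elements way below it.\<close>
 have "q = Sup (B \<inter> {y. y \<lless> q})" using B by (simp add: quantale_basis_def)
 also have "... \<le> hdist M (dn G v A) (dn G w A)" using arch by (intro Sup_least) auto
 finally show ?case .
next
 case (join G v A w Q)
 then show ?case by (intro Sup_least) auto
next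
 case (cong_op f Gs vs qs ws E)
 have ty: "typed T (Gs ! i) (vs ! i) (op_args T f ! i)" "typed T (Gs ! i) (ws ! i) (op_args T f ! i)"
  if "i < length (op_args T f)" for i
  using cong_op.IH that theorem_typed[OF th] by blast+
 define n where "n = length (op_args T f)"
 define ms where "ms = map (%i. dn (Gs ! i) (vs ! i) (op_args T f ! i)) [0..<n]"
 define ns where "ns = map (%i. dn (Gs ! i) (ws ! i) (op_args T f ! i)) [0..<n]"
 have "Gs \<noteq> []" using cong_op.hyps op_args_nonempty by auto
 then obtain s where s: "nshuffle_mor M Gs E s" using nshuffles_nshuffle_mor cong_op.hyps by blast
 have d1: "denotes T M E (Op f vs) (op_res T f) (op_mor M f \<cdot> ntmor M ms \<cdot> s)"
  using cong_op.hyps s ty typed_denotation by (intro den_op[of f T Gs]) (auto simp: ms_def n_def)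
 have d2: "denotes T M E (Op f ws) (op_res T f) (op_mor M f \<cdot> ntmor M ns \<cdot> s)"
  using cong_op.hyps s ty typed_denotation by (intro den_op[of f T Gs]) (auto simp: ns_def n_def)
 have F: "agr (env E) E" using agr_env denotes_typed[OF d1] typed_iff by blast
 have "ntmor M ms \<in> hom M (ntobj M (map (ctx_obj M) Gs)) (ntobj M (map (ty_obj M) (op_args T f))) &
   ntmor M ns \<in> hom M (ntobj M (map (ctx_obj M) Gs)) (ntobj M (map (ty_obj M) (op_args T f))) &
   prod_list qs \<le> hdist M (ntmor M ms) (ntmor M ns)"
  using cong_op.hyps ty denotation_hom cong_op.IH by (intro hd_ntmor) (auto simp: ms_def ns_def n_def)
 then have "prod_list qs \<le> hdist M (op_mor M f \<cdot> ntmor M ms \<cdot> s) (op_mor M f \<cdot> ntmor M ns \<cdot> s)"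
  using nshuffle_mor_hom[OF s F] op_mor_hom[OF cong_op.hyps(1)] by (intro hd_post hd_pre) (auto intro: hom_comp)
 then show ?case using denotes_denotation[OF d1] denotes_denotation[OF d2] by simp
next
 case (cong_pair G v q w A H v' r w' A' E)
 have ty: "typed T G v A" "typed T G w A" "typed T H v' A'" "typed T H w' A'"
  using cong_pair.hyps theorem_typed[OF th] by blast+
 note h = ty[THEN denotation_hom] and d = ty[THEN typed_denotation]
 obtain s where s: "shuffle_mor M G H E s" using cong_pair.hyps shuffles_shuffle_mor by blast
 note d1 = den_pair[OF d(1) d(3) cong_pair.hyps(3) s] and d2 = den_pair[OF d(2) d(4) cong_pair.hyps(3) s]
 have F: "agr (env E) E" using agr_env denotes_typed[OF d1] typed_iff by blast
 show ?case
  unfolding denotes_denotation[OF d1] denotes_denotation[OF d2]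
  by (rule hd_pre[OF hd_tenI[OF cong_pair.IH h] shuffle_mor_hom[OF s F] tmor_hom[OF h(1) h(3)] tmor_hom[OF h(2) h(4)]])
next
 case (cong_letstar G v q w H v' r w' A E)
 have ty: "typed T G v TUnit" "typed T G w TUnit" "typed T H v' A" "typed T H w' A"
  using cong_letstar.hyps theorem_typed[OF th] by blast+
 note h = ty[THEN denotation_hom] and d = ty[THEN typed_denotation]
 obtain s where s: "shuffle_mor M G H E s" using cong_letstar.hyps shuffles_shuffle_mor by blast
 note d1 = den_letstar[OF d(1) d(3) cong_letstar.hyps(3) s] and d2 = den_letstar[OF d(2) d(4) cong_letstar.hyps(3) s]
 have F: "agr (env E) E" using agr_env denotes_typed[OF d1] typed_iff by blast
 note hs = shuffle_mor_hom[OF s F]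
 have o: "ctx_obj M H \<in> obj M" using h(3) mor_obj[of "dn H v' A"] by (simp add: hom_def)
 note hi = id_hom[OF o] and hl = lunit_hom[OF o, THEN conjunct1]
 have ht: "dn G u TUnit \<otimes> \<i> (ctx_obj M H) \<in> hom M (ctx_obj M G \<odot> ctx_obj M H) (\<one> \<odot> ctx_obj M H)"
  if "typed T G u TUnit" for u
  using tmor_hom[OF denotation_hom[OF that] hi] by simp
 \<comment> \<open>The context of the body is carried along by an identity, which contributes the
   factor 1. The body itself contributes \<open>r\<close> only at the last composition.\<close>
 have "q * 1 \<le> hdist M (dn G v TUnit \<otimes> \<i> (ctx_obj M H)) (dn G w TUnit \<otimes> \<i> (ctx_obj M H))"
  by (rule hd_tenI[OF cong_letstar.IH(1) hd_refl[OF hi] h(1,2) hi hi])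
 then have 1: "q \<le> hdist M ((dn G v TUnit \<otimes> \<i> (ctx_obj M H)) \<cdot> s) ((dn G w TUnit \<otimes> \<i> (ctx_obj M H)) \<cdot> s)"
  using hs ht ty by (intro hd_pre) auto
 then have 2: "q \<le> hdist M (\<l> (ctx_obj M H) \<cdot> (dn G v TUnit \<otimes> \<i> (ctx_obj M H)) \<cdot> s)
   (\<l> (ctx_obj M H) \<cdot> (dn G w TUnit \<otimes> \<i> (ctx_obj M H)) \<cdot> s)"
  using hs ht ty hl by (intro hd_post[OF 1 hl]) (auto intro: hom_comp)
 show ?case
  unfolding denotes_denotation[OF d1] denotes_denotation[OF d2]
  by (rule hd_compI[OF 2 cong_letstar.IH(2) _ _ h(3,4)]) (use hs ht ty hl in \<open>auto intro: hom_comp\<close>)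
next
 case (cong_app G v q w A A' H v' r w' E)
 have ty: "typed T G v (Lolli A A')" "typed T G w (Lolli A A')" "typed T H v' A" "typed T H w' A"
  using cong_app.hyps theorem_typed[OF th] by blast+
 note h = ty[THEN denotation_hom] and d = ty[THEN typed_denotation]
 obtain s where s: "shuffle_mor M G H E s" using cong_app.hyps shuffles_shuffle_mor by blast
 note d1 = den_app[OF d(1) d(3) cong_app.hyps(3) s] and d2 = den_app[OF d(2) d(4) cong_app.hyps(3) s]
 have F: "agr (env E) E" using agr_env denotes_typed[OF d1] typed_iff by blast
 have "set_ty (Lolli A A') \<subseteq> ground T" using typed_res_ground[OF op_res_ground ty(1)] .
 then have e: "eval_at M (ty_obj M A) (ty_obj M A') \<in> hom M (ty_obj M (Lolli A A') \<odot> ty_obj M A) (ty_obj M A')"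
  by (simp add: hom_iff)
 note t = tmor_hom[OF h(1) h(3)] tmor_hom[OF h(2) h(4)]
 show ?case
  unfolding denotes_denotation[OF d1] denotes_denotation[OF d2]
  by (rule hd_post[OF hd_pre[OF hd_tenI[OF cong_app.IH h] shuffle_mor_hom[OF s F] t] e])
   (use t shuffle_mor_hom[OF s F] in \<open>auto intro: hom_comp\<close>)
next
 case (cong_pm G v q w A A' H x y v' r w' C E)
 have ty: "typed T G v (Tensor A A')" "typed T G w (Tensor A A')" "typed T (H @ [(x, A), (y, A')]) v' C" "typed T (H @ [(x, A), (y, A')]) w' C"
  using cong_pm.hyps theorem_typed[OF th] by blast+
 note h = ty[THEN denotation_hom] and d = ty[THEN typed_denotation]
 obtain s where s: "shuffle_mor M G H E s" using cong_pm.hyps shuffles_shuffle_mor by blast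
 note d1 = den_pm[OF d(1) d(3) cong_pm.hyps(3) s] and d2 = den_pm[OF d(2) d(4) cong_pm.hyps(3) s]
 have F: "agr (env E) E" using agr_env denotes_typed[OF d1] typed_iff by blast
 note hs = shuffle_mor_hom[OF s F]
 have wt: "wty T ((H @ [(x, A)]) @ [(y, A')]) v' C" unfolding typed_iff[symmetric] using ty(3) by simp
 note F2 = agr_env[OF wt]
 then have F1: "agr (env ((H @ [(x, A)]) @ [(y, A')])) (H @ [(x, A)])" "agr (env ((H @ [(x, A)]) @ [(y, A')])) H" by auto
 have o: "ty_obj M A \<in> obj M" "ty_obj M A' \<in> obj M" "ctx_obj M H \<in> obj M"
  using F2 F1 ctx_obj_ce wfe_ce by auto
 note hi = id_hom[OF o(3)] and hi' = id_hom[OF o(2)]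
 note ht = tmor_hom[OF h(1) hi] tmor_hom[OF h(2) hi]
 have 1: "q * 1 \<le> hdist M (dn G v (Tensor A A') \<otimes> \<i> (ctx_obj M H)) (dn G w (Tensor A A') \<otimes> \<i> (ctx_obj M H))"
  by (rule hd_tenI[OF cong_pm.IH(1) hd_refl[OF hi] h(1,2) hi hi])
 note c = hd_pre[OF 1 hs ht] hom_comp[OF hs ht(1)] hom_comp[OF hs ht(2)]
 have sw: "\<s> (ty_obj M (Tensor A A')) (ctx_obj M H) \<in> hom M (ty_obj M (Tensor A A') \<odot> ctx_obj M H) (ctx_obj M H \<odot> (ty_obj M A \<odot> ty_obj M A'))"
  using o by (simp add: hom_iff)
 note c = hd_post[OF c(1) sw c(2,3)] hom_comp[OF c(2) sw] hom_comp[OF c(3) sw]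
 have as: "inv_arr M (\<a> (ctx_obj M H) (ty_obj M A) (ty_obj M A')) \<in> hom M (ctx_obj M H \<odot> (ty_obj M A \<odot> ty_obj M A')) (ctx_obj M H \<odot> ty_obj M A \<odot> ty_obj M A')"
  using o by (simp add: hom_iff)
 note c = hd_post[OF c(1) as c(2,3)] hom_comp[OF c(2) as] hom_comp[OF c(3) as]
 note j = tmor_hom[OF jn_hom[OF F1(1)] hi']
 note c = hd_post[OF c(1) j c(2,3)] hom_comp[OF c(2) j] hom_comp[OF c(3) j]
 note j = jn_hom[OF F2]
 note c = hd_post[OF c(1) j c(2,3)] hom_comp[OF c(2) j] hom_comp[OF c(3) j]
 show ?case
  unfolding denotes_denotation[OF d1] denotes_denotation[OF d2]
  using hd_compI[OF c(1) cong_pm.IH(2) c(2,3)] h(3,4) by simp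
next
 case (cong_subst G x A v q w A' H v' r w' E)
 have ty: "typed T (G @ [(x, A)]) v A'" "typed T (G @ [(x, A)]) w A'" "typed T H v' A" "typed T H w' A"
  using cong_subst.hyps theorem_typed[OF th] by blast+
 note l = ty_lam[OF ty(1)] ty_lam[OF ty(2)]
 note h = l(1)[THEN denotation_hom] l(2)[THEN denotation_hom] ty(3,4)[THEN denotation_hom]
 obtain s where s: "shuffle_mor M G H E s" using cong_subst.hyps shuffles_shuffle_mor by blast
 have E: "agr (env E) E"
  using agr_env denotes_typed[OF den_pair[OF typed_denotation[OF l(1)] typed_denotation[OF ty(3)] cong_subst.hyps(3) s]] typed_iff by blast
 have "set_ty (Lolli A A') \<subseteq> ground T" using typed_res_ground[OF op_res_ground l(1)] .
 then have e: "eval_at M (ty_obj M A) (ty_obj M A') \<in> hom M (ty_obj M (Lolli A A') \<odot> ty_obj M A) (ty_obj M A')"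
  by (simp add: hom_iff)
 note t = tmor_hom[OF h(1) h(3)] tmor_hom[OF h(2) h(4)] and hs = shuffle_mor_hom[OF s E]
 show ?case
  \<comment> \<open>Read as applications of abstractions, the two sides differ in a tensor of
    morphisms between a fixed shuffle and a fixed evaluation.\<close>
  unfolding subst_sound[OF ty(1,3) cong_subst.hyps(3) s] subst_sound[OF ty(2,4) cong_subst.hyps(3) s]
  by (rule hd_post[OF hd_pre[OF hd_tenI[OF hd_Lam[OF ty(1,2) cong_subst.IH(1)] cong_subst.IH(2) h] hs t] e hom_comp[OF hs t(1)] hom_comp[OF hs t(2)]])
next
 case (cong_lam G x A v q w A')
 then show ?case using hd_Lam theorem_typed[OF th] by blast
next
 case (perm G v q w A H)
 have ty: "typed T G v A" "typed T G w A" using perm.hyps theorem_typed[OF th] by blast+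
 then have wt: "wty T G v A" "wty T G w A" using typed_iff by blast+
 then have wt': "wty T H v A" "wty T H w A" using wty_perm perm.hyps by blast+
 define F where "F = env G"
 have F: "agr F G" using agr_env[OF wt(1)] by (simp add: F_def)
 have F': "agr F H" using F perm.hyps by (auto simp: agr_def dest: mset_eq_setD)
 have n: "names H = names G" using perm.hyps names_mset by blast
 note d = dok_wty[OF wt(1) F] dok_wty[OF wt(2) F]
 \<comment> \<open>Exchange is precomposition with one rearrangement, common to both sides.\<close>
 have "can (om F) (ce H) (ce G) \<in> hom M (ob (om F) (ce H)) (ob (om F) (ce G))"
  using can_arr[OF wfe_ce[OF F'], of "ce G"] n by (simp add: hom_iff)
 then have "q \<le> hdist M (Dn F (ce G) v \<cdot> can (om F) (ce H) (ce G)) (Dn F (ce G) w \<cdot> can (om F) (ce H) (ce G))"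
  using perm.IH Dn_arr[OF d(1)] Dn_arr[OF d(2)] denotation_Dn[OF wt(1) F] denotation_Dn[OF wt(2) F]
  by (intro hd_pre) (auto simp: hom_iff)
 then show ?case
  using Dn_pre[OF d(1), of "ce H"] Dn_pre[OF d(2), of "ce H"] n denotation_Dn[OF wt'(1) F'] denotation_Dn[OF wt'(2) F'] by simp
qed

end

lemma model_lam_interp:
 "linear_vlam_theory B T ==> is_model T M ==> lam_interp M T"
 unfolding lam_interp_def lam_interp_axioms_def is_model_def linear_vlam_theory_def by blast

theorem soundness:
 assumes "quantale_basis B" "linear_vlam_theory B T" "is_model T M" "is_theorem B T G v q w A"
 shows "holds T M G v q w A"
proof -
 interpret lam_interp M T using model_lam_interp assms by blast
 show ?thesis unfolding holds_def
  by (rule theorem_sound[OF assms(2,1) _ assms(4)]) (use assms(3) in \<open>auto simp: is_model_def\<close>)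
qed

subsection \<open>Theorems up to exchange\<close>

lemma uses_typed: "typed T G v A ==> Free x \<in># uses v \<longleftrightarrow> x \<in> ctx_vars G"
 by (simp add: typed_iff wty_def)

locale linear_theory =
 fixes B :: "'v::continuous_integral_quantale set" and T :: "('g, 'f, 'v) vlam_theory"
 assumes basis: "quantale_basis B" and lin_thy: "linear_vlam_theory B T"
begin

abbreviation thr :: "'g ctx => ('g, 'f) tm => 'v => ('g, 'f) tm => 'g ty => bool" where
 "thr \<equiv> is_theorem B T"

lemma thr_typed: "thr G v q w A ==> typed T G v A & typed T G w A"
 using theorem_typed[OF lin_thy] .

lemma thr_is_ctx: "thr G v q w A ==> is_ctx G"
 using thr_typed typed_is_ctx by blast

lemma op_ground:
 "f \<in> ops T ==> op_args T f \<noteq> [] & (\<forall>A\<in>set (op_args T f). set_ty A \<subseteq> ground T) & set_ty (op_res T f) \<subseteq> ground T"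
 using lin_thy by (simp add: linear_vlam_theory_def)

lemma res_ground: "typed T G v A ==> set_ty A \<subseteq> ground T"
 using typed_res_ground[of T] op_ground by blast

lemma ctx_append_mset: "is_ctx E ==> mset E = mset G + mset H ==> is_ctx (G @ H)"
 using is_ctx_mset[of "G @ H" E] by simp

lemma thr_Ten:
 assumes "thr G v q w A" "thr H v' r w' A'" "is_ctx E" "mset E = mset G + mset H"
 shows "thr E (Ten v v') (q * r) (Ten w w') (Tensor A A')"
 by (rule is_theorem.perm[OF cong_pair[OF assms(1,2) ctx_append_mset[OF assms(3,4)] append_in_shuffles]]) (simp add: assms(4))

lemma thr_LetStar:
 assumes "thr G v q w TUnit" "thr H v' r w' A" "is_ctx E" "mset E = mset G + mset H"
 shows "thr E (LetStar v v') (q * r) (LetStar w w') A"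
 by (rule is_theorem.perm[OF cong_letstar[OF assms(1,2) ctx_append_mset[OF assms(3,4)] append_in_shuffles]]) (simp add: assms(4))

lemma thr_App:
 assumes "thr G v q w (Lolli A A')" "thr H v' r w' A" "is_ctx E" "mset E = mset G + mset H"
 shows "thr E (App v v') (q * r) (App w w') A'"
 by (rule is_theorem.perm[OF cong_app[OF assms(1,2) ctx_append_mset[OF assms(3,4)] append_in_shuffles]]) (simp add: assms(4))

lemma thr_Pm:
 assumes "thr G v q w (Tensor A A')" "thr H' v' r w' C" "mset H' = mset H + {#(x, A), (y, A')#}"
  "is_ctx E" "mset E = mset G + mset H"
 shows "thr E (Pm v x y v') (q * r) (Pm w x y w') C"
proof -
 have "thr (H @ [(x, A), (y, A')]) v' r w' C" using is_theorem.perm[OF assms(2), of "H @ [(x, A), (y, A')]"] assms(3) by simp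
 from is_theorem.perm[OF cong_pm[OF assms(1) this ctx_append_mset[OF assms(4,5)] append_in_shuffles]] assms(5) show ?thesis by simp
qed

lemma thr_subst1:
 assumes "thr G' v q w C" "mset G' = add_mset (x, A) (mset G)" "thr H v' r w' A" "is_ctx E" "mset E = mset G + mset H"
 shows "thr E (v[x ::= v']) (q * r) (w[x ::= w']) C"
proof -
 have "thr (G @ [(x, A)]) v q w C" using is_theorem.perm[OF assms(1)] assms(2) by simp
 from is_theorem.perm[OF cong_subst[OF this assms(3) ctx_append_mset[OF assms(4,5)] append_in_shuffles]] assms(5)
 show ?thesis by simp
qed

lemma top_mult [simp]: "top * (q :: 'v) = q" "q * top = q"
 by (simp_all flip: one_eq_top)

text \<open>The substituted variables are disjoint from the new context; the general case follows by renaming.\<close>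

lemma thr_substs_fresh:
 assumes "thr G0 v q w A" "mset G0 = mset H + mset G" "\<And>x C. (x, C) \<in> set G ==> typed T (D x) (s x) C"
  "mset E = mset H + sum_list (map (%p. mset (D (fst p))) G)" "is_ctx E" "ctx_vars G \<inter> ctx_vars E = {}"
  "\<And>x. x \<notin> ctx_vars G ==> s x = Var x"
 shows "thr E (subst s v) q (subst s w) A"
 using assms
proof (induction G arbitrary: G0 H v w s)
 case Nil
 then have "s = Var" by auto
 with Nil show ?case using is_theorem.perm[OF Nil.prems(1)] by simp
next
 case (Cons p G)
 obtain x C where p: "p = (x, C)" by (cases p)
 have "is_ctx G0" using thr_is_ctx Cons.prems(1) .
 then have c: "is_ctx (H @ p # G)" using is_ctx_mset[of "H @ p # G" G0] Cons.prems(2) by simp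
 then have x: "x \<notin> ctx_vars G" using p by simp
 have sx: "typed T (D x) (s x) C" using Cons.prems(3) p by simp
 have "mset (H @ D x) \<subseteq># mset E" using Cons.prems(4) by (simp add: p flip: add.assoc)
 then have "is_ctx (H @ D x)" using Cons.prems(5) is_ctx_sub by blast
 moreover have DE: "ctx_vars (D x) \<subseteq> ctx_vars E"
  using arg_cong[OF Cons.prems(4), of set_mset] p by (auto simp: ctx_vars_def)
 ultimately have c': "is_ctx (H @ G @ D x)" using c Cons.prems(6) by auto
 have t: "thr (H @ G @ D x) (v[x ::= s x]) (q * top) (w[x ::= s x]) A"
  using thr_subst1[OF Cons.prems(1) _ is_theorem.refl[OF sx] c', of x "H @ G"] Cons.prems(2) p by simp
 \<comment> \<open>The variable \<open>x\<close> has been dealt with, so the remaining substitution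
   leaves it alone. It also fixes \<open>s x\<close>, whose variables lie in \<open>E\<close> and
   hence outside the old context.\<close>
 define s' where "s' = s(x := Var x)"
 have e: "subst s' (u[x ::= s x]) = subst s u" for u
 proof -
  have "subst s' (s x) = s x"
   using uses_typed[OF sx] DE Cons.prems(6,7) by (intro subst_ident) (auto simp: s'_def p)
  then have "(%y. subst s' ((Var(x := s x)) y)) = s" by (auto simp: s'_def)
  then show ?thesis unfolding subst_subst by simp
 qed
 have "thr E (subst s' (v[x ::= s x])) q (subst s' (w[x ::= s x])) A"
 proof (rule Cons.IH[where H = "H @ D x"])
  show "typed T (D y) (s' y) C'" if "(y, C') \<in> set G" for y C'
   using that x Cons.prems(3) by (auto simp: s'_def dest: ctx_varsI)
 qed (use t Cons.prems p in \<open>auto simp: s'_def\<close>)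
 then show ?case by (simp add: e del: fun_upd_apply)
qed

text \<open>\<open>cong_subst\<close> replaces one variable at a time, which goes wrong if the terms
  put in mention variables still to be replaced. Hence two passes: all variables are first moved to
  fresh ones, then replaced.\<close>

lemma thr_substs:
 assumes v: "thr G v q w A" and s: "\<And>x C. (x, C) \<in> set G ==> typed T (D x) (s x) C"
  and E: "mset E = sum_list (map (%p. mset (D (fst p))) G)" "is_ctx E"
 shows "thr E (subst s v) q (subst s w) A"
proof -
 have c: "is_ctx G" using thr_is_ctx v .
 \<comment> \<open>A bound above every variable of both contexts; adding \<open>N\<close> makes the
   intermediate variables disjoint from either of them.\<close>
 obtain N where N: "\<And>x. x \<in> ctx_vars G \<union> ctx_vars E ==> x < N"
  using finite_nat_set_iff_bounded[of "ctx_vars G \<union> ctx_vars E"] by auto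
 define G' where "G' = map (%p. (fst p + N, the (map_of G (fst p)))) G"
 have m: "map_of G x = Some C" if "(x, C) \<in> set G" for x C
  using that c by (simp add: is_ctx_def)
 have g': "\<exists>x. y = x + N & (x, C) \<in> set G" if "(y, C) \<in> set G'" for y C
  using that m by (fastforce simp: G'_def)
 have cv: "ctx_vars G' = (%x. x + N) ` ctx_vars G" by (auto simp: G'_def ctx_vars_def image_image)
 have "map fst G' = map (%x. x + N) (map fst G)" by (simp add: G'_def)
 then have c': "is_ctx G'" using c unfolding is_ctx_def by (simp add: distinct_map del: map_map)
 define s1 where "s1 x = (if x \<in> ctx_vars G then Var (x + N) else Var x :: ('g, 'f) tm)" for x
 have 1: "thr G' (subst s1 v) q (subst s1 w) A"
 proof (rule thr_substs_fresh[OF v, where H = "[]" and D = "%x. [(x + N, the (map_of G x))]"])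
  show "typed T [(x + N, the (map_of G x))] (s1 x) C" if "(x, C) \<in> set G" for x C
   using m[OF that] ctx_varsI[OF that] typed_ground[OF conjunct1[OF thr_typed[OF v]] that] by (simp add: s1_def ty_var)
  have "mset G' = sum_list (map (%p. mset [(fst p + N, the (map_of G (fst p)))]) G)"
   unfolding G'_def by (induction G) simp_all
  then show "mset G' = mset [] + sum_list (map (%p. mset [(fst p + N, the (map_of G (fst p)))]) G)" by simp
  show "ctx_vars G \<inter> ctx_vars G' = {}" using N by (fastforce simp: cv)
 qed (use c' in \<open>auto simp: s1_def\<close>)
 define s2 where "s2 y = (if y \<in> ctx_vars G' then s (y - N) else Var y)" for y
 have "thr E (subst s2 (subst s1 v)) q (subst s2 (subst s1 w)) A"
 proof (rule thr_substs_fresh[OF 1, where H = "[]" and D = "%y. D (y - N)"])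
  show "typed T (D (y - N)) (s2 y) C" if "(y, C) \<in> set G'" for y C
   using g'[OF that] s ctx_varsI[OF that] by (auto simp: s2_def)
  show "mset E = mset [] + sum_list (map (%p. mset (D (fst p - N))) G')"
   using E(1) by (simp add: G'_def comp_def)
  show "ctx_vars G' \<inter> ctx_vars E = {}" using N by (fastforce simp: cv)
 qed (use E in \<open>auto simp: s2_def\<close>)
 moreover have "subst s2 (subst s1 u) = subst s u" if "typed T G u A" for u
  unfolding subst_subst
  by (rule subst_cong) (use uses_typed[OF that] in \<open>auto simp: s1_def s2_def cv\<close>)
 ultimately show ?thesis using thr_typed[OF v] by simp
qed

abbreviation eqv :: "'g ctx => ('g, 'f) tm => ('g, 'f) tm => 'g ty => bool" where
 "eqv G v w A \<equiv> thr G v top w A & thr G w top v A"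

lemma thr_trans1: "thr G v top w A ==> thr G w r u A ==> thr G v r u A"
 using is_theorem.trans[of B T G v top w A r u] by simp

lemma thr_trans2: "thr G v r w A ==> thr G w top u A ==> thr G v r u A"
 using is_theorem.trans[of B T G v r w A top u] by simp

lemma eqv_lam: "lam_eq T G v w A ==> eqv G v w A"
 using is_theorem.lam_eq is_theorem.lam_eq_sym by blast

lemma eqv_trans: "eqv G v w A ==> eqv G w u A ==> eqv G v u A"
 using thr_trans1 by blast

lemma eqv_perm: "eqv G v w A ==> mset H = mset G ==> eqv H v w A"
 using is_theorem.perm by blast

lemma thr_sandwich: "eqv G v' v A ==> eqv G w' w A ==> thr G v' q w' A ==> thr G v q w A"
 using thr_trans1 thr_trans2 by blast

subsection \<open>Patterns\<close>

declare fun_upd_apply [simp del]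

text \<open>A variable is a pattern at every type, so a pattern may stop above the leaves of a
  tensor type. That the variables are distinct is enforced by \<open>is_ctx\<close>.\<close>

inductive pat :: "'g ctx => ('g, 'f) tm => 'g ty => bool" where
 pat_Var: "set_ty A \<subseteq> ground T ==> pat [(x, A)] (Var x) A"
| pat_Star: "pat [] Star TUnit"
| pat_Ten: "pat G p A ==> pat H p' A' ==> is_ctx (G @ H) ==> pat (G @ H) (Ten p p') (Tensor A A')"

lemma pat_typed: "pat G p A ==> typed T G p A"
 by (induction rule: pat.induct) (auto intro: typed.intros append_in_shuffles)

lemma subst1_split_Ten:
 assumes "typed T G u C" "x \<notin> ctx_vars G" "y \<notin> ctx_vars G" "x \<noteq> y" "Free y \<notin># uses p"
 shows "((u[z ::= Ten (Var x) (Var y)])[x ::= p])[y ::= p'] = u[z ::= Ten p p']"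
  and "(u[z ::= Ten (Var x) (Var y)])[y ::= p'] = u[z ::= Ten (Var x) p']"
  and "(u[z ::= Ten (Var x) p'])[x ::= p] = u[z ::= Ten p (p'[x ::= p])]"
  and "(u[z ::= Ten (Var x) (Var y)])[x ::= p, y ::= p'] = u[z ::= Ten p p']"
proof -
 have "p[y ::= p'] = p" using assms(5) by (intro subst_ident) (auto simp: fun_upd_apply)
 then show "((u[z ::= Ten (Var x) (Var y)])[x ::= p])[y ::= p'] = u[z ::= Ten p p']"
  "(u[z ::= Ten (Var x) (Var y)])[y ::= p'] = u[z ::= Ten (Var x) p']"
  "(u[z ::= Ten (Var x) p'])[x ::= p] = u[z ::= Ten p (p'[x ::= p])]"
  "(u[z ::= Ten (Var x) (Var y)])[x ::= p, y ::= p'] = u[z ::= Ten p p']"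
  using assms by (auto simp: fun_upd_apply subst_subst uses_typed intro!: subst_cong)
qed

lemma two_fresh: "finite X ==> \<exists>x y :: var. x \<noteq> y & x \<notin> X & y \<notin> X"
 using fresh_var[of X] fresh_var[of "insert _ X"] by (metis finite_insert insertCI)

text \<open>Undoes the pattern. A variable is renamed back; for \<open>Star\<close> and for pairs,
  the terms are rebuilt from their values on the constructor by the congruence rules of
  \<open>LetStar\<close> and \<open>Pm\<close>, and the \<eta>-rules identify the results with
  \<open>u\<close> and \<open>u'\<close>.\<close>

lemma pat_ext:
 assumes "pat G p A" "typed T (H @ [(z, A)]) u C" "typed T (H @ [(z, A)]) u' C" "is_ctx (H @ G)"
  "thr (H @ G) (u[z ::= p]) q (u'[z ::= p]) C"
 shows "thr (H @ [(z, A)]) u q u' C"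
 using assms
proof (induction arbitrary: H z u u' rule: pat.induct)
 case (pat_Var A x)
 have c: "is_ctx (H @ [(z, A)])" using typed_is_ctx pat_Var by blast
 have "thr (H @ [(z, A)]) ((u[z ::= Var x])[x ::= Var z]) (q * top) ((u'[z ::= Var x])[x ::= Var z]) C"
  by (rule thr_subst1[OF pat_Var.prems(4) _ is_theorem.refl[OF ty_var[OF pat_Var.hyps]] c]) auto
 moreover have "(t[z ::= Var x])[x ::= Var z] = t" if "typed T (H @ [(z, A)]) t C" for t
  unfolding subst_subst using pat_Var.prems(3) by (intro subst_ident) (auto simp: fun_upd_apply uses_typed[OF that])
 ultimately show ?case using pat_Var by (simp del: fun_upd_apply)
next
 case pat_Star
 have c: "is_ctx (H @ [(z, TUnit)])" using typed_is_ctx pat_Star by blast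
 have v: "typed T [(z, TUnit)] (Var z) TUnit" by (simp add: ty_var)
 have "eqv ([(z, TUnit)] @ H) (LetStar (Var z) (t[z ::= Star])) (t[z ::= Var z]) C"
  if "typed T (H @ [(z, TUnit)]) t C" for t
  by (rule eqv_lam[OF star_eta[OF v that _ append_in_shuffles]]) (use c in auto)
 then have e: "eqv (H @ [(z, TUnit)]) (LetStar (Var z) (t[z ::= Star])) t C" if "typed T (H @ [(z, TUnit)]) t C" for t
  using that eqv_perm[of "[(z, TUnit)] @ H" _ _ _ "H @ [(z, TUnit)]"] by (auto simp: fun_upd_idem)
 have "thr (H @ [(z, TUnit)]) (LetStar (Var z) (u[z ::= Star])) (top * q) (LetStar (Var z) (u'[z ::= Star])) C"
  using pat_Star.prems(4) by (intro thr_LetStar[OF is_theorem.refl[OF v] _ c, where H = H]) (auto simp del: fun_upd_apply)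
 then show ?case using thr_sandwich[OF e[OF pat_Star.prems(1)] e[OF pat_Star.prems(2)]] by simp
next
 case (pat_Ten G1 p1 A1 G2 p2 A2)
 let ?H = "H @ [(z, Tensor A1 A2)]"
 obtain x y where xy: "x \<noteq> y" "x \<notin> ctx_vars (?H @ G1 @ G2)" "y \<notin> ctx_vars (?H @ G1 @ G2)"
  using two_fresh[of "ctx_vars (?H @ G1 @ G2)"] by (meson finite_ctx_vars)
 have c: "is_ctx ?H" using typed_is_ctx pat_Ten by blast
 have p: "typed T G1 p1 A1" "typed T G2 p2 A2" using pat_typed pat_Ten by blast+
 have g: "set_ty A1 \<subseteq> ground T" "set_ty A2 \<subseteq> ground T" using p res_ground by auto
 have n: "Free y \<notin># uses p1" "Free x \<notin># uses p2" using xy uses_typed[OF p(1)] uses_typed[OF p(2)] by auto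
 then have p2: "p2[x ::= p1] = p2" by (intro subst_ident) (auto simp: fun_upd_apply)
 let ?xy = "Ten (Var x) (Var y)"
 have xyt: "typed T [(x, A1), (y, A2)] ?xy (Tensor A1 A2)"
  by (rule typed_Ten[OF ty_var[OF g(1)] ty_var[OF g(2)]]) (use xy in auto)
 have c1: "is_ctx ((H @ [(x, A1)]) @ [(y, A2)])" "is_ctx ((H @ [(x, A1)]) @ G2)" "is_ctx ((H @ G2) @ [(x, A1)])" "is_ctx ((H @ G2) @ G1)"
  using c xy pat_Ten.prems(3) pat_Ten.hyps by auto
 have s: "(t[z ::= Ten (Var x) p2])[x ::= p1] = t[z ::= Ten p1 p2]" "(t[z ::= ?xy])[y ::= p2] = t[z ::= Ten (Var x) p2]"
  if "typed T ?H t C" for t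
  using subst1_split_Ten[OF that _ _ xy(1) n(1)] xy p2 by auto
 have t1: "typed T ((H @ [(x, A1)]) @ [(y, A2)]) (t[z ::= ?xy]) C" if "typed T ?H t C" for t
  by (rule typed_subst1[OF that _ xyt, of z "H"]) (use c1 in auto)
 have t2: "typed T ((H @ G2) @ [(x, A1)]) (t[z ::= Ten (Var x) p2]) C" if "typed T ?H t C" for t
  unfolding s(2)[OF that, symmetric] by (rule typed_subst1[OF t1[OF that] _ p(2), where G = "H @ [(x, A1)]"]) (use c1 in auto)
 \<comment> \<open>The components are undone one at a time: first the left one becomes
   \<open>x\<close> while the right one stays, then the right one becomes \<open>y\<close>.\<close>
 have "thr ((H @ G2) @ [(x, A1)]) (u[z ::= Ten (Var x) p2]) q (u'[z ::= Ten (Var x) p2]) C"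
  by (rule pat_Ten.IH(1)[OF t2 t2 c1(4)])
   (use pat_Ten.prems s is_theorem.perm[OF pat_Ten.prems(4), of "(H @ G2) @ G1"] in \<open>auto simp del: fun_upd_apply\<close>)
 then have "thr ((H @ [(x, A1)]) @ G2) (u[z ::= Ten (Var x) p2]) q (u'[z ::= Ten (Var x) p2]) C"
  by (rule is_theorem.perm) auto
 then have "thr ((H @ [(x, A1)]) @ [(y, A2)]) (u[z ::= ?xy]) q (u'[z ::= ?xy]) C"
  by (intro pat_Ten.IH(2)[OF t1 t1 c1(2)]) (use pat_Ten.prems s in \<open>auto simp del: fun_upd_apply\<close>)
 then have 1: "thr ?H (Pm (Var z) x y (u[z ::= ?xy])) (top * q) (Pm (Var z) x y (u'[z ::= ?xy])) C"
  by (intro thr_Pm[OF is_theorem.refl[OF ty_var[of "Tensor A1 A2" T z]], where H = H]) (use g c in auto)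
 have e: "eqv ?H (Pm (Var z) x y (t[z ::= ?xy])) t C" if "typed T ?H t C" for t
 proof -
  have "eqv ([(z, Tensor A1 A2)] @ H) (Pm (Var z) x y (t[z ::= ?xy])) (t[z ::= Var z]) C"
   by (rule eqv_lam[OF pm_eta[OF ty_var that xy(1) _ _ _ append_in_shuffles]]) (use g c xy in auto)
  then have "eqv ?H (Pm (Var z) x y (t[z ::= ?xy])) (t[z ::= Var z]) C" by (rule eqv_perm) simp
  then show ?thesis by (simp add: fun_upd_idem del: fun_upd_apply)
 qed
 show ?case using thr_sandwich[OF e e] 1 pat_Ten.prems(1,2) by simp
qed

text \<open>The existence that goes with the uniqueness in \<open>pat_ext\<close>, obtained from the
  \<beta>-rules: the witness destructs \<open>z\<close> with \<open>LetStar\<close> or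
  \<open>Pm\<close> and continues as \<open>u\<close>. With it, arrows can be defined by their
  effect on a pattern.\<close>

lemma pat_surj:
 assumes "pat G p A" "typed T (H @ G) u C" "z \<notin> ctx_vars H"
 shows "\<exists>t. typed T (H @ [(z, A)]) t C & eqv (H @ G) (t[z ::= p]) u C"
 using assms
proof (induction arbitrary: H z u rule: pat.induct)
 case (pat_Var A x)
 have c: "is_ctx (H @ [(x, A)])" using typed_is_ctx pat_Var by blast
 have "typed T (H @ [(z, A)]) (u[x ::= Var z]) C"
  by (rule typed_subst1[OF pat_Var.prems(1) _ ty_var[OF pat_Var.hyps]]) (use c pat_Var.prems in auto)
 moreover have "(u[x ::= Var z])[z ::= Var x] = u"
  unfolding subst_subst using pat_Var.prems by (intro subst_ident) (auto simp: fun_upd_apply uses_typed)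
 ultimately show ?case using is_theorem.refl[OF pat_Var.prems(1)] by (intro exI[of _ "u[x ::= Var z]"]) simp
next
 case pat_Star
 have c: "is_ctx H" using typed_is_ctx pat_Star by force
 have "u[z ::= Star] = u"
  using pat_Star.prems(2) by (intro subst_ident) (auto simp: fun_upd_apply uses_typed[OF pat_Star.prems(1)])
 then have "(LetStar (Var z) u)[z ::= Star] = LetStar Star u" by (simp add: fun_upd_same)
 moreover have "typed T (H @ [(z, TUnit)]) (LetStar (Var z) u) C"
  by (rule typed_LetStar[OF ty_var pat_Star.prems(1)]) (use c pat_Star.prems in auto)
 ultimately show ?case using eqv_lam[OF star_beta[OF pat_Star.prems(1)]] by metis
next
 case (pat_Ten G1 p1 A1 G2 p2 A2)
 obtain x y where xy: "x \<noteq> y" "x \<notin> ctx_vars (H @ (z, Tensor A1 A2) # G1 @ G2)" "y \<notin> ctx_vars (H @ (z, Tensor A1 A2) # G1 @ G2)"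
  using two_fresh[of "ctx_vars (H @ (z, Tensor A1 A2) # G1 @ G2)"] by (meson finite_ctx_vars)
 have c: "is_ctx (H @ G1 @ G2)" using typed_is_ctx pat_Ten by blast
 have p: "typed T G1 p1 A1" "typed T G2 p2 A2" using pat_typed pat_Ten by blast+
 have g: "set_ty A1 \<subseteq> ground T" "set_ty A2 \<subseteq> ground T" using p res_ground by auto
 have n: "Free y \<notin># uses p1" using xy uses_typed[OF p(1)] by auto
 obtain t1 where t1: "typed T ((H @ G1) @ [(y, A2)]) t1 C" "eqv ((H @ G1) @ G2) (t1[y ::= p2]) u C"
  using pat_Ten.IH(2)[of "H @ G1" u y] pat_Ten.prems xy by (auto simp del: append_assoc simp flip: append_assoc)
 have "typed T ((H @ [(y, A2)]) @ G1) t1 C" by (rule typed_perm[OF t1(1)]) simp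
 then obtain t2 where t2: "typed T ((H @ [(y, A2)]) @ [(x, A1)]) t2 C" "eqv ((H @ [(y, A2)]) @ G1) (t2[x ::= p1]) t1 C"
  using pat_Ten.IH(1)[of "H @ [(y, A2)]" t1 x] xy by auto
 let ?t = "Pm (Var z) x y t2"
 have ty: "typed T (H @ [(z, Tensor A1 A2)]) ?t C"
  by (rule typed_Pm[OF ty_var t2(1), where H = H]) (use g c pat_Ten.prems in auto)
 have t2': "typed T (H @ [(x, A1), (y, A2)]) t2 C" by (rule typed_perm[OF t2(1)]) simp
 have nz: "Free z \<notin># uses t2" using uses_typed[OF t2(1)] xy pat_Ten.prems by auto
 have e: "?t[z ::= Ten p1 p2] = Pm (Ten p1 p2) x y t2"
 proof -
  have "Free z \<notin># uses (bindv 1 x (bindv 0 y t2))" using nz by (auto simp: bindv_rnm uses_rnm bnd_def split: if_splits name.splits)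
  then have "(bindv 1 x (bindv 0 y t2))[z ::= Ten p1 p2] = bindv 1 x (bindv 0 y t2)"
   by (intro subst_ident) (auto simp: fun_upd_apply)
  then show ?thesis by (simp add: Pm_def fun_upd_same)
 qed
 have m: "mset (H @ G1 @ G2) = mset (G1 @ G2 @ H)" by simp
 have "is_ctx (G1 @ G2 @ H)" using c is_ctx_mset[OF m] by simp
 then have "eqv (G1 @ G2 @ H) (Pm (Ten p1 p2) x y t2) (t2[x ::= p1, y ::= p2]) C"
  by (intro eqv_lam[OF pm_beta[OF p t2']]) (auto intro: append_in_shuffles intro!: bexI[where x = "G2 @ H"])
 then have 1: "eqv (H @ G1 @ G2) (Pm (Ten p1 p2) x y t2) (t2[x ::= p1, y ::= p2]) C"
  by (rule eqv_perm) simp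
 have s2: "(t2[x ::= p1])[y ::= p2] = t2[x ::= p1, y ::= p2]"
  unfolding subst_subst using xy n by (intro subst_cong) (auto simp: fun_upd_apply intro!: subst_ident)
 have "thr (H @ G1 @ G2) (a[y ::= p2]) (top * top) (b[y ::= p2]) C" if "thr ((H @ [(y, A2)]) @ G1) a top b C" for a b
  by (rule thr_subst1[OF that _ is_theorem.refl[OF p(2)] c, where G = "H @ G1"]) simp_all
 from this[OF conjunct1[OF t2(2)]] this[OF conjunct2[OF t2(2)]]
 have "eqv (H @ G1 @ G2) (t2[x ::= p1, y ::= p2]) (t1[y ::= p2]) C" unfolding s2 by simp
 with 1 t1(2) have "eqv (H @ G1 @ G2) (?t[z ::= Ten p1 p2]) u C" unfolding e append_assoc using eqv_trans by blast
 then show ?case using ty by blast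
qed

end

subsection \<open>Terms relative to a typing of all variables\<close>

definition fv :: "('g, 'f) tm => var set" where
 "fv v = {x. Free x \<in># uses v}"

text \<open>The sorted listing selects one context for a set of variables;
  \<open>mset_ctx_eqI\<close> and exchange relate it to any other with the same variables and
  types.\<close>

definition cx :: "(var => 'g ty) => var set => 'g ctx" where
 "cx F X = map (%x. (x, F x)) (sorted_list_of_set X)"

definition types_ctx :: "(var => 'g ty) => 'g ctx => bool" where
 "types_ctx F G \<longleftrightarrow> (\<forall>(x, A)\<in>set G. F x = A)"

lemma types_ctx_simps [simp]:
 "types_ctx F []" "types_ctx F (p # G) \<longleftrightarrow> F (fst p) = snd p & types_ctx F G"
 "types_ctx F (G @ H) \<longleftrightarrow> types_ctx F G & types_ctx F H"
 by (auto simp: types_ctx_def ball_Un)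

lemma finite_fv [simp]: "finite (fv v)"
proof -
 have "fv v \<subseteq> (%n. case n of Free x => x | Bd i => i) ` set_mset (uses v)"
  by (force simp: fv_def image_iff)
 then show ?thesis by (rule finite_subset) simp
qed

lemma cx_simps [simp]:
 assumes "finite X" shows "is_ctx (cx F X)" "ctx_vars (cx F X) = X" "types_ctx F (cx F X)"
 using assms by (auto simp: cx_def is_ctx_def ctx_vars_def types_ctx_def image_image comp_def)

lemma mset_ctx_eqI:
 assumes "is_ctx G" "is_ctx H" "ctx_vars G = ctx_vars H" "types_ctx F G" "types_ctx F H"
 shows "mset G = mset H"
proof -
 have "set G = (%x. (x, F x)) ` ctx_vars G" "set H = (%x. (x, F x)) ` ctx_vars H"
  using assms(4,5) by (force simp: types_ctx_def ctx_vars_def image_image)+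
 then have "set G = set H" using assms(3) by simp
 moreover have "distinct G" "distinct H" using assms(1,2) by (auto simp: is_ctx_def distinct_map)
 ultimately show ?thesis using set_eq_iff_mset_eq_distinct by blast
qed

lemma fv_typed: "typed T G v A ==> fv v = ctx_vars G"
 by (auto simp: fv_def uses_typed)

lemma mset_cx_Union:
 assumes "finite X" "\<And>x. x \<in> X ==> finite (K x)" "\<And>x y. x \<in> X ==> y \<in> X ==> x \<noteq> y ==> K x \<inter> K y = {}"
 shows "mset (cx F (\<Union>x\<in>X. K x)) = (\<Sum>x\<in>X. mset (cx F (K x)))"
 using assms
proof (induction X rule: finite_induct)
 case (insert x X)
 have e: "mset (cx F Y) = image_mset (%x. (x, F x)) (mset_set Y)" for Y using mset_set_set[of "sorted_list_of_set Y"] by (cases "finite Y") (simp_all add: cx_def)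
 have "K x \<inter> (\<Union>x\<in>X. K x) = {}" using insert.prems(2)[of x] insert.hyps by fastforce
 then have "mset (cx F (K x \<union> (\<Union>x\<in>X. K x))) = mset (cx F (K x)) + mset (cx F (\<Union>x\<in>X. K x))"
  using insert.hyps insert.prems(1) unfolding e by (subst mset_set_Union) auto
 then show ?case using insert by simp
qed (simp add: cx_def)

context linear_theory
begin

text \<open>Once \<open>F\<close> fixes the types of all variables, the context is a function of the
  term. Terms with different variables can then be combined without bookkeeping of contexts.\<close>

definition tm :: "(var => 'g ty) => ('g, 'f) tm => 'g ty => bool" where
 "tm F v A \<longleftrightarrow> typed T (cx F (fv v)) v A"

definition th :: "(var => 'g ty) => ('g, 'f) tm => 'v => ('g, 'f) tm => 'g ty => bool" where
 "th F v q w A \<longleftrightarrow> thr (cx F (fv v)) v q w A"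

lemma tmI: "typed T G v A ==> types_ctx F G ==> tm F v A"
 unfolding tm_def by (rule typed_perm, assumption, rule mset_ctx_eqI[where F = F]) (auto simp: fv_typed typed_is_ctx)

lemma thI: assumes "thr G v q w A" "types_ctx F G" shows "th F v q w A"
 unfolding th_def
proof (rule is_theorem.perm[OF assms(1)], rule mset_ctx_eqI[where F = F])
 show "ctx_vars (cx F (fv v)) = ctx_vars G" using fv_typed[OF conjunct1[OF thr_typed[OF assms(1)]]] by simp
qed (use thr_is_ctx[OF assms(1)] assms(2) in simp_all)

lemma thD:
 assumes "th F v q w A" "is_ctx G" "ctx_vars G = fv v" "types_ctx F G" shows "thr G v q w A"
proof (rule is_theorem.perm[OF assms(1)[unfolded th_def]], rule mset_ctx_eqI[where F = F])
qed (simp_all add: assms(2-))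

lemma th_tm: assumes "th F v q w A" shows "tm F v A" "tm F w A" "fv w = fv v"
proof -
 have t: "typed T (cx F (fv v)) v A" "typed T (cx F (fv v)) w A" using thr_typed assms th_def by auto
 then show "tm F v A" by (simp add: tm_def)
 show "fv w = fv v" using fv_typed[OF t(2)] by simp
 show "tm F w A" using tmI[OF t(2)] by simp
qed

lemma tm_unique: "tm F v A ==> tm F v A' ==> A = A'"
 unfolding tm_def typed_iff wty_def using hty_unique by blast

lemma tm_ground: "tm F v A ==> set_ty A \<subseteq> ground T"
 using res_ground tm_def by blast

lemma th_subst:
 assumes v: "thr G v q w A" and s: "\<And>x D. (x, D) \<in> set G ==> tm F (s x) D"
  and d: "\<And>x y. x \<in> ctx_vars G ==> y \<in> ctx_vars G ==> x \<noteq> y ==> fv (s x) \<inter> fv (s y) = {}"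
 shows "th F (subst s v) q (subst s w) A"
proof (rule thI[OF thr_substs[OF v, where D = "%x. cx F (fv (s x))" and E = "cx F (\<Union>x\<in>ctx_vars G. fv (s x))"]])
 have "is_ctx G" using v thr_is_ctx by blast
 then have "sum_list (map (%p. mset (cx F (fv (s (fst p))))) G) = (\<Sum>x\<in>ctx_vars G. mset (cx F (fv (s x))))"
  by (induction G) auto
 then show "mset (cx F (\<Union>x\<in>ctx_vars G. fv (s x))) = sum_list (map (%p. mset (cx F (fv (s (fst p))))) G)"
  using d by (subst mset_cx_Union) auto
qed (use s in \<open>auto simp: tm_def\<close>)

lemma th_trans: "th F v q w A ==> th F w r u A' ==> th F v (q * r) u A"
 using th_tm[of F v q w A] th_tm[of F w r u A'] tm_unique[of F w A A'] is_theorem.trans unfolding th_def by fastforce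

lemma th_refl: "tm F v A ==> th F v top v A"
 using is_theorem.refl by (simp add: th_def tm_def)

lemma th_Ten:
 assumes "th F v q w A" "th F v' r w' A'" "fv v \<inter> fv v' = {}"
 shows "th F (Ten v v') (q * r) (Ten w w') (Tensor A A')"
 by (rule thI[OF thr_Ten[OF assms(1,2)[unfolded th_def], of "cx F (fv v) @ cx F (fv v')"]]) (use assms in auto)

lemma th_App:
 assumes "th F v q w (Lolli A A')" "th F v' r w' A" "fv v \<inter> fv v' = {}"
 shows "th F (App v v') (q * r) (App w w') A'"
 by (rule thI[OF thr_App[OF assms(1,2)[unfolded th_def], of "cx F (fv v) @ cx F (fv v')"]]) (use assms in auto)

subsection \<open>Distances of terms\<close>

text \<open>Types are unique, so at most one type contributes to the join; quantifying over it
  spares a type argument.\<close>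

definition ds :: "(var => 'g ty) => ('g, 'f) tm => ('g, 'f) tm => 'v" where
 "ds F v w = Sup {q. \<exists>A. th F v q w A}"

text \<open>A label \<open>r\<close> way below \<open>q\<close> lies below a finite join of labels
  of theorems. The join rule and weakening give the theorem at \<open>r\<close>, and the Archimedean
  rule then gives it at \<open>q\<close>.\<close>

lemma Sup_theorem:
 assumes "typed T G v A" "typed T G w A" "q \<in> B" "q \<le> Sup {r. thr G v r w A}"
 shows "thr G v q w A"
proof (rule is_theorem.arch[OF assms(1-3)], intro ballI impI)
 fix r assume r: "r \<in> B" "r \<lless> q"
 then obtain Q where Q: "Q \<subseteq> {r. thr G v r w A}" "finite Q" "r \<le> Sup Q"
  using assms(4) unfolding way_below_def by blast
 then have "thr G v (Sup Q) w A" using is_theorem.join[OF assms(1,2) Q(2)] by blast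
 then show "thr G v r w A" using is_theorem.weak r Q by blast
qed

lemma one_in_basis: "(top :: 'v) \<in> B"
 using basis by (simp add: quantale_basis_def one_eq_top)

lemma le_ds: "th F v q w A ==> q \<le> ds F v w"
 unfolding ds_def by (rule Sup_upper) blast

lemma th_ds:
 assumes "tm F v A" "tm F w A" "fv w = fv v" "1 \<le> ds F v w"
 shows "th F v top w A"
proof -
 have "{q. \<exists>A. th F v q w A} = {q. th F v q w A}" using th_tm(1) tm_unique assms(1) by blast
 then have "top \<le> Sup {r. thr (cx F (fv v)) v r w A}" using assms(4) by (simp add: ds_def one_eq_top th_def)
 then show ?thesis using Sup_theorem[of "cx F (fv v)"] assms one_in_basis by (simp add: tm_def th_def)
qed

lemma ds_mono:
 assumes "\<And>q A. th F v q w A ==> \<exists>A. th F' v' q w' A"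
 shows "ds F v w \<le> ds F' v' w'"
 unfolding ds_def by (rule Sup_subset_mono) (use assms in blast)

text \<open>Distributivity of the tensor over joins, in both arguments. It carries a bound from
  labels of theorems to distances.\<close>

lemma Sup_mult_le:
 assumes "\<And>q r. q \<in> S ==> r \<in> S' ==> q * r \<le> (z :: 'v)"
 shows "Sup S * Sup S' \<le> z"
proof -
 have "q * Sup S' \<le> z" if "q \<in> S" for q unfolding mult_Sup using assms that by (auto intro!: Sup_least)
 then show ?thesis unfolding mult.commute[of "Sup S"] mult_Sup[of "Sup S'"] by (auto intro!: Sup_least simp: mult.commute)
qed

section \<open>Provable equality and normal forms\<close>

definition eq :: "(var => 'g ty) => ('g, 'f) tm => ('g, 'f) tm => bool" where
 "eq F v w \<longleftrightarrow> (\<exists>A. th F v top w A & th F w top v A)"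

lemma eq_refl: "tm F v A ==> eq F v v"
 using th_refl eq_def by blast

lemma eq_sym: "eq F v w ==> eq F w v"
 using eq_def by blast

lemma eq_trans: "eq F v w ==> eq F w u ==> eq F v u"
proof -
 assume "eq F v w" "eq F w u"
 then obtain A A' where a: "th F v top w A" "th F w top v A" "th F w top u A'" "th F u top w A'" unfolding eq_def by blast
 then have "A = A'" using tm_unique[OF th_tm(2)[OF a(1)] th_tm(1)[OF a(3)]] by simp
 then show ?thesis unfolding eq_def using th_trans[OF a(1,3)] th_trans[OF a(4,2)] unfolding top_mult by blast
qed

lemma eqI: "eqv G v w A ==> types_ctx F G ==> eq F v w"
 unfolding eq_def using thI by blast

lemma eq_tm: "eq F v w ==> tm F v A ==> tm F w A"
 unfolding eq_def using th_tm tm_unique by metis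

lemma eq_th: "eq F v w ==> tm F v A ==> th F v top w A & th F w top v A"
 unfolding eq_def using th_tm tm_unique by metis

lemma eq_fv: "eq F v w ==> fv w = fv v"
 unfolding eq_def using th_tm by blast

lemma th_eq: "th F v q w A ==> eq F v v' ==> eq F w w' ==> th F v' q w' A"
 using th_trans[of F v' top v A q w A] th_trans[of F v' q w A top w' A] eq_th th_tm by (metis top_mult)

text \<open>An arbitrary representative of the class of \<open>v\<close>. Equal terms have equal
  classes, so the same choice is made for them, and provable equality becomes equality.\<close>

definition nf :: "(var => 'g ty) => ('g, 'f) tm => ('g, 'f) tm" where
 "nf F v = (SOME w. eq F v w)"

definition el :: "(var => 'g ty) => ('g, 'f) tm => bool" where
 "el F v \<longleftrightarrow> nf F v = v & (\<exists>A. tm F v A)"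

definition tyo :: "(var => 'g ty) => ('g, 'f) tm => 'g ty" where
 "tyo F v = (THE A. tm F v A)"

lemma tyo: "tm F v A ==> tyo F v = A"
 unfolding tyo_def using tm_unique by blast

lemma el_tm: "el F v ==> tm F v (tyo F v)"
 unfolding el_def using tyo by metis

lemma eq_nf: "tm F v A ==> eq F v (nf F v)"
 unfolding nf_def by (rule someI, rule eq_refl)

lemma nf_cong: assumes "eq F v w" shows "nf F v = nf F w"
proof -
 have "eq F v u \<longleftrightarrow> eq F w u" for u using eq_trans[OF assms, of u] eq_trans[OF eq_sym[OF assms], of u] by blast
 then show ?thesis by (simp add: nf_def)
qed

lemma nf_el: assumes "tm F v A" shows "el F (nf F v)" "tyo F (nf F v) = A" "fv (nf F v) = fv v"
proof -
 note e = eq_nf[OF assms]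
 have t: "tm F (nf F v) A" using eq_tm[OF e assms] .
 then show "el F (nf F v)" using nf_cong[OF e] by (auto simp: el_def)
 show "tyo F (nf F v) = A" using tyo[OF t] .
 show "fv (nf F v) = fv v" using eq_fv[OF e] .
qed

lemma nf_eq: "nf F v = nf F w ==> tm F v A ==> tm F w A' ==> eq F v w"
 using eq_trans[OF eq_nf, of F v A "nf F v"] eq_trans[OF _ eq_sym[OF eq_nf], of F v w A'] eq_nf[of F v A] by simp

lemma el_nf: "el F v ==> nf F v = v"
 by (simp add: el_def)

lemma ds_nf: "tm F v A ==> tm F w A ==> ds F (nf F v) (nf F w) = ds F v w"
 using th_eq eq_nf eq_sym by (intro antisym ds_mono) metis+

lemma ds_refl: "tm F v A ==> 1 \<le> ds F v v"
 using le_ds[OF th_refl] by (simp add: one_eq_top)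

lemma ds_refl_el [simp]: "el F v ==> ds F v v = 1"
 using ds_refl el_tm by (metis one_eq_top top.extremum_unique)

lemma el_eqI:
 assumes "el F v" "el F w" "tyo F v = tyo F w" "fv v = fv w" "1 \<le> ds F v w" "1 \<le> ds F w v"
 shows "v = w"
proof -
 have "eq F v w" unfolding eq_def using th_ds assms el_tm by metis
 then show ?thesis using nf_cong assms el_nf by metis
qed

definition vr :: "(var => 'g ty) => var => ('g, 'f) tm" where "vr F x = nf F (Var x)"
definition st :: "(var => 'g ty) => ('g, 'f) tm" where "st F = nf F Star"
definition tn :: "(var => 'g ty) => ('g, 'f) tm => ('g, 'f) tm => ('g, 'f) tm" where "tn F v w = nf F (Ten v w)"
definition ap :: "(var => 'g ty) => ('g, 'f) tm => ('g, 'f) tm => ('g, 'f) tm" where "ap F v w = nf F (App v w)"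

primrec res_ty :: "'g ty => 'g ty" where "res_ty (Lolli A A') = A'"

lemma tm_Var: "set_ty (F x) \<subseteq> ground T ==> tm F (Var x) (F x)"
 by (rule tmI[OF ty_var]) auto

lemma tm_Star: "tm F Star TUnit"
 by (rule tmI[OF ty_star]) auto

lemma tm_Ten: "tm F v A ==> tm F w A' ==> fv v \<inter> fv w = {} ==> tm F (Ten v w) (Tensor A A')"
 using th_Ten th_refl th_tm by metis

lemma tm_App: "tm F v (Lolli A A') ==> tm F w A ==> fv v \<inter> fv w = {} ==> tm F (App v w) A'"
 using th_App th_refl th_tm by metis

lemma fv_simps [simp]: "fv (Var x) = {x}" "fv Star = {}" "fv (Ten v w) = fv v \<union> fv w" "fv (App v w) = fv v \<union> fv w"
 by (auto simp: fv_def)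

lemma vr_simps [simp]:
 assumes "set_ty (F x) \<subseteq> ground T" shows "el F (vr F x)" "tyo F (vr F x) = F x" "fv (vr F x) = {x}"
 using nf_el[OF tm_Var[of F x, OF assms]] by (auto simp: vr_def)

lemma st_simps [simp]: "el F (st F)" "tyo F (st F) = TUnit" "fv (st F) = {}"
 using nf_el[OF tm_Star[of F]] by (auto simp: st_def)

lemma tn_simps [simp]:
 assumes "el F v" "el F w" "fv v \<inter> fv w = {}"
 shows "el F (tn F v w)" "tyo F (tn F v w) = Tensor (tyo F v) (tyo F w)" "fv (tn F v w) = fv v \<union> fv w"
 using nf_el[OF tm_Ten[OF el_tm el_tm]] assms by (auto simp: tn_def)

lemma ap_simps [simp]:
 assumes "el F v" "el F w" "\<exists>C. tyo F v = Lolli (tyo F w) C" "fv v \<inter> fv w = {}"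
 shows "el F (ap F v w)" "tyo F (ap F v w) = res_ty (tyo F v)" "fv (ap F v w) = fv v \<union> fv w"
proof -
 obtain C where C: "tyo F v = Lolli (tyo F w) C" using assms by blast
 with nf_el[OF tm_App[of F v "tyo F w" C w]] assms el_tm[of F v] el_tm[of F w]
 show "el F (ap F v w)" "tyo F (ap F v w) = res_ty (tyo F v)" "fv (ap F v w) = fv v \<union> fv w"
  by (auto simp: ap_def)
qed

lemma eq_Ten: "eq F v w ==> eq F v' w' ==> fv v \<inter> fv v' = {} ==> eq F (Ten v v') (Ten w w')"
 unfolding eq_def using th_Ten[of F v top w] th_Ten[of F w top v] th_tm(3) by (metis top_mult(1))

lemma eq_App:
 assumes "eq F v w" "eq F v' w'" "fv v \<inter> fv v' = {}" "tm F v (Lolli A A')" "tm F v' A"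
 shows "eq F (App v v') (App w w')"
proof -
 note a = eq_th[OF assms(1,4)] eq_th[OF assms(2,5)]
 have "th F (App v v') top (App w w') A'" "th F (App w w') top (App v v') A'"
  using th_App[of F v top w A A' v' top w'] th_App[of F w top v A A' w' top v'] a assms eq_fv[OF assms(1)] eq_fv[OF assms(2)] by auto
 then show ?thesis using eq_def by blast
qed

lemma tn_nf: "tm F v A ==> tm F w A' ==> fv v \<inter> fv w = {} ==> tn F (nf F v) (nf F w) = nf F (Ten v w)"
 unfolding tn_def using nf_cong[OF eq_Ten[OF eq_nf eq_nf]] by metis

lemma ap_nf: "tm F v (Lolli A A') ==> tm F w A ==> fv v \<inter> fv w = {} ==> ap F (nf F v) (nf F w) = nf F (App v w)"
 unfolding ap_def using nf_cong[OF eq_App[OF eq_nf eq_nf]] by metis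

lemma ds_tn:
 assumes "el F v" "el F w" "el F v'" "el F w'" "fv v \<inter> fv w = {}" "fv v' \<inter> fv w' = {}" "tyo F v = tyo F v'" "tyo F w = tyo F w'"
 shows "ds F v v' * ds F w w' \<le> ds F (tn F v w) (tn F v' w')"
proof -
 have "ds F v v' * ds F w w' \<le> ds F (Ten v w) (Ten v' w')"
  unfolding ds_def[of F v] ds_def[of F w] using assms le_ds[OF th_Ten] by (intro Sup_mult_le) auto
 also have "... = ds F (tn F v w) (tn F v' w')"
  unfolding tn_def using ds_nf[of F "Ten v w" "Tensor (tyo F v) (tyo F w)" "Ten v' w'"] tm_Ten[OF el_tm el_tm, of F v w] tm_Ten[OF el_tm el_tm, of F v' w'] assms by simp
 finally show ?thesis .
qed

lemma ds_ap:
 assumes "el F v" "el F v'" "el F w" "fv v \<inter> fv w = {}" "fv v' \<inter> fv w = {}" "tyo F v = tyo F v'" "\<exists>C. tyo F v = Lolli (tyo F w) C"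
 shows "ds F v v' \<le> ds F (ap F v w) (ap F v' w)"
proof -
 obtain C where C: "tyo F v = Lolli (tyo F w) C" using assms by blast
 then have t: "tm F v (Lolli (tyo F w) C)" "tm F v' (Lolli (tyo F w) C)" "tm F w (tyo F w)" using assms el_tm by metis+
 have "\<exists>A. th F (App v w) q (App v' w) A" if "th F v q v' A" for q A
 proof -
  have "A = Lolli (tyo F w) C" using that th_tm tm_unique t by blast
  then show ?thesis using th_App[of F v q v' "tyo F w" C w top w] that th_refl[OF t(3)] assms by auto
 qed
 then have "ds F v v' \<le> ds F (App v w) (App v' w)" by (rule ds_mono)
 also have "... = ds F (ap F v w) (ap F v' w)"
  unfolding ap_def using ds_nf[OF tm_App[OF t(1,3)] tm_App[OF t(2,3)]] assms by simp
 finally show ?thesis .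
qed

text \<open>Extensionality for functions, with labels: a theorem about the values at a fresh
  variable is abstracted by \<open>cong_lam\<close> and simplified by
  \<open>lam_eta\<close>.\<close>

lemma lolli_ext_ds:
 assumes "el F v" "el F w" "tyo F v = Lolli (F x) C" "tyo F w = Lolli (F x) C" "fv v = fv w" "x \<notin> fv v"
 shows "ds F (ap F v (vr F x)) (ap F w (vr F x)) \<le> ds F v w"
proof (rule ds_mono)
 have t: "tm F v (Lolli (F x) C)" "tm F w (Lolli (F x) C)" using assms el_tm by metis+
 then have g: "set_ty (F x) \<subseteq> ground T" using tm_ground by fastforce
 note x = tm_Var[of F x, OF g]
 have e: "ap F u (vr F x) = nf F (App u (Var x))" if "el F u" "tm F u (Lolli (F x) C)" "x \<notin> fv u" for u
  using ap_nf[OF that(2) x] that el_nf by (simp add: vr_def)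
 have ta: "tm F (App u (Var x)) C" if "tm F u (Lolli (F x) C)" "x \<notin> fv u" for u
  using tm_App[OF that(1) x] that by simp
 fix q A assume q: "th F (ap F v (vr F x)) q (ap F w (vr F x)) A"
 then have "th F (App v (Var x)) q (App w (Var x)) A"
  using th_eq[OF q] eq_sym[OF eq_nf[OF ta[OF t(1)]]] eq_sym[OF eq_nf[OF ta[OF t(2)]]] e[OF assms(1) t(1)] e[OF assms(2) t(2)] assms(5,6) by simp
 then have "thr (cx F (fv v) @ [(x, F x)]) (App v (Var x)) q (App w (Var x)) C"
  using th_tm(1)[of F "App v (Var x)" q "App w (Var x)" A] tm_unique[OF ta[OF t(1)]] assms by (intro thD) auto
 then have 1: "thr (cx F (fv v)) (Lam x (F x) (App v (Var x))) q (Lam x (F x) (App w (Var x))) (Lolli (F x) C)"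
  by (rule cong_lam)
 have "eqv (cx F (fv v)) (Lam x (F x) (App u (Var x))) u (Lolli (F x) C)" if "tm F u (Lolli (F x) C)" "fv u = fv v" for u
  by (rule eqv_lam, rule lam_eta) (use that assms(6) in \<open>simp_all add: tm_def\<close>)
 from thr_sandwich[OF this[OF t(1) HOL.refl] this[OF t(2) assms(5)[symmetric]] 1]
 have "thr (cx F (fv v)) v q w (Lolli (F x) C)" .
 then show "\<exists>A. th F v q w A" using th_def by blast
qed

lemma lolli_ext:
 assumes "ap F v (vr F x) = ap F w (vr F x)" "el F v" "el F w" "tyo F v = Lolli (F x) C" "tyo F w = Lolli (F x) C" "fv v = fv w" "x \<notin> fv v"
 shows "v = w"
proof (rule el_eqI)
 have g: "set_ty (F x) \<subseteq> ground T" using assms tm_ground[OF el_tm[OF assms(2)]] by auto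
 have "ds F (ap F v (vr F x)) (ap F v (vr F x)) = 1" using assms g by (intro ds_refl_el ap_simps) auto
 then show "1 \<le> ds F v w" "1 \<le> ds F w v"
  using lolli_ext_ds[of F v w x C] lolli_ext_ds[of F w v x C] assms by auto
qed (use assms in auto)

end

subsection \<open>Arrows of the syntactic category\<close>

primrec ntup :: "('g, 'f) tm list => ('g, 'f) tm" where
 "ntup [] = Star" | "ntup (v # vs) = foldl Ten v vs"

primrec nty :: "'g ty list => 'g ty" where
 "nty [] = TUnit" | "nty (A # As) = foldl Tensor A As"

locale varietal_theory = linear_theory B T for B :: "'v::continuous_integral_quantale set" and T :: "('g, 'f, 'v) vlam_theory" +
 fixes U :: "'u itself"
 assumes varietal: "varietal B T U"
begin

definition vrel :: "'g ty => 'g ty => (('g, 'f) tm \<times> ('g, 'f) tm) set" where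
 "vrel A A' = {(v, w) \<in> Val T A A' \<times> Val T A A'. 1 \<le> val_dist B T A A' v w & 1 \<le> val_dist B T A A' w v}"

text \<open>A code in \<open>'u\<close> for each class of terms; varietality says precisely that an
  injective coding exists. Arrows carry such codes as labels, so that equality of arrows is provable
  equality of terms (\<open>mk_eq_iff\<close>).\<close>

definition enc :: "'g ty => 'g ty => ('g, 'f) tm set => 'u" where
 "enc A A' = (SOME e. inj_on e (val_quot B T A A'))"

definition mk :: "'g ty => 'g ty => ('g, 'f) tm => ('g ty, 'u) arr" where
 "mk A A' t = Arr A A' (enc A A' (vrel A A' `` {t}))"

definition ar :: "('g ty, 'u) arr => bool" where
 "ar f \<longleftrightarrow> (\<exists>A A' t. f = mk A A' t & typed T [(0, A)] t A')"

definition rep :: "('g ty, 'u) arr => ('g, 'f) tm" where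
 "rep f = (SOME t. typed T [(0, src f)] t (tgt f) & f = mk (src f) (tgt f) t)"

definition hdi :: "('g ty, 'u) arr => ('g ty, 'u) arr => 'v" where
 "hdi f g = val_dist B T (src f) (tgt f) (rep f) (rep g)"

text \<open>An arrow acts on all terms of its source type, with their free variables as parameters:
  these are its generalised elements.\<close>

definition ac :: "(var => 'g ty) => ('g ty, 'u) arr => ('g, 'f) tm => ('g, 'f) tm" where
 "ac F f v = nf F ((rep f)[0 ::= v])"

lemma one_le_val_dist:
 assumes "typed T [(0, A)] v A'" "typed T [(0, A)] w A'"
 shows "1 \<le> val_dist B T A A' v w \<longleftrightarrow> thr [(0, A)] v top w A'"
 unfolding val_dist_def one_eq_top using Sup_theorem[OF assms one_in_basis] by (auto intro: Sup_upper)

lemma vrel_iff: "(v, w) \<in> vrel A A' \<longleftrightarrow> eqv [(0, A)] v w A'"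
 by (auto simp: vrel_def Val_def one_le_val_dist dest: thr_typed)

lemma equiv_vrel: "equiv (Val T A A') (vrel A A')"
proof (rule equivI)
 show "vrel A A' \<subseteq> Val T A A' \<times> Val T A A'" by (auto simp: vrel_def)
 show "refl_on (Val T A A') (vrel A A')" unfolding refl_on_def by (auto simp: vrel_iff Val_def intro: is_theorem.refl)
 show "sym (vrel A A')" by (auto simp: sym_def vrel_iff)
 show "trans (vrel A A')" unfolding trans_def vrel_iff using thr_trans1 by blast
qed

lemma mk_simps [simp]: "src (mk A A' t) = A" "tgt (mk A A' t) = A'"
 by (simp_all add: mk_def)

lemma mk_eq_iff:
 assumes "typed T [(0, A)] t A'" "typed T [(0, A)] t' A'"
 shows "mk A A' t = mk A A' t' \<longleftrightarrow> eqv [(0, A)] t t' A'"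
proof -
 have "set_ty A \<subseteq> ground T" "set_ty A' \<subseteq> ground T" using assms typed_ground[of T "[(0, A)]"] res_ground by auto
 then have "\<exists>e :: _ => 'u. inj_on e (val_quot B T A A')"
  using varietal by (auto simp: varietal_def lepoll_def)
 then have "inj_on (enc A A') (val_quot B T A A')" unfolding enc_def by (rule someI_ex)
 then have "mk A A' t = mk A A' t' \<longleftrightarrow> vrel A A' `` {t} = vrel A A' `` {t'}"
  unfolding mk_def val_quot_def vrel_def[symmetric]
  using inj_on_eq_iff[of "enc A A'" "Val T A A' // vrel A A'" "vrel A A' `` {t}" "vrel A A' `` {t'}"] assms
  by (simp add: quotientI Val_def)
 also have "... \<longleftrightarrow> (t, t') \<in> vrel A A'" using eq_equiv_class_iff[OF equiv_vrel] assms by (simp add: Val_def)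
 finally show ?thesis by (simp add: vrel_iff)
qed

lemma ar_mk: "typed T [(0, A)] t A' ==> ar (mk A A' t)"
 by (auto simp: ar_def)

lemma rep: assumes "ar f" shows "typed T [(0, src f)] (rep f) (tgt f)" "mk (src f) (tgt f) (rep f) = f"
proof -
 have "\<exists>t. typed T [(0, src f)] t (tgt f) & f = mk (src f) (tgt f) t" using assms by (auto simp: ar_def)
 from someI_ex[OF this] show "typed T [(0, src f)] (rep f) (tgt f)" "mk (src f) (tgt f) (rep f) = f" by (simp_all add: rep_def)
qed

lemma rep_mk: "typed T [(0, A)] t A' ==> eqv [(0, A)] (rep (mk A A' t)) t A'"
 using rep[OF ar_mk] mk_eq_iff by (metis mk_simps)

lemma ar_ground: "ar f ==> set_ty (src f) \<subseteq> ground T" "ar f ==> set_ty (tgt f) \<subseteq> ground T"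
 using typed_ground[OF rep(1), of f 0 "src f"] res_ground[OF rep(1)] by auto

definition args :: "(var => 'g ty) => 'g ctx => (var => ('g, 'f) tm) => bool" where
 "args F G s \<longleftrightarrow> (\<forall>(x, D)\<in>set G. tm F (s x) D) &
   (\<forall>x\<in>ctx_vars G. \<forall>y\<in>ctx_vars G. x \<noteq> y --> fv (s x) \<inter> fv (s y) = {})"

text \<open>Disjointness is symmetric, so for an explicit context only half of the pairs have to be
  compared.\<close>

lemma pairwise_insert_sym:
 assumes "\<And>x y. d x y = d y x"
 shows "(\<forall>x\<in>insert a V. \<forall>y\<in>insert a V. x \<noteq> y --> d x y) \<longleftrightarrow>
  (\<forall>y\<in>V. y \<noteq> a --> d a y) & (\<forall>x\<in>V. \<forall>y\<in>V. x \<noteq> y --> d x y)"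
  (is "?L \<longleftrightarrow> ?R")
proof
 assume R: ?R
 show ?L
 proof (intro ballI impI)
  fix x y assume "x \<in> insert a V" "y \<in> insert a V" "x \<noteq> y"
  then show "d x y" using R assms[of x y] by (cases "x = a"; cases "y = a") auto
 qed
qed simp

lemma args_simps [simp]:
 "args F [] s"
 "args F ((x, D) # G) s \<longleftrightarrow> tm F (s x) D &
   (\<forall>y\<in>ctx_vars G. y \<noteq> x --> fv (s x) \<inter> fv (s y) = {}) & args F G s"
 unfolding args_def ctx_vars_simps pairwise_insert_sym[where d = "%x y. fv (s x) \<inter> fv (s y) = {}", OF arg_cong[OF Int_commute]]
 by (simp_all add: conj_ac)

lemma th_args: "thr G v q w A ==> args F G s ==> th F (subst s v) q (subst s w) A"
 by (erule th_subst) (auto simp: args_def)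

lemma eq_args: "eqv G v w A ==> args F G s ==> eq F (subst s v) (subst s w)"
 unfolding eq_def using th_args by blast

lemma th_subst0:
 assumes "thr [(0, A)] t q t' A'" "th F v r w A" shows "th F (t[0 ::= v]) (q * r) (t'[0 ::= w]) A'"
 by (rule thI[OF thr_subst1[OF assms(1) _ assms(2)[unfolded th_def], where G = "[]"]]) auto

lemma tm_subst0: "typed T [(0, A)] t A' ==> tm F v A ==> tm F (t[0 ::= v]) A'"
 using th_subst0[OF is_theorem.refl th_refl] th_tm by blast

lemma fv_subst0: assumes "typed T [(0, A)] t A'" "tm F v A" shows "fv (t[0 ::= v]) = fv v"
proof -
 have "typed T (cx F (fv v)) (t[0 ::= v]) A'"
  by (rule typed_subst1[OF assms(1), of 0 A "[]"]) (use assms(2) in \<open>auto simp: tm_def\<close>)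
 from fv_typed[OF this] show ?thesis by simp
qed

lemma eq_subst0: "eqv [(0, A)] t t' A' ==> eq F v w ==> tm F v A ==> eq F (t[0 ::= v]) (t'[0 ::= w])"
 unfolding eq_def using th_subst0[of A t top t' A' F v top w] th_subst0[of A t' top t A' F w top v] eq_th[of F v w A]
 by (auto simp: eq_def)

lemma ac_simps [simp]:
 assumes "ar f" "el F v" "tyo F v = src f"
 shows "el F (ac F f v)" "tyo F (ac F f v) = tgt f" "fv (ac F f v) = fv v"
 using nf_el[OF tm_subst0[OF rep(1)[OF assms(1)]], of F v] fv_subst0[OF rep(1)[OF assms(1)], of F v] el_tm[OF assms(2)] assms(3)
 by (simp_all add: ac_def)

lemma ac_mk:
 assumes "typed T [(0, A)] t A'" "el F v" "tyo F v = A"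
 shows "ac F (mk A A' t) v = nf F (t[0 ::= v])"
 unfolding ac_def using el_tm[OF assms(2)] assms(3)
 by (intro nf_cong eq_subst0[OF rep_mk[OF assms(1)]]) (auto intro: eq_refl)

text \<open>Comes from congruence of substitution, where labels multiply; \<open>Sup_mult_le\<close>
  passes to the distances.\<close>

lemma hdi_ac:
 assumes "ar f" "ar g" "src g = src f" "tgt g = tgt f" "el F v" "el F w" "tyo F v = src f" "tyo F w = src f"
 shows "hdi f g * ds F v w \<le> ds F (ac F f v) (ac F g w)"
proof -
 have v: "tm F v (src f)" using el_tm assms by metis
 have "hdi f g * ds F v w \<le> ds F ((rep f)[0 ::= v]) ((rep g)[0 ::= w])"
  unfolding hdi_def val_dist_def ds_def[of F v]
 proof (rule Sup_mult_le)
  fix q r assume q: "q \<in> {q. thr [(0, src f)] (rep f) q (rep g) (tgt f)}" and "r \<in> {q. \<exists>A. th F v q w A}"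
  then obtain A where r: "th F v r w A" by blast
  then have "A = src f" using tm_unique[OF th_tm(1) v] by blast
  then show "q * r \<le> ds F ((rep f)[0 ::= v]) ((rep g)[0 ::= w])" using q r le_ds[OF th_subst0] by blast
 qed
 also have "... = ds F (ac F f v) (ac F g w)"
  unfolding ac_def using ds_nf[OF tm_subst0[OF rep(1)[OF assms(1)]] tm_subst0[OF rep(1)[OF assms(2), unfolded assms(3,4)]]] el_tm[OF assms(5)] el_tm[OF assms(6)] assms(7,8) by simp
 finally show ?thesis .
qed

lemma hdi_ac1:
 assumes "ar f" "ar g" "src g = src f" "tgt g = tgt f" "el F v" "tyo F v = src f"
 shows "hdi f g \<le> ds F (ac F f v) (ac F g v)"
 using hdi_ac[OF assms(1-5) assms(5,6,6)] assms(5) by simp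

lemma one_le_hdi:
 assumes "ar f" "ar g" "src g = src f" "tgt g = tgt f"
 shows "1 \<le> hdi f g & 1 \<le> hdi g f \<longleftrightarrow> f = g"
proof -
 have "1 \<le> hdi f g & 1 \<le> hdi g f \<longleftrightarrow> eqv [(0, src f)] (rep f) (rep g) (tgt f)"
  unfolding hdi_def using one_le_val_dist[of "src f" _ "tgt f"] rep(1)[OF assms(1)] rep(1)[OF assms(2)] assms by auto
 also have "... \<longleftrightarrow> mk (src f) (tgt f) (rep f) = mk (src f) (tgt f) (rep g)"
  using mk_eq_iff[of "src f" "rep f" "tgt f" "rep g"] rep(1)[OF assms(1)] rep(1)[OF assms(2)] assms by simp
 also have "... \<longleftrightarrow> f = g" using rep(2)[OF assms(1)] rep(2)[OF assms(2)] assms by simp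
 finally show ?thesis .
qed

text \<open>Elements given by patterns, on which arrows are determined by their action.\<close>

definition gp :: "(var => 'g ty) => ('g, 'f) tm => bool" where
 "gp F P \<longleftrightarrow> (\<exists>G p A. pat G p A & types_ctx F G & P = nf F p)"

lemma gp_vr [simp]: "set_ty (F x) \<subseteq> ground T ==> gp F (vr F x)"
 unfolding gp_def vr_def using pat_Var[of "F x" x] by fastforce

lemma gp_st [simp]: "gp F (st F)"
 unfolding gp_def st_def using pat_Star by fastforce

lemma gp_tn [simp]: assumes "gp F P" "gp F Q" "fv P \<inter> fv Q = {}" shows "gp F (tn F P Q)"
proof -
 obtain G p A H p' A' where p: "pat G p A" "types_ctx F G" "P = nf F p" "pat H p' A'" "types_ctx F H" "Q = nf F p'"
  using assms by (auto simp: gp_def)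
 note t = tmI[OF pat_typed[OF p(1)] p(2)] tmI[OF pat_typed[OF p(4)] p(5)]
 have d: "fv p \<inter> fv p' = {}" using assms(3) nf_el(3)[OF t(1)] nf_el(3)[OF t(2)] p by simp
 then have "is_ctx (G @ H)"
  using typed_is_ctx[OF pat_typed[OF p(1)]] typed_is_ctx[OF pat_typed[OF p(4)]] fv_typed[OF pat_typed[OF p(1)]] fv_typed[OF pat_typed[OF p(4)]] by simp
 from pat_Ten[OF p(1,4) this] show ?thesis unfolding gp_def using tn_nf[OF t d] p by fastforce
qed

lemma gp_el: "gp F P ==> el F P"
 unfolding gp_def using nf_el(1) tmI pat_typed by blast

text \<open>The converse of \<open>hdi_ac1\<close> at a pattern, by \<open>pat_ext\<close>: the
  distance of two arrows can be measured at a single tuple.\<close>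

lemma ext_ds:
 assumes "gp F P" "ar f" "ar g" "src g = src f" "tgt g = tgt f" "tyo F P = src f"
 shows "ds F (ac F f P) (ac F g P) \<le> hdi f g"
proof -
 obtain G p A where p: "pat G p A" "types_ctx F G" "P = nf F p" using assms(1) by (auto simp: gp_def)
 note t = tmI[OF pat_typed[OF p(1)] p(2)]
 have A: "A = src f" using nf_el(2)[OF t] p assms(6) by simp
 note r = rep(1)[OF assms(2)] rep(1)[OF assms(3), unfolded assms(4,5)]
 have e: "eq F (ac F h P) ((rep h)[0 ::= p])" if "typed T [(0, A)] (rep h) (tgt f)" for h
 proof -
  have "eq F ((rep h)[0 ::= p]) ((rep h)[0 ::= P])"
   unfolding p(3) using is_theorem.refl[OF that] by (intro eq_subst0[OF _ eq_nf[OF t] t]) auto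
  from eq_trans[OF this eq_nf] show ?thesis unfolding ac_def using eq_sym tm_subst0[OF that] nf_el(1)[OF t] nf_el(2)[OF t] el_tm p(3) by metis
 qed
 have "thr [(0, A)] (rep f) q (rep g) (tgt f)" if q: "th F (ac F f P) q (ac F g P) C" for q C
 proof -
  have q': "th F ((rep f)[0 ::= p]) q ((rep g)[0 ::= p]) C" using th_eq[OF q] e r A by metis
  have "C = tgt f" using th_tm(1)[OF q'] tm_unique tm_subst0[OF r(1)] t A by blast
  then have "thr G ((rep f)[0 ::= p]) q ((rep g)[0 ::= p]) (tgt f)"
   using q' typed_is_ctx[OF pat_typed[OF p(1)]] fv_subst0[OF r(1)[folded A] t] fv_typed[OF pat_typed[OF p(1)]] p(2) by (intro thD) auto
  then show ?thesis
   using pat_ext[OF p(1), of "[]" 0 "rep f" "tgt f" "rep g" q] r A typed_is_ctx[OF pat_typed[OF p(1)]] by simp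
 qed
 then show ?thesis unfolding hdi_def val_dist_def ds_def A[symmetric] by (intro Sup_subset_mono) blast
qed

text \<open>The method by which the laws of the syntactic category are checked. Agreement on a
  pattern makes both distances at least 1, and the homs are separated.\<close>

lemma ext_eq:
 assumes "ac F f P = ac F g P" "gp F P" "ar f" "ar g" "src g = src f" "tgt g = tgt f" "tyo F P = src f"
 shows "f = g"
proof -
 have "ds F (ac F f P) (ac F f P) = 1" using assms gp_el by simp
 then show ?thesis
  using ext_ds[OF assms(2-7)] ext_ds[OF assms(2) assms(4,3) assms(5,6)[symmetric]] assms one_le_hdi[OF assms(3-6)] by simp
qed

text \<open>The arrow that sends the pattern \<open>p\<close> to the term \<open>u\<close>. It
  exists by \<open>pat_surj\<close> and is determined by \<open>pat_ext\<close>.\<close>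

definition parr :: "'g ctx => ('g, 'f) tm => 'g ty => ('g, 'f) tm => 'g ty => ('g ty, 'u) arr" where
 "parr G p A u C = mk A C (SOME t. typed T [(0, A)] t C & eqv G (t[0 ::= p]) u C)"

lemma parr_simps [simp]: "src (parr G p A u C) = A" "tgt (parr G p A u C) = C"
 by (simp_all add: parr_def)

lemma parr_ac:
 assumes "pat G p A" "typed T G u C"
 shows "ar (parr G p A u C)"
  and "args F G s ==> ac F (parr G p A u C) (nf F (subst s p)) = nf F (subst s u)"
proof -
 obtain t where t: "parr G p A u C = mk A C t" "typed T [(0, A)] t C" "eqv G (t[0 ::= p]) u C"
  using someI_ex[OF pat_surj[OF assms(1), of "[]" u C 0]] assms(2) unfolding parr_def by auto
 then show "ar (parr G p A u C)" by (simp add: ar_mk)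
 assume s: "args F G s"
 have p: "tm F (subst s p) A" using th_tm(1)[OF th_args[OF is_theorem.refl[OF pat_typed[OF assms(1)]] s]] .
 note e = nf_el[OF p]
 have "ac F (parr G p A u C) (nf F (subst s p)) = nf F (t[0 ::= nf F (subst s p)])"
  unfolding t(1) by (rule ac_mk[OF t(2) e(1,2)])
 also have "... = nf F (t[0 ::= subst s p])"
  using is_theorem.refl[OF t(2)] eq_tm[OF eq_nf[OF p] p] by (intro nf_cong eq_subst0[OF _ eq_sym[OF eq_nf[OF p]]]) auto
 also have "t[0 ::= subst s p] = subst s (t[0 ::= p])"
  unfolding subst_subst by (rule subst_cong) (use uses_typed[OF t(2)] in \<open>auto simp: fun_upd_apply\<close>)
 also have "nf F ... = nf F (subst s u)"
  by (rule nf_cong[OF eq_args[OF t(3) s]])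
 finally show "ac F (parr G p A u C) (nf F (subst s p)) = nf F (subst s u)" .
qed

text \<open>An arrow into a function type, given by a body in which 0 is the argument of the arrow
  and 1 the argument of the function.\<close>

definition larr :: "'g ty => 'g ty => 'g ty => ('g, 'f) tm => ('g ty, 'u) arr" where
 "larr Y X Z t = mk Y (Lolli X Z) (Lam 1 X t)"

lemma larr_simps [simp]: "src (larr Y X Z t) = Y" "tgt (larr Y X Z t) = Lolli X Z"
 by (simp_all add: larr_def)

lemma larr_ac:
 assumes "typed T [(0, Y), (1, X)] t Z"
 shows "ar (larr Y X Z t)"
  and "el F v ==> el F w ==> tyo F v = Y ==> tyo F w = X ==> fv v \<inter> fv w = {} ==>
   ap F (ac F (larr Y X Z t) v) w = nf F (t[0 ::= v, 1 ::= w])"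
proof -
 have l: "typed T [(0, Y)] (Lam 1 X t) (Lolli X Z)" using assms by (intro ty_lam) simp
 then show "ar (larr Y X Z t)" unfolding larr_def by (rule ar_mk)
 assume e: "el F v" "el F w" "tyo F v = Y" "tyo F w = X" "fv v \<inter> fv w = {}"
 note tv = el_tm[OF e(1), unfolded e(3)] and tw = el_tm[OF e(2), unfolded e(4)]
 note lv = tm_subst0[OF l tv] fv_subst0[OF l tv]
 have gX: "set_ty X \<subseteq> ground T" using tm_ground tw by blast
 have "ap F (ac F (larr Y X Z t) v) w = ap F (nf F ((Lam 1 X t)[0 ::= v])) (nf F w)"
  unfolding larr_def ac_mk[OF l e(1,3)] el_nf[OF e(2)] ..
 also have "... = nf F (App ((Lam 1 X t)[0 ::= v]) w)" using ap_nf[OF lv(1) tw] lv(2) e(5) by simp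
 also have "... = nf F (t[0 ::= v, 1 ::= w])"
 proof -
  \<comment> \<open>The \<beta>-rule is used with the variable 2 as argument, and \<open>v\<close>
    and \<open>w\<close> are put in afterwards, both at once; thus their free variables cannot
    interfere with 0 and 1.\<close>
  define s where "s = Var(0 := v, 2 := w)"
  have "eqv [(0, Y), (2, X)] (App (Lam 1 X t) (Var 2)) (t[1 ::= Var 2]) Z"
  proof (rule eqv_lam, rule lam_beta)
   show "typed T ([(0, Y)] @ [(1, X)]) t Z" using assms by simp
   show "[(0, Y), (2, X)] \<in> shuffles [(0, Y)] [(2, X)]" using append_in_shuffles[of "[(0, Y)]" "[(2, X)]"] by simp
  qed (use ty_var[OF gX, of 2] in auto)
  moreover have "args F [(0, Y), (2, X)] s" using tv tw e(5) by (simp add: s_def fun_upd_apply)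
  ultimately have "eq F (subst s (App (Lam 1 X t) (Var 2))) (subst s (t[1 ::= Var 2]))" by (rule eq_args)
  moreover have "subst s (Lam 1 X t) = (Lam 1 X t)[0 ::= v]"
   by (rule subst_cong) (use uses_typed[OF l] in \<open>auto simp: s_def fun_upd_apply\<close>)
  moreover have "subst s (t[1 ::= Var 2]) = t[0 ::= v, 1 ::= w]"
   unfolding subst_subst
  proof (rule subst_cong)
   fix x assume "Free x \<in># uses t"
   then have "x = 0 \<or> x = 1" using uses_typed[OF assms, of x] by auto
   then show "subst s ((Var(1 := Var 2)) x) = (Var(0 := v, 1 := w)) x" by (auto simp: s_def fun_upd_apply)
  qed
  ultimately show ?thesis by (intro nf_cong) (simp add: s_def fun_upd_apply)
 qed
 finally show "ap F (ac F (larr Y X Z t) v) w = nf F (t[0 ::= v, 1 ::= w])" .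
qed

end

subsection \<open>The syntactic autonomous category\<close>

context varietal_theory
begin

definition Id :: "'g ty => ('g ty, 'u) arr" where
 "Id A = mk A A (Var 0)"

definition Cm :: "('g ty, 'u) arr => ('g ty, 'u) arr => ('g ty, 'u) arr" where
 "Cm g f = mk (src f) (tgt g) ((rep g)[0 ::= rep f])"

text \<open>The arrows of the monoidal structure are given by their effect on a tuple. Pattern
  variables start at 2, as 0 is the variable of arrows and 1 the one bound in
  \<open>larr\<close>.\<close>

definition Tm :: "('g ty, 'u) arr => ('g ty, 'u) arr => ('g ty, 'u) arr" where
 "Tm f g = parr [(2, src f), (3, src g)] (Ten (Var 2) (Var 3)) (Tensor (src f) (src g))
   (Ten ((rep f)[0 ::= Var 2]) ((rep g)[0 ::= Var 3])) (Tensor (tgt f) (tgt g))"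

definition As :: "'g ty => 'g ty => 'g ty => ('g ty, 'u) arr" where
 "As A A' A'' = parr [(2, A), (3, A'), (4, A'')] (Ten (Ten (Var 2) (Var 3)) (Var 4)) (Tensor (Tensor A A') A'')
   (Ten (Var 2) (Ten (Var 3) (Var 4))) (Tensor A (Tensor A' A''))"

definition As' :: "'g ty => 'g ty => 'g ty => ('g ty, 'u) arr" where
 "As' A A' A'' = parr [(2, A), (3, A'), (4, A'')] (Ten (Var 2) (Ten (Var 3) (Var 4))) (Tensor A (Tensor A' A''))
   (Ten (Ten (Var 2) (Var 3)) (Var 4)) (Tensor (Tensor A A') A'')"

definition Lu :: "'g ty => ('g ty, 'u) arr" where
 "Lu A = parr [(2, A)] (Ten Star (Var 2)) (Tensor TUnit A) (Var 2) A"

definition Lu' :: "'g ty => ('g ty, 'u) arr" where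
 "Lu' A = parr [(2, A)] (Var 2) A (Ten Star (Var 2)) (Tensor TUnit A)"

definition Ru :: "'g ty => ('g ty, 'u) arr" where
 "Ru A = parr [(2, A)] (Ten (Var 2) Star) (Tensor A TUnit) (Var 2) A"

definition Ru' :: "'g ty => ('g ty, 'u) arr" where
 "Ru' A = parr [(2, A)] (Var 2) A (Ten (Var 2) Star) (Tensor A TUnit)"

definition Sw :: "'g ty => 'g ty => ('g ty, 'u) arr" where
 "Sw A A' = parr [(2, A), (3, A')] (Ten (Var 2) (Var 3)) (Tensor A A') (Ten (Var 3) (Var 2)) (Tensor A' A)"

definition Cu :: "'g ty => 'g ty => 'g ty => ('g ty, 'u) arr => ('g ty, 'u) arr" where
 "Cu X Y Z f = larr Y X Z ((rep f)[0 ::= Ten (Var 0) (Var 1)])"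

definition Uc :: "'g ty => 'g ty => 'g ty => ('g ty, 'u) arr => ('g ty, 'u) arr" where
 "Uc X Y Z g = parr [(2, Y), (3, X)] (Ten (Var 2) (Var 3)) (Tensor Y X) (App ((rep g)[0 ::= Var 2]) (Var 3)) Z"

definition Im :: "'g ty => ('g ty, 'u) arr => ('g ty, 'u) arr" where
 "Im X g = larr (Lolli X (src g)) X (tgt g) ((rep g)[0 ::= App (Var 0) (Var 1)])"

lemma src_tgt [simp]:
 "src (Id A) = A" "tgt (Id A) = A" "src (Cm g f) = src f" "tgt (Cm g f) = tgt g"
 "src (Tm f g) = Tensor (src f) (src g)" "tgt (Tm f g) = Tensor (tgt f) (tgt g)"
 "src (As A A' A'') = Tensor (Tensor A A') A''" "tgt (As A A' A'') = Tensor A (Tensor A' A'')"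
 "src (As' A A' A'') = Tensor A (Tensor A' A'')" "tgt (As' A A' A'') = Tensor (Tensor A A') A''"
 "src (Lu A) = Tensor TUnit A" "tgt (Lu A) = A" "src (Lu' A) = A" "tgt (Lu' A) = Tensor TUnit A"
 "src (Ru A) = Tensor A TUnit" "tgt (Ru A) = A" "src (Ru' A) = A" "tgt (Ru' A) = Tensor A TUnit"
 "src (Sw A A') = Tensor A A'" "tgt (Sw A A') = Tensor A' A"
 "src (Cu X Y Z f) = Y" "tgt (Cu X Y Z f) = Lolli X Z" "src (Uc X Y Z f) = Tensor Y X" "tgt (Uc X Y Z f) = Z"
 "src (Im X g) = Lolli X (src g)" "tgt (Im X g) = Lolli X (tgt g)"
 by (simp_all add: Id_def Cm_def Tm_def As_def As'_def Lu_def Lu'_def Ru_def Ru'_def Sw_def Cu_def Uc_def Im_def)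

definition gnd :: "'g ty => bool" where "gnd A \<longleftrightarrow> set_ty A \<subseteq> ground T"

lemma gnd_simps [simp]: "gnd TUnit" "gnd (Tensor A A') \<longleftrightarrow> gnd A & gnd A'" "gnd (Lolli A A') \<longleftrightarrow> gnd A & gnd A'"
 by (auto simp: gnd_def)

lemma gnd_el [simp]: "el F v ==> gnd (tyo F v)"
 unfolding gnd_def using tm_ground el_tm by blast

lemma gnd_ar [simp]: "ar f ==> gnd (src f)" "ar f ==> gnd (tgt f)"
 unfolding gnd_def using ar_ground by blast+

lemmas vr_gnd [simp] = vr_simps[folded gnd_def] gp_vr[folded gnd_def]
lemmas pat_V = pat_Var[folded gnd_def]

lemma pats:
 "gnd A ==> pat [(x, A)] (Var x) A"
 "gnd A ==> pat [(x, A)] (Ten Star (Var x)) (Tensor TUnit A)"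
 "gnd A ==> pat [(x, A)] (Ten (Var x) Star) (Tensor A TUnit)"
 "gnd A ==> gnd A' ==> x \<noteq> y ==> pat [(x, A), (y, A')] (Ten (Var x) (Var y)) (Tensor A A')"
 "gnd A ==> gnd A' ==> gnd A'' ==>
  pat [(2, A), (3, A'), (4, A'')] (Ten (Ten (Var 2) (Var 3)) (Var 4)) (Tensor (Tensor A A') A'')"
 "gnd A ==> gnd A' ==> gnd A'' ==>
  pat [(2, A), (3, A'), (4, A'')] (Ten (Var 2) (Ten (Var 3) (Var 4))) (Tensor A (Tensor A' A''))"
 using pat_V[of A x] pat_Ten[OF pat_Star pat_V, of A x] pat_Ten[OF pat_V pat_Star, of A x] pat_Ten[OF pat_V pat_V, of A A' x y]
  pat_Ten[OF pat_Ten[OF pat_V pat_V] pat_V, of A A' 2 3 A'' 4] pat_Ten[OF pat_V pat_Ten[OF pat_V pat_V], of A A' A'' 3 4 2]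
 by auto

lemma okt: "el F v ==> \<exists>A. tm F v A"
 using el_tm by blast

lemma nf_Ten [simp]:
 assumes "\<exists>A. tm F v A" "\<exists>A. tm F w A" "fv v \<inter> fv w = {}"
 shows "nf F (Ten v w) = tn F (nf F v) (nf F w)" "\<exists>A. tm F (Ten v w) A"
 using assms tn_nf tm_Ten by (metis, blast)

lemma nf_Var: "nf F (Var x) = vr F x" and nf_Star [simp]: "nf F Star = st F"
 by (simp_all add: vr_def st_def)

lemma rep_subst:
 assumes "ar f" shows "subst s (rep f) = (rep f)[0 ::= s 0]" "subst s ((rep f)[0 ::= v]) = (rep f)[0 ::= subst s v]"
 by (auto simp: subst_subst fun_upd_apply uses_typed[OF rep(1)[OF assms]] intro!: subst_cong)

lemma el_okt [simp]: "el F v ==> \<exists>A. tm F v A" "el F v ==> nf F v = v"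
 using okt el_nf by blast+

lemma tm_Star_ex [simp]: "\<exists>A. tm F Star A"
 using tm_Star by blast

lemma tm_el: "el F v ==> tyo F v = A ==> tm F v A"
 using el_tm by blast

lemma ar_Id [simp]: "gnd A ==> ar (Id A)"
 unfolding Id_def gnd_def by (intro ar_mk ty_var)

lemma ac_Id [simp]: "el F v ==> tyo F v = A ==> ac F (Id A) v = v"
 unfolding Id_def using gnd_el[of F v] by (subst ac_mk[OF ty_var]) (auto simp: gnd_def fun_upd_same)

lemma typed_subst_rep:
 "ar f ==> typed T G v (src f) ==> typed T G ((rep f)[0 ::= v]) (tgt f)"
 by (rule typed_subst1[OF rep(1), where G = "[]"]) (auto simp: typed_is_ctx)

text \<open>From here on each kind of arrow gets simplification rules for its value on a tuple.
  Together they evaluate any composite of arrows.\<close>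

lemma Cm [simp]:
 assumes "ar f" "ar g" "src g = tgt f"
 shows "ar (Cm g f)" and "el F v ==> tyo F v = src f ==> ac F (Cm g f) v = ac F g (ac F f v)"
proof -
 have t: "typed T [(0, src f)] ((rep g)[0 ::= rep f]) (tgt g)"
  using typed_subst_rep[OF assms(2)] rep(1)[OF assms(1)] assms(3) by simp
 then show "ar (Cm g f)" unfolding Cm_def by (rule ar_mk)
 assume v: "el F v" "tyo F v = src f"
 note tv = tm_subst0[OF rep(1)[OF assms(1)] tm_el[OF v]]
 have "ac F (Cm g f) v = nf F ((rep g)[0 ::= (rep f)[0 ::= v]])"
  unfolding Cm_def ac_mk[OF t v] using rep_subst(2)[OF assms(2), of "Var(0 := v)" "rep f"] by simp
 also have "... = ac F g (ac F f v)"
  unfolding ac_def using is_theorem.refl[OF rep(1)[OF assms(2)]] tv assms(3) by (intro nf_cong eq_subst0[OF _ eq_nf[OF tv]]) auto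
 finally show "ac F (Cm g f) v = ac F g (ac F f v)" .
qed

lemma Tm [simp]:
 assumes "ar f" "ar g"
 shows "ar (Tm f g)"
  and "el F v ==> el F w ==> tyo F v = src f ==> tyo F w = src g ==> fv v \<inter> fv w = {} ==>
   ac F (Tm f g) (tn F v w) = tn F (ac F f v) (ac F g w)"
proof -
 have "typed T [(2, src f), (3, src g)] (Ten ((rep f)[0 ::= Var 2]) ((rep g)[0 ::= Var 3])) (Tensor (tgt f) (tgt g))"
  by (rule typed_Ten[OF typed_subst_rep[OF assms(1) ty_var] typed_subst_rep[OF assms(2) ty_var]]) (use assms ar_ground in auto)
 note p = parr_ac[OF pats(4)[OF gnd_ar(1)[OF assms(1)] gnd_ar(1)[OF assms(2)]] this, folded Tm_def]
 then show "ar (Tm f g)" by simp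
 assume v: "el F v" "el F w" "tyo F v = src f" "tyo F w = src g" "fv v \<inter> fv w = {}"
 note t = tm_subst0[OF rep(1)[OF assms(1)] tm_el[OF v(1,3)]] tm_subst0[OF rep(1)[OF assms(2)] tm_el[OF v(2,4)]]
  fv_subst0[OF rep(1)[OF assms(1)] tm_el[OF v(1,3)]] fv_subst0[OF rep(1)[OF assms(2)] tm_el[OF v(2,4)]]
 have "args F [(2, src f), (3, src g)] (Var(2 := v, 3 := w))" using v by (simp add: fun_upd_apply tm_el)
 from p(2)[OF _ this] show "ac F (Tm f g) (tn F v w) = tn F (ac F f v) (ac F g w)"
  using v rep_subst(2)[OF assms(1)] rep_subst(2)[OF assms(2)] tn_nf[OF t(1,2)] t(3,4) by (simp add: ac_def) (simp add: fun_upd_apply)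
qed

lemma As [simp]:
 shows "gnd A ==> gnd A' ==> gnd A'' ==> ar (As A A' A'')" "gnd A ==> gnd A' ==> gnd A'' ==> ar (As' A A' A'')"
  and "el F u ==> el F v ==> el F w ==> tyo F u = A ==> tyo F v = A' ==> tyo F w = A'' ==>
   fv u \<inter> fv v = {} ==> fv u \<inter> fv w = {} ==> fv v \<inter> fv w = {} ==>
   ac F (As A A' A'') (tn F (tn F u v) w) = tn F u (tn F v w)"
  and "el F u ==> el F v ==> el F w ==> tyo F u = A ==> tyo F v = A' ==> tyo F w = A'' ==>
   fv u \<inter> fv v = {} ==> fv u \<inter> fv w = {} ==> fv v \<inter> fv w = {} ==>
   ac F (As' A A' A'') (tn F u (tn F v w)) = tn F (tn F u v) w"
proof -
 note p = parr_ac[OF pats(5) pat_typed[OF pats(6)], folded As_def] parr_ac[OF pats(6) pat_typed[OF pats(5)], folded As'_def]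
 show "gnd A ==> gnd A' ==> gnd A'' ==> ar (As A A' A'')" "gnd A ==> gnd A' ==> gnd A'' ==> ar (As' A A' A'')"
  using p(1,3) by blast+
 assume e: "el F u" "el F v" "el F w" "tyo F u = A" "tyo F v = A'" "tyo F w = A''" and d: "fv u \<inter> fv v = {}" "fv u \<inter> fv w = {}" "fv v \<inter> fv w = {}"
 have a: "args F [(2, A), (3, A'), (4, A'')] (Var(2 := u, 3 := v, 4 := w))" using e d by (simp add: fun_upd_apply tm_el)
 have g: "gnd A" "gnd A'" "gnd A''" using e gnd_el by blast+
 show "ac F (As A A' A'') (tn F (tn F u v) w) = tn F u (tn F v w)"
  using p(2)[OF g g a] e d by (simp add: fun_upd_apply Int_Un_distrib Int_Un_distrib2)
 show "ac F (As' A A' A'') (tn F u (tn F v w)) = tn F (tn F u v) w"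
  using p(4)[OF g g a] e d by (simp add: fun_upd_apply Int_Un_distrib Int_Un_distrib2)
qed

lemma units [simp]:
 shows "gnd A ==> ar (Lu A)" "gnd A ==> ar (Lu' A)" "gnd A ==> ar (Ru A)" "gnd A ==> ar (Ru' A)"
  and "el F v ==> tyo F v = A ==> ac F (Lu A) (tn F (st F) v) = v"
  and "el F v ==> tyo F v = A ==> ac F (Lu' A) v = tn F (st F) v"
  and "el F v ==> tyo F v = A ==> ac F (Ru A) (tn F v (st F)) = v"
  and "el F v ==> tyo F v = A ==> ac F (Ru' A) v = tn F v (st F)"
proof -
 note p = parr_ac[OF pats(2)[where x = 2] pat_typed[OF pats(1)[where x = 2]], folded Lu_def] parr_ac[OF pats(1)[where x = 2] pat_typed[OF pats(2)[where x = 2]], folded Lu'_def]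
  parr_ac[OF pats(3)[where x = 2] pat_typed[OF pats(1)[where x = 2]], folded Ru_def] parr_ac[OF pats(1)[where x = 2] pat_typed[OF pats(3)[where x = 2]], folded Ru'_def]
 show "gnd A ==> ar (Lu A)" "gnd A ==> ar (Lu' A)" "gnd A ==> ar (Ru A)" "gnd A ==> ar (Ru' A)"
  using p(1,3,5,7) by blast+
 assume e: "el F v" "tyo F v = A"
 have a: "args F [(2, A)] (Var(2 := v))" using e by (simp add: fun_upd_apply tm_el)
 have g: "gnd A" using e gnd_el by blast
 show "ac F (Lu A) (tn F (st F) v) = v" using p(2)[OF g g a] e by (simp add: fun_upd_apply)
 show "ac F (Lu' A) v = tn F (st F) v" using p(4)[OF g g a] e by (simp add: fun_upd_apply)
 show "ac F (Ru A) (tn F v (st F)) = v" using p(6)[OF g g a] e by (simp add: fun_upd_apply)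
 show "ac F (Ru' A) v = tn F v (st F)" using p(8)[OF g g a] e by (simp add: fun_upd_apply)
qed

lemma Sw [simp]:
 shows "gnd A ==> gnd A' ==> ar (Sw A A')"
  and "el F u ==> el F v ==> tyo F u = A ==> tyo F v = A' ==> fv u \<inter> fv v = {} ==>
   ac F (Sw A A') (tn F u v) = tn F v u"
proof -
 have "typed T [(2, A), (3, A')] (Ten (Var 3) (Var 2)) (Tensor A' A)" if "gnd A" "gnd A'"
  by (rule typed_perm[OF pat_typed[OF pats(4)[of A' A 3 2]]]) (use that in auto)
 note p = parr_ac[OF pats(4)[of A A' 2 3] this, folded Sw_def]
 show "gnd A ==> gnd A' ==> ar (Sw A A')" using p(1) by simp
 assume e: "el F u" "el F v" "tyo F u = A" "tyo F v = A'" "fv u \<inter> fv v = {}"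
 have a: "args F [(2, A), (3, A')] (Var(2 := u, 3 := v))" using e by (simp add: fun_upd_apply tm_el)
 have g: "gnd A" "gnd A'" using e gnd_el by blast+
 show "ac F (Sw A A') (tn F u v) = tn F v u"
  using p(2)[OF g _ g a] e by (simp add: fun_upd_apply Int_commute)
qed

lemma Cu [simp]:
 assumes "ar f" "src f = Tensor Y X" "tgt f = Z"
 shows "ar (Cu X Y Z f)"
  and "el F v ==> el F w ==> tyo F v = Y ==> tyo F w = X ==> fv v \<inter> fv w = {} ==>
   ap F (ac F (Cu X Y Z f) v) w = ac F f (tn F v w)"
proof -
 have g: "gnd Y" "gnd X" using gnd_ar(1)[OF assms(1)] assms(2) by auto
 have "typed T [(0, Y), (1, X)] ((rep f)[0 ::= Ten (Var 0) (Var 1)]) Z"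
  using typed_subst_rep[OF assms(1)] pat_typed[OF pats(4)[OF g, of 0 1]] assms by simp
 note p = larr_ac[OF this, folded Cu_def]
 show "ar (Cu X Y Z f)" using p(1) .
 assume e: "el F v" "el F w" "tyo F v = Y" "tyo F w = X" "fv v \<inter> fv w = {}"
 note t = tm_Ten[OF tm_el[OF e(1,3)] tm_el[OF e(2,4)] e(5)]
 have "ap F (ac F (Cu X Y Z f) v) w = nf F ((rep f)[0 ::= Ten v w])"
  using p(2)[OF e] rep_subst(2)[OF assms(1)] by simp (simp add: fun_upd_apply)
 also have "... = ac F f (tn F v w)"
  unfolding ac_def tn_def using is_theorem.refl[OF rep(1)[OF assms(1)]] t assms by (intro nf_cong eq_subst0[OF _ eq_nf[OF t]]) auto
 finally show "ap F (ac F (Cu X Y Z f) v) w = ac F f (tn F v w)" .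
qed

lemma Im [simp]:
 assumes "ar g" "gnd X"
 shows "ar (Im X g)"
  and "el F v ==> el F w ==> tyo F v = Lolli X (src g) ==> tyo F w = X ==> fv v \<inter> fv w = {} ==>
   ap F (ac F (Im X g) v) w = ac F g (ap F v w)"
proof -
 have "typed T [(0, Lolli X (src g)), (1, X)] (App (Var 0) (Var 1)) (src g)"
  by (rule typed_App[OF ty_var ty_var]) (use assms ar_ground[OF assms(1)] in \<open>auto simp: gnd_def\<close>)
 note p = larr_ac[OF typed_subst_rep[OF assms(1) this], folded Im_def]
 show "ar (Im X g)" using p(1) .
 assume e: "el F v" "el F w" "tyo F v = Lolli X (src g)" "tyo F w = X" "fv v \<inter> fv w = {}"
 note t = tm_App[OF tm_el[OF e(1,3)] tm_el[OF e(2,4)] e(5)]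
 have "ap F (ac F (Im X g) v) w = nf F ((rep g)[0 ::= App v w])"
  using p(2)[OF e] rep_subst(2)[OF assms(1)] by simp (simp add: fun_upd_apply)
 also have "... = ac F g (ap F v w)"
  unfolding ac_def ap_def using is_theorem.refl[OF rep(1)[OF assms(1)]] t assms by (intro nf_cong eq_subst0[OF _ eq_nf[OF t]]) auto
 finally show "ap F (ac F (Im X g) v) w = ac F g (ap F v w)" .
qed

lemma Uc [simp]:
 assumes "ar g" "src g = Y" "tgt g = Lolli X Z"
 shows "ar (Uc X Y Z g)"
  and "el F v ==> el F w ==> tyo F v = Y ==> tyo F w = X ==> fv v \<inter> fv w = {} ==>
   ac F (Uc X Y Z g) (tn F v w) = ap F (ac F g v) w"
proof -
 have g: "gnd Y" "gnd X" using gnd_ar[OF assms(1)] assms(2,3) by auto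
 have "typed T [(2, Y), (3, X)] (App ((rep g)[0 ::= Var 2]) (Var 3)) Z"
  by (rule typed_App[where G = "[(2, Y)]" and H = "[(3, X)]"])
   (use typed_subst_rep[OF assms(1) ty_var] assms g ty_var in \<open>auto simp: gnd_def\<close>)
 note p = parr_ac[OF pats(4)[OF g] this, folded Uc_def]
 show "ar (Uc X Y Z g)" using p(1) by simp
 assume e: "el F v" "el F w" "tyo F v = Y" "tyo F w = X" "fv v \<inter> fv w = {}"
 note t = tm_subst0[OF rep(1)[OF assms(1)] tm_el[OF e(1)], unfolded assms(2,3), OF e(3)]
  fv_subst0[OF rep(1)[OF assms(1)] tm_el[OF e(1)], unfolded assms(2), OF e(3)]
 have "args F [(2, Y), (3, X)] (Var(2 := v, 3 := w))" using e by (simp add: fun_upd_apply tm_el)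
 from p(2)[OF _ this] show "ac F (Uc X Y Z g) (tn F v w) = ap F (ac F g v) w"
  using e rep_subst(2)[OF assms(1)] ap_nf[OF t(1) tm_el[OF e(2,4)]] t(2) by (simp add: ac_def) (simp add: fun_upd_apply)
qed

end

lemma concat_in_nshuffles: "concat xss \<in> nshuffles xss"
 by (induction xss) (auto intro: append_in_shuffles)

context varietal_theory
begin

definition opctx :: "'f => 'g ctx" where
 "opctx f = map (%i. (i, op_args T f ! i)) [0..<length (op_args T f)]"

definition OpM :: "'f => ('g ty, 'u) arr" where
 "OpM f = parr (opctx f) (ntup (map Var [0..<length (op_args T f)])) (nty (op_args T f))
   (Op f (map Var [0..<length (op_args T f)])) (op_res T f)"

primrec ntn :: "(var => 'g ty) => ('g, 'f) tm list => ('g, 'f) tm" where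
 "ntn F [] = st F" | "ntn F (v # vs) = foldl (tn F) v vs"

abbreviation disj :: "('g, 'f) tm list => bool" where
 "disj \<equiv> sorted_wrt (%v w. fv v \<inter> fv w = {})"

definition synm :: "('g ty, 'u, 'v, 'g, 'f) interp" where
 "synm = \<lparr>obj = {A. gnd A}, mor = {f. ar f}, ident = Id, cmp = Cm, tunit = TUnit, tobj = Tensor, tmor = Tm,
   asc = As, lunit = Lu, runit = Ru, swap = Sw, iobj = Lolli, imor = Im, curry_at = Cu, hdist = hdi,
   ground_obj = Ground, op_mor = OpM\<rparr>"

lemma synm_simps [simp]:
 "A \<in> obj synm \<longleftrightarrow> gnd A" "f \<in> mor synm \<longleftrightarrow> ar f" "ident synm = Id" "cmp synm = Cm" "tunit synm = TUnit" "tobj synm = Tensor"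
 "tmor synm = Tm" "asc synm = As" "lunit synm = Lu" "runit synm = Ru" "swap synm = Sw" "iobj synm = Lolli"
 "imor synm = Im" "curry_at synm = Cu" "hdist synm = hdi" "ground_obj synm = Ground" "op_mor synm = OpM"
 by (simp_all add: synm_def)

lemma hom_synm: "f \<in> hom synm X Y \<longleftrightarrow> gnd X & gnd Y & ar f & src f = X & tgt f = Y"
 by (auto simp: hom_def)

text \<open>Four variables with prescribed types, which is what the pentagon takes.\<close>

lemma typing_exists: "\<exists>F :: var => 'g ty. F 2 = W & F 3 = X & F 4 = Y & F 5 = Z"
 by (rule exI[of _ "(%_. W)(3 := X, 4 := Y, 5 := Z)"]) (simp add: fun_upd_apply)

lemma inverse_synm:
 assumes "ar f" "ar g" "src g = tgt f" "tgt g = src f" "Cm g f = Id (src f)" "Cm f g = Id (tgt f)"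
 shows "inverse_arr synm f g"
 unfolding inverse_arr_def using assms by (simp add: hom_synm)

lemma inverse_As:
 assumes "gnd X" "gnd Y" "gnd Z" shows "inverse_arr synm (As X Y Z) (As' X Y Z)"
proof -
 obtain F :: "var => 'g ty" where F: "F 2 = X" "F 3 = Y" "F 4 = Z"  using typing_exists[of "X" "Y" "Z" "X"] by blast
 show ?thesis
 proof (rule inverse_synm)
  show "Cm (As' X Y Z) (As X Y Z) = Id (src (As X Y Z))"
   by (rule ext_eq[of F _ "tn F (tn F (vr F 2) (vr F 3)) (vr F 4)"]) (simp_all add: assms F)
  show "Cm (As X Y Z) (As' X Y Z) = Id (tgt (As X Y Z))"
   by (rule ext_eq[of F _ "tn F (vr F 2) (tn F (vr F 3) (vr F 4))"]) (simp_all add: assms F)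
 qed (simp_all add: assms)
qed

lemma inverse_units:
 assumes "gnd X" shows "inverse_arr synm (Lu X) (Lu' X)" "inverse_arr synm (Ru X) (Ru' X)"
proof -
 obtain F :: "var => 'g ty" where F: "F 2 = X"  using typing_exists[of "X" "X" "X" "X"] by blast
 show "inverse_arr synm (Lu X) (Lu' X)"
 proof (rule inverse_synm)
  show "Cm (Lu' X) (Lu X) = Id (src (Lu X))"
   by (rule ext_eq[of F _ "tn F (st F) (vr F 2)"]) (simp_all add: assms F)
  show "Cm (Lu X) (Lu' X) = Id (tgt (Lu X))"
   by (rule ext_eq[of F _ "vr F 2"]) (simp_all add: assms F)
 qed (simp_all add: assms)
 show "inverse_arr synm (Ru X) (Ru' X)"
 proof (rule inverse_synm)
  show "Cm (Ru' X) (Ru X) = Id (src (Ru X))"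
   by (rule ext_eq[of F _ "tn F (vr F 2) (st F)"]) (simp_all add: assms F)
  show "Cm (Ru X) (Ru' X) = Id (tgt (Ru X))"
   by (rule ext_eq[of F _ "vr F 2"]) (simp_all add: assms F)
 qed (simp_all add: assms)
qed

text \<open>For arrows into a function type, whose values are not tuples: the values at one variable
  are compared after application to another.\<close>

lemma ext_lolli:
 assumes "ap F (ac F f (vr F 2)) (vr F 3) = ap F (ac F g (vr F 2)) (vr F 3)" "ar f" "ar g" "src g = src f" "tgt g = tgt f"
  "F 2 = src f" "tgt f = Lolli (F 3) C"
 shows "f = g"
proof (rule ext_eq)
 have "gnd (F 2)" "gnd (F 3)" using gnd_ar[OF assms(2)] assms(6,7) by auto
 then show "ac F f (vr F 2) = ac F g (vr F 2)" "gp F (vr F 2)" "tyo F (vr F 2) = src f"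
  using assms by (auto intro!: lolli_ext[OF assms(1)])
qed (use assms in simp_all)

lemma ext_lolli_ds:
 assumes "ar f" "ar g" "src g = src f" "tgt g = tgt f" "F 2 = src f" "tgt f = Lolli (F 3) C"
 shows "ds F (ap F (ac F f (vr F 2)) (vr F 3)) (ap F (ac F g (vr F 2)) (vr F 3)) \<le> hdi f g"
proof -
 have g: "gnd (F 2)" "gnd (F 3)" using gnd_ar[OF assms(1)] assms(5,6) by auto
 have "ds F (ap F (ac F f (vr F 2)) (vr F 3)) (ap F (ac F g (vr F 2)) (vr F 3)) \<le> ds F (ac F f (vr F 2)) (ac F g (vr F 2))"
  by (rule lolli_ext_ds) (use assms g in simp_all)
 also have "... \<le> hdi f g" by (rule ext_ds) (use assms g in simp_all)
 finally show ?thesis .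
qed

text \<open>All laws follow one route: variables are typed by the factors of the source, both
  composites are evaluated on the tuple bracketed like the source, and \<open>ext_eq\<close>
  concludes.\<close>

lemma symmetric_monoidal_synm: "symmetric_monoidal_cat synm"
proof unfold_locales
 show "f \<in> mor synm ==> src f \<in> obj synm & tgt f \<in> obj synm" for f by simp
 show "X \<in> obj synm ==> ident synm X \<in> hom synm X X" for X by (simp add: hom_synm)
 show "f \<in> hom synm X Y ==> g \<in> hom synm Y Z ==> cmp synm g f \<in> hom synm X Z" for f g X Y Z by (simp add: hom_synm)
 show "cmp synm (ident synm Y) f = f" if f: "f \<in> hom synm X Y" for f X Y
 proof -
  obtain F :: "var => 'g ty" where "F 2 = X"  using typing_exists[of "X" "X" "X" "X"] by blast
  then show ?thesis using f by (intro ext_eq[of F _ "vr F 2"]) (auto simp: hom_synm)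
 qed
 show "cmp synm f (ident synm X) = f" if f: "f \<in> hom synm X Y" for f X Y
 proof -
  obtain F :: "var => 'g ty" where "F 2 = X"  using typing_exists[of "X" "X" "X" "X"] by blast
  then show ?thesis using f by (intro ext_eq[of F _ "vr F 2"]) (auto simp: hom_synm)
 qed
 show "cmp synm (cmp synm h g) f = cmp synm h (cmp synm g f)" if f: "f \<in> hom synm W X" "g \<in> hom synm X Y" "h \<in> hom synm Y Z" for f g h W X Y Z
 proof -
  obtain F :: "var => 'g ty" where "F 2 = W"  using typing_exists[of "W" "W" "W" "W"] by blast
  then show ?thesis using f by (intro ext_eq[of F _ "vr F 2"]) (auto simp: hom_synm)
 qed
 show "tunit synm \<in> obj synm" by simp
 show "X \<in> obj synm ==> Y \<in> obj synm ==> tobj synm X Y \<in> obj synm" for X Y by simp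
 show "f \<in> hom synm X Y ==> g \<in> hom synm X' Y' ==> tmor synm f g \<in> hom synm (tobj synm X X') (tobj synm Y Y')" for f g X Y X' Y'
  by (auto simp: hom_synm)
 show "tmor synm (ident synm X) (ident synm Y) = ident synm (tobj synm X Y)" if "X \<in> obj synm" "Y \<in> obj synm" for X Y
 proof -
  obtain F :: "var => 'g ty" where "F 2 = X" "F 3 = Y"  using typing_exists[of "X" "Y" "X" "X"] by blast
  then show ?thesis using that by (intro ext_eq[of F _ "tn F (vr F 2) (vr F 3)"]) simp_all
 qed
 show "tmor synm (cmp synm g f) (cmp synm g' f') = cmp synm (tmor synm g g') (tmor synm f f')"
  if "f \<in> hom synm X Y" "g \<in> hom synm Y Z" "f' \<in> hom synm X' Y'" "g' \<in> hom synm Y' Z'" for f g f' g' X Y Z X' Y' Z'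
 proof -
  obtain F :: "var => 'g ty" where "F 2 = X" "F 3 = X'"  using typing_exists[of "X" "X'" "X" "X"] by blast
  then show ?thesis using that by (intro ext_eq[of F _ "tn F (vr F 2) (vr F 3)"]) (auto simp: hom_synm)
 qed
 show "asc synm X Y Z \<in> hom synm (tobj synm (tobj synm X Y) Z) (tobj synm X (tobj synm Y Z)) & iso_arr synm (asc synm X Y Z)"
  if "X \<in> obj synm" "Y \<in> obj synm" "Z \<in> obj synm" for X Y Z
  using that inverse_As[of X Y Z] by (auto simp: hom_synm iso_arr_def)
 show "cmp synm (asc synm X' Y' Z') (tmor synm (tmor synm f g) h) = cmp synm (tmor synm f (tmor synm g h)) (asc synm X Y Z)"
  if "f \<in> hom synm X X'" "g \<in> hom synm Y Y'" "h \<in> hom synm Z Z'" for f g h X Y Z X' Y' Z'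
 proof -
  obtain F :: "var => 'g ty" where "F 2 = X" "F 3 = Y" "F 4 = Z"  using typing_exists[of "X" "Y" "Z" "X"] by blast
  then show ?thesis using that by (intro ext_eq[of F _ "tn F (tn F (vr F 2) (vr F 3)) (vr F 4)"]) (auto simp: hom_synm)
 qed
 show "lunit synm X \<in> hom synm (tobj synm (tunit synm) X) X & iso_arr synm (lunit synm X)" if "X \<in> obj synm" for X
  using that inverse_units(1)[of X] by (auto simp: hom_synm iso_arr_def)
 show "cmp synm (lunit synm Y) (tmor synm (ident synm (tunit synm)) f) = cmp synm f (lunit synm X)" if "f \<in> hom synm X Y" for f X Y
 proof -
  obtain F :: "var => 'g ty" where "F 2 = X"  using typing_exists[of "X" "X" "X" "X"] by blast
  then show ?thesis using that by (intro ext_eq[of F _ "tn F (st F) (vr F 2)"]) (auto simp: hom_synm)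
 qed
 show "runit synm X \<in> hom synm (tobj synm X (tunit synm)) X & iso_arr synm (runit synm X)" if "X \<in> obj synm" for X
  using that inverse_units(2)[of X] by (auto simp: hom_synm iso_arr_def)
 show "cmp synm (runit synm Y) (tmor synm f (ident synm (tunit synm))) = cmp synm f (runit synm X)" if "f \<in> hom synm X Y" for f X Y
 proof -
  obtain F :: "var => 'g ty" where "F 2 = X"  using typing_exists[of "X" "X" "X" "X"] by blast
  then show ?thesis using that by (intro ext_eq[of F _ "tn F (vr F 2) (st F)"]) (auto simp: hom_synm)
 qed
 show "X \<in> obj synm ==> Y \<in> obj synm ==> swap synm X Y \<in> hom synm (tobj synm X Y) (tobj synm Y X)" for X Y by (simp add: hom_synm)
 show "cmp synm (swap synm X' Y') (tmor synm f g) = cmp synm (tmor synm g f) (swap synm X Y)"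
  if "f \<in> hom synm X X'" "g \<in> hom synm Y Y'" for f g X Y X' Y'
 proof -
  obtain F :: "var => 'g ty" where "F 2 = X" "F 3 = Y"  using typing_exists[of "X" "Y" "X" "X"] by blast
  then show ?thesis using that by (intro ext_eq[of F _ "tn F (vr F 2) (vr F 3)"]) (auto simp: hom_synm)
 qed
 show "cmp synm (swap synm Y X) (swap synm X Y) = ident synm (tobj synm X Y)" if "X \<in> obj synm" "Y \<in> obj synm" for X Y
 proof -
  obtain F :: "var => 'g ty" where "F 2 = X" "F 3 = Y"  using typing_exists[of "X" "Y" "X" "X"] by blast
  then show ?thesis using that by (intro ext_eq[of F _ "tn F (vr F 2) (vr F 3)"]) simp_all
 qed
 show "cmp synm (asc synm W X (tobj synm Y Z)) (asc synm (tobj synm W X) Y Z) =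
   cmp synm (tmor synm (ident synm W) (asc synm X Y Z)) (cmp synm (asc synm W (tobj synm X Y) Z) (tmor synm (asc synm W X Y) (ident synm Z)))"
  if "W \<in> obj synm" "X \<in> obj synm" "Y \<in> obj synm" "Z \<in> obj synm" for W X Y Z
 proof -
  obtain F :: "var => 'g ty" where "F 2 = W" "F 3 = X" "F 4 = Y" "F 5 = Z"  using typing_exists[of "W" "X" "Y" "Z"] by blast
  then show ?thesis using that by (intro ext_eq[of F _ "tn F (tn F (tn F (vr F 2) (vr F 3)) (vr F 4)) (vr F 5)"]) simp_all
 qed
 show "cmp synm (tmor synm (ident synm X) (lunit synm Y)) (asc synm X (tunit synm) Y) = tmor synm (runit synm X) (ident synm Y)"
  if "X \<in> obj synm" "Y \<in> obj synm" for X Y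
 proof -
  obtain F :: "var => 'g ty" where "F 2 = X" "F 3 = Y"  using typing_exists[of "X" "Y" "X" "X"] by blast
  then show ?thesis using that by (intro ext_eq[of F _ "tn F (tn F (vr F 2) (st F)) (vr F 3)"]) simp_all
 qed
 show "cmp synm (asc synm Y Z X) (cmp synm (swap synm X (tobj synm Y Z)) (asc synm X Y Z)) =
   cmp synm (tmor synm (ident synm Y) (swap synm X Z)) (cmp synm (asc synm Y X Z) (tmor synm (swap synm X Y) (ident synm Z)))"
  if "X \<in> obj synm" "Y \<in> obj synm" "Z \<in> obj synm" for X Y Z
 proof -
  obtain F :: "var => 'g ty" where "F 2 = X" "F 3 = Y" "F 4 = Z"  using typing_exists[of "X" "Y" "Z" "X"] by blast
  then show ?thesis using that by (intro ext_eq[of F _ "tn F (tn F (vr F 2) (vr F 3)) (vr F 4)"]) simp_all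
 qed
qed

section \<open>Currying and distances in the syntactic category\<close>

lemma Uc_Cu: "ar f ==> src f = Tensor Y X ==> tgt f = Z ==> Uc X Y Z (Cu X Y Z f) = f"
proof -
 assume f: "ar f" "src f = Tensor Y X" "tgt f = Z"
 obtain F :: "var => 'g ty" where F: "F 2 = Y" "F 3 = X"  using typing_exists[of "Y" "X" "Y" "Y"] by blast
 have "gnd Y" "gnd X" using gnd_ar(1)[OF f(1)] f(2) by auto
 then show ?thesis using f F by (intro ext_eq[of F _ "tn F (vr F 2) (vr F 3)"]) simp_all
qed

lemma Cu_Uc: "ar g ==> src g = Y ==> tgt g = Lolli X Z ==> Cu X Y Z (Uc X Y Z g) = g"
proof -
 assume g: "ar g" "src g = Y" "tgt g = Lolli X Z"
 obtain F :: "var => 'g ty" where F: "F 2 = Y" "F 3 = X"  using typing_exists[of "Y" "X" "Y" "Y"] by blast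
 have "gnd Y" "gnd X" using gnd_ar[OF g(1)] g(2,3) by auto
 then show ?thesis using g F by (intro ext_lolli[of F]) simp_all
qed

text \<open>The pattern of the distance estimates: pass to values at a variable by
  \<open>hdi_ac1\<close>, estimate there, and return by \<open>ext_ds\<close>.\<close>

lemma hdi_Cm: "ar f ==> ar f' ==> ar g ==> ar g' ==> src f' = src f ==> tgt f' = tgt f ==> src g = tgt f ==> src g' = tgt f ==> tgt g' = tgt g ==>
  hdi f f' * hdi g g' \<le> hdi (Cm g f) (Cm g' f')"
proof -
 assume a: "ar f" "ar f'" "ar g" "ar g'" "src f' = src f" "tgt f' = tgt f" "src g = tgt f" "src g' = tgt f" "tgt g' = tgt g"
 obtain F :: "var => 'g ty" where F: "F 2 = src f"  using typing_exists[of "src f" "src f" "src f" "src f"] by blast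
 have "hdi g g' * hdi f f' \<le> hdi g g' * ds F (ac F f (vr F 2)) (ac F f' (vr F 2))"
  using a F by (intro quantale_mult_mono order_refl hdi_ac1) simp_all
 also have "... \<le> ds F (ac F g (ac F f (vr F 2))) (ac F g' (ac F f' (vr F 2)))"
  using a F by (intro hdi_ac) simp_all
 also have "... = ds F (ac F (Cm g f) (vr F 2)) (ac F (Cm g' f') (vr F 2))" using a F by simp
 also have "... \<le> hdi (Cm g f) (Cm g' f')" using a F by (intro ext_ds) simp_all
 finally show ?thesis by (simp add: mult.commute)
qed

lemma hdi_Tm: "ar f ==> ar f' ==> ar g ==> ar g' ==> src f' = src f ==> tgt f' = tgt f ==> src g' = src g ==> tgt g' = tgt g ==>
  hdi f f' * hdi g g' \<le> hdi (Tm f g) (Tm f' g')"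
proof -
 assume a: "ar f" "ar f'" "ar g" "ar g'" "src f' = src f" "tgt f' = tgt f" "src g' = src g" "tgt g' = tgt g"
 obtain F :: "var => 'g ty" where F: "F 2 = src f" "F 3 = src g"  using typing_exists[of "src f" "src g" "src f" "src f"] by blast
 have "hdi f f' * hdi g g' \<le> ds F (ac F f (vr F 2)) (ac F f' (vr F 2)) * ds F (ac F g (vr F 3)) (ac F g' (vr F 3))"
  using a F by (intro quantale_mult_mono hdi_ac1) simp_all
 also have "... \<le> ds F (tn F (ac F f (vr F 2)) (ac F g (vr F 3))) (tn F (ac F f' (vr F 2)) (ac F g' (vr F 3)))"
  using a F by (intro ds_tn) simp_all
 also have "... = ds F (ac F (Tm f g) (tn F (vr F 2) (vr F 3))) (ac F (Tm f' g') (tn F (vr F 2) (vr F 3)))" using a F by simp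
 also have "... \<le> hdi (Tm f g) (Tm f' g')" using a F by (intro ext_ds) simp_all
 finally show ?thesis .
qed

lemma hdi_Im: "gnd X ==> ar g ==> ar g' ==> src g' = src g ==> tgt g' = tgt g ==> hdi g g' \<le> hdi (Im X g) (Im X g')"
proof -
 assume a: "gnd X" "ar g" "ar g'" "src g' = src g" "tgt g' = tgt g"
 obtain F :: "var => 'g ty" where F: "F 2 = Lolli X (src g)" "F 3 = X"  using typing_exists[of "Lolli X (src g)" "X" "Lolli X (src g)" "Lolli X (src g)"] by blast
 have "hdi g g' \<le> ds F (ac F g (ap F (vr F 2) (vr F 3))) (ac F g' (ap F (vr F 2) (vr F 3)))"
  using a F by (intro hdi_ac1) simp_all
 also have "... = ds F (ap F (ac F (Im X g) (vr F 2)) (vr F 3)) (ap F (ac F (Im X g') (vr F 2)) (vr F 3))" using a F by simp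
 also have "... \<le> hdi (Im X g) (Im X g')" using a F by (intro ext_lolli_ds) simp_all
 finally show ?thesis .
qed

text \<open>Both distances equal the distance of the values at a pair: \<open>f\<close> takes the
  pair as one argument, its currying takes the components in turn.\<close>

lemma hdi_Cu:
 assumes a: "ar f" "ar g" "src f = Tensor Y X" "src g = Tensor Y X" "tgt f = Z" "tgt g = Z"
 shows "hdi (Cu X Y Z f) (Cu X Y Z g) = hdi f g"
proof -
 obtain F :: "var => 'g ty" where F: "F 2 = Y" "F 3 = X"  using typing_exists[of "Y" "X" "Y" "Y"] by blast
 have gn: "gnd Y" "gnd X" using gnd_ar(1)[OF a(1)] a(3) by auto
 let ?d = "ds F (ac F f (tn F (vr F 2) (vr F 3))) (ac F g (tn F (vr F 2) (vr F 3)))"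
 have e: "?d = ds F (ap F (ac F (Cu X Y Z f) (vr F 2)) (vr F 3)) (ap F (ac F (Cu X Y Z g) (vr F 2)) (vr F 3))"
  using a F gn by simp
 show ?thesis
 proof (rule antisym)
  have "hdi (Cu X Y Z f) (Cu X Y Z g) \<le> ds F (ac F (Cu X Y Z f) (vr F 2)) (ac F (Cu X Y Z g) (vr F 2))"
   using a F gn by (intro hdi_ac1) simp_all
  also have "... \<le> ?d" unfolding e using a F gn by (intro ds_ap) simp_all
  also have "... \<le> hdi f g" using a F gn by (intro ext_ds) simp_all
  finally show "hdi (Cu X Y Z f) (Cu X Y Z g) \<le> hdi f g" .
  have "hdi f g \<le> ?d" using a F gn by (intro hdi_ac1) simp_all
  also have "... \<le> hdi (Cu X Y Z f) (Cu X Y Z g)" unfolding e using a F gn by (intro ext_lolli_ds) simp_all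
  finally show "hdi f g \<le> hdi (Cu X Y Z f) (Cu X Y Z g)" .
 qed
qed

lemma hdi_refl: "ar f ==> 1 \<le> hdi f f"
 using one_le_hdi[of f f] by simp

lemma hdi_trans:
 assumes "ar f" "ar g" "ar h" "src g = src f" "tgt g = tgt f" "src h = src f" "tgt h = tgt f"
 shows "hdi f g * hdi g h \<le> hdi f h"
 unfolding hdi_def val_dist_def assms(4-7)
proof (rule Sup_mult_le)
 fix q r assume "q \<in> {q. thr [(0, src f)] (rep f) q (rep g) (tgt f)}" "r \<in> {q. thr [(0, src f)] (rep g) q (rep h) (tgt f)}"
 then have "thr [(0, src f)] (rep f) (q * r) (rep h) (tgt f)" using is_theorem.trans by blast
 then show "q * r \<le> Sup {q. thr [(0, src f)] (rep f) q (rep h) (tgt f)}" by (auto intro: Sup_upper)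
qed

lemma bij_Cu:
 assumes "gnd X" "gnd Y" "gnd Z"
 shows "bij_betw (Cu X Y Z) (hom synm (Tensor Y X) Z) (hom synm Y (Lolli X Z))"
 by (rule bij_betw_byWitness[where f' = "Uc X Y Z"]) (auto simp: hom_synm Uc_Cu Cu_Uc)

lemma enriched_synm: "enriched_autonomous_cat synm"
proof -
 interpret symmetric_monoidal_cat synm by (rule symmetric_monoidal_synm)
 show ?thesis
 proof unfold_locales
  show "X \<in> obj synm ==> Z \<in> obj synm ==> iobj synm X Z \<in> obj synm" for X Z by simp
  show "X \<in> obj synm ==> g \<in> hom synm Z Z' ==> imor synm X g \<in> hom synm (iobj synm X Z) (iobj synm X Z')" for X g Z Z'
   by (auto simp: hom_synm)
  show "imor synm X (ident synm Z) = ident synm (iobj synm X Z)" if "X \<in> obj synm" "Z \<in> obj synm" for X Z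
  proof -
   obtain F :: "var => 'g ty" where "F 2 = Lolli X Z" "F 3 = X"  using typing_exists[of "Lolli X Z" "X" "Lolli X Z" "Lolli X Z"] by blast
   then show ?thesis using that by (intro ext_lolli[of F]) simp_all
  qed
  show "imor synm X (cmp synm g f) = cmp synm (imor synm X g) (imor synm X f)"
   if "X \<in> obj synm" "f \<in> hom synm Y Z" "g \<in> hom synm Z Z'" for X f g Y Z Z'
  proof -
   obtain F :: "var => 'g ty" where "F 2 = Lolli X Y" "F 3 = X"  using typing_exists[of "Lolli X Y" "X" "Lolli X Y" "Lolli X Y"] by blast
   then show ?thesis using that by (intro ext_lolli[of F]) (auto simp: hom_synm)
  qed
  show bij: "bij_betw (curry_at synm X Y Z) (hom synm (tobj synm Y X) Z) (hom synm Y (iobj synm X Z))"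
   if "X \<in> obj synm" "Y \<in> obj synm" "Z \<in> obj synm" for X Y Z
   using that bij_Cu by simp
  show "curry_at synm X Y' Z' (cmp synm g (cmp synm f (tmor synm h (ident synm X)))) =
    cmp synm (imor synm X g) (cmp synm (curry_at synm X Y Z f) h)"
   if "X \<in> obj synm" "h \<in> hom synm Y' Y" "f \<in> hom synm (tobj synm Y X) Z" "g \<in> hom synm Z Z'" for X h Y' Y f Z g Z'
  proof -
   obtain F :: "var => 'g ty" where "F 2 = Y'" "F 3 = X"  using typing_exists[of "Y'" "X" "Y'" "Y'"] by blast
   then show ?thesis using that by (intro ext_lolli[of F]) (auto simp: hom_synm)
  qed
  show "sep_vcat (hom synm X Y) (hdist synm)" for X Y
   unfolding sep_vcat_def vcat_def using hdi_refl hdi_trans one_le_hdi[THEN iffD1] by (auto simp: hom_synm)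
  show "vfunctor (hom synm X Y \<times> hom synm Y Z) (vtensor (hdist synm) (hdist synm)) (hom synm X Z) (hdist synm) (%(f, g). cmp synm g f)" for X Y Z
   unfolding vfunctor_def vtensor_def using hdi_Cm by (auto simp: hom_synm)
  show "vfunctor (hom synm X Y \<times> hom synm X' Y') (vtensor (hdist synm) (hdist synm)) (hom synm (tobj synm X X') (tobj synm Y Y')) (hdist synm)
    (%(f, g). tmor synm f g)" for X Y X' Y'
   unfolding vfunctor_def vtensor_def using hdi_Tm by (auto simp: hom_synm)
  show "vfunctor (hom synm Y Z) (hdist synm) (hom synm (tobj synm Y X) (tobj synm Z X)) (hdist synm) (%f. tmor synm f (ident synm X))"
   if "X \<in> obj synm" for X Y Z
  proof -
   \<comment> \<open>The identity has self-distance at least 1, so \<open>hdi_Tm\<close> specialises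
     to tensoring with a fixed object.\<close>
   have "hdi f g \<le> hdi (Tm f (Id X)) (Tm g (Id X))" if "f \<in> hom synm Y Z" "g \<in> hom synm Y Z" for f g
    using that \<open>X \<in> obj synm\<close> hdi_Tm[of f g "Id X" "Id X"] quantale_mult_mono[OF order_refl[of "hdi f g"] hdi_refl[of "Id X"]]
    by (auto simp: hom_synm intro: order_trans)
   then show ?thesis unfolding vfunctor_def using that by (auto simp: hom_synm)
  qed
  show "vfunctor (hom synm Y Z) (hdist synm) (hom synm (iobj synm X Y) (iobj synm X Z)) (hdist synm) (imor synm X)"
   if "X \<in> obj synm" for X Y Z
   unfolding vfunctor_def using hdi_Im that by (auto simp: hom_synm)
  show "viso (hom synm (tobj synm Y X) Z) (hdist synm) (hom synm Y (iobj synm X Z)) (hdist synm) (curry_at synm X Y Z)"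
   if "X \<in> obj synm" "Y \<in> obj synm" "Z \<in> obj synm" for X Y Z
  proof -
   have b: "bij_betw (Cu X Y Z) (hom synm (Tensor Y X) Z) (hom synm Y (Lolli X Z))" using bij[OF that] by simp
   have c: "hdi (Cu X Y Z f) (Cu X Y Z g) = hdi f g" "Cu X Y Z f \<in> hom synm Y (Lolli X Z)" if "f \<in> hom synm (Tensor Y X) Z" "g \<in> hom synm (Tensor Y X) Z" for f g
    using that hdi_Cu by (auto simp: hom_synm)
   let ?i = "inv_into (hom synm (Tensor Y X) Z) (Cu X Y Z)"
   have d: "?i g \<in> hom synm (Tensor Y X) Z" "Cu X Y Z (?i g) = g" if "g \<in> hom synm Y (Lolli X Z)" for g
    using that b by (auto simp: bij_betw_def inv_into_into f_inv_into_f)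
   have "hdi g h \<le> hdi (?i g) (?i h)" if "g \<in> hom synm Y (Lolli X Z)" "h \<in> hom synm Y (Lolli X Z)" for g h
    using c(1)[OF d(1)[OF that(1)] d(1)[OF that(2)]] d(2)[OF that(1)] d(2)[OF that(2)] by simp
   with b c d show ?thesis unfolding viso_def vfunctor_def by simp
  qed
 qed
qed

end

subsection \<open>Denotations in the syntactic category\<close>

lemma is_ctx_nshuffles:
 assumes "is_ctx E" "E \<in> nshuffles Gs"
 shows "sorted_wrt (%G H. ctx_vars G \<inter> ctx_vars H = {}) Gs"
proof -
 have "mset (concat Gs) = mset E" using mset_nshuffles[OF assms(2)] by (simp add: mset_concat)
 then have "is_ctx (concat Gs)" using is_ctx_mset assms(1) by blast
 then show ?thesis
 proof (induction Gs)
  case (Cons G Gs)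
  have "ctx_vars H \<subseteq> ctx_vars (concat Gs)" if "H \<in> set Gs" for H
   using that by (auto simp: ctx_vars_def)
  with Cons show ?case by fastforce
 qed simp
qed

lemma ntup_snoc: "vs \<noteq> [] ==> ntup (vs @ [v]) = Ten (ntup vs) v"
 by (cases vs) auto

lemma nty_snoc: "As \<noteq> [] ==> nty (As @ [A]) = Tensor (nty As) A"
 by (cases As) auto

lemma subst_ntup: "subst s (ntup vs) = ntup (map (subst s) vs)"
proof (cases vs)
 case (Cons v vs')
 have "subst s (foldl Ten u ws) = foldl Ten (subst s u) (map (subst s) ws)" for u ws
  by (induction ws arbitrary: u) auto
 with Cons show ?thesis by simp
qed simp

text \<open>The variables of a context, bracketed exactly like its object: nested to the left, and
  the unit only for the empty context.\<close>

definition rtup :: "'g ctx => ('g, 'f) tm" where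
 "rtup G = ntup (map (%p. Var (fst p)) G)"

definition cty :: "'g ctx => 'g ty" where
 "cty G = nty (map snd G)"

lemma rtup_snoc: "rtup (G @ [p]) = (if G = [] then Var (fst p) else Ten (rtup G) (Var (fst p)))"
 by (simp add: rtup_def ntup_snoc)

lemma cty_snoc: "cty (G @ [p]) = (if G = [] then snd p else Tensor (cty G) (snd p))"
 by (simp add: cty_def nty_snoc)

context varietal_theory
begin

interpretation synm: enriched_autonomous_cat synm
 by (rule enriched_synm)

definition gctx :: "'g ctx => bool" where
 "gctx G \<longleftrightarrow> is_ctx G & (\<forall>p\<in>set G. gnd (snd p))"

lemma gctx_simps [simp]:
 "gctx []" "gctx (G @ H) \<longleftrightarrow> gctx G & gctx H & ctx_vars G \<inter> ctx_vars H = {}"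
 "gctx (p # G) \<longleftrightarrow> gnd (snd p) & fst p \<notin> ctx_vars G & gctx G"
 by (auto simp: gctx_def)

lemma typed_gctx: "typed T G v A ==> gctx G"
 unfolding gctx_def gnd_def using typed_is_ctx typed_ground by fastforce

lemma pat_rtup: "gctx G ==> pat G (rtup G) (cty G)"
proof (induction G rule: rev_induct)
 case Nil
 then show ?case using pat_Star by (simp add: rtup_def cty_def)
next
 case (snoc p G)
 have g: "gnd (snd p)" "is_ctx G" using snoc.prems by (simp_all add: gctx_def)
 show ?case
  using g(2) snoc pat_V[OF g(1), of "fst p"] pat_Ten[OF _ pat_V[OF g(1), of "fst p"], of G "rtup G" "cty G"]
  by (auto simp: rtup_snoc cty_snoc)
qed

definition tup :: "(var => 'g ty) => 'g ctx => ('g, 'f) tm" where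
 "tup F G = nf F (rtup G)"

lemma tm_rtup: "gctx G ==> types_ctx F G ==> tm F (rtup G) (cty G)"
 by (rule tmI[OF pat_typed[OF pat_rtup]])

lemma fv_rtup: "gctx G ==> fv (rtup G :: ('g, 'f) tm) = ctx_vars G"
 by (rule fv_typed[OF pat_typed[OF pat_rtup]])

lemma gnd_cty [simp]: "gctx G ==> gnd (cty G)"
 unfolding gnd_def by (rule res_ground[OF pat_typed[OF pat_rtup]])

lemma tup_simps [simp]:
 assumes "gctx G" "types_ctx F G"
 shows "el F (tup F G)" "tyo F (tup F G) = cty G" "fv (tup F G) = ctx_vars G" "gp F (tup F G)"
proof -
 note t = nf_el[OF tm_rtup[OF assms]]
 show "el F (tup F G)" "tyo F (tup F G) = cty G" unfolding tup_def by (rule t)+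
 show "fv (tup F G) = ctx_vars G" unfolding tup_def t(3) by (rule fv_rtup[OF assms(1)])
 show "gp F (tup F G)" unfolding tup_def gp_def using pat_rtup[OF assms(1)] assms(2) by blast
qed

lemma tup_Nil: "tup F [] = st F"
 by (simp add: tup_def rtup_def)

lemma tup_snoc:
 assumes "gctx (G @ [(x, A)])" "types_ctx F G" "F x = A"
 shows "tup F (G @ [(x, A)]) = (if G = [] then vr F x else tn F (tup F G) (vr F x))"
proof -
 have "tm F (rtup G) (cty G)" "tm F (Var x) A" "fv (rtup G :: ('g, 'f) tm) \<inter> fv (Var x) = {}"
  using assms tm_rtup tm_Var[of F x] fv_rtup by (auto simp: gnd_def)
 from tn_nf[OF this] show ?thesis by (auto simp: tup_def rtup_snoc vr_def)
qed

lemma ty_obj_synm [simp]: "ty_obj synm A = A"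
 by (induction A) auto

lemma ntobj_synm [simp]: "ntobj synm Xs = nty Xs"
 by (cases Xs) auto

lemma ctx_obj_synm [simp]: "ctx_obj synm G = cty G"
 by (simp add: ctx_obj_def cty_def case_prod_beta' flip: snd_def)

lemma inv_synm [simp]:
 "gnd X ==> gnd Y ==> gnd Z ==> inv_arr synm (As X Y Z) = As' X Y Z" "gnd X ==> inv_arr synm (Lu X) = Lu' X"
 "gnd X ==> inv_arr synm (Id X) = Id X"
 using synm.inv_arr_eq[OF inverse_As] synm.inv_arr_eq[OF inverse_units(1)]
  synm.inv_arr_eq[OF inverse_synm[of "Id X" "Id X"]] synm.id_comp[of "Id X" X X] by (auto simp: hom_synm)

lemma jn_synm: "jn synm G A = (if G = [] then Lu A else Id (Tensor (cty G) A))"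
 by (simp add: jn_def)

lemma cty_Nil [simp]: "cty [] = TUnit"
 by (simp add: cty_def)

lemma jn_ac [simp]:
 assumes "gctx G" "gnd A"
 shows "ar (jn synm G A)" "src (jn synm G A) = Tensor (cty G) A" "tgt (jn synm G A) = (if G = [] then A else Tensor (cty G) A)"
  "ar (inv_arr synm (jn synm G A))" "src (inv_arr synm (jn synm G A)) = (if G = [] then A else Tensor (cty G) A)"
  "tgt (inv_arr synm (jn synm G A)) = Tensor (cty G) A"
  "types_ctx F G ==> F x = A ==> x \<notin> ctx_vars G ==> ac F (jn synm G A) (tn F (tup F G) (vr F x)) = tup F (G @ [(x, A)])"
  "types_ctx F G ==> F x = A ==> x \<notin> ctx_vars G ==> ac F (inv_arr synm (jn synm G A)) (tup F (G @ [(x, A)])) = tn F (tup F G) (vr F x)"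
 using assms by (auto simp: jn_synm tup_snoc tup_Nil)

text \<open>On tuples a shuffle is what it should be: the tuple of \<open>E\<close> goes to the pair
  of the tuples of \<open>G\<close> and \<open>H\<close>. By induction along the construction of the
  morphism, each factor being evaluated.\<close>

lemma shuffle_ac:
 assumes "shuffle_mor synm G H E s" "gctx E" "types_ctx F E"
 shows "gctx G & gctx H & types_ctx F G & types_ctx F H & ctx_vars G \<union> ctx_vars H = ctx_vars E & ctx_vars G \<inter> ctx_vars H = {} &
  ar s & src s = cty E & tgt s = Tensor (cty G) (cty H) & ac F s (tup F E) = tn F (tup F G) (tup F H)"
 using assms
proof (induction rule: shuffle_mor.induct)
 case 1
 then show ?case by (simp add: tup_Nil)
next
 case (2 G H E s x A)
 then have IH: "gctx G & gctx H & types_ctx F G & types_ctx F H & ctx_vars G \<union> ctx_vars H = ctx_vars E & ctx_vars G \<inter> ctx_vars H = {} &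
  ar s & src s = cty E & tgt s = Tensor (cty G) (cty H) & ac F s (tup F E) = tn F (tup F G) (tup F H)"
  "gctx E" "gnd A" "x \<notin> ctx_vars E" "types_ctx F E" "F x = A" by auto
 have "x \<notin> ctx_vars G" "x \<notin> ctx_vars H" using IH by auto
 then show ?case using IH by (auto simp: Int_Un_distrib Int_Un_distrib2 cty_snoc)
next
 case (3 G H E s x A)
 then have IH: "gctx G & gctx H & types_ctx F G & types_ctx F H & ctx_vars G \<union> ctx_vars H = ctx_vars E & ctx_vars G \<inter> ctx_vars H = {} &
  ar s & src s = cty E & tgt s = Tensor (cty G) (cty H) & ac F s (tup F E) = tn F (tup F G) (tup F H)"
  "gctx E" "gnd A" "x \<notin> ctx_vars E" "types_ctx F E" "F x = A" by auto
 have "x \<notin> ctx_vars G" "x \<notin> ctx_vars H" using IH by auto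
 then show ?case using IH by (auto simp: Int_Un_distrib Int_Un_distrib2 cty_snoc)
qed

text \<open>The value is a tuple of tuples, one for each context. It is stated with terms and
  \<open>nf\<close> because the length of the list varies.\<close>

lemma nshuffle_ac:
 assumes "nshuffle_mor synm Gs E s" "gctx E" "types_ctx F E"
 shows "(\<forall>G\<in>set Gs. gctx G & types_ctx F G) & ar s & src s = cty E & tm F (ntup (map rtup Gs)) (tgt s) & fv (ntup (map rtup Gs) :: ('g, 'f) tm) = ctx_vars E &
  ac F s (tup F E) = nf F (ntup (map rtup Gs))"
 using assms
proof (induction rule: nshuffle_mor.induct)
 case (1 G)
 then show ?case by (auto simp: tup_def tm_rtup fv_rtup nf_el[OF tm_rtup])
next
 case (2 Gs D t H E s)
 note S = shuffle_ac[OF 2(2) 2(4,5)]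
 then have IH: "(\<forall>G\<in>set Gs. gctx G & types_ctx F G) & ar t & src t = cty D & tm F (ntup (map rtup Gs)) (tgt t) & fv (ntup (map rtup Gs) :: ('g, 'f) tm) = ctx_vars D &
  ac F t (tup F D) = nf F (ntup (map rtup Gs))" using 2(3) by blast
 have ne: "(map rtup Gs :: ('g, 'f) tm list) \<noteq> []" using nshuffle_mor_nshuffles[OF 2(1)] by simp
 have d: "fv (ntup (map rtup Gs) :: ('g, 'f) tm) \<inter> fv (rtup H :: ('g, 'f) tm) = {}" using IH S fv_rtup by auto
 have r: "tm F (rtup H) (cty H)" "fv (rtup H :: ('g, 'f) tm) = ctx_vars H" using S tm_rtup fv_rtup by blast+
 have "ac F (Cm (Tm t (Id (cty H))) s) (tup F E) = tn F (nf F (ntup (map rtup Gs))) (nf F (rtup H))"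
  using S IH 2(4,5) nf_el[of F "ntup (map rtup Gs)"] by (simp add: tup_def[of F H, symmetric])
 also have "... = nf F (Ten (ntup (map rtup Gs)) (rtup H))" using tn_nf[OF _ r(1) d] IH by blast
 finally show ?case using S IH tm_Ten[OF _ r(1) d] ntup_snoc[OF ne] r(2) by auto
qed

lemma ntmor_snoc: "ms \<noteq> [] ==> ntmor synm (ms @ [m]) = Tm (ntmor synm ms) m"
 by (cases ms) auto

text \<open>Each entry of the list is an arrow \<open>m\<close> together with terms \<open>u\<close>
  and \<open>w\<close> such that \<open>m\<close> sends \<open>u\<close> to \<open>w\<close>; the
  tensor of the arrows then sends the tuple of the \<open>u\<close> to that of the
  \<open>w\<close>.\<close>

lemma ntmor_ac:
 assumes "\<forall>(m, u, w)\<in>set xs. ar m & tm F u (src m) & tm F w (tgt m) & fv w = fv u & ac F m (nf F u) = nf F w"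
  "disj (map (%x. fst (snd x)) xs)"
 shows "ar (ntmor synm (map fst xs)) & tm F (ntup (map (%x. fst (snd x)) xs)) (src (ntmor synm (map fst xs))) &
  tm F (ntup (map (%x. snd (snd x)) xs)) (tgt (ntmor synm (map fst xs))) &
  fv (ntup (map (%x. fst (snd x)) xs)) = (\<Union>x\<in>set xs. fv (fst (snd x))) &
  fv (ntup (map (%x. snd (snd x)) xs)) = fv (ntup (map (%x. fst (snd x)) xs)) &
  ac F (ntmor synm (map fst xs)) (nf F (ntup (map (%x. fst (snd x)) xs))) = nf F (ntup (map (%x. snd (snd x)) xs))"
 using assms
proof (induction xs rule: rev_induct)
 case Nil
 then show ?case using tm_Star by simp
next
 case (snoc x xs)
 obtain m u w where x: "x = (m, u, w)" by (metis prod.exhaust)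
 let ?u = "ntup (map (%x. fst (snd x)) xs)" and ?w = "ntup (map (%x. snd (snd x)) xs)" and ?m = "ntmor synm (map fst xs)"
 have m: "ar m" "tm F u (src m)" "tm F w (tgt m)" "fv w = fv u" "ac F m (nf F u) = nf F w" using snoc.prems(1) x by auto
 show ?case
 proof (cases "xs = []")
  case True
  then show ?thesis using m x by simp
 next
  case False
  have IH: "ar ?m & tm F ?u (src ?m) & tm F ?w (tgt ?m) & fv ?u = (\<Union>x\<in>set xs. fv (fst (snd x))) & fv ?w = fv ?u & ac F ?m (nf F ?u) = nf F ?w"
   by (rule snoc.IH) (use snoc.prems in \<open>auto simp: sorted_wrt_append\<close>)
  have d: "fv ?u \<inter> fv u = {}" "fv ?w \<inter> fv w = {}" using IH m snoc.prems(2) by (auto simp: sorted_wrt_append x)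
  have t: "tm F ?u (src ?m)" "tm F ?w (tgt ?m)" using IH by auto
  note e = nf_el[OF t(1)] nf_el[OF m(2)]
  have "ac F (Tm ?m m) (nf F (Ten ?u u)) = nf F (Ten ?w w)"
   unfolding tn_nf[OF t(1) m(2) d(1), symmetric] tn_nf[OF t(2) m(3) d(2), symmetric] using IH m e d by simp
  then show ?thesis
   using False IH m tm_Ten[OF t(1) m(2) d(1)] tm_Ten[OF t(2) m(3) d(2)] by (simp add: x ntup_snoc ntmor_snoc Un_commute)
 qed
qed

lemma gctx_opctx: "f \<in> ops T ==> gctx (opctx f)"
 using op_ground[of f] by (force simp: gctx_def opctx_def is_ctx_def gnd_def comp_def)

lemma opctx_simps: "rtup (opctx f) = ntup (map Var [0..<length (op_args T f)])" "cty (opctx f) = nty (op_args T f)"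
 by (simp_all add: rtup_def cty_def opctx_def comp_def map_nth)

lemma typed_opctx:
 assumes "f \<in> ops T" shows "typed T (opctx f) (Op f (map Var [0..<length (op_args T f)])) (op_res T f)"
proof -
 have g: "set_ty (op_args T f ! i) \<subseteq> ground T" if "i < length (op_args T f)" for i
  using op_ground[OF assms] that by simp
 show ?thesis
 proof (rule ty_op[where \<Gamma>s = "map (%i. [(i, op_args T f ! i)]) [0..<length (op_args T f)]"])
  show "is_ctx (opctx f)" using gctx_opctx[OF assms] by (simp add: gctx_def)
  show "opctx f \<in> nshuffles (map (%i. [(i, op_args T f ! i)]) [0..<length (op_args T f)])"
  using concat_in_nshuffles[of "map (%i. [(i, op_args T f ! i)]) [0..<length (op_args T f)]"] by (simp add: opctx_def)
 qed (use g assms in \<open>auto intro!: ty_var\<close>)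
qed

lemma OpM:
 assumes "f \<in> ops T"
 shows "ar (OpM f)" "src (OpM f) = nty (op_args T f)" "tgt (OpM f) = op_res T f"
  and "length vs = length (op_args T f) ==> (\<And>i. i < length vs ==> tm F (vs ! i) (op_args T f ! i)) ==> disj vs ==>
   tm F (ntup vs) (nty (op_args T f)) & ac F (OpM f) (nf F (ntup vs)) = nf F (Op f vs)"
proof -
 note p = parr_ac[OF pat_rtup[OF gctx_opctx[OF assms]] typed_opctx[OF assms], unfolded opctx_simps, folded OpM_def]
 show "ar (OpM f)" by (rule p(1))
 show "src (OpM f) = nty (op_args T f)" "tgt (OpM f) = op_res T f" by (simp_all add: OpM_def)
 assume v: "length vs = length (op_args T f)" "\<And>i. i < length vs ==> tm F (vs ! i) (op_args T f ! i)" "disj vs"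
 define s where "s i = (if i < length vs then vs ! i else Var i)" for i
 have d: "fv (vs ! i) \<inter> fv (vs ! j) = {}" if "i < length vs" "j < length vs" "i \<noteq> j" for i j
  using v(3) that unfolding sorted_wrt_iff_nth_less by (metis Int_commute nat_neq_iff)
 have a: "args F (opctx f) s"
  unfolding args_def using v d by (auto simp: opctx_def s_def ctx_vars_def)
 have e: "map s [0..<length (op_args T f)] = vs"
  unfolding v(1)[symmetric] by (rule nth_equalityI) (auto simp: s_def)
 show "tm F (ntup vs) (nty (op_args T f)) & ac F (OpM f) (nf F (ntup vs)) = nf F (Op f vs)"
  using p(2)[OF a] th_tm(1)[OF th_args[OF is_theorem.refl[OF pat_typed[OF pat_rtup[OF gctx_opctx[OF assms]]]] a]]
  by (simp add: opctx_simps subst_ntup comp_def e)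
qed

end

section \<open>Evaluating denotations on the tuple of their context\<close>

context varietal_theory
begin

lemma cx_agree: "\<forall>x\<in>X. F x = F' x ==> finite X ==> cx F X = cx F' X"
 by (simp add: cx_def)

lemma tm_agree: "tm F v A ==> \<forall>x\<in>fv v. F x = F' x ==> tm F' v A"
 by (simp add: tm_def cx_agree[of "fv v" F F'])

lemma eq_agree: "eq F v w ==> \<forall>x\<in>fv v. F x = F' x ==> eq F' v w"
 using eq_fv[of F v w] by (simp add: eq_def th_def cx_agree[of "fv v" F F'])

text \<open>The class of a term depends only on the types of its free variables, hence so does the
  choice. This allows the typing to be changed at a bound variable.\<close>

lemma nf_agree:
 assumes "\<forall>x\<in>fv v. F x = F' x" shows "nf F v = nf F' v"
proof -
 have "eq F v w \<longleftrightarrow> eq F' v w" for w using eq_agree[of F v w F'] eq_agree[of F' v w F] assms by auto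
 then show ?thesis by (simp add: nf_def)
qed

lemma ac_nf: "ar f ==> tm F u (src f) ==> ac F f (nf F u) = nf F ((rep f)[0 ::= u])"
 unfolding ac_def using is_theorem.refl[OF rep(1)] eq_tm[OF eq_nf]
 by (intro nf_cong eq_subst0[OF _ eq_sym[OF eq_nf]]) auto

text \<open>Evaluates an arrow at a pair whose first component is an arbitrary term of unit type:
  \<open>star_eta\<close> reduces it to the value at \<open>Star\<close>, at the price of a
  \<open>LetStar\<close> outside.\<close>

lemma ac_LetStar:
 assumes h: "ar h" "src h = Tensor TUnit Y" "tgt h = C" and v: "tm F v TUnit" and t: "tm F t Y" "fv v \<inter> fv t = {}"
  and w: "tm F w C" "fv w = fv t" "ac F h (nf F (Ten Star t)) = nf F w"
 shows "ac F h (nf F (Ten v t)) = nf F (LetStar v w)"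
proof -
 obtain z where z: "z \<notin> fv t" using fresh_var[of "fv t"] by auto
 let ?H = "cx F (fv t)" and ?u = "(rep h)[0 ::= Ten (Var z) t]"
 have t': "typed T ?H t Y" using t(1) by (simp add: tm_def)
 have "typed T (?H @ [(z, TUnit)]) (Ten (Var z) t) (src h)"
  unfolding h(2) by (rule typed_Ten[OF ty_var t']) (use z in auto)
 from typed_subst_rep[OF h(1) this] have u: "typed T (?H @ [(z, TUnit)]) ?u C" using h(3) by simp
 have "t[z ::= x] = t" for x using z by (intro subst_ident) (auto simp: fun_upd_apply fv_def)
 then have s: "?u[z ::= x] = (rep h)[0 ::= Ten x t]" for x
  unfolding rep_subst(2)[OF h(1)] by (simp add: fun_upd_same)
 have c: "is_ctx (cx F (fv v) @ ?H)" "types_ctx F (cx F (fv v) @ ?H)" using t(2) by auto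
 have tt: "tm F (Ten Star t) (src h)" "tm F (Ten v t) (src h)" using tm_Ten[OF tm_Star t(1)] tm_Ten[OF v t] h(2) by auto
 have "eqv (cx F (fv v) @ ?H) (LetStar v (?u[z ::= Star])) (?u[z ::= v]) C"
  by (rule eqv_lam[OF star_eta[OF v[unfolded tm_def] u c(1) append_in_shuffles]])
 then have 1: "eq F (LetStar v ((rep h)[0 ::= Ten Star t])) ((rep h)[0 ::= Ten v t])" unfolding s using c(2) by (rule eqI)
 have "eq F w ((rep h)[0 ::= Ten Star t])"
  using w(3) ac_nf[OF h(1) tt(1)] by (intro nf_eq[OF _ w(1) tm_subst0[OF rep(1)[OF h(1)] tt(1)]]) simp
 note e = eq_th[OF this w(1)]
 have th: "thr ?H w top ((rep h)[0 ::= Ten Star t]) C" "thr ?H ((rep h)[0 ::= Ten Star t]) top w C"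
  using e th_tm(3)[OF conjunct1[OF e]] w(2) by (simp_all add: th_def)
 note r = is_theorem.refl[OF v[unfolded tm_def], of B]
 have "eqv (cx F (fv v) @ ?H) (LetStar v w) (LetStar v ((rep h)[0 ::= Ten Star t])) C"
  using thr_LetStar[OF r th(1) c(1)] thr_LetStar[OF r th(2) c(1)] by simp
 from nf_cong[OF eq_trans[OF eqI[OF this c(2)] 1]] have "nf F (LetStar v w) = nf F ((rep h)[0 ::= Ten v t])" .
 then show ?thesis using ac_nf[OF h(1) tt(2)] by simp
qed

text \<open>As \<open>ac_LetStar\<close>, with \<open>pm_eta\<close>. The value at a pair of
  variables is computed in \<open>F'\<close>, where these have the types of the components.\<close>

lemma ac_Pm:
 assumes h: "ar h" "src h = Tensor Y (Tensor A A')" "tgt h = C" and v: "tm F v (Tensor A A')" and t: "tm F t Y" "fv v \<inter> fv t = {}"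
  and xy: "x \<noteq> y" "x \<notin> fv t" "y \<notin> fv t" and F': "F' = F(x := A, y := A')"
  and w: "tm F' w C" "fv w = fv t \<union> {x, y}" "ac F' h (nf F' (Ten t (Ten (Var x) (Var y)))) = nf F' w"
 shows "ac F h (nf F (Ten t v)) = nf F (Pm v x y w)"
proof -
 obtain z where z: "z \<notin> fv t" using fresh_var[of "fv t"] by auto
 let ?H = "cx F (fv t)" and ?u = "(rep h)[0 ::= Ten t (Var z)]" and ?xy = "Ten (Var x) (Var y)"
 have g: "gnd A" "gnd A'" using tm_ground[OF v] by (auto simp: gnd_def)
 have Fx: "F' x = A" "F' y = A'" and Ft: "\<forall>a\<in>fv t. F a = F' a" using xy by (auto simp: F' fun_upd_apply)
 have t': "typed T ?H t Y" "tm F' t Y" using t(1) tm_agree[OF t(1) Ft] by (simp_all add: tm_def)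
 have "typed T (?H @ [(z, Tensor A A')]) (Ten t (Var z)) (src h)"
  unfolding h(2) by (rule typed_Ten[OF t'(1) ty_var]) (use z tm_ground[OF v] in auto)
 from typed_subst_rep[OF h(1) this] have u: "typed T (?H @ [(z, Tensor A A')]) ?u C" using h(3) by simp
 have "t[z ::= x] = t" for x using z by (intro subst_ident) (auto simp: fun_upd_apply fv_def)
 then have s: "?u[z ::= x] = (rep h)[0 ::= Ten t x]" for x
  unfolding rep_subst(2)[OF h(1)] by (simp add: fun_upd_same)
 have c: "is_ctx (cx F (fv v) @ ?H)" "types_ctx F (cx F (fv v) @ ?H)" using t(2) by auto
 have "tm F' (Var x) A" "tm F' (Var y) A'" using tm_Var[of F' x] tm_Var[of F' y] g Fx by (auto simp: gnd_def)
 from tm_Ten[OF this] have "tm F' ?xy (Tensor A A')" using xy(1) by simp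
 from tm_Ten[OF t'(2) this] have txy: "tm F' (Ten t ?xy) (src h)" using xy h(2) by simp
 have tv: "tm F (Ten t v) (src h)" using tm_Ten[OF t(1) v] t(2) h(2) by (simp add: Int_commute)
 have "eqv (cx F (fv v) @ ?H) (Pm v x y (?u[z ::= ?xy])) (?u[z ::= v]) C"
  by (rule eqv_lam[OF pm_eta[OF v[unfolded tm_def] u xy(1) _ _ c(1) append_in_shuffles]]) (use xy in auto)
 then have 1: "eq F (Pm v x y ((rep h)[0 ::= Ten t ?xy])) ((rep h)[0 ::= Ten t v])" unfolding s using c(2) by (rule eqI)
 have "eq F' w ((rep h)[0 ::= Ten t ?xy])"
  using w(3) ac_nf[OF h(1) txy] by (intro nf_eq[OF _ w(1) tm_subst0[OF rep(1)[OF h(1)] txy]]) simp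
 note e = eq_th[OF this w(1)]
 have d: "is_ctx (?H @ [(x, A), (y, A')])" "ctx_vars (?H @ [(x, A), (y, A')]) = fv w" "types_ctx F' (?H @ [(x, A), (y, A')])"
  using xy w(2) Fx Ft by (auto simp: cx_agree[OF Ft])
 have th: "thr (?H @ [(x, A), (y, A')]) w top ((rep h)[0 ::= Ten t ?xy]) C" "thr (?H @ [(x, A), (y, A')]) ((rep h)[0 ::= Ten t ?xy]) top w C"
  using thD[OF conjunct1[OF e] d] thD[OF conjunct2[OF e] d(1) _ d(3)] d(2) th_tm(3)[OF conjunct1[OF e]] by auto
 note r = is_theorem.refl[OF v[unfolded tm_def], of B]
 have "eqv (cx F (fv v) @ ?H) (Pm v x y w) (Pm v x y ((rep h)[0 ::= Ten t ?xy])) C"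
  using thr_Pm[OF r th(1) _ c(1), of ?H] thr_Pm[OF r th(2) _ c(1), of ?H] by simp
 from nf_cong[OF eq_trans[OF eqI[OF this c(2)] 1]] have "nf F (Pm v x y w) = nf F ((rep h)[0 ::= Ten t v])" .
 then show ?thesis using ac_nf[OF h(1) tv] by simp
qed

lemma eval_synm:
 assumes "gnd X" "gnd Z" shows "eval_at synm X Z = Uc X (Lolli X Z) Z (Id (Lolli X Z))"
proof -
 have "inj_on (Cu X (Lolli X Z) Z) (hom synm (Tensor (Lolli X Z) X) Z)" using bij_Cu[of X "Lolli X Z" Z] assms by (simp add: bij_betw_def)
 from inv_into_f_eq[OF this _ Cu_Uc] show ?thesis using assms by (simp add: eval_at_def hom_synm)
qed

lemma lam_interp_synm: "lam_interp synm T"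
 unfolding lam_interp_def lam_interp_axioms_def
proof (intro conjI allI impI enriched_synm)
 fix f assume f: "f \<in> ops T"
 have "map (ty_obj synm) (op_args T f) = op_args T f" by (simp add: map_idI)
 then show "op_mor synm f \<in> hom synm (ntobj synm (map (ty_obj synm) (op_args T f))) (ty_obj synm (op_res T f))"
  using OpM(1-3)[OF f] gnd_ar[OF OpM(1)[OF f]] by (simp add: hom_synm)
 show "op_args T f \<noteq> []" "set_ty (op_res T f) \<subseteq> ground T" using op_ground[OF f] by auto
 show "set_ty A \<subseteq> ground T" if "A \<in> set (op_args T f)" for A using op_ground[OF f] that by blast
qed (simp add: gnd_def)

lemma denotes_hom:
 assumes "denotes T synm G v A m" shows "ar m & src m = cty G & tgt m = A"
proof -
 show ?thesis
  using lam_interp.denotation_hom[OF lam_interp_synm denotes_typed[OF assms]] lam_interp.denotes_denotation[OF lam_interp_synm assms]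
  by (simp add: hom_synm)
qed

text \<open>Every factor of the morphism in a denotation rule can be evaluated on a tuple. The
  typing \<open>F\<close> varies in the induction because it is changed at the variables of a
  binder.\<close>

lemma denotes_ac:
 assumes "denotes T synm G v A m" "types_ctx F G" shows "ac F m (tup F G) = nf F v"
 using assms
proof (induction arbitrary: F rule: denotes.induct)
 case (den_op f Gs vs ms E s)
 let ?n = "length (op_args T f)"
 have D: "denotes T synm (Gs ! i) (vs ! i) (op_args T f ! i) (ms ! i)"
  and IH: "types_ctx F (Gs ! i) ==> ac F (ms ! i) (tup F (Gs ! i)) = nf F (vs ! i)" if "i < ?n" for i F
  using den_op.IH that by blast+
 have "denotes T synm E (Op f vs) (op_res T f) (op_mor synm f \<cdot>\<^bsub>synm\<^esub> ntmor synm ms \<cdot>\<^bsub>synm\<^esub> s)"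
  using den_op.hyps D by (intro denotes.den_op[of f T Gs]) auto
 note g = typed_gctx[OF denotes_typed[OF this]]
 note S = nshuffle_ac[OF den_op.hyps(6) g den_op.prems]
 have G: "gctx (Gs ! i)" "types_ctx F (Gs ! i)" if "i < ?n" for i using S that den_op.hyps(2) by auto
 \<comment> \<open>For each argument: its denotation, the tuple of its context, and the argument as
   the value, in the format of \<open>ntmor_ac\<close>.\<close>
 define xs where "xs = map (%i. (ms ! i, rtup (Gs ! i) :: ('g, 'f) tm, vs ! i)) [0..<?n]"
 have xs: "map fst xs = ms" "map (%x. fst (snd x)) xs = map rtup Gs" "map (%x. snd (snd x)) xs = vs"
  unfolding xs_def using den_op.hyps by (auto intro!: nth_equalityI)
 have V: "tm F (vs ! i) (op_args T f ! i)" "fv (vs ! i) = ctx_vars (Gs ! i)" if "i < ?n" for i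
  using tmI[OF denotes_typed[OF D[OF that]] G(2)[OF that]] fv_typed[OF denotes_typed[OF D[OF that]]] by auto
 have sw: "sorted_wrt (%G H. ctx_vars G \<inter> ctx_vars H = {}) Gs"
  using is_ctx_nshuffles den_op.hyps nshuffle_mor_nshuffles by blast
 have dj: "disj (map (%x. fst (snd x)) xs)" "disj vs"
  using sw G(1) V(2) den_op.hyps(2,3) unfolding xs(2) by (auto simp: sorted_wrt_iff_nth_less fv_rtup)
 have N: "ar (ntmor synm ms) & tm F (ntup (map rtup Gs)) (src (ntmor synm ms)) & tm F (ntup vs) (tgt (ntmor synm ms)) &
   ac F (ntmor synm ms) (nf F (ntup (map rtup Gs))) = nf F (ntup vs)"
  using ntmor_ac[of xs F, OF _ dj(1)] unfolding xs
  using G V IH[unfolded tup_def] denotes_hom[OF D] by (auto simp: xs_def tm_rtup fv_rtup)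
 note O = OpM[OF den_op.hyps(1)]
 have O4: "tm F (ntup vs) (nty (op_args T f))" "ac F (OpM f) (nf F (ntup vs)) = nf F (Op f vs)"
  using O(4)[of vs F] V(1) den_op.hyps(3) dj(2) by auto
 have e: "src (ntmor synm ms) = tgt s" "tgt (ntmor synm ms) = nty (op_args T f)" using N S O4(1) tm_unique by blast+
 then show ?case using N S O(1-3) O4(2) g den_op.prems by simp
next
 case (den_var A x)
 then show ?case by (simp add: tup_def rtup_def nf_Var gnd_def)
next
 case den_star
 then show ?case by (simp add: tup_Nil)
next
 case (den_letstar G v m H w A n E s)
 note g = typed_gctx[OF denotes_typed[OF denotes.den_letstar[OF den_letstar.hyps]]]
 note S = shuffle_ac[OF den_letstar.hyps(4) g den_letstar.prems]
 note H = denotes_hom[OF den_letstar.hyps(1)] denotes_hom[OF den_letstar.hyps(2)]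
 note t = denotes_typed[OF den_letstar.hyps(1)] denotes_typed[OF den_letstar.hyps(2)]
 have v: "tm F v TUnit" "fv v = ctx_vars G" "tm F w A" "fv w = ctx_vars H" using tmI[OF t(1)] tmI[OF t(2)] fv_typed[OF t(1)] fv_typed[OF t(2)] S by auto
 have r: "tm F (rtup H) (cty H)" "fv (rtup H :: ('g, 'f) tm) = ctx_vars H" using tm_rtup fv_rtup S by blast+
 \<comment> \<open>The part of the composite behind the scrutinee: it sends a unit beside the tuple
   of \<open>H\<close> to the body.\<close>
 let ?h = "Cm n (Lu (cty H))"
 have I: "ac F m (tup F G) = nf F v" "ac F n (tup F H) = nf F w" using den_letstar.IH S by blast+
 have d: "fv v \<inter> fv (rtup H :: ('g, 'f) tm) = {}" using v r S by simp
 have "ac F ?h (nf F (Ten v (rtup H))) = nf F (LetStar v w)"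
 proof (rule ac_LetStar[OF _ _ _ v(1) r(1) d v(3)])
  have "nf F (Ten Star (rtup H)) = tn F (st F) (tup F H)" unfolding tup_def st_def by (rule tn_nf[symmetric, OF tm_Star r(1)]) simp
  then show "ac F ?h (nf F (Ten Star (rtup H))) = nf F w" using S H I by simp
 qed (use S H v r in auto)
 moreover have "nf F (Ten v (rtup H)) = tn F (nf F v) (tup F H)" unfolding tup_def by (rule tn_nf[symmetric, OF v(1) r(1) d])
 ultimately show ?case using S H I g den_letstar.prems nf_el[OF v(1)] v(2) by simp
next
 case (den_pair G v A m H w A' n E s)
 note g = typed_gctx[OF denotes_typed[OF denotes.den_pair[OF den_pair.hyps]]]
 note S = shuffle_ac[OF den_pair.hyps(4) g den_pair.prems]
 note H = denotes_hom[OF den_pair.hyps(1)] denotes_hom[OF den_pair.hyps(2)]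
 note t = denotes_typed[OF den_pair.hyps(1)] denotes_typed[OF den_pair.hyps(2)]
 have v: "tm F v A" "fv v = ctx_vars G" "tm F w A'" "fv w = ctx_vars H" using tmI[OF t(1)] tmI[OF t(2)] fv_typed[OF t(1)] fv_typed[OF t(2)] S by auto
 have I: "ac F m (tup F G) = nf F v" "ac F n (tup F H) = nf F w" using den_pair.IH S by blast+
 show ?case using S H I g den_pair.prems tn_nf[OF v(1,3)] v(2,4) by simp
next
 case (den_pm G v A A' m H x y w C n E s)
 note g = typed_gctx[OF denotes_typed[OF denotes.den_pm[OF den_pm.hyps]]]
 note S = shuffle_ac[OF den_pm.hyps(4) g den_pm.prems]
 note H = denotes_hom[OF den_pm.hyps(1)] denotes_hom[OF den_pm.hyps(2)]
 note t = denotes_typed[OF den_pm.hyps(1)] denotes_typed[OF den_pm.hyps(2)]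
 have v: "tm F v (Tensor A A')" "fv v = ctx_vars G" "fv w = ctx_vars H \<union> {x, y}" using tmI[OF t(1)] fv_typed[OF t(1)] fv_typed[OF t(2)] S by auto
 have G: "gctx (H @ [(x, A)])" "x \<noteq> y" "x \<notin> ctx_vars H" "y \<notin> ctx_vars H" "gnd A" "gnd A'" using typed_gctx[OF t(2)] by auto
 have r: "tm F (rtup H) (cty H)" "fv (rtup H :: ('g, 'f) tm) = ctx_vars H" using tm_rtup fv_rtup S by blast+
 define F' where "F' = F(x := A, y := A')"
 have Fx: "F' x = A" "F' y = A'" and FD: "types_ctx F' H" using G S by (auto simp: F'_def fun_upd_apply types_ctx_def dest: ctx_varsI)
 \<comment> \<open>The part of the composite behind the symmetry, so that the scrutinee stands on
   the right, as in \<open>ac_Pm\<close>.\<close>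
 let ?h = "Cm n (Cm (jn synm (H @ [(x, A)]) A') (Cm (Tm (jn synm H A) (Id A')) (As' (cty H) A A')))"
 have I: "ac F m (tup F G) = nf F v" "ac F' n (tup F' (H @ [(x, A), (y, A')])) = nf F' w" using den_pm.IH S FD Fx by auto
 have d: "fv v \<inter> fv (rtup H :: ('g, 'f) tm) = {}" using v r S by simp
 have hh: "ar ?h" "src ?h = Tensor (cty H) (Tensor A A')" "tgt ?h = C"
  using S H G cty_snoc[of "H @ [(x, A)]" "(y, A')"] by (auto simp: cty_snoc)
 have j: "ac F' (jn synm (H @ [(x, A)]) A') (tn F' (tup F' (H @ [(x, A)])) (vr F' y)) = tup F' (H @ [(x, A), (y, A')])"
  using jn_ac(7)[OF G(1) G(6), of F' y] FD Fx G by simp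
 have "ac F ?h (nf F (Ten (rtup H) v)) = nf F (Pm v x y w)"
 proof (rule ac_Pm[OF hh v(1) r(1) d G(2) _ _ F'_def])
  have gv: "tm F' (rtup H) (cty H)" "tm F' (Var x) A" "tm F' (Var y) A'"
   using tm_rtup FD S tm_Var[of F' x] tm_Var[of F' y] Fx G by (auto simp: gnd_def)
  have "nf F' (Ten (rtup H) (Ten (Var x) (Var y))) = tn F' (tup F' H) (tn F' (vr F' x) (vr F' y))"
   unfolding tup_def vr_def using tn_nf[OF gv(2,3)] tn_nf[OF gv(1) tm_Ten[OF gv(2,3)]] G r(2) by simp
  then show "ac F' ?h (nf F' (Ten (rtup H) (Ten (Var x) (Var y)))) = nf F' w"
   using S H I(2) G FD Fx j cty_snoc[of "H @ [(x, A)]" "(y, A')"] by (simp add: cty_snoc split: if_splits)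
  show "tm F' w C" using tmI[OF t(2)] FD Fx by simp
 qed (use v r G in auto)
 moreover have "nf F (Ten (rtup H) v) = tn F (tup F H) (nf F v)" unfolding tup_def by (rule tn_nf[symmetric, OF r(1) v(1)]) (use d in auto)
 ultimately show ?case using S H I(1) g den_pm.prems nf_el[OF v(1)] v(2) G hh cty_snoc[of "H @ [(x, A)]" "(y, A')"]
  by (simp add: Int_commute cty_snoc split: if_splits)
next
 case (den_lam G x A v A' m)
 note t = denotes_typed[OF den_lam.hyps] denotes_typed[OF denotes.den_lam[OF den_lam.hyps]]
 note H = denotes_hom[OF den_lam.hyps] denotes_hom[OF denotes.den_lam[OF den_lam.hyps]]
 define F' where "F' = F(x := A)"
 have G: "gctx G" "x \<notin> ctx_vars G" "gnd A" using typed_gctx[OF t(1)] by auto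
 have Fx: "F' x = A" and FG: "types_ctx F' G" using G den_lam.prems by (auto simp: F'_def fun_upd_apply types_ctx_def dest: ctx_varsI)
 have I: "ac F' m (tup F' (G @ [(x, A)])) = nf F' v" using den_lam.IH FG Fx by simp
 let ?c = "Cu A (cty G) A' (Cm m (jn synm G A))" and ?l = "Lam x A v"
 have c: "ar ?c" "src ?c = cty G" "tgt ?c = Lolli A A'" using H(2) by simp_all
 have jc: "ar (Cm m (jn synm G A))" "src (Cm m (jn synm G A)) = Tensor (cty G) A" "tgt (Cm m (jn synm G A)) = A'"
  using H(1) G by (auto simp: cty_snoc)
 have l: "tm F' ?l (Lolli A A')" "fv ?l = ctx_vars G" using tmI[OF t(2) FG] fv_typed[OF t(2)] by auto
 note ll = nf_el[OF l(1)]
 have vx: "tm F' (Var x) A" using tm_Var[of F' x] G Fx by (simp add: gnd_def)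
 have "eqv (G @ [(x, A)]) (App ?l (Var x)) (v[x ::= Var x]) A'"
  by (rule eqv_lam[OF lam_beta[OF t(1) ty_var _ append_in_shuffles]]) (use G in \<open>auto simp: gnd_def gctx_def\<close>)
 then have "nf F' (App ?l (Var x)) = nf F' v"
  using nf_cong[OF eqI[of "G @ [(x, A)]" "App ?l (Var x)" v A' F']] FG Fx by (simp add: fun_upd_idem)
 then have 1: "ap F' (nf F' ?l) (vr F' x) = nf F' v" unfolding vr_def using ap_nf[OF l(1) vx] l(2) G by simp
 have 2: "ap F' (ac F' ?c (tup F' G)) (vr F' x) = nf F' v" using I G FG Fx jc H(1) by (simp add: cty_snoc split: if_splits)
 \<comment> \<open>By extensionality at \<open>x\<close>: both functions send \<open>x\<close> to
   the body, one by the rule for currying, the other by \<beta>.\<close>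
 have "ac F' ?c (tup F' G) = nf F' ?l"
  by (rule lolli_ext[where x = x and C = A']) (use 1 2 ll l G FG Fx c in auto)
 moreover have "nf F' ?l = nf F ?l" using G l(2) by (intro nf_agree) (auto simp: F'_def fun_upd_apply)
 \<comment> \<open>The variable \<open>x\<close> is not free on either side, so the typing can be
   reset to \<open>F\<close>.\<close>
 moreover have "ac F' ?c (tup F' G) = ac F ?c (tup F G)"
 proof -
  have f: "fv ((rep ?c)[0 ::= rtup G]) = ctx_vars G"
   using fv_subst0[OF rep(1)[OF c(1)]] tm_rtup[OF G(1) FG] fv_rtup[OF G(1)] c(2) by metis
  show ?thesis unfolding tup_def using ac_nf[OF c(1)] tm_rtup[OF G(1) FG] tm_rtup[OF G(1) den_lam.prems] c(2)
   nf_agree[of "(rep ?c)[0 ::= rtup G]" F' F] f G(2) by (auto simp: F'_def fun_upd_apply)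
 qed
 ultimately show ?case by simp
next
 case (den_app G v A A' m H w n E s)
 note g = typed_gctx[OF denotes_typed[OF denotes.den_app[OF den_app.hyps]]]
 note S = shuffle_ac[OF den_app.hyps(4) g den_app.prems]
 note H = denotes_hom[OF den_app.hyps(1)] denotes_hom[OF den_app.hyps(2)]
 note t = denotes_typed[OF den_app.hyps(1)] denotes_typed[OF den_app.hyps(2)]
 have v: "tm F v (Lolli A A')" "fv v = ctx_vars G" "tm F w A" "fv w = ctx_vars H" using tmI[OF t(1)] tmI[OF t(2)] fv_typed[OF t(1)] fv_typed[OF t(2)] S by auto
 have gd: "gnd A" "gnd A'" using tm_ground[OF v(1)] by (auto simp: gnd_def)
 have I: "ac F m (tup F G) = nf F v" "ac F n (tup F H) = nf F w" using den_app.IH S by blast+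
 show ?case using S H I g den_app.prems ap_nf[OF v(1,3)] nf_el[OF v(1)] nf_el[OF v(3)] v(2,4) gd by (simp add: eval_synm)
qed

text \<open>The tuple of the context is a pattern, so the distance of the denotations is that of
  their values there, and these values are the two terms.\<close>

lemma hdi_denotation:
 assumes v: "typed T G v A" and w: "typed T G w A"
 shows "hdi (denotation T synm G v A) (denotation T synm G w A) = Sup {q. thr G v q w A}"
proof -
 define F where "F x = the (map_of G x)" for x
 note c = typed_is_ctx[OF v] and g = typed_gctx[OF v]
 have F: "types_ctx F G" using c by (auto simp: F_def types_ctx_def is_ctx_def)
 note d = lam_interp.typed_denotation[OF lam_interp_synm v] lam_interp.typed_denotation[OF lam_interp_synm w]
 note h = denotes_hom[OF d(1)] denotes_hom[OF d(2)] and a = denotes_ac[OF d(1) F] denotes_ac[OF d(2) F]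
 note t = tmI[OF v F] tmI[OF w F]
 have "hdi (denotation T synm G v A) (denotation T synm G w A) = ds F (nf F v) (nf F w)"
  unfolding a[symmetric] by (rule antisym; (rule hdi_ac1 ext_ds)) (use h g F in auto)
 also have "... = ds F v w" by (rule ds_nf[OF t])
 also have "{q. \<exists>A. th F v q w A} = {q. thr G v q w A}"
 proof (intro Collect_cong iffI)
  fix q assume "\<exists>A. th F v q w A"
  then obtain A' where q: "th F v q w A'" by blast
  then have "A' = A" using th_tm(1) tm_unique t(1) by blast
  then show "thr G v q w A" using thD[OF q c _ F] fv_typed[OF v] by simp
 qed (use thI F in blast)
 then have "ds F v w = Sup {q. thr G v q w A}" by (simp add: ds_def)
 finally show ?thesis .
qed

lemma is_model_synm: "is_model T synm"
proof -
 have "holds T synm G v q w A" if "(G, v, q, w, A) \<in> axs T" for G v q w A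
 proof -
  have "thr G v q w A" using that by (rule is_theorem.ax)
  then show ?thesis using thr_typed[of G v q w A] hdi_denotation by (auto simp: holds_def intro: Sup_upper)
 qed
 then show ?thesis unfolding is_model_def using enriched_synm lam_interp.ground_in[OF lam_interp_synm] lam_interp.op_mor_hom[OF lam_interp_synm] by auto
qed

lemma completeness:
 assumes "vequation B T G v q w A" "holds T synm G v q w A" shows "thr G v q w A"
 using assms Sup_theorem hdi_denotation by (simp add: vequation_def holds_def)

end

text \<open>A formula quantifies over models only at fixed types of objects and labels. The
  equivalence is stated at the types where the syntactic model lives, and the second conjunct
  extends soundness to models over any other types.\<close>

theorem theorem3p15:
  fixes B :: "'v::continuous_integral_quantale set"
    and T :: "('g, 'f, 'v) vlam_theory"
    and \<Gamma> :: "'g ctx" and v w :: "('g, 'f) tm" and q :: 'v and A :: "'g ty"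
  assumes "quantale_basis B"
    and "linear_vlam_theory B T"
    and "varietal B T TYPE('u)"
    and "vequation B T \<Gamma> v q w A"
  shows "(is_theorem B T \<Gamma> v q w A \<longleftrightarrow>
            (\<forall>M :: ('g ty, 'u, 'v, 'g, 'f) interp. is_model T M \<longrightarrow> holds T M \<Gamma> v q w A)) \<and>
         (is_theorem B T \<Gamma> v q w A \<longrightarrow>
            (\<forall>M :: ('o, 'm, 'v, 'g, 'f) interp. is_model T M \<longrightarrow> holds T M \<Gamma> v q w A))"
proof -
 interpret varietal_theory B T "TYPE('u)" by unfold_locales fact+
 show ?thesis
 proof (intro conjI iffI allI impI)
  assume "\<forall>M :: ('g ty, 'u, 'v, 'g, 'f) interp. is_model T M --> holds T M \<Gamma> v q w A"
  then have "holds T synm \<Gamma> v q w A" using is_model_synm by blast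
  then show "is_theorem B T \<Gamma> v q w A" by (rule completeness[OF assms(4)])
 qed (rule soundness[OF assms(1,2)], assumption+)+
qed

end
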